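(* Let $m$ be a positive even integer such that $m-1$ and $m+1$ are both prime and $m^2+1$ is square-free, and let $E_m$ be the elliptic curve over $\mathbb{Q}$ given by $$E_m:\ y^2 = x\bigl(x-(m^2+1)^2\bigr)\bigl(x+(m^2-1)^2\bigr)+\bigl(2m(m^4-1)\bigr)^2 .$$ If moreover both $m^4-1-4m^2$ and $m^4-1+4m^2$ are prime numbers, then the $2$-Selmer rank of $E_m$ is $s_2(E_m)=w+1$, where $w$ denotes the number of prime factors of $m^4-1$.
   Context: The $2$-Selmer rank $s_2(E_m)$ is defined by $|\mathrm{Sel}_2(E_m)|=2^{2+s_2(E_m)}$, where $\mathrm{Sel}_2(E_m)$ is the $2$-Selmer group of $E_m$ over $\mathbb{Q}$. The curve can also be written $E_m: y^2=(x-(m^4-1))(x+(m^4-1))(x-4m^2)$. *)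

theory Defs
  imports
    Complex_Main
    "HOL-Computational_Algebra.Computational_Algebra"
    "HOL-Algebra.Algebra"
    "HOL-Algebra.Algebraic_Closure_Type"
begin

section \<open>The places of \<open>\<rat>\<close> and the completions\<close>

abbreviation rat_ring :: "rat ring"
  where "rat_ring \<equiv> ring_of_type_algebra"

definition padic_abs :: "nat \<Rightarrow> rat \<Rightarrow> real"
  where "padic_abs p x =
    (if x = 0 then 0
     else real p powi (int (multiplicity (int p) (snd (quotient_of x)))
                     - int (multiplicity (int p) (fst (quotient_of x)))))"

text \<open>A place is represented by its normalised absolute value.\<close>

definition places :: "(rat \<Rightarrow> real) set"
  where "places = insert (\<lambda>x. real_of_rat \<bar>x\<bar>) {padic_abs p |p. Factorial_Ring.prime p}"

definition cauchy_ring :: "(rat \<Rightarrow> real) \<Rightarrow> (nat \<Rightarrow> rat) ring"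
  where "cauchy_ring v =
    \<lparr>carrier = {s. \<forall>e>0. \<exists>N. \<forall>i\<ge>N. \<forall>j\<ge>N. v (s i - s j) < e},
     monoid.mult = (\<lambda>s t n. s n * t n), one = (\<lambda>n. 1),
     ring.zero = (\<lambda>n. 0), add = (\<lambda>s t n. s n + t n)\<rparr>"

definition null_seqs :: "(rat \<Rightarrow> real) \<Rightarrow> (nat \<Rightarrow> rat) set"
  where "null_seqs v = {s. (\<lambda>n. v (s n)) \<longlonglongrightarrow> 0}"

text \<open>The completion \<open>\<rat>\<^sub>v\<close>: Cauchy sequences of rationals modulo null sequences.\<close>

definition completion :: "(rat \<Rightarrow> real) \<Rightarrow> (nat \<Rightarrow> rat) set ring"
  where "completion v = cauchy_ring v Quot null_seqs v"

definition completion_emb :: "(rat \<Rightarrow> real) \<Rightarrow> rat \<Rightarrow> (nat \<Rightarrow> rat) set"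
  where "completion_emb v q = null_seqs v +>\<^bsub>cauchy_ring v\<^esub> (\<lambda>n. q)"

section \<open>Absolute Galois groups and continuous cohomology in degree one\<close>

type_synonym 'a clos = "('a list \<times> nat) multiset \<Rightarrow> 'a"

abbreviation alg_clos :: "'a ring \<Rightarrow> 'a clos ring"
  where "alg_clos F \<equiv> field.alg_closure F"

abbreviation clos_emb :: "'a ring \<Rightarrow> 'a \<Rightarrow> 'a clos"
  where "clos_emb F \<equiv> ring.indexed_const F"

definition abs_gal :: "'a ring \<Rightarrow> ('a clos \<Rightarrow> 'a clos) monoid"
  where "abs_gal F = BijGroup (carrier (alg_clos F))
    \<lparr>carrier := {\<sigma> \<in> Bij (carrier (alg_clos F)).
        \<sigma> \<in> ring_hom (alg_clos F) (alg_clos F) \<and>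
        (\<forall>a\<in>carrier F. \<sigma> (clos_emb F a) = clos_emb F a)}\<rparr>"

text \<open>
  In the following a Galois module is an abelian group \<open>M\<close> with an action \<open>act\<close> of
  \<^term>\<open>abs_gal F\<close>. Continuity of a cochain refers to the Krull topology on the Galois group
  (basic neighbourhoods of \<open>\<sigma>\<close>: the automorphisms agreeing with \<open>\<sigma>\<close> on a given finite set) and
  the discrete topology on \<open>M\<close>. Cochains are extensional functions, so that the cohomology
  groups have the right cardinality.
\<close>

definition continuous_cochain :: "'a ring \<Rightarrow> (('a clos \<Rightarrow> 'a clos) \<Rightarrow> 'm) \<Rightarrow> bool"
  where "continuous_cochain F \<xi> \<longleftrightarrow>
    (\<forall>\<sigma>\<in>carrier (abs_gal F). \<exists>S. finite S \<and> S \<subseteq> carrier (alg_clos F) \<and>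
       (\<forall>\<tau>\<in>carrier (abs_gal F). (\<forall>x\<in>S. \<tau> x = \<sigma> x) \<longrightarrow> \<xi> \<tau> = \<xi> \<sigma>))"

definition cocycles ::
  "'a ring \<Rightarrow> 'm monoid \<Rightarrow> (('a clos \<Rightarrow> 'a clos) \<Rightarrow> 'm \<Rightarrow> 'm) \<Rightarrow>
   (('a clos \<Rightarrow> 'a clos) \<Rightarrow> 'm) monoid"
  where "cocycles F M act =
    \<lparr>carrier = {\<xi> \<in> carrier (abs_gal F) \<rightarrow>\<^sub>E carrier M.
        continuous_cochain F \<xi> \<and>
        (\<forall>\<sigma>\<in>carrier (abs_gal F). \<forall>\<tau>\<in>carrier (abs_gal F).
           \<xi> (\<sigma> \<otimes>\<^bsub>abs_gal F\<^esub> \<tau>) = \<xi> \<sigma> \<otimes>\<^bsub>M\<^esub> act \<sigma> (\<xi> \<tau>))},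
     monoid.mult = (\<lambda>\<xi> \<eta>. \<lambda>\<sigma>\<in>carrier (abs_gal F). \<xi> \<sigma> \<otimes>\<^bsub>M\<^esub> \<eta> \<sigma>),
     one = (\<lambda>\<sigma>\<in>carrier (abs_gal F). \<one>\<^bsub>M\<^esub>)\<rparr>"

definition coboundaries ::
  "'a ring \<Rightarrow> 'm monoid \<Rightarrow> (('a clos \<Rightarrow> 'a clos) \<Rightarrow> 'm \<Rightarrow> 'm) \<Rightarrow>
   (('a clos \<Rightarrow> 'a clos) \<Rightarrow> 'm) set"
  where "coboundaries F M act =
    {(\<lambda>\<sigma>\<in>carrier (abs_gal F). act \<sigma> P \<otimes>\<^bsub>M\<^esub> inv\<^bsub>M\<^esub> P) |P. P \<in> carrier M}"

definition H1 ::
  "'a ring \<Rightarrow> 'm monoid \<Rightarrow> (('a clos \<Rightarrow> 'a clos) \<Rightarrow> 'm \<Rightarrow> 'm) \<Rightarrow>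
   (('a clos \<Rightarrow> 'a clos) \<Rightarrow> 'm) set monoid"
  where "H1 F M act = cocycles F M act Mod coboundaries F M act"

section \<open>Elliptic curves \<open>y\<^sup>2 = f(x)\<close>\<close>

datatype 'a point = Infinity | Affine 'a 'a

text \<open>
  The chord and tangent law on \<open>y\<^sup>2 = x\<^sup>3 + c\<^sub>2 x\<^sup>2 + c\<^sub>1 x + c\<^sub>0\<close> over a field \<open>K\<close> of
  characteristic different from 2.
\<close>

fun ec_add :: "'a ring \<Rightarrow> (nat \<Rightarrow> 'a) \<Rightarrow> 'a point \<Rightarrow> 'a point \<Rightarrow> 'a point"
  where
    "ec_add K c Infinity Q = Q"
  | "ec_add K c (Affine x1 y1) Infinity = Affine x1 y1"
  | "ec_add K c (Affine x1 y1) (Affine x2 y2) =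
      (if x1 = x2 \<and> y1 = \<ominus>\<^bsub>K\<^esub> y2 then Infinity
       else
         let l = (if x1 = x2
                  then ([(3::nat)] \<cdot>\<^bsub>K\<^esub> (x1 [^]\<^bsub>K\<^esub> (2::nat)) \<oplus>\<^bsub>K\<^esub> [(2::nat)] \<cdot>\<^bsub>K\<^esub> (c 2 \<otimes>\<^bsub>K\<^esub> x1) \<oplus>\<^bsub>K\<^esub> c 1)
                       \<otimes>\<^bsub>K\<^esub> inv\<^bsub>K\<^esub> ([(2::nat)] \<cdot>\<^bsub>K\<^esub> y1)
                  else (y2 \<ominus>\<^bsub>K\<^esub> y1) \<otimes>\<^bsub>K\<^esub> inv\<^bsub>K\<^esub> (x2 \<ominus>\<^bsub>K\<^esub> x1));
             x3 = l [^]\<^bsub>K\<^esub> (2::nat) \<ominus>\<^bsub>K\<^esub> c 2 \<ominus>\<^bsub>K\<^esub> x1 \<ominus>\<^bsub>K\<^esub> x2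
         in Affine x3 (l \<otimes>\<^bsub>K\<^esub> (x1 \<ominus>\<^bsub>K\<^esub> x3) \<ominus>\<^bsub>K\<^esub> y1))"

definition ec_group :: "'a ring \<Rightarrow> (nat \<Rightarrow> 'a) \<Rightarrow> 'a point monoid"
  where "ec_group K c =
    \<lparr>carrier = insert Infinity
       {Affine x y |x y. x \<in> carrier K \<and> y \<in> carrier K \<and>
          y [^]\<^bsub>K\<^esub> (2::nat) =
            x [^]\<^bsub>K\<^esub> (3::nat) \<oplus>\<^bsub>K\<^esub> c 2 \<otimes>\<^bsub>K\<^esub> x [^]\<^bsub>K\<^esub> (2::nat) \<oplus>\<^bsub>K\<^esub> c 1 \<otimes>\<^bsub>K\<^esub> x \<oplus>\<^bsub>K\<^esub> c 0},
     monoid.mult = ec_add K c, one = Infinity\<rparr>"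

definition torsion :: "nat \<Rightarrow> 'm monoid \<Rightarrow> 'm monoid"
  where "torsion n M = M \<lparr>carrier := {P \<in> carrier M. P [^]\<^bsub>M\<^esub> n = \<one>\<^bsub>M\<^esub>}\<rparr>"

text \<open>
  A monic cubic \<^term>\<open>f :: rat poly\<close> without repeated roots encodes the elliptic curve
  \<open>E: y\<^sup>2 = f(x)\<close> over \<open>\<rat>\<close>; the next two groups are its points over the algebraic closures of
  \<open>\<rat>\<close> and of \<open>\<rat>\<^sub>v\<close>.
\<close>

definition ec_Qbar :: "rat poly \<Rightarrow> rat clos point monoid"
  where "ec_Qbar f =
    ec_group (alg_clos rat_ring) (\<lambda>i. clos_emb rat_ring (Polynomial.coeff f i))"

definition ec_local :: "(rat \<Rightarrow> real) \<Rightarrow> rat poly \<Rightarrow> (nat \<Rightarrow> rat) set clos point monoid"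
  where "ec_local v f =
    ec_group (alg_clos (completion v))
      (\<lambda>i. clos_emb (completion v) (completion_emb v (Polynomial.coeff f i)))"

section \<open>Selmer groups\<close>

text \<open>
  A chosen embedding over \<open>\<rat>\<close> of the algebraic closure of \<open>\<rat>\<close> into that of \<open>\<rat>\<^sub>v\<close>. The
  localisation map on cohomology classes does not depend on the choice.
\<close>

definition closure_emb :: "(rat \<Rightarrow> real) \<Rightarrow> rat clos \<Rightarrow> (nat \<Rightarrow> rat) set clos"
  where "closure_emb v =
    (SOME \<iota>. \<iota> \<in> ring_hom (alg_clos rat_ring) (alg_clos (completion v)) \<and>
       (\<forall>q. \<iota> (clos_emb rat_ring q) = clos_emb (completion v) (completion_emb v q)))"

definition gal_restrict ::
  "(rat \<Rightarrow> real) \<Rightarrow> ((nat \<Rightarrow> rat) set clos \<Rightarrow> (nat \<Rightarrow> rat) set clos) \<Rightarrow> rat clos \<Rightarrow> rat clos"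
  where "gal_restrict v \<tau> =
    (\<lambda>x\<in>carrier (alg_clos rat_ring).
       inv_into (carrier (alg_clos rat_ring)) (closure_emb v) (\<tau> (closure_emb v x)))"

text \<open>
  The cochain map inducing the composite of restriction to the decomposition group with the map
  coming from the inclusion of \<open>E[n]\<close> into the points of \<open>E\<close> over the closure of \<open>\<rat>\<^sub>v\<close>.
\<close>

definition localize ::
  "(rat \<Rightarrow> real) \<Rightarrow> ((rat clos \<Rightarrow> rat clos) \<Rightarrow> rat clos point) \<Rightarrow>
   ((nat \<Rightarrow> rat) set clos \<Rightarrow> (nat \<Rightarrow> rat) set clos) \<Rightarrow> (nat \<Rightarrow> rat) set clos point"
  where "localize v \<xi> =
    (\<lambda>\<tau>\<in>carrier (abs_gal (completion v)). map_point (closure_emb v) (\<xi> (gal_restrict v \<tau>)))"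

text \<open>
  The \<open>n\<close>-Selmer group over \<open>\<rat>\<close>: the kernel of the map from \<open>H\<^sup>1(\<rat>, E[n])\<close> to the product of
  the groups \<open>H\<^sup>1(\<rat>\<^sub>v, E)\<close> over all places \<open>v\<close>.
\<close>

definition selmer_group ::
  "nat \<Rightarrow> rat poly \<Rightarrow> ((rat clos \<Rightarrow> rat clos) \<Rightarrow> rat clos point) set set"
  where "selmer_group n f =
    {C \<in> carrier (H1 rat_ring (torsion n (ec_Qbar f)) map_point).
       \<forall>v\<in>places. localize v ` C \<subseteq> coboundaries (completion v) (ec_local v f) map_point}"

text \<open>
  The solution \<open>s\<close> of \<open>|Sel\<^sub>2(E)| = 2\<^bsup>2 + s\<^esup>\<close>. If the Selmer group were infinite, the value
  would be \<open>-2\<close> by the library conventions for \<^const>\<open>card\<close> and \<^const>\<open>log\<close>.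
\<close>

definition two_selmer_rank :: "rat poly \<Rightarrow> real"
  where "two_selmer_rank f = log 2 (real (card (selmer_group 2 f))) - 2"

definition E_curve :: "int \<Rightarrow> rat poly"
  where "E_curve m = (let M = rat_of_int m in
    [:0, 1:] * [:- ((M^2 + 1)^2), 1:] * [:(M^2 - 1)^2, 1:] + [:(2 * M * (M^4 - 1))^2:])"

end

theory Submission
  imports Defs "HOL-Number_Theory.Number_Theory"
begin

text \<open>
  Put \<open>a = m\<^sup>4 - 1\<close> and \<open>b = 4 m\<^sup>2\<close>, so that the curve is \<open>y\<^sup>2 = (x - a)(x + a)(x - b)\<close> with \<open>p = a - b\<close>
  and \<open>q = a + b\<close> prime. Kummer theory identifies the classes in \<open>H\<^sup>1(\<rat>, E[2])\<close> with pairs \<open>(d\<^sub>1, d\<^sub>2)\<close> of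
  rationals modulo squares; such a class dies in \<open>H\<^sup>1(\<rat>\<^sub>v, E)\<close> iff \<open>d\<^sub>1\<close> and \<open>d\<^sub>2\<close> are squares in \<open>\<rat>\<^sub>v\<close> or
  \<open>d\<^sub>1 z\<^sub>1\<^sup>2 + a = d\<^sub>2 z\<^sub>2\<^sup>2 - a = d\<^sub>1 d\<^sub>2 z\<^sub>3\<^sup>2 + b\<close> is soluble in \<open>\<rat>\<^sub>v\<close>. Local solubility forces \<open>d\<^sub>2 > 0\<close>, forces
  \<open>d\<^sub>1\<close> and \<open>d\<^sub>2\<close> to be supported on \<open>2\<close>, \<open>p\<close>, \<open>q\<close> and the \<open>w\<close> primes dividing \<open>a\<close>, with \<open>p\<close> only in \<open>d\<^sub>1\<close>, \<open>q\<close>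
  only in \<open>d\<^sub>2\<close> and every other prime in both or in neither, and makes \<open>d\<^sub>1\<close> a square in \<open>\<rat>\<^sub>q\<close>, which determines
  its sign as \<open>q \<equiv> 3\<close> modulo 4. So there is at most one pair for each set of these \<open>w + 3\<close> primes.
  Conversely all these pairs are soluble everywhere: a character sum settles the primes of good
  reduction, and at the others translation by the rational two-torsion, together with quadratic
  reciprocity (\<open>p \<equiv> q \<equiv> - 1\<close> modulo 16, and exactly one prime factor \<open>r\<close> of \<open>a\<close> is \<open>3\<close> modulo 4), reduces
  to trivial classes and a few explicit points.
\<close>

section \<open>Embeddings into algebraically closed fields\<close>

text \<open>The obstacle is that the Selmer group is made of literal continuous cocycles on
  automorphism groups of two constructed algebraic closures. The bridge to arithmetic is explicit
  halving. If \<open>s_i\<close> is a square root of \<open>W - e_i\<close> for each root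
  \<open>e_i\<close>, a half of the point above \<open>W\<close> has coordinates polynomial in the
  \<open>s_i\<close>, and adding a two-torsion point to that half changes two of the signs. So a
  cocycle with values in \<open>E[2]\<close> is a coboundary in \<open>E\<close> exactly if the
  square roots it moves come from such a half, over any field of characteristic zero.

  Solubility at a place occurs in two strengths. To exclude a pair, approximate solutions suffice,
  and \<open>soluble\<close> speaks of Cauchy sequences. To realise a pair,
  \<open>visibly_soluble\<close> asks for a rational \<open>x\<close>; since the rationals are dense
  and square classes are open, this is the natural certificate, and all local work becomes
  congruences between integers.

  At a place of bad reduction few square classes are left once the residue symbols between the bad
  primes are known, and the classes of the two-torsion points move one case to the next.\<close>

definition hom_graph :: "('a, 'm) ring_scheme \<Rightarrow> ('b, 'n) ring_scheme \<Rightarrow> ('a \<times> 'b) set \<Rightarrow> bool"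
  where "hom_graph A B g \<longleftrightarrow> g \<subseteq> carrier A \<times> carrier B \<and> (\<one>\<^bsub>A\<^esub>, \<one>\<^bsub>B\<^esub>) \<in> g \<and> single_valued g \<and>
    (\<forall>x y x' y'. (x, y) \<in> g \<longrightarrow> (x', y') \<in> g \<longrightarrow>
       (x \<oplus>\<^bsub>A\<^esub> x', y \<oplus>\<^bsub>B\<^esub> y') \<in> g \<and> (x \<otimes>\<^bsub>A\<^esub> x', y \<otimes>\<^bsub>B\<^esub> y') \<in> g) \<and>
    (\<forall>x y. (x, y) \<in> g \<longrightarrow> (\<ominus>\<^bsub>A\<^esub> x, \<ominus>\<^bsub>B\<^esub> y) \<in> g) \<and>
    (\<forall>x y. (x, y) \<in> g \<longrightarrow> x \<noteq> \<zero>\<^bsub>A\<^esub> \<longrightarrow> (inv\<^bsub>A\<^esub> x, inv\<^bsub>B\<^esub> y) \<in> g)"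

lemma hom_graphE:
  assumes "hom_graph A B g" "field A"
  obtains \<psi> where "subfield (Domain g) A" "\<psi> \<in> ring_hom (A\<lparr>carrier := Domain g\<rparr>) B"
    "g = (\<lambda>x. (x, \<psi> x)) ` Domain g"
proof -
  interpret A: field A by fact
  define \<psi> where "\<psi> x = (THE y. (x, y) \<in> g)" for x
  have sv: "single_valued g" and sub: "g \<subseteq> carrier A \<times> carrier B"
    using assms(1) by (auto simp: hom_graph_def)
  have \<psi>: "\<psi> x = y" if "(x, y) \<in> g" for x y
    using that sv unfolding \<psi>_def by (auto dest: single_valuedD)
  have "subfield (Domain g) A"
  proof (rule A.subfieldI')
    show "subring (Domain g) A"
      by (rule A.subringI) (use assms(1) sub in \<open>auto simp: hom_graph_def\<close>, blast+)
    fix k assume k: "k \<in> Domain g - {\<zero>\<^bsub>A\<^esub>}"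
    then obtain y where "(k, y) \<in> g" by auto
    then have "(inv\<^bsub>A\<^esub> k, inv\<^bsub>B\<^esub> y) \<in> g" using assms(1) k unfolding hom_graph_def by auto
    then show "inv\<^bsub>A\<^esub> k \<in> Domain g" by auto
  qed
  moreover have "\<psi> \<in> ring_hom (A\<lparr>carrier := Domain g\<rparr>) B"
  proof (rule ring_hom_memI; simp)
    fix x assume "x \<in> Domain g"
    then obtain y where y: "(x, y) \<in> g" by auto
    with sub \<psi>[OF y] show "\<psi> x \<in> carrier B" by auto
    fix x' assume "x' \<in> Domain g"
    then obtain y' where y': "(x', y') \<in> g" by auto
    have "(x \<otimes>\<^bsub>A\<^esub> x', y \<otimes>\<^bsub>B\<^esub> y') \<in> g" "(x \<oplus>\<^bsub>A\<^esub> x', y \<oplus>\<^bsub>B\<^esub> y') \<in> g"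
      using y y' assms(1) unfolding hom_graph_def by blast+
    then show "\<psi> (x \<otimes>\<^bsub>A\<^esub> x') = \<psi> x \<otimes>\<^bsub>B\<^esub> \<psi> x'" "\<psi> (x \<oplus>\<^bsub>A\<^esub> x') = \<psi> x \<oplus>\<^bsub>B\<^esub> \<psi> x'"
      using \<psi> y y' by auto
  next
    show "\<psi> \<one>\<^bsub>A\<^esub> = \<one>\<^bsub>B\<^esub>" using \<psi> assms(1) by (auto simp: hom_graph_def)
  qed
  moreover have "g = (\<lambda>x. (x, \<psi> x)) ` Domain g"
    using \<psi> by (force simp: image_iff)
  ultimately show ?thesis by (rule that)
qed

text \<open>Send the value at \<open>z\<close> of a polynomial over \<open>L\<close> to the value at
  \<open>w\<close> of its image under \<open>\<psi>\<close>. The result depends only on the value at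
  \<open>z\<close>: a polynomial vanishing at \<open>z\<close> is a multiple of the minimal
  polynomial, whose image vanishes at \<open>w\<close>. Working with a relation avoids choosing a
  polynomial for each element of \<open>L(z)\<close>.\<close>

lemma hom_graph_step:
  assumes "field A" "field B" "subfield L A" "\<psi> \<in> ring_hom (A\<lparr>carrier := L\<rparr>) B"
    and z: "z \<in> carrier A" "(ring.algebraic A over L) z"
    and w: "w \<in> carrier B" "ring.eval B (map \<psi> (ring.Irr A L z)) w = \<zero>\<^bsub>B\<^esub>"
  shows "\<exists>g. hom_graph A B g \<and> (\<lambda>x. (x, \<psi> x)) ` L \<subseteq> g \<and> (z, w) \<in> g"
proof -
  interpret A: field A by fact
  interpret B: field B by fact
  have sL: "subring L A" using assms(3) by (rule subfieldE(1))
  note L = subringE[OF sL]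
  interpret L: field "A\<lparr>carrier := L\<rparr>" using A.subfield_iff(2)[OF assms(3)] .
  interpret H: ring_hom_ring "A\<lparr>carrier := L\<rparr>" B \<psi>
    by (rule ring_hom_ringI2[OF L.ring_axioms B.ring_axioms assms(4)])
  let ?P = "univ_poly A L"
  interpret P: domain ?P by (rule A.univ_poly_is_domain[OF sL])
  have Pset: "set p \<subseteq> L" if "p \<in> carrier ?P" for p
    using that by (auto simp: univ_poly_def polynomial_def)
  define E where "E q = ring.eval B (map \<psi> q) w" for q
  define e where "e q = ring.eval A q z" for q
  have mapc: "set (map \<psi> p) \<subseteq> carrier B" if "set p \<subseteq> L" for p
    using that ring_hom_closed[OF assms(4)] by auto
  interpret e: ring_hom_ring ?P A e
    unfolding e_def by (rule A.eval_ring_hom[OF sL z(1)])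
  have Ehom: "E \<in> ring_hom ?P B"
  proof (rule ring_hom_memI)
    fix p assume p: "p \<in> carrier ?P"
    show "E p \<in> carrier B"
      unfolding E_def by (rule B.eval_in_carrier[OF mapc[OF Pset[OF p]] w(1)])
    fix q assume q: "q \<in> carrier ?P"
    have "E (p \<oplus>\<^bsub>?P\<^esub> q) = B.eval (B.normalize (map \<psi> (L.poly_add p q))) w"
      unfolding E_def using Pset[OF P.add.m_closed[OF p q]]
      by (subst B.eval_normalize) (simp_all add: mapc w univ_poly_add A.poly_add_consistent[OF sL] del: set_map)
    also have "\<dots> = B.eval (B.poly_add (map \<psi> p) (map \<psi> q)) w"
      using H.poly_add_hom'[of p q] Pset[OF p] Pset[OF q] by simp
    also have "\<dots> = E p \<oplus>\<^bsub>B\<^esub> E q"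
      unfolding E_def by (rule B.eval_poly_add[OF mapc[OF Pset[OF p]] mapc[OF Pset[OF q]] w(1)])
    finally show "E (p \<oplus>\<^bsub>?P\<^esub> q) = E p \<oplus>\<^bsub>B\<^esub> E q" .
    have "E (p \<otimes>\<^bsub>?P\<^esub> q) = B.eval (B.normalize (map \<psi> (L.poly_mult p q))) w"
      unfolding E_def using Pset[OF P.m_closed[OF p q]]
      by (subst B.eval_normalize) (simp_all add: mapc w univ_poly_mult A.poly_mult_consistent[OF sL] del: set_map)
    also have "\<dots> = B.eval (B.poly_mult (map \<psi> p) (map \<psi> q)) w"
      using H.poly_mult_hom'[of p q] Pset[OF p] Pset[OF q] by simp
    also have "\<dots> = E p \<otimes>\<^bsub>B\<^esub> E q"
      unfolding E_def by (rule B.eval_poly_mult[OF mapc[OF Pset[OF p]] mapc[OF Pset[OF q]] w(1)])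
    finally show "E (p \<otimes>\<^bsub>?P\<^esub> q) = E p \<otimes>\<^bsub>B\<^esub> E q" .
  next
    show "E \<one>\<^bsub>?P\<^esub> = \<one>\<^bsub>B\<^esub>"
      unfolding E_def univ_poly_one using ring_hom_one[OF assms(4)] w by simp
  qed
  interpret E: ring_hom_ring ?P B E
    by (rule ring_hom_ringI2[OF P.ring_axioms B.ring_axioms Ehom])
  have wd0: "E p = \<zero>\<^bsub>B\<^esub>" if p: "p \<in> carrier ?P" and ep: "e p = \<zero>\<^bsub>A\<^esub>" for p
  proof -
    have "A.Irr L z pdivides\<^bsub>A\<^esub> p"
      using A.Irr_minimal[OF assms(3) z p] ep by (simp add: e_def)
    then have "A.Irr L z divides\<^bsub>?P\<^esub> p"
      using A.pdivides_iff_shell[OF assms(3) A.IrrE(1)[OF assms(3) z] p] by simp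
    then obtain r where "r \<in> carrier ?P" "p = A.Irr L z \<otimes>\<^bsub>?P\<^esub> r" by (auto simp: factor_def)
    then show ?thesis
      using E.hom_mult[of "A.Irr L z" r] A.IrrE(1)[OF assms(3) z] w by (simp add: E_def[of "A.Irr L z"])
  qed
  have wd: "E p = E q" if "p \<in> carrier ?P" "q \<in> carrier ?P" "e p = e q" for p q
  proof -
    have "e (p \<ominus>\<^bsub>?P\<^esub> q) = \<zero>\<^bsub>A\<^esub>" using that by (simp add: a_minus_def A.r_neg)
    then have "E (p \<ominus>\<^bsub>?P\<^esub> q) = \<zero>\<^bsub>B\<^esub>" using wd0 that by auto
    then show ?thesis using that by (simp add: a_minus_def) (metis B.minus_equality B.minus_minus E.hom_closed B.a_inv_closed)
  qed
  define g where "g = (\<lambda>q. (e q, E q)) ` carrier ?P"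
  have dom: "Domain g = A.simple_extension L z"
    using A.simple_extension_as_eval_img[OF L(1) z(1)] by (auto simp: g_def e_def)
  have sfD: "subfield (Domain g) A"
    using A.simple_extension_is_subfield[OF assms(3) z(1)] z(2) dom by simp
  have "hom_graph A B g"
    unfolding hom_graph_def
  proof (intro conjI allI impI)
    show "g \<subseteq> carrier A \<times> carrier B" by (auto simp: g_def)
    show "(\<one>\<^bsub>A\<^esub>, \<one>\<^bsub>B\<^esub>) \<in> g" unfolding g_def by (rule image_eqI[of _ _ "\<one>\<^bsub>?P\<^esub>"]) auto
    show sv: "single_valued g" unfolding g_def single_valued_def by clarify (rule wd)
    fix x y assume "(x, y) \<in> g"
    then obtain p where p: "p \<in> carrier ?P" "x = e p" "y = E p" by (auto simp: g_def)
    show "(\<ominus>\<^bsub>A\<^esub> x, \<ominus>\<^bsub>B\<^esub> y) \<in> g" unfolding g_def by (rule image_eqI[of _ _ "\<ominus>\<^bsub>?P\<^esub> p"]) (auto simp: p)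
    { assume x: "x \<noteq> \<zero>\<^bsub>A\<^esub>"
      have "inv\<^bsub>A\<^esub> x \<in> Domain g" "x \<otimes>\<^bsub>A\<^esub> inv\<^bsub>A\<^esub> x = \<one>\<^bsub>A\<^esub>"
        using A.subfield_m_inv[OF sfD, of x] x \<open>(x, y) \<in> g\<close> by auto
      then obtain r where r: "r \<in> carrier ?P" "inv\<^bsub>A\<^esub> x = e r" by (auto simp: g_def)
      have "E (p \<otimes>\<^bsub>?P\<^esub> r) = E \<one>\<^bsub>?P\<^esub>"
        by (rule wd) (use p r \<open>x \<otimes>\<^bsub>A\<^esub> inv\<^bsub>A\<^esub> x = \<one>\<^bsub>A\<^esub>\<close> in auto)
      then have "y \<otimes>\<^bsub>B\<^esub> E r = \<one>\<^bsub>B\<^esub>" using p r by simp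
      then have "inv\<^bsub>B\<^esub> y = E r" using p r by (metis B.comm_inv_char E.hom_closed)
      then show "(inv\<^bsub>A\<^esub> x, inv\<^bsub>B\<^esub> y) \<in> g" using r by (auto simp: g_def) }
    fix x' y' assume "(x', y') \<in> g"
    then obtain p' where p': "p' \<in> carrier ?P" "x' = e p'" "y' = E p'" by (auto simp: g_def)
    show "(x \<oplus>\<^bsub>A\<^esub> x', y \<oplus>\<^bsub>B\<^esub> y') \<in> g" unfolding g_def by (rule image_eqI[of _ _ "p \<oplus>\<^bsub>?P\<^esub> p'"]) (auto simp: p p')
    show "(x \<otimes>\<^bsub>A\<^esub> x', y \<otimes>\<^bsub>B\<^esub> y') \<in> g" unfolding g_def by (rule image_eqI[of _ _ "p \<otimes>\<^bsub>?P\<^esub> p'"]) (auto simp: p p')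
  qed
  moreover have "(\<lambda>x. (x, \<psi> x)) ` L \<subseteq> g"
  proof clarify
    fix x assume x: "x \<in> L"
    show "(x, \<psi> x) \<in> g"
    proof (cases "x = \<zero>\<^bsub>A\<^esub>")
      case True
      moreover have "e \<zero>\<^bsub>?P\<^esub> = \<zero>\<^bsub>A\<^esub>" "E \<zero>\<^bsub>?P\<^esub> = \<zero>\<^bsub>B\<^esub>" by auto
      moreover have "\<psi> \<zero>\<^bsub>A\<^esub> = \<zero>\<^bsub>B\<^esub>" using H.hom_zero by simp
      ultimately show ?thesis unfolding g_def by (metis (no_types, lifting) P.zero_closed image_eqI)
    next
      case False
      then have "[x] \<in> carrier ?P" using x by (auto simp: univ_poly_def polynomial_def)
      moreover have "e [x] = x" "E [x] = \<psi> x" using x L w z H.hom_closed[of x] by (auto simp: e_def E_def subset_iff)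
      ultimately show ?thesis unfolding g_def by (metis (no_types, lifting) image_eqI)
    qed
  qed
  moreover have "(z, w) \<in> g"
  proof -
    have "[\<one>\<^bsub>A\<^esub>, \<zero>\<^bsub>A\<^esub>] \<in> carrier ?P" using L by (auto simp: univ_poly_def polynomial_def)
    moreover have "e [\<one>\<^bsub>A\<^esub>, \<zero>\<^bsub>A\<^esub>] = z" using z by (auto simp: e_def)
    moreover have "E [\<one>\<^bsub>A\<^esub>, \<zero>\<^bsub>A\<^esub>] = w" using w H.hom_one H.hom_zero by (auto simp: E_def)
    ultimately show ?thesis unfolding g_def by (metis (no_types, lifting) image_eqI)
  qed
  ultimately show ?thesis by blast
qed

text \<open>Partial homomorphisms are sets of pairs so that Zorn's lemma applies to inclusion, with
  unions as upper bounds. A maximal one is total: the minimal polynomial of a missing element has an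
  image of positive degree, hence a root in \<open>B\<close>, and \<open>hom_graph_step\<close>
  extends. Starting from a relation rather than a base field allows the value at one further element
  to be prescribed, as in \<open>exists_gal\<close>.\<close>

theorem hom_graph_extend:
  assumes "field A" "algebraically_closed B" "hom_graph A B g\<^sub>0"
    and alg: "\<And>x. x \<in> carrier A \<Longrightarrow> (ring.algebraic A over Domain g\<^sub>0) x"
  obtains \<psi> where "\<psi> \<in> ring_hom A B" "\<And>x y. (x, y) \<in> g\<^sub>0 \<Longrightarrow> \<psi> x = y"
proof -
  interpret A: field A by fact
  interpret B: algebraically_closed B by fact
  define C where "C = {g. hom_graph A B g \<and> g\<^sub>0 \<subseteq> g}"
  have "\<exists>M\<in>C. \<forall>N\<in>C. M \<subseteq> N \<longrightarrow> N = M"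
  proof (rule subset_Zorn_nonempty)
    show "C \<noteq> {}" using assms(3) by (auto simp: C_def)
    fix D assume D: "D \<noteq> {}" "subset.chain C D"
    have HG: "hom_graph A B g" if "g \<in> D" for g
      using that D by (auto simp: C_def subset.chain_def)
    have two: "\<exists>g\<in>D. u \<in> g \<and> v \<in> g" if "u \<in> \<Union>D" "v \<in> \<Union>D" for u v
    proof -
      from that obtain g h where "g \<in> D" "h \<in> D" "u \<in> g" "v \<in> h" by auto
      then show ?thesis using D(2) unfolding subset.chain_def by blast
    qed
    have "hom_graph A B (\<Union>D)"
      unfolding hom_graph_def
    proof (intro conjI allI impI)
      show "\<Union>D \<subseteq> carrier A \<times> carrier B" using HG unfolding hom_graph_def by blast
      show "(\<one>\<^bsub>A\<^esub>, \<one>\<^bsub>B\<^esub>) \<in> \<Union>D" using HG D(1) unfolding hom_graph_def by blast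
      show "single_valued (\<Union>D)"
        using two HG unfolding hom_graph_def single_valued_def by metis
      fix x y assume xy: "(x, y) \<in> \<Union>D"
      show "(\<ominus>\<^bsub>A\<^esub> x, \<ominus>\<^bsub>B\<^esub> y) \<in> \<Union>D" using HG xy unfolding hom_graph_def by blast
      show "x \<noteq> \<zero>\<^bsub>A\<^esub> \<Longrightarrow> (inv\<^bsub>A\<^esub> x, inv\<^bsub>B\<^esub> y) \<in> \<Union>D" using HG xy unfolding hom_graph_def by blast
      fix x' y' assume xy': "(x', y') \<in> \<Union>D"
      obtain g where "g \<in> D" "(x, y) \<in> g" "(x', y') \<in> g" using two[OF xy xy'] by blast
      then show "(x \<oplus>\<^bsub>A\<^esub> x', y \<oplus>\<^bsub>B\<^esub> y') \<in> \<Union>D" "(x \<otimes>\<^bsub>A\<^esub> x', y \<otimes>\<^bsub>B\<^esub> y') \<in> \<Union>D"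
        using HG unfolding hom_graph_def by blast+
    qed
    moreover have "g\<^sub>0 \<subseteq> \<Union>D"
    proof -
      obtain g where "g \<in> D" using D(1) by blast
      moreover have "D \<subseteq> C" using D(2) by (simp add: subset.chain_def)
      ultimately have "g\<^sub>0 \<subseteq> g" by (auto simp: C_def)
      with \<open>g \<in> D\<close> show ?thesis by blast
    qed
    ultimately show "\<Union>D \<in> C" unfolding C_def by blast
  qed
  then obtain M where MC: "M \<in> C" and maxC: "\<forall>N\<in>C. M \<subseteq> N \<longrightarrow> N = M" ..
  then have M: "hom_graph A B M" "g\<^sub>0 \<subseteq> M" by (simp_all add: C_def)
  have max: "N = M" if "hom_graph A B N" "M \<subseteq> N" for N
    using maxC that M(2) by (simp add: C_def)
  obtain \<psi> where L: "subfield (Domain M) A" and \<psi>: "\<psi> \<in> ring_hom (A\<lparr>carrier := Domain M\<rparr>) B"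
    and Meq: "M = (\<lambda>x. (x, \<psi> x)) ` Domain M"
    by (rule hom_graphE[OF M(1) assms(1)])
  have "Domain M = carrier A"
  proof (rule equalityI)
    show "Domain M \<subseteq> carrier A" using M(1) by (auto simp: hom_graph_def)
    show "carrier A \<subseteq> Domain M"
    proof
      fix z assume z: "z \<in> carrier A"
      have za: "(A.algebraic over Domain M) z"
        by (rule A.algebraic_mono[OF _ alg[OF z]]) (use M(2) in auto)
      define p where "p = A.Irr (Domain M) z"
      note p = A.IrrE[OF L z za, folded p_def]
      have fL: "field (A\<lparr>carrier := Domain M\<rparr>)" using A.subfield_iff(2)[OF L] .
      have "p \<in> carrier (poly_ring (A\<lparr>carrier := Domain M\<rparr>))"
        using p(1) A.univ_poly_consistent[OF subfieldE(1)[OF L]] by simp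
      then have mp: "map \<psi> p \<in> carrier (poly_ring B)"
        by (rule polynomial_hom[OF \<psi> fL B.field_axioms])
      have "Polynomials.degree p \<ge> 1" using A.pirreducible_degree[OF L p(1,2)] .
      then have "B.roots (map \<psi> p) \<noteq> {#}"
        using B.roots_over_carrier[OF mp] unfolding B.splitted_def by auto
      then obtain w where "B.is_root (map \<psi> p) w"
        using B.roots_mem_iff_is_root[OF mp] by blast
      then have w: "w \<in> carrier B" "B.eval (map \<psi> p) w = \<zero>\<^bsub>B\<^esub>" by (auto simp: B.is_root_def)
      obtain g where "hom_graph A B g" "M \<subseteq> g" "(z, w) \<in> g"
        using hom_graph_step[OF assms(1) B.field_axioms L \<psi> z za w(1) w(2)[unfolded p_def]] Meq by auto
      then show "z \<in> Domain M" using max by blast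
    qed
  qed
  then have "\<psi> \<in> ring_hom A B" using \<psi> by simp
  moreover have "\<psi> x = y" if "(x, y) \<in> g\<^sub>0" for x y
  proof -
    have "(x, y) \<in> (\<lambda>x. (x, \<psi> x)) ` Domain M" using that M(2) Meq by (metis subsetD)
    then show ?thesis by auto
  qed
  ultimately show ?thesis by (rule that)
qed

text \<open>The start for comparing two extensions of the same field; injectivity of
  \<open>i\<close> makes the relation single valued.\<close>

lemma graph_of_const:
  assumes "field F" "field A" "field B" "i \<in> ring_hom F A" "j \<in> ring_hom F B"
  shows "hom_graph A B ((\<lambda>x. (i x, j x)) ` carrier F)"
proof -
  interpret F: field F by fact
  interpret A: field A by fact
  interpret B: field B by fact
  interpret i: ring_hom_ring F A i by (rule ring_hom_ringI2) (use assms in \<open>auto intro: F.ring_axioms A.ring_axioms\<close>)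
  interpret j: ring_hom_ring F B j by (rule ring_hom_ringI2) (use assms in \<open>auto intro: F.ring_axioms B.ring_axioms\<close>)
  have inji: "inj_on i (carrier F)"
    by (rule non_trivial_field_hom_is_inj) (use assms in auto)
  have injj: "inj_on j (carrier F)"
    by (rule non_trivial_field_hom_is_inj) (use assms in auto)
  show ?thesis
    unfolding hom_graph_def
  proof (intro conjI allI impI)
    show "(\<lambda>x. (i x, j x)) ` carrier F \<subseteq> carrier A \<times> carrier B" by auto
    show "(\<one>\<^bsub>A\<^esub>, \<one>\<^bsub>B\<^esub>) \<in> (\<lambda>x. (i x, j x)) ` carrier F"
      by (rule image_eqI[of _ _ "\<one>\<^bsub>F\<^esub>"]) auto
    show "single_valued ((\<lambda>x. (i x, j x)) ` carrier F)"
      using inji by (auto simp: single_valued_def dest: inj_onD)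
    fix x y assume "(x, y) \<in> (\<lambda>x. (i x, j x)) ` carrier F"
    then obtain a where a: "a \<in> carrier F" "x = i a" "y = j a" by auto
    show "(\<ominus>\<^bsub>A\<^esub> x, \<ominus>\<^bsub>B\<^esub> y) \<in> (\<lambda>x. (i x, j x)) ` carrier F"
      by (rule image_eqI[of _ _ "\<ominus>\<^bsub>F\<^esub> a"]) (use a in auto)
    { assume "x \<noteq> \<zero>\<^bsub>A\<^esub>"
      then have a0: "a \<noteq> \<zero>\<^bsub>F\<^esub>" using a by auto
      have aU: "a \<in> Units F" using a a0 F.field_Units by auto
      have "i a \<otimes>\<^bsub>A\<^esub> i (inv\<^bsub>F\<^esub> a) = \<one>\<^bsub>A\<^esub>" "j a \<otimes>\<^bsub>B\<^esub> j (inv\<^bsub>F\<^esub> a) = \<one>\<^bsub>B\<^esub>"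
        using aU by (simp_all add: F.Units_closed flip: i.hom_mult j.hom_mult)
      then have "inv\<^bsub>A\<^esub> x = i (inv\<^bsub>F\<^esub> a)" "inv\<^bsub>B\<^esub> y = j (inv\<^bsub>F\<^esub> a)"
        using a aU by (simp_all add: A.comm_inv_char B.comm_inv_char)
      then show "(inv\<^bsub>A\<^esub> x, inv\<^bsub>B\<^esub> y) \<in> (\<lambda>x. (i x, j x)) ` carrier F"
        using aU by (intro image_eqI[of _ _ "inv\<^bsub>F\<^esub> a"]) auto }
    fix x' y' assume "(x', y') \<in> (\<lambda>x. (i x, j x)) ` carrier F"
    then obtain b where b: "b \<in> carrier F" "x' = i b" "y' = j b" by auto
    show "(x \<oplus>\<^bsub>A\<^esub> x', y \<oplus>\<^bsub>B\<^esub> y') \<in> (\<lambda>x. (i x, j x)) ` carrier F"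
      by (rule image_eqI[of _ _ "a \<oplus>\<^bsub>F\<^esub> b"]) (use a b in auto)
    show "(x \<otimes>\<^bsub>A\<^esub> x', y \<otimes>\<^bsub>B\<^esub> y') \<in> (\<lambda>x. (i x, j x)) ` carrier F"
      by (rule image_eqI[of _ _ "a \<otimes>\<^bsub>F\<^esub> b"]) (use a b in auto)
  qed
qed

section \<open>The absolute Galois group\<close>

locale gal_field = F: field F for F :: "'a ring"
begin

abbreviation "Om \<equiv> alg_clos F"
abbreviation "emb \<equiv> clos_emb F"
abbreviation "KF \<equiv> clos_emb F ` carrier F"
abbreviation "G \<equiv> carrier (abs_gal F)"

sublocale O: algebraic_closure "alg_clos F" "clos_emb F ` carrier F"
  by (rule F.alg_closureE(1))

lemma emb_hom: "emb \<in> ring_hom F Om" by (rule F.alg_closureE(2))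

sublocale emb: ring_hom_ring F "alg_clos F" "clos_emb F"
  by (rule ring_hom_ringI2) (use emb_hom in \<open>auto intro: F.ring_axioms O.ring_axioms\<close>)

lemma subfield_KF: "subfield KF Om"
  using O.subfield_axioms .

lemma gal_iff: "\<sigma> \<in> G \<longleftrightarrow> \<sigma> \<in> Bij (carrier Om) \<and> \<sigma> \<in> ring_hom Om Om \<and> (\<forall>a\<in>carrier F. \<sigma> (emb a) = emb a)"
  by (auto simp: abs_gal_def)

lemma gal_hom: "\<sigma> \<in> G \<Longrightarrow> \<sigma> \<in> ring_hom Om Om"
  and gal_fix: "\<sigma> \<in> G \<Longrightarrow> a \<in> carrier F \<Longrightarrow> \<sigma> (emb a) = emb a"
  and gal_bij: "\<sigma> \<in> G \<Longrightarrow> bij_betw \<sigma> (carrier Om) (carrier Om)"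
  and gal_ext: "\<sigma> \<in> G \<Longrightarrow> \<sigma> \<in> extensional (carrier Om)"
  by (auto simp: gal_iff Bij_def)

lemma gal_closed [simp]: "\<sigma> \<in> G \<Longrightarrow> x \<in> carrier Om \<Longrightarrow> \<sigma> x \<in> carrier Om"
  using ring_hom_closed[OF gal_hom] .

lemma gal_mult_eq: "\<sigma> \<in> G \<Longrightarrow> \<tau> \<in> G \<Longrightarrow> \<sigma> \<otimes>\<^bsub>abs_gal F\<^esub> \<tau> = compose (carrier Om) \<sigma> \<tau>"
  by (simp add: abs_gal_def BijGroup_def)

lemma gal_mult_closed:
  assumes "\<sigma> \<in> G" "\<tau> \<in> G" shows "\<sigma> \<otimes>\<^bsub>abs_gal F\<^esub> \<tau> \<in> G"
proof -
  have *: "emb a \<in> carrier Om" if "a \<in> carrier F" for a using that by auto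
  show ?thesis
    unfolding gal_mult_eq[OF assms] gal_iff
  proof (intro conjI ballI)
    show "compose (carrier Om) \<sigma> \<tau> \<in> Bij (carrier Om)" using assms by (simp add: gal_iff compose_Bij)
    show "compose (carrier Om) \<sigma> \<tau> \<in> ring_hom Om Om"
      by (rule ring_hom_memI) (use assms in \<open>auto simp: compose_def ring_hom_mult[OF gal_hom] ring_hom_add[OF gal_hom] ring_hom_one[OF gal_hom]\<close>)
    show "compose (carrier Om) \<sigma> \<tau> (emb a) = emb a" if "a \<in> carrier F" for a
      using that assms * by (simp add: compose_def gal_fix)
  qed
qed

lemma gal_mult_apply: "\<sigma> \<in> G \<Longrightarrow> \<tau> \<in> G \<Longrightarrow> x \<in> carrier Om \<Longrightarrow> (\<sigma> \<otimes>\<^bsub>abs_gal F\<^esub> \<tau>) x = \<sigma> (\<tau> x)"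
  by (simp add: gal_mult_eq compose_def)

lemma gal_id: "(\<lambda>x\<in>carrier Om. x) \<in> G"
proof -
  have *: "emb a \<in> carrier Om" if "a \<in> carrier F" for a using that by auto
  show ?thesis
    unfolding gal_iff by (auto simp: id_Bij * intro!: ring_hom_memI)
qed

lemma gal_eqI: "\<sigma> \<in> G \<Longrightarrow> \<tau> \<in> G \<Longrightarrow> (\<And>x. x \<in> carrier Om \<Longrightarrow> \<sigma> x = \<tau> x) \<Longrightarrow> \<sigma> = \<tau>"
  by (rule extensionalityI[OF gal_ext gal_ext]) auto

text \<open>\<open>C\<close> is the root set of one nonzero polynomial over the base field. It turns
  questions about endomorphisms of the closure into questions about maps of a finite set.\<close>

lemma conjugates:
  assumes z: "z \<in> carrier Om"
  obtains C where "finite C" "C \<subseteq> carrier Om" "z \<in> C"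
    "\<And>\<psi> x. \<psi> \<in> ring_hom Om Om \<Longrightarrow> (\<And>a. a \<in> carrier F \<Longrightarrow> \<psi> (emb a) = emb a) \<Longrightarrow> x \<in> C \<Longrightarrow> \<psi> x \<in> C"
proof -
  obtain p where p: "p \<in> carrier (univ_poly Om KF)" "p \<noteq> []" "O.eval p z = \<zero>\<^bsub>Om\<^esub>"
    using O.algebraicE[OF subfieldE(1)[OF subfield_KF] z O.algebraic_extension[OF z]] by blast
  have pO: "p \<in> carrier (poly_ring Om)"
    using O.carrier_polynomial_shell[OF subfieldE(1)[OF subfield_KF] p(1)] .
  have setp: "set p \<subseteq> KF" "set p \<subseteq> carrier Om" using p(1) pO by (auto simp: univ_poly_def polynomial_def)
  show ?thesis
  proof (rule that[of "{x. O.is_root p x}"])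
    show "finite {x. O.is_root p x}" by (rule O.finite_number_of_roots[OF pO])
    show "{x. O.is_root p x} \<subseteq> carrier Om" "z \<in> {x. O.is_root p x}" using p z by (auto simp: O.is_root_def)
    fix \<psi> x assume \<psi>: "\<psi> \<in> ring_hom Om Om" "\<And>a. a \<in> carrier F \<Longrightarrow> \<psi> (emb a) = emb a"
      and x: "x \<in> {x. O.is_root p x}"
    interpret \<psi>: ring_hom_ring Om Om \<psi> by (rule ring_hom_ringI2) (use \<psi> in \<open>auto intro: O.ring_axioms\<close>)
    have "map \<psi> p = p" using setp(1) \<psi>(2) by (intro map_idI) auto
    have x': "x \<in> carrier Om" "O.eval p x = \<zero>\<^bsub>Om\<^esub>" using x by (auto simp: O.is_root_def)
    have "O.eval p (\<psi> x) = \<psi> (O.eval p x)"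
      unfolding \<psi>.eval_hom'[OF x'(1) setp(2)] \<open>map \<psi> p = p\<close> ..
    also have "\<dots> = \<zero>\<^bsub>Om\<^esub>" unfolding x'(2) by (rule \<psi>.hom_zero)
    finally show "\<psi> x \<in> {x. O.is_root p x}" using x p by (simp add: O.is_root_def)
  qed
qed

text \<open>Surjectivity is the point: on a finite stable set an injective map is onto. The
  restriction puts the map into the extensional form that \<open>BijGroup\<close> demands.\<close>

lemma hom_in_gal:
  assumes \<psi>: "\<psi> \<in> ring_hom Om Om" "\<And>a. a \<in> carrier F \<Longrightarrow> \<psi> (emb a) = emb a"
  shows "restrict \<psi> (carrier Om) \<in> G"
proof -
  have *: "emb a \<in> carrier Om" if "a \<in> carrier F" for a using that by auto
  have inj: "inj_on \<psi> (carrier Om)"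
    by (rule non_trivial_field_hom_is_inj[OF \<psi>(1) O.field_axioms O.field_axioms])
  have "\<psi> ` carrier Om = carrier Om"
  proof
    show "\<psi> ` carrier Om \<subseteq> carrier Om" using ring_hom_closed[OF \<psi>(1)] by auto
    show "carrier Om \<subseteq> \<psi> ` carrier Om"
    proof
      fix z assume "z \<in> carrier Om"
      then obtain C where C: "finite C" "C \<subseteq> carrier Om" "z \<in> C" "\<And>x. x \<in> C \<Longrightarrow> \<psi> x \<in> C"
        using conjugates[of z] \<psi> by metis
      have "\<psi> ` C = C"
        by (rule endo_inj_surj) (use C inj in \<open>auto intro: inj_on_subset\<close>)
      then show "z \<in> \<psi> ` carrier Om" using C by blast
    qed
  qed
  then have "bij_betw (restrict \<psi> (carrier Om)) (carrier Om) (carrier Om)"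
    using inj by (simp add: bij_betw_def)
  moreover have "restrict \<psi> (carrier Om) \<in> ring_hom Om Om"
    by (rule ring_hom_memI)
      (auto simp: ring_hom_mult[OF \<psi>(1)] ring_hom_add[OF \<psi>(1)] ring_hom_one[OF \<psi>(1)] ring_hom_closed[OF \<psi>(1)])
  ultimately show ?thesis
    unfolding gal_iff using \<psi>(2) * by (auto simp: Bij_def)
qed

lemma algebraic_KF: "x \<in> carrier Om \<Longrightarrow> KF \<subseteq> L \<Longrightarrow> (ring.algebraic Om over L) x"
  by (rule O.algebraic_mono[OF _ O.algebraic_extension])

text \<open>The map over the base field that sends \<open>z\<close> to the root \<open>w\<close>
  extends to the whole closure, since the closure is algebraic over every subfield containing the
  base.\<close>

lemma exists_gal:
  assumes z: "z \<in> carrier Om" and w: "w \<in> carrier Om" "O.eval (O.Irr KF z) w = \<zero>\<^bsub>Om\<^esub>"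
  obtains \<sigma> where "\<sigma> \<in> G" "\<sigma> z = w"
proof -
  have "id \<in> ring_hom (Om\<lparr>carrier := KF\<rparr>) Om"
    using subfieldE(3)[OF subfield_KF] by (auto simp: ring_hom_def)
  then obtain g where g: "hom_graph Om Om g" "(\<lambda>x. (x, id x)) ` KF \<subseteq> g" "(z, w) \<in> g"
    using hom_graph_step[OF O.field_axioms O.field_axioms subfield_KF _ z O.algebraic_extension[OF z] w(1), of id] w(2)
    by auto
  have alg: "(O.algebraic over (Domain g)) x" if "x \<in> carrier Om" for x
    by (rule algebraic_KF[OF that]) (use g(2) in force)
  obtain \<psi> where \<psi>: "\<psi> \<in> ring_hom Om Om" "\<And>x y. (x, y) \<in> g \<Longrightarrow> \<psi> x = y"
    using hom_graph_extend[OF O.field_axioms O.algebraically_closed_axioms g(1) alg] by blast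
  have "restrict \<psi> (carrier Om) \<in> G"
    by (rule hom_in_gal[OF \<psi>(1)]) (use g(2) in \<open>auto intro!: \<psi>(2)\<close>)
  with that show ?thesis using z \<psi>(2)[OF g(3)] by (metis restrict_apply)
qed

end

section \<open>Fixed field and Kummer theory in characteristic zero\<close>

text \<open>The coefficient \<open>- n z\<close> is what \<open>fixed_field\<close> reads off. The
  vanishing above \<open>n\<close> is carried along because the recursion for a coefficient also
  looks at the same place of the previous power.\<close>

lemma (in domain) linear_power_coeff:
  assumes z: "z \<in> carrier R"
  shows "[\<one>, \<ominus> z] [^]\<^bsub>poly_ring R\<^esub> n \<in> carrier (poly_ring R) \<and>
    ring.coeff R ([\<one>, \<ominus> z] [^]\<^bsub>poly_ring R\<^esub> n) n = \<one> \<and>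
    (\<forall>i>n. ring.coeff R ([\<one>, \<ominus> z] [^]\<^bsub>poly_ring R\<^esub> n) i = \<zero>) \<and>
    (n > 0 \<longrightarrow> ring.coeff R ([\<one>, \<ominus> z] [^]\<^bsub>poly_ring R\<^esub> n) (n - 1) = \<ominus> ([n] \<cdot> z))"
proof (induction n)
  case 0
  interpret P: domain "poly_ring R" by (rule univ_poly_is_domain[OF carrier_is_subring])
  show ?case by (simp add: univ_poly_one) (simp add: univ_poly_def polynomial_def)
next
  case (Suc n)
  interpret P: domain "poly_ring R" by (rule univ_poly_is_domain[OF carrier_is_subring])
  define q where "q = [\<one>, \<ominus> z] [^]\<^bsub>poly_ring R\<^esub> n"
  have q: "q \<in> carrier (poly_ring R)" "ring.coeff R q n = \<one>" "\<And>i. i > n \<Longrightarrow> ring.coeff R q i = \<zero>"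
    "n > 0 \<Longrightarrow> ring.coeff R q (n - 1) = \<ominus> ([n] \<cdot> z)"
    using Suc by (auto simp: q_def)
  have l: "[\<one>, \<ominus> z] \<in> carrier (poly_ring R)" using z by (simp add: univ_poly_def polynomial_def)
  have setq: "set q \<subseteq> carrier R" using q(1) by (auto simp: univ_poly_def polynomial_def)
  have qc: "ring.coeff R q i \<in> carrier R" for i using setq by simp
  have eq: "[\<one>, \<ominus> z] [^]\<^bsub>poly_ring R\<^esub> Suc n = poly_mult [\<one>, \<ominus> z] q"
  proof -
    have "[\<one>, \<ominus> z] [^]\<^bsub>poly_ring R\<^esub> Suc n = [\<one>, \<ominus> z] \<otimes>\<^bsub>poly_ring R\<^esub> q"
      using P.m_comm[OF q(1) l] by (simp add: q_def)
    then show ?thesis by (simp add: univ_poly_mult)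
  qed
  have c: "ring.coeff R (poly_mult [\<one>, \<ominus> z] q) = (\<lambda>i. ring.coeff R (q @ [\<zero>]) i \<oplus> (\<ominus> z) \<otimes> ring.coeff R q i)"
  proof -
    define t where "t = map (\<lambda>a. (\<ominus> z) \<otimes> a) q"
    have st: "set t \<subseteq> carrier R" using setq z by (auto simp: t_def)
    have m1: "map (\<lambda>a. \<one> \<otimes> a) q = q" using setq by (intro map_idI) auto
    have p1: "poly_mult [\<ominus> z] q = poly_add t []" by (simp add: t_def)
    have "poly_mult [\<one>, \<ominus> z] q = poly_add (q @ [\<zero>]) (poly_add t [])"
      using p1 m1 by (simp del: poly_add.simps)
    moreover have "ring.coeff R (poly_add t []) = ring.coeff R t"
      using poly_add_coeff[OF st, of "[]"] st by simp
    moreover have "set (poly_add t []) \<subseteq> carrier R" by (rule poly_add_in_carrier[OF st]) simp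
    ultimately have "ring.coeff R (poly_mult [\<one>, \<ominus> z] q) = (\<lambda>i. ring.coeff R (q @ [\<zero>]) i \<oplus> ring.coeff R t i)"
      using poly_add_coeff[of "q @ [\<zero>]" "poly_add t []"] setq by (simp del: poly_add.simps)
    then show ?thesis using scalar_coeff[of "\<ominus> z" q] z by (simp add: t_def)
  qed
  have cS: "ring.coeff R (poly_mult [\<one>, \<ominus> z] q) (Suc i) = ring.coeff R q i \<oplus> (\<ominus> z) \<otimes> ring.coeff R q (Suc i)" for i
    unfolding c by (simp add: append_coeff)
  have c0: "ring.coeff R (poly_mult [\<one>, \<ominus> z] q) 0 = (\<ominus> z) \<otimes> ring.coeff R q 0"
    unfolding c using z qc by (simp add: append_coeff)
  have "ring.coeff R (poly_mult [\<one>, \<ominus> z] q) n = \<ominus> ([Suc n] \<cdot> z)"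
  proof (cases n)
    case 0 then show ?thesis using c0 q z by simp
  next
    case (Suc m)
    then show ?thesis using cS[of m] q z by (simp add: minus_add a_comm)
  qed
  moreover have "ring.coeff R (poly_mult [\<one>, \<ominus> z] q) i = \<zero>" if "i > Suc n" for i
    using that cS[of "i - 1"] q(3) z by simp
  moreover have "ring.coeff R (poly_mult [\<one>, \<ominus> z] q) (Suc n) = \<one>" using cS[of n] q z by simp
  moreover have "[\<one>, \<ominus> z] [^]\<^bsub>poly_ring R\<^esub> Suc n \<in> carrier (poly_ring R)" using l by simp
  ultimately show ?case unfolding eq by simp
qed

text \<open>Independence of distinct characters, on a multiplicative submonoid. Evaluate the
  relation at \<open>u y\<close> and subtract \<open>f k u\<close> times the relation at
  \<open>y\<close>: this removes the index \<open>k\<close>, where \<open>u\<close> separates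
  \<open>k\<close> from the index under study.\<close>

lemma (in domain) dedekind_independence:
  assumes "finite I" "M \<subseteq> carrier R" "\<one> \<in> M" "\<And>x y. x \<in> M \<Longrightarrow> y \<in> M \<Longrightarrow> x \<otimes> y \<in> M"
    and f: "\<And>i x. i \<in> I \<Longrightarrow> x \<in> M \<Longrightarrow> f i x \<in> carrier R"
      "\<And>i x y. i \<in> I \<Longrightarrow> x \<in> M \<Longrightarrow> y \<in> M \<Longrightarrow> f i (x \<otimes> y) = f i x \<otimes> f i y"
      "\<And>i. i \<in> I \<Longrightarrow> f i \<one> = \<one>"
      "\<And>i j. i \<in> I \<Longrightarrow> j \<in> I \<Longrightarrow> i \<noteq> j \<Longrightarrow> \<exists>y\<in>M. f i y \<noteq> f j y"
    and a: "a \<in> I \<rightarrow> carrier R"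
    and z: "\<And>y. y \<in> M \<Longrightarrow> (\<Oplus>i\<in>I. a i \<otimes> f i y) = \<zero>"
  shows "\<forall>i\<in>I. a i = \<zero>"
  using assms(1) f a z
proof (induction I arbitrary: a rule: finite_induct)
  case (insert k I)
  note [simp] = insert.prems(1)
  have ac: "a i \<in> carrier R" if "i \<in> insert k I" for i using insert.prems(5) that by auto
  have "a j = \<zero>" if j: "j \<in> I" for j
  proof -
    have "j \<noteq> k" using insert.hyps j by auto
    then obtain u where u: "u \<in> M" "f j u \<noteq> f k u" using insert.prems(4)[of j k] j by auto
    define b where "b i = a i \<otimes> (f i u \<ominus> f k u)" for i
    have bc: "b i \<in> carrier R" if "i \<in> insert k I" for i using that u ac by (auto simp: b_def)
    have "\<forall>i\<in>I. b i = \<zero>"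
    proof (rule insert.IH)
      show "b \<in> I \<rightarrow> carrier R" using bc by auto
      fix y assume y: "y \<in> M"
      have uy: "u \<otimes> y \<in> M" using assms(4) u y by auto
      have "(\<Oplus>i\<in>insert k I. b i \<otimes> f i y) =
        (\<Oplus>i\<in>insert k I. a i \<otimes> f i (u \<otimes> y) \<oplus> (\<ominus> f k u) \<otimes> (a i \<otimes> f i y))"
      proof (rule add.finprod_cong')
        fix i assume i: "i \<in> insert k I"
        have "f i (u \<otimes> y) = f i u \<otimes> f i y" using insert.prems(2) i u y by auto
        moreover have c: "a i \<in> carrier R" "f i u \<in> carrier R" "f k u \<in> carrier R" "f i y \<in> carrier R"
          using i u y ac by auto
        moreover have "b i = a i \<otimes> f i u \<oplus> (\<ominus> f k u) \<otimes> a i"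
          using c unfolding b_def by algebra
        ultimately show "b i \<otimes> f i y = a i \<otimes> f i (u \<otimes> y) \<oplus> (\<ominus> f k u) \<otimes> (a i \<otimes> f i y)"
          by (simp add: l_distr m_assoc)
      qed (use u y uy ac in auto)
      also have "\<dots> = (\<Oplus>i\<in>insert k I. a i \<otimes> f i (u \<otimes> y)) \<oplus> (\<Oplus>i\<in>insert k I. (\<ominus> f k u) \<otimes> (a i \<otimes> f i y))"
        by (rule finsum_addf) (use u y uy ac in auto)
      also have "(\<Oplus>i\<in>insert k I. (\<ominus> f k u) \<otimes> (a i \<otimes> f i y)) = (\<ominus> f k u) \<otimes> (\<Oplus>i\<in>insert k I. a i \<otimes> f i y)"
        by (rule finsum_rdistr[symmetric]) (use u y uy ac insert.hyps in auto)
      finally have "(\<Oplus>i\<in>insert k I. b i \<otimes> f i y) = \<zero>"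
        using insert.prems(6)[OF y] insert.prems(6)[OF uy] u by simp
      moreover have "(\<Oplus>i\<in>insert k I. b i \<otimes> f i y) = b k \<otimes> f k y \<oplus> (\<Oplus>i\<in>I. b i \<otimes> f i y)"
        by (rule finsum_insert) (use insert.hyps bc y in auto)
      moreover have "b k = \<zero>" using ac u by (simp add: b_def r_neg a_minus_def)
      moreover have "(\<Oplus>i\<in>I. b i \<otimes> f i y) \<in> carrier R" by (rule finsum_closed) (use bc y in auto)
      ultimately show "(\<Oplus>i\<in>I. b i \<otimes> f i y) = \<zero>" using y by simp
    qed (use insert.prems in auto)
    then have "a j \<otimes> (f j u \<ominus> f k u) = \<zero>" using j by (auto simp: b_def)
    then show ?thesis using u ac j by (subst (asm) integral_iff) auto
  qed
  moreover have "a k = \<zero>"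
  proof -
    have "(\<Oplus>i\<in>insert k I. a i \<otimes> f i \<one>) = a k \<otimes> f k \<one> \<oplus> (\<Oplus>i\<in>I. a i \<otimes> f i \<one>)"
      by (rule finsum_insert) (use insert.hyps ac assms(3) in auto)
    moreover have "(\<Oplus>i\<in>I. a i \<otimes> f i \<one>) = (\<Oplus>i\<in>I. \<zero>)"
      by (rule add.finprod_cong') (use calculation \<open>\<And>j. j \<in> I \<Longrightarrow> a j = \<zero>\<close> assms(3) in auto)
    moreover have "(\<Oplus>i\<in>I. \<zero>) = \<zero>" by (rule finsum_zero)
    ultimately show ?thesis using insert.prems(6)[OF assms(3)] insert.prems(3)[of k] ac[of k] by simp
  qed
  ultimately show ?case by auto
qed auto

locale gal_field0 = gal_field +
  assumes char0: "\<And>n::nat. n > 0 \<Longrightarrow> [n] \<cdot>\<^bsub>F\<^esub> \<one>\<^bsub>F\<^esub> \<noteq> \<zero>\<^bsub>F\<^esub>"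
begin

lemma emb_inj: "inj_on emb (carrier F)"
  by (rule non_trivial_field_hom_is_inj[OF emb_hom F.field_axioms O.field_axioms])

lemma char0_Om:
  assumes "(n::nat) > 0" shows "[n] \<cdot>\<^bsub>Om\<^esub> \<one>\<^bsub>Om\<^esub> \<in> KF - {\<zero>\<^bsub>Om\<^esub>}"
proof -
  have *: "[n] \<cdot>\<^bsub>F\<^esub> \<one>\<^bsub>F\<^esub> \<in> carrier F \<and> emb ([n] \<cdot>\<^bsub>F\<^esub> \<one>\<^bsub>F\<^esub>) = [n] \<cdot>\<^bsub>Om\<^esub> \<one>\<^bsub>Om\<^esub>" for n :: nat
    by (induction n) (auto simp: F.add.nat_pow_Suc)
  have "emb ([n] \<cdot>\<^bsub>F\<^esub> \<one>\<^bsub>F\<^esub>) \<noteq> emb \<zero>\<^bsub>F\<^esub>"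
    using emb_inj char0[OF assms] * by (metis F.zero_closed inj_onD)
  then show ?thesis using *[of n] by (metis DiffI emb.hom_zero image_eqI singletonD)
qed

text \<open>If \<open>z\<close> is fixed, every root of its minimal polynomial equals
  \<open>z\<close>, as any root is the image of \<open>z\<close> under some automorphism. The
  polynomial is therefore \<open>(X - z)^n\<close>, its second coefficient \<open>- n z\<close> lies
  in the base field, and \<open>n\<close> is invertible there.\<close>

theorem fixed_field:
  assumes z: "z \<in> carrier Om" and fx: "\<And>\<sigma>. \<sigma> \<in> G \<Longrightarrow> \<sigma> z = z"
  shows "z \<in> KF"
proof -
  define p where "p = O.Irr KF z"
  note p = O.IrrE[OF subfield_KF z O.algebraic_extension[OF z], folded p_def]
  have pO: "p \<in> carrier (poly_ring Om)"
    using O.carrier_polynomial_shell[OF subfieldE(1)[OF subfield_KF] p(1)] .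
  have pne: "p \<noteq> []" using p(2) O.pirreducible_degree[OF subfield_KF p(1,2)] by auto
  have root: "w = z" if "O.is_root p w" for w
    using exists_gal[OF z, of w] that fx unfolding O.is_root_def p_def by metis
  define n where "n = Polynomials.degree p"
  have n: "n > 0" using O.pirreducible_degree[OF subfield_KF p(1,2)] by (simp add: n_def)
  have "set_mset (O.roots p) \<subseteq> {z}"
    using root O.roots_mem_iff_is_root[OF pO] by auto
  then have "O.roots p = replicate_mset (size (O.roots p)) z"
    using set_mset_subset_singletonD by fastforce
  moreover have "size (O.roots p) = n"
    using O.roots_over_carrier[OF pO] by (simp add: O.splitted_def n_def)
  ultimately have "O.alg_mult p z = n"
    using O.alg_mult_eq_count_roots[OF pO] by (metis count_replicate_mset)
  then have "([\<one>\<^bsub>Om\<^esub>, \<ominus>\<^bsub>Om\<^esub> z] [^]\<^bsub>poly_ring Om\<^esub> n) pdivides\<^bsub>Om\<^esub> p"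
    using O.alg_multE(1)[OF z pO pne] by simp
  then obtain r where r: "r \<in> carrier (poly_ring Om)"
    and pr: "p = ([\<one>\<^bsub>Om\<^esub>, \<ominus>\<^bsub>Om\<^esub> z] [^]\<^bsub>poly_ring Om\<^esub> n) \<otimes>\<^bsub>poly_ring Om\<^esub> r"
    by (auto simp: pdivides_def factor_def)
  interpret P: domain "poly_ring Om" by (rule O.univ_poly_is_domain[OF O.carrier_is_subring])
  define q where "q = [\<one>\<^bsub>Om\<^esub>, \<ominus>\<^bsub>Om\<^esub> z] [^]\<^bsub>poly_ring Om\<^esub> n"
  have l: "[\<one>\<^bsub>Om\<^esub>, \<ominus>\<^bsub>Om\<^esub> z] \<in> carrier (poly_ring Om)" using z by (simp add: univ_poly_def polynomial_def)
  note qq = O.linear_power_coeff[OF z, of n, folded q_def]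
  have pr: "p = O.poly_mult q r" using pr by (simp add: q_def univ_poly_mult)
  have qne: "q \<noteq> []" using qq by auto
  have rne: "r \<noteq> []" using pr pne qne P.r_null[of q] qq by (auto simp: univ_poly_mult univ_poly_zero)
  have "Polynomials.degree q = n"
    using O.polynomial_pow_degree[OF l, of n] by (simp add: q_def)
  then have "Polynomials.degree r = 0"
    using O.poly_mult_degree_eq[OF O.carrier_is_subring, of q r] qne rne qq r pr
    by (simp add: univ_poly_carrier n_def)
  then obtain c where rc: "r = [c]" using rne by (cases r) auto
  have c: "c \<in> carrier Om" "c \<noteq> \<zero>\<^bsub>Om\<^esub>" using r rc by (auto simp: univ_poly_def polynomial_def)
  have "p = O.poly_mult [c] q"
    using P.m_comm[of q r] qq r pr rc by (simp add: univ_poly_mult del: O.poly_mult.simps)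
  also have "\<dots> = map (\<lambda>b. c \<otimes>\<^bsub>Om\<^esub> b) q"
    by (rule O.poly_mult_const(1)[OF O.carrier_is_subring]) (use qq c in \<open>auto simp: univ_poly_carrier\<close>)
  finally have coeffp: "O.coeff p i = c \<otimes>\<^bsub>Om\<^esub> O.coeff q i" for i using O.scalar_coeff[OF c(1), of q] by simp
  have "O.coeff p n = \<one>\<^bsub>Om\<^esub>" using O.lead_coeff_simp[OF pne] p(3) by (simp add: n_def)
  then have c1: "c = \<one>\<^bsub>Om\<^esub>" using coeffp[of n] qq c by simp
  have "O.coeff p (n - 1) = \<ominus>\<^bsub>Om\<^esub> ([n] \<cdot>\<^bsub>Om\<^esub> z)"
    using coeffp[of "n - 1"] qq n z by (simp add: c1)
  moreover have "O.coeff p (n - 1) \<in> set p" using O.coeff_nth[of "n - 1" p] n n_def by auto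
  moreover have "set p \<subseteq> KF" using p(1) by (auto simp: univ_poly_def polynomial_def)
  ultimately have k: "\<ominus>\<^bsub>Om\<^esub> ([n] \<cdot>\<^bsub>Om\<^esub> z) \<in> KF" by auto
  note K = subringE[OF subfieldE(1)[OF subfield_KF]]
  have nz: "[n] \<cdot>\<^bsub>Om\<^esub> z \<in> KF" using K(5)[OF k] z by simp
  define N where "N = [n] \<cdot>\<^bsub>Om\<^esub> \<one>\<^bsub>Om\<^esub>"
  have N: "N \<in> KF - {\<zero>\<^bsub>Om\<^esub>}" using char0_Om[OF n] by (simp add: N_def)
  have Nz: "[n] \<cdot>\<^bsub>Om\<^esub> z = N \<otimes>\<^bsub>Om\<^esub> z" using O.add_pow_ldistr[of "\<one>\<^bsub>Om\<^esub>" z n] z by (simp add: N_def)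
  have i: "inv\<^bsub>Om\<^esub> N \<in> KF" "inv\<^bsub>Om\<^esub> N \<otimes>\<^bsub>Om\<^esub> N = \<one>\<^bsub>Om\<^esub>"
    using O.subfield_m_inv[OF subfield_KF N] by auto
  have "inv\<^bsub>Om\<^esub> N \<otimes>\<^bsub>Om\<^esub> (N \<otimes>\<^bsub>Om\<^esub> z) = z"
    using i N K(1) z by (subst O.m_assoc[symmetric]) auto
  then show ?thesis using K(6)[OF i(1) nz] by (simp add: Nz)
qed

lemma gal_inverse:
  assumes "\<sigma> \<in> G"
  shows "\<exists>\<tau>\<in>G. \<forall>x\<in>carrier Om. \<tau> (\<sigma> x) = x \<and> \<sigma> (\<tau> x) = x"
proof -
  have "\<sigma> \<in> ring_iso Om Om" using gal_hom[OF assms] gal_bij[OF assms] by (simp add: ring_iso_def)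
  then have h: "inv_into (carrier Om) \<sigma> \<in> ring_hom Om Om"
    using ring_iso_set_sym[OF O.ring_axioms] by (auto simp: ring_iso_def)
  have b: "inv_into (carrier Om) \<sigma> (\<sigma> x) = x" "\<sigma> (inv_into (carrier Om) \<sigma> x) = x" if "x \<in> carrier Om" for x
    using that gal_bij[OF assms] by (auto simp: bij_betw_def f_inv_into_f)
  have "emb a \<in> carrier Om" if "a \<in> carrier F" for a using that by auto
  then have "inv_into (carrier Om) \<sigma> (emb a) = emb a" if "a \<in> carrier F" for a
    using b(1)[of "emb a"] gal_fix[OF assms that] that by auto
  then have "restrict (inv_into (carrier Om) \<sigma>) (carrier Om) \<in> G" by (rule hom_in_gal[OF h])
  then show ?thesis
    by (rule bexI[rotated]) (use b assms in auto)
qed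

text \<open>Hilbert 90 for a quadratic character, by a Lagrange resolvent. The character is a
  boolean with \<open>True\<close> for the sign \<open>+1\<close>, so that equality of booleans is
  the product of signs.\<close>

theorem kummer:
  assumes hom: "\<And>\<sigma> \<tau>. \<sigma> \<in> G \<Longrightarrow> \<tau> \<in> G \<Longrightarrow> \<chi> (\<sigma> \<otimes>\<^bsub>abs_gal F\<^esub> \<tau>) = (\<chi> \<sigma> = \<chi> \<tau>)"
    and S: "finite S" "S \<subseteq> carrier Om" "\<And>\<tau>. \<tau> \<in> G \<Longrightarrow> (\<And>x. x \<in> S \<Longrightarrow> \<tau> x = x) \<Longrightarrow> \<chi> \<tau>"
  obtains x d where "x \<in> carrier Om" "x \<noteq> \<zero>\<^bsub>Om\<^esub>" "d \<in> carrier F" "d \<noteq> \<zero>\<^bsub>F\<^esub>" "x \<otimes>\<^bsub>Om\<^esub> x = emb d"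
    "\<And>\<sigma>. \<sigma> \<in> G \<Longrightarrow> \<sigma> x = (if \<chi> \<sigma> then x else \<ominus>\<^bsub>Om\<^esub> x)"
proof -
  have "\<exists>C. finite C \<and> C \<subseteq> carrier Om \<and> z \<in> C \<and> (\<forall>\<psi>\<in>G. \<forall>x\<in>C. \<psi> x \<in> C)" if "z \<in> carrier Om" for z
    using conjugates[OF that] gal_hom gal_fix by metis
  then obtain C where C: "\<And>z. z \<in> carrier Om \<Longrightarrow> finite (C z) \<and> C z \<subseteq> carrier Om \<and> z \<in> C z \<and> (\<forall>\<psi>\<in>G. \<forall>x\<in>C z. \<psi> x \<in> C z)"
    by metis
  \<comment> \<open>Closing \<open>S\<close> under conjugation makes \<open>T\<close> stable under
    the group; restriction to \<open>T\<close> is then a finite quotient through which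
    \<open>\<chi>\<close> factors.\<close>
  define T where "T = (\<Union>z\<in>S. C z)"
  have Sc: "z \<in> carrier Om" if "z \<in> S" for z using S(2) that by auto
  have T: "finite T" "T \<subseteq> carrier Om" "S \<subseteq> T"
    using C[OF Sc] S(1) unfolding T_def by auto
  have T4: "\<sigma> x \<in> T" if sx: "\<sigma> \<in> G" "x \<in> T" for \<sigma> x
  proof -
    obtain z where z: "z \<in> S" "x \<in> C z" using sx by (auto simp: T_def)
    then have "\<sigma> x \<in> C z" using C[OF Sc[OF z(1)]] sx by auto
    with z show ?thesis by (auto simp: T_def)
  qed
  have agree: "\<chi> \<sigma> = \<chi> \<tau>" if st: "\<sigma> \<in> G" "\<tau> \<in> G" "\<And>x. x \<in> T \<Longrightarrow> \<sigma> x = \<tau> x" for \<sigma> \<tau>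
  proof -
    from gal_inverse[OF st(1)] obtain \<rho> where \<rho>1: "\<rho> \<in> G"
      and "\<forall>x\<in>carrier Om. \<rho> (\<sigma> x) = x \<and> \<sigma> (\<rho> x) = x" ..
    then have "\<And>x. x \<in> carrier Om \<Longrightarrow> \<rho> (\<sigma> x) = x" by blast
    note \<rho> = \<rho>1 this
    have "\<chi> (\<rho> \<otimes>\<^bsub>abs_gal F\<^esub> \<sigma>)"
      by (rule S(3)[OF gal_mult_closed[OF \<rho>(1) st(1)]]) (use \<rho> st Sc in \<open>auto simp: gal_mult_apply\<close>)
    moreover have "\<chi> (\<rho> \<otimes>\<^bsub>abs_gal F\<^esub> \<tau>)"
    proof (rule S(3)[OF gal_mult_closed[OF \<rho>(1) st(2)]])
      fix x assume "x \<in> S"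
      then have "x \<in> carrier Om" "\<sigma> x = \<tau> x" using Sc T(3) st(3) by auto
      then show "(\<rho> \<otimes>\<^bsub>abs_gal F\<^esub> \<tau>) x = x" using gal_mult_apply[OF \<rho>(1) st(2)] \<rho>(2) by metis
    qed
    ultimately show ?thesis using hom[OF \<rho>(1) st(1)] hom[OF \<rho>(1) st(2)] by blast
  qed
  define I where "I = (\<lambda>\<sigma>. restrict \<sigma> T) ` G"
  have "I \<subseteq> T \<rightarrow>\<^sub>E T" using T4 by (auto simp: I_def)
  then have finI: "finite I" using finite_PiE[OF T(1), of "\<lambda>_. T"] T(1) finite_subset by auto
  define rep where "rep \<rho> = (SOME \<sigma>. \<sigma> \<in> G \<and> restrict \<sigma> T = \<rho>)" for \<rho>
  have rep: "rep \<rho> \<in> G" "restrict (rep \<rho>) T = \<rho>" if "\<rho> \<in> I" for \<rho>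
    using that someI_ex[of "\<lambda>\<sigma>. \<sigma> \<in> G \<and> restrict \<sigma> T = \<rho>"] by (auto simp: rep_def I_def)
  \<comment> \<open>\<open>M\<close> plays the part of the field generated by \<open>T\<close>: an
    automorphism acts on it through its restriction to \<open>T\<close>, and distinct elements of
    \<open>I\<close> are distinct characters of it.\<close>
  define M where "M = {y \<in> carrier Om. \<forall>\<sigma>\<in>G. \<forall>\<tau>\<in>G. restrict \<sigma> T = restrict \<tau> T \<longrightarrow> \<sigma> y = \<tau> y}"
  have Meq: "\<sigma> y = \<tau> y" if "y \<in> M" "\<sigma> \<in> G" "\<tau> \<in> G" "restrict \<sigma> T = restrict \<tau> T" for y \<sigma> \<tau>
    using that unfolding M_def by blast
  have Mc: "y \<in> carrier Om" if "y \<in> M" for y using that by (simp add: M_def)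
  have MT: "T \<subseteq> M" unfolding M_def using T(2) by (auto dest: fun_cong split: if_splits)
  define a where "a \<rho> = (if \<chi> (rep \<rho>) then \<one>\<^bsub>Om\<^esub> else \<ominus>\<^bsub>Om\<^esub> \<one>\<^bsub>Om\<^esub>)" for \<rho>
  have ac: "a \<rho> \<in> carrier Om" "a \<rho> \<noteq> \<zero>\<^bsub>Om\<^esub>" for \<rho> by (auto simp: a_def)
  have "\<exists>y\<in>M. (\<Oplus>\<^bsub>Om\<^esub>\<rho>\<in>I. a \<rho> \<otimes>\<^bsub>Om\<^esub> rep \<rho> y) \<noteq> \<zero>\<^bsub>Om\<^esub>"
  proof (rule ccontr)
    assume "\<not> ?thesis"
    then have z: "\<And>y. y \<in> M \<Longrightarrow> (\<Oplus>\<^bsub>Om\<^esub>\<rho>\<in>I. a \<rho> \<otimes>\<^bsub>Om\<^esub> rep \<rho> y) = \<zero>\<^bsub>Om\<^esub>" by auto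
    have "\<forall>\<rho>\<in>I. a \<rho> = \<zero>\<^bsub>Om\<^esub>"
    proof (rule O.dedekind_independence[OF finI, of M rep])
      show "M \<subseteq> carrier Om" by (auto simp: M_def)
      show "\<one>\<^bsub>Om\<^esub> \<in> M" by (auto simp: M_def ring_hom_one[OF gal_hom])
      show "x \<otimes>\<^bsub>Om\<^esub> y \<in> M" if "x \<in> M" "y \<in> M" for x y
      proof -
        have xy: "x \<in> carrier Om" "y \<in> carrier Om" using that Mc by auto
        show ?thesis
          unfolding M_def
        proof (intro CollectI conjI ballI impI)
          show "x \<otimes>\<^bsub>Om\<^esub> y \<in> carrier Om" using xy by simp
          fix \<sigma> \<tau> assume "\<sigma> \<in> G" "\<tau> \<in> G" "restrict \<sigma> T = restrict \<tau> T"
          then show "\<sigma> (x \<otimes>\<^bsub>Om\<^esub> y) = \<tau> (x \<otimes>\<^bsub>Om\<^esub> y)"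
            using xy Meq[OF that(1)] Meq[OF that(2)] by (metis ring_hom_mult[OF gal_hom])
        qed
      qed
      show "\<exists>y\<in>M. rep i y \<noteq> rep j y" if "i \<in> I" "j \<in> I" "i \<noteq> j" for i j
      proof (rule ccontr)
        assume "\<not> ?thesis"
        then have "\<forall>t\<in>T. rep i t = rep j t" using MT by auto
        then have "restrict (rep i) T = restrict (rep j) T" by (intro restrict_ext) auto
        then show False using rep that by metis
      qed
    qed (use rep ac z Mc in \<open>auto simp: ring_hom_mult[OF gal_hom] ring_hom_one[OF gal_hom]\<close>)
    moreover have "restrict (\<lambda>x\<in>carrier Om. x) T \<in> I" unfolding I_def by (rule imageI[OF gal_id])
    ultimately show False using ac by blast
  qed
  then obtain y where y: "y \<in> M" and ne: "(\<Oplus>\<^bsub>Om\<^esub>\<rho>\<in>I. a \<rho> \<otimes>\<^bsub>Om\<^esub> rep \<rho> y) \<noteq> \<zero>\<^bsub>Om\<^esub>" by auto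
  have yc: "y \<in> carrier Om" using y by (simp add: M_def)
  \<comment> \<open>The resolvent. Applying \<open>\<sigma>\<close> permutes the index set by
    \<open>h\<close>, and each coefficient differs from the one at the permuted index by the sign
    \<open>e\<close> of \<open>\<sigma>\<close>.\<close>
  define x where "x = (\<Oplus>\<^bsub>Om\<^esub>\<rho>\<in>I. a \<rho> \<otimes>\<^bsub>Om\<^esub> rep \<rho> y)"
  have terms: "a \<rho> \<otimes>\<^bsub>Om\<^esub> rep \<rho> y \<in> carrier Om" if "\<rho> \<in> I" for \<rho> using that ac rep yc by auto
  have xc: "x \<in> carrier Om" unfolding x_def by (rule O.finsum_closed) (use terms in auto)
  have act: "\<sigma> x = (if \<chi> \<sigma> then x else \<ominus>\<^bsub>Om\<^esub> x)" if \<sigma>: "\<sigma> \<in> G" for \<sigma>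
  proof -
    interpret \<sigma>: ring_hom_ring Om Om \<sigma>
      by (rule ring_hom_ringI2) (use gal_hom[OF \<sigma>] in \<open>auto intro: O.ring_axioms\<close>)
    define e where "e = (if \<chi> \<sigma> then \<one>\<^bsub>Om\<^esub> else \<ominus>\<^bsub>Om\<^esub> \<one>\<^bsub>Om\<^esub>)"
    define h where "h \<rho> = restrict (\<sigma> \<otimes>\<^bsub>abs_gal F\<^esub> rep \<rho>) T" for \<rho>
    have hI: "h \<rho> \<in> I" if "\<rho> \<in> I" for \<rho>
      using gal_mult_closed[OF \<sigma> rep(1)[OF that]] by (auto simp: h_def I_def)
    have hr: "restrict (rep (h \<rho>)) T = restrict (\<sigma> \<otimes>\<^bsub>abs_gal F\<^esub> rep \<rho>) T" if "\<rho> \<in> I" for \<rho>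
      using rep(2)[OF hI[OF that]] by (simp add: h_def)
    have hy: "rep (h \<rho>) y = \<sigma> (rep \<rho> y)" if "\<rho> \<in> I" for \<rho>
    proof -
      have "rep (h \<rho>) y = (\<sigma> \<otimes>\<^bsub>abs_gal F\<^esub> rep \<rho>) y"
        by (rule Meq[OF y rep(1)[OF hI[OF that]] gal_mult_closed[OF \<sigma> rep(1)[OF that]] hr[OF that]])
      then show ?thesis using gal_mult_apply[OF \<sigma> rep(1)[OF that] yc] by simp
    qed
    have ha: "a \<rho> = e \<otimes>\<^bsub>Om\<^esub> a (h \<rho>)" if "\<rho> \<in> I" for \<rho>
    proof -
      have "\<chi> (rep (h \<rho>)) = \<chi> (\<sigma> \<otimes>\<^bsub>abs_gal F\<^esub> rep \<rho>)"
        by (rule agree[OF rep(1)[OF hI[OF that]] gal_mult_closed[OF \<sigma> rep(1)[OF that]]])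
          (metis hr[OF that] restrict_apply')
      then show ?thesis using hom[OF \<sigma> rep(1)[OF that]] by (auto simp: a_def e_def O.l_minus)
    qed
    have injh: "inj_on h I"
    proof (rule inj_onI)
      fix \<rho> \<rho>' assume r: "\<rho> \<in> I" "\<rho>' \<in> I" "h \<rho> = h \<rho>'"
      have "rep \<rho> t = rep \<rho>' t" if t: "t \<in> T" for t
      proof -
        have tc: "t \<in> carrier Om" using t T(2) by auto
        have "\<sigma> (rep \<rho> t) = \<sigma> (rep \<rho>' t)"
          using fun_cong[OF r(3), of t] t tc \<sigma> rep r by (simp add: h_def gal_mult_apply)
        then show ?thesis using gal_bij[OF \<sigma>] rep r tc by (auto simp: bij_betw_def dest!: inj_onD)
      qed
      then have "restrict (rep \<rho>) T = restrict (rep \<rho>') T" by (intro restrict_ext) auto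
      then show "\<rho> = \<rho>'" using rep r by metis
    qed
    have hII: "h ` I = I" by (rule endo_inj_surj) (use finI hI injh in auto)
    have ec: "e \<in> carrier Om" by (auto simp: e_def)
    have \<sigma>a: "\<sigma> (a \<rho>) = a \<rho>" for \<rho> by (auto simp: a_def)
    have "\<sigma> x = (\<Oplus>\<^bsub>Om\<^esub>\<rho>\<in>I. \<sigma> (a \<rho> \<otimes>\<^bsub>Om\<^esub> rep \<rho> y))"
      unfolding x_def using terms by (subst \<sigma>.hom_finsum) (auto simp: comp_def)
    also have "\<dots> = (\<Oplus>\<^bsub>Om\<^esub>\<rho>\<in>I. e \<otimes>\<^bsub>Om\<^esub> (a (h \<rho>) \<otimes>\<^bsub>Om\<^esub> rep (h \<rho>) y))"
    proof (rule O.add.finprod_cong'[OF refl])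
      show "(\<lambda>\<rho>. e \<otimes>\<^bsub>Om\<^esub> (a (h \<rho>) \<otimes>\<^bsub>Om\<^esub> rep (h \<rho>) y)) \<in> I \<rightarrow> carrier Om"
        using terms[OF hI] ec by blast
      fix \<rho> assume \<rho>: "\<rho> \<in> I"
      have "\<sigma> (a \<rho> \<otimes>\<^bsub>Om\<^esub> rep \<rho> y) = a \<rho> \<otimes>\<^bsub>Om\<^esub> rep (h \<rho>) y"
        using \<sigma>.hom_mult[OF ac(1)] rep(1)[OF \<rho>] yc by (simp add: \<sigma>a hy[OF \<rho>])
      also have "\<dots> = e \<otimes>\<^bsub>Om\<^esub> (a (h \<rho>) \<otimes>\<^bsub>Om\<^esub> rep (h \<rho>) y)"
        by (subst ha[OF \<rho>]) (use ec ac rep(1)[OF hI[OF \<rho>]] yc in \<open>simp add: O.m_assoc\<close>)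
      finally show "\<sigma> (a \<rho> \<otimes>\<^bsub>Om\<^esub> rep \<rho> y) = e \<otimes>\<^bsub>Om\<^esub> (a (h \<rho>) \<otimes>\<^bsub>Om\<^esub> rep (h \<rho>) y)" .
    qed
    also have "\<dots> = e \<otimes>\<^bsub>Om\<^esub> (\<Oplus>\<^bsub>Om\<^esub>\<rho>\<in>I. a (h \<rho>) \<otimes>\<^bsub>Om\<^esub> rep (h \<rho>) y)"
      by (rule O.finsum_rdistr[symmetric]) (use finI ec terms hI in auto)
    also have "(\<Oplus>\<^bsub>Om\<^esub>\<rho>\<in>I. a (h \<rho>) \<otimes>\<^bsub>Om\<^esub> rep (h \<rho>) y) = (\<Oplus>\<^bsub>Om\<^esub>\<rho>\<in>h ` I. a \<rho> \<otimes>\<^bsub>Om\<^esub> rep \<rho> y)"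
      by (rule O.finsum_reindex[symmetric]) (use terms hI injh in auto)
    also have "\<dots> = x" by (simp add: hII x_def)
    finally show ?thesis using xc by (auto simp: e_def O.l_minus)
  qed
  have "x \<otimes>\<^bsub>Om\<^esub> x \<in> KF"
    by (rule fixed_field) (use xc act in \<open>auto simp: ring_hom_mult[OF gal_hom] O.l_minus O.r_minus\<close>)
  then obtain d where d: "d \<in> carrier F" "x \<otimes>\<^bsub>Om\<^esub> x = emb d" by auto
  have "d \<noteq> \<zero>\<^bsub>F\<^esub>" using d ne xc by (auto simp: x_def[symmetric] O.integral_iff)
  then show ?thesis using that xc ne d act by (auto simp: x_def[symmetric])
qed

end

section \<open>Absolute values on the rationals and the completed field\<close>

locale abs_value =
  fixes v :: "rat \<Rightarrow> real"
  assumes v_mult: "v (x * y) = v x * v y"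
    and v_triangle: "v (x + y) \<le> v x + v y"
    and v_zero_iff [simp]: "v x = 0 \<longleftrightarrow> x = 0"
    and v_nonneg [simp]: "v x \<ge> 0"
begin

abbreviation "CR \<equiv> cauchy_ring v"
abbreviation "NS \<equiv> null_seqs v"

lemma v_0 [simp]: "v 0 = 0"
  by simp

lemma v_one [simp]: "v 1 = 1"
  using v_mult[of 1 1] v_zero_iff[of 1] by auto

lemma v_minus [simp]: "v (- x) = v x"
proof -
  have "v (-1) * v (-1) = 1" using v_mult[of "-1" "-1"] by simp
  then have "v (-1) = 1" using v_nonneg[of "-1"] by (metis abs_of_nonneg power2_eq_square real_sqrt_abs real_sqrt_one)
  then show ?thesis using v_mult[of "-1" x] by simp
qed

lemma v_diff_commute: "v (x - y) = v (y - x)"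
  using v_minus[of "x - y"] by simp

lemma v_divide: "y \<noteq> 0 \<Longrightarrow> v (x / y) = v x / v y"
  using v_mult[of "x / y" y] by (simp add: field_simps)

definition cauchy :: "(nat \<Rightarrow> rat) \<Rightarrow> bool"
  where "cauchy s \<longleftrightarrow> (\<forall>e>0. \<exists>N. \<forall>i\<ge>N. \<forall>j\<ge>N. v (s i - s j) < e)"

lemma cauchyD: "cauchy s \<Longrightarrow> e > 0 \<Longrightarrow> \<exists>N. \<forall>i\<ge>N. \<forall>j\<ge>N. v (s i - s j) < e"
  by (simp add: cauchy_def)

definition null :: "(nat \<Rightarrow> rat) \<Rightarrow> bool"
  where "null s \<longleftrightarrow> (\<lambda>n. v (s n)) \<longlonglongrightarrow> 0"

lemma carrier_CR: "carrier CR = {s. cauchy s}"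
  by (simp add: cauchy_ring_def cauchy_def)

lemma NS_eq: "NS = {s. null s}"
  by (simp add: null_seqs_def null_def)

lemma CR_simps [simp]:
  "s \<otimes>\<^bsub>CR\<^esub> t = (\<lambda>n. s n * t n)" "s \<oplus>\<^bsub>CR\<^esub> t = (\<lambda>n. s n + t n)" "\<one>\<^bsub>CR\<^esub> = (\<lambda>n. 1)" "\<zero>\<^bsub>CR\<^esub> = (\<lambda>n. 0)"
  by (simp_all add: cauchy_ring_def)

lemma null_iff: "null s \<longleftrightarrow> (\<forall>e>0. \<exists>N. \<forall>n\<ge>N. v (s n) < e)"
  unfolding null_def by (simp add: lim_sequentially dist_real_def)

lemma cauchy_const: "cauchy (\<lambda>n. c)"
  by (simp add: cauchy_def)

lemma cauchy_add:
  assumes "cauchy s" "cauchy t" shows "cauchy (\<lambda>n. s n + t n)"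
  unfolding cauchy_def
proof (intro allI impI)
  fix e :: real assume "e > 0"
  then obtain M N where "\<forall>i\<ge>M. \<forall>j\<ge>M. v (s i - s j) < e / 2" "\<forall>i\<ge>N. \<forall>j\<ge>N. v (t i - t j) < e / 2"
    using cauchyD[OF assms(1), of "e / 2"] cauchyD[OF assms(2), of "e / 2"] by auto
  moreover have "v (s i + t i - (s j + t j)) \<le> v (s i - s j) + v (t i - t j)" for i j
    using v_triangle[of "s i - s j" "t i - t j"] by (simp add: algebra_simps)
  ultimately have "\<forall>i\<ge>max M N. \<forall>j\<ge>max M N. v (s i + t i - (s j + t j)) < e"
    by (smt (verit, best) field_sum_of_halves max.bounded_iff)
  then show "\<exists>N. \<forall>i\<ge>N. \<forall>j\<ge>N. v (s i + t i - (s j + t j)) < e" by blast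
qed

lemma cauchy_minus: "cauchy s \<Longrightarrow> cauchy (\<lambda>n. - s n)"
  unfolding cauchy_def by (simp add: v_diff_commute)

lemma cauchy_bounded:
  assumes "cauchy s" obtains B where "B > 0" "\<And>n. v (s n) \<le> B"
proof -
  obtain N where N: "\<And>i. i \<ge> N \<Longrightarrow> v (s i - s N) < 1"
    using cauchyD[OF assms, of 1] by auto
  define B where "B = 1 + v (s N) + Max ((\<lambda>n. v (s n)) ` {..N})"
  have m: "v (s n) \<le> Max ((\<lambda>n. v (s n)) ` {..N})" if "n \<le> N" for n
    by (rule Max_ge) (use that in auto)
  have B: "v (s n) \<le> B" for n
  proof (cases "n \<le> N")
    case True then show ?thesis using m[OF True] v_nonneg[of "s N"] unfolding B_def by linarith
  next
    case False
    have "v (s n) \<le> v (s n - s N) + v (s N)" using v_triangle[of "s n - s N" "s N"] by simp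
    then show ?thesis
      using N[of n] False m[OF order_refl] v_nonneg[of "s N"] unfolding B_def by linarith
  qed
  have "B > 0" using m[of N] v_nonneg[of "s N"] unfolding B_def by linarith
  then show ?thesis using B by (rule that)
qed

lemma cauchy_mult:
  assumes "cauchy s" "cauchy t" shows "cauchy (\<lambda>n. s n * t n)"
proof -
  obtain A where A: "A > 0" "\<And>n. v (s n) \<le> A" by (rule cauchy_bounded[OF assms(1)]) blast
  obtain B where B: "B > 0" "\<And>n. v (t n) \<le> B" by (rule cauchy_bounded[OF assms(2)]) blast
  show ?thesis
    unfolding cauchy_def
  proof (intro allI impI)
    fix e :: real assume e: "e > 0"
    obtain M where M: "\<forall>i\<ge>M. \<forall>j\<ge>M. v (s i - s j) < e / (2 * B)"
      using cauchyD[OF assms(1), of "e / (2 * B)"] e B by auto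
    obtain N where N: "\<forall>i\<ge>N. \<forall>j\<ge>N. v (t i - t j) < e / (2 * A)"
      using cauchyD[OF assms(2), of "e / (2 * A)"] e A by auto
    have "v (s i * t i - s j * t j) < e" if "i \<ge> max M N" "j \<ge> max M N" for i j
    proof -
      have "s i * t i - s j * t j = s i * (t i - t j) + (s i - s j) * t j" by (simp add: algebra_simps)
      then have "v (s i * t i - s j * t j) \<le> v (s i) * v (t i - t j) + v (s i - s j) * v (t j)"
        using v_triangle[of "s i * (t i - t j)" "(s i - s j) * t j"] by (simp add: v_mult)
      also have "\<dots> \<le> A * v (t i - t j) + v (s i - s j) * B"
        by (intro add_mono mult_mono A B) (use A B in auto)
      also have "\<dots> < A * (e / (2 * A)) + (e / (2 * B)) * B"
        using M N that A B by (intro add_strict_mono mult_strict_left_mono mult_strict_right_mono) auto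
      also have "\<dots> = e" using A B by simp
      finally show ?thesis .
    qed
    then show "\<exists>N. \<forall>i\<ge>N. \<forall>j\<ge>N. v (s i * t i - s j * t j) < e" by blast
  qed
qed

lemma null_cauchy: "null s \<Longrightarrow> cauchy s"
proof -
  assume n: "null s"
  show "cauchy s"
    unfolding cauchy_def
  proof (intro allI impI)
    fix e :: real assume "e > 0"
    then obtain N where N: "\<forall>n\<ge>N. v (s n) < e / 2" using n by (auto simp: null_iff dest: spec[of _ "e / 2"])
    have "v (s i - s j) < e" if "i \<ge> N" "j \<ge> N" for i j
      using v_triangle[of "s i" "- s j"] N that by (smt (verit) field_sum_of_halves v_minus uminus_add_conv_diff add.commute)
    then show "\<exists>N. \<forall>i\<ge>N. \<forall>j\<ge>N. v (s i - s j) < e" by blast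
  qed
qed

lemma null_add: assumes "null s" "null t" shows "null (\<lambda>n. s n + t n)"
  unfolding null_def
proof (rule tendsto_sandwich[of "\<lambda>_. 0" _ _ "\<lambda>n. v (s n) + v (t n)"])
  show "(\<lambda>n. v (s n) + v (t n)) \<longlonglongrightarrow> 0"
    using tendsto_add[OF assms[unfolded null_def]] by simp
qed (auto simp: v_triangle)

lemma null_minus: "null s \<Longrightarrow> null (\<lambda>n. - s n)"
  by (simp add: null_def)

lemma null_mult: assumes "null s" "cauchy t" shows "null (\<lambda>n. t n * s n)"
proof -
  obtain B where B: "B > 0" "\<And>n. v (t n) \<le> B" by (rule cauchy_bounded[OF assms(2)]) blast
  show ?thesis
    unfolding null_def
  proof (rule tendsto_sandwich[of "\<lambda>_. 0" _ _ "\<lambda>n. B * v (s n)"])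
    show "(\<lambda>n. B * v (s n)) \<longlonglongrightarrow> 0"
      using tendsto_mult_left[OF assms(1)[unfolded null_def], of B] by simp
  qed (auto simp: v_mult intro!: always_eventually mult_right_mono B)
qed

lemma null_const: "null (\<lambda>n. c) \<longleftrightarrow> c = 0"
  by (simp add: null_def LIMSEQ_const_iff)

lemma cauchy_not_null:
  assumes "cauchy s" "\<not> null s"
  obtains e N where "e > 0" "\<And>n. n \<ge> N \<Longrightarrow> v (s n) > e"
proof -
  obtain e where e: "e > 0" "\<And>N. \<exists>n\<ge>N. v (s n) \<ge> e"
    using assms(2) by (auto simp: null_iff not_less)
  obtain N where N: "\<And>i j. i \<ge> N \<Longrightarrow> j \<ge> N \<Longrightarrow> v (s i - s j) < e / 2"
    using cauchyD[OF assms(1), of "e / 2"] e by auto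
  obtain k where k: "k \<ge> N" "v (s k) \<ge> e" using e by blast
  have "v (s n) > e / 4" if "n \<ge> N" for n
    using v_triangle[of "s k - s n" "s n"] N[OF k(1) that] k e(1) by simp
  then show ?thesis using that[of "e / 4" N] e by auto
qed

text \<open>Inverses are taken term by term. Finitely many terms may vanish, where
  \<open>inverse 0 = 0\<close> does no harm, since both conclusions concern tails only.\<close>

lemma cauchy_inverse:
  assumes "cauchy s" "\<not> null s"
  shows "cauchy (\<lambda>n. inverse (s n))" "null (\<lambda>n. s n * inverse (s n) - 1)"
proof -
  obtain e N where e: "e > 0" "\<And>n. n \<ge> N \<Longrightarrow> v (s n) > e" by (rule cauchy_not_null[OF assms]) blast
  have nz: "s n \<noteq> 0" if "n \<ge> N" for n using e that by (metis less_asym' v_zero_iff)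
  show "cauchy (\<lambda>n. inverse (s n))"
    unfolding cauchy_def
  proof (intro allI impI)
    fix d :: real assume d: "d > 0"
    obtain M where M: "\<And>i j. i \<ge> M \<Longrightarrow> j \<ge> M \<Longrightarrow> v (s i - s j) < d * (e * e)"
      using cauchyD[OF assms(1), of "d * (e * e)"] d e by auto
    have "v (inverse (s i) - inverse (s j)) < d" if "i \<ge> max M N" "j \<ge> max M N" for i j
    proof -
      have z: "s i \<noteq> 0" "s j \<noteq> 0" using nz that by auto
      then have "inverse (s i) - inverse (s j) = (s j - s i) / (s i * s j)" by (simp add: field_simps)
      then have "v (inverse (s i) - inverse (s j)) = v (s j - s i) / (v (s i) * v (s j))"
        using z by (simp add: v_divide v_mult)
      also have "\<dots> < d"
      proof -
        have "e * e \<le> v (s i) * v (s j)" using e(1) e(2)[of i] e(2)[of j] that by (intro mult_mono) auto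
        then have "d * (e * e) \<le> d * (v (s i) * v (s j))" using d by simp
        moreover have "v (s i) * v (s j) > 0" using z by (simp add: less_le)
        ultimately show ?thesis using M[of j i] that by (simp add: pos_divide_less_eq)
      qed
      finally show ?thesis .
    qed
    then show "\<exists>N. \<forall>i\<ge>N. \<forall>j\<ge>N. v (inverse (s i) - inverse (s j)) < d" by blast
  qed
  show "null (\<lambda>n. s n * inverse (s n) - 1)"
    unfolding null_iff using nz by (auto intro!: exI[of _ N])
qed

lemma ring_CR: "cring CR"
proof (rule cringI)
  show "abelian_group CR"
  proof (rule abelian_groupI)
    fix x assume "x \<in> carrier CR"
    then show "\<exists>y\<in>carrier CR. y \<oplus>\<^bsub>CR\<^esub> x = \<zero>\<^bsub>CR\<^esub>"
      by (intro bexI[of _ "\<lambda>n. - x n"]) (auto simp: carrier_CR cauchy_minus)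
  qed (auto simp: carrier_CR cauchy_add cauchy_const algebra_simps)
  show "comm_monoid CR"
    by (rule comm_monoidI) (auto simp: carrier_CR cauchy_mult cauchy_const algebra_simps)
qed (auto simp: carrier_CR algebra_simps)

end

locale completed = abs_value
begin

sublocale C: cring CR by (rule ring_CR)

lemma a_inv_CR: "s \<in> carrier CR \<Longrightarrow> \<ominus>\<^bsub>CR\<^esub> s = (\<lambda>n. - s n)"
  by (rule C.minus_equality) (auto simp: carrier_CR cauchy_minus)

lemma ideal_NS: "ideal NS CR"
proof (rule idealI)
  show "subgroup NS (add_monoid CR)"
  proof (rule C.add.subgroupI)
    show "NS \<subseteq> carrier CR" by (auto simp: NS_eq carrier_CR null_cauchy)
    have "(\<lambda>n. 0) \<in> NS" by (simp add: NS_eq null_const)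
    then show "NS \<noteq> {}" by blast
    show "\<ominus>\<^bsub>CR\<^esub> a \<in> NS" if "a \<in> NS" for a
      using that by (subst a_inv_CR) (auto simp: NS_eq carrier_CR null_cauchy null_minus)
    show "a \<oplus>\<^bsub>CR\<^esub> b \<in> NS" if "a \<in> NS" "b \<in> NS" for a b using that by (auto simp: NS_eq null_add)
  qed
  show "a \<otimes>\<^bsub>CR\<^esub> x \<in> NS" if "a \<in> NS" "x \<in> carrier CR" for a x
    using null_mult[of a x] that by (simp add: NS_eq carrier_CR mult.commute)
qed (auto simp: NS_eq carrier_CR null_mult C.ring_axioms)

sublocale N: ideal "null_seqs v" "cauchy_ring v" by (rule ideal_NS)

abbreviation "QV \<equiv> completion v"

definition cls :: "(nat \<Rightarrow> rat) \<Rightarrow> (nat \<Rightarrow> rat) set"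
  where "cls s = NS +>\<^bsub>CR\<^esub> s"

lemma carrier_QV: "x \<in> carrier QV \<longleftrightarrow> (\<exists>s. cauchy s \<and> x = cls s)"
  by (auto simp: completion_def FactRing_def A_RCOSETS_def' cls_def carrier_CR)

lemma cls_add: "cauchy s \<Longrightarrow> cauchy t \<Longrightarrow> cls s \<oplus>\<^bsub>QV\<^esub> cls t = cls (\<lambda>n. s n + t n)"
  by (simp add: completion_def FactRing_def cls_def N.a_rcos_sum carrier_CR)

lemma cls_mult: "cauchy s \<Longrightarrow> cauchy t \<Longrightarrow> cls s \<otimes>\<^bsub>QV\<^esub> cls t = cls (\<lambda>n. s n * t n)"
  by (simp add: completion_def FactRing_def cls_def N.rcoset_mult_add carrier_CR)

lemma cls_one: "\<one>\<^bsub>QV\<^esub> = cls (\<lambda>n. 1)"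
  by (simp add: completion_def FactRing_def cls_def)

lemma cls_eq_iff: "cauchy s \<Longrightarrow> cauchy t \<Longrightarrow> cls s = cls t \<longleftrightarrow> null (\<lambda>n. s n - t n)"
proof -
  assume s: "cauchy s" and t: "cauchy t"
  have "s \<ominus>\<^bsub>CR\<^esub> t = (\<lambda>n. s n - t n)" using t by (simp add: a_minus_def a_inv_CR carrier_CR)
  then show ?thesis
    using N.a_rcos_module_imp N.a_rcos_module_rev s t C.quotient_eq_iff_same_a_r_cos[OF ideal_NS, of s t]
    unfolding cls_def carrier_CR NS_eq[symmetric] by (simp add: carrier_CR NS_eq)
qed

lemma cls_zero: "\<zero>\<^bsub>QV\<^esub> = cls (\<lambda>n. 0)"
proof -
  have "NS = cls (\<lambda>n. 0)" unfolding cls_def using C.a_coset_add_zero[of NS] N.a_subset by simp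
  then show ?thesis by (simp add: completion_def FactRing_def)
qed

lemma cls_closed: "cauchy s \<Longrightarrow> cls s \<in> carrier QV"
  by (auto simp: carrier_QV)

lemma field_QV: "field QV"
proof -
  interpret Q: cring QV unfolding completion_def by (rule N.quotient_is_cring[OF ring_CR])
  show ?thesis
  proof (rule Q.cring_fieldI2)
    show "\<zero>\<^bsub>QV\<^esub> \<noteq> \<one>\<^bsub>QV\<^esub>"
      using null_const[of "-1"] by (simp add: cls_zero cls_one cls_eq_iff cauchy_const)
    fix a assume a: "a \<in> carrier QV" "a \<noteq> \<zero>\<^bsub>QV\<^esub>"
    then obtain s where s: "cauchy s" "a = cls s" by (auto simp: carrier_QV)
    then have "\<not> null s" using a by (simp add: cls_zero cls_eq_iff cauchy_const)
    note i = cauchy_inverse[OF s(1) this]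
    then show "\<exists>b\<in>carrier QV. a \<otimes>\<^bsub>QV\<^esub> b = \<one>\<^bsub>QV\<^esub>"
      using s by (intro bexI[of _ "cls (\<lambda>n. inverse (s n))"])
        (auto simp: cls_mult cls_one cls_eq_iff cauchy_mult cauchy_const cls_closed)
  qed
qed

lemma completion_emb_eq: "completion_emb v q = cls (\<lambda>n. q)"
  by (simp add: completion_emb_def cls_def)

lemma completion_emb_hom: "completion_emb v \<in> ring_hom rat_ring QV"
  by (rule ring_hom_memI)
    (simp_all add: completion_emb_eq ring_of_type_algebra_def cls_closed cauchy_const cls_add cls_mult cls_one)

lemma completion_emb_inj: "completion_emb v p = completion_emb v q \<longleftrightarrow> p = q"
  by (simp add: completion_emb_eq cls_eq_iff cauchy_const null_const)

end

section \<open>Two-torsion and halving on \<open>y\<^sup>2 = (x - e\<^sub>1)(x - e\<^sub>2)(x - e\<^sub>3)\<close>\<close>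

text \<open>\<open>c\<close> stays a coefficient function because \<open>ec_add\<close> takes one;
  \<open>c_eq\<close> ties it to the roots by Vieta. The curve does not depend on the order of the
  roots, but the lemmas below single out \<open>e1\<close>, and \<open>perm\<close> supplies the
  other two cases.\<close>

locale split_cubic = field R for R :: "'a ring" (structure) +
  fixes e1 e2 e3 :: 'a and c :: "nat \<Rightarrow> 'a"
  assumes e_closed [simp]: "e1 \<in> carrier R" "e2 \<in> carrier R" "e3 \<in> carrier R"
    and e_distinct: "e1 \<noteq> e2" "e1 \<noteq> e3" "e2 \<noteq> e3"
    and two_nz: "\<one> \<oplus> \<one> \<noteq> \<zero>"
    and c_eq: "c 2 = \<ominus> (e1 \<oplus> e2 \<oplus> e3)" "c 1 = e1 \<otimes> e2 \<oplus> e1 \<otimes> e3 \<oplus> e2 \<otimes> e3" "c 0 = \<ominus> (e1 \<otimes> e2 \<otimes> e3)"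
begin

lemma perm: "split_cubic R e2 e1 e3 c" "split_cubic R e3 e1 e2 c"
proof -
  have 1: "e2 \<oplus> e1 \<oplus> e3 = e1 \<oplus> e2 \<oplus> e3" "e3 \<oplus> e1 \<oplus> e2 = e1 \<oplus> e2 \<oplus> e3"
    using e_closed by (simp_all add: a_ac)
  have 2: "e2 \<otimes> e1 \<oplus> e2 \<otimes> e3 \<oplus> e1 \<otimes> e3 = e1 \<otimes> e2 \<oplus> e1 \<otimes> e3 \<oplus> e2 \<otimes> e3"
    "e3 \<otimes> e1 \<oplus> e3 \<otimes> e2 \<oplus> e1 \<otimes> e2 = e1 \<otimes> e2 \<oplus> e1 \<otimes> e3 \<oplus> e2 \<otimes> e3"
    using e_closed by (simp_all add: a_ac m_ac)
  have 3: "e2 \<otimes> e1 \<otimes> e3 = e1 \<otimes> e2 \<otimes> e3" "e3 \<otimes> e1 \<otimes> e2 = e1 \<otimes> e2 \<otimes> e3"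
    using e_closed by (simp_all add: m_ac)
  show "split_cubic R e2 e1 e3 c" "split_cubic R e3 e1 e2 c"
    by (unfold_locales; use e_closed e_distinct two_nz c_eq 1 2 3 in auto)+
qed

abbreviation "E \<equiv> ec_group R c"

fun neg :: "'a point \<Rightarrow> 'a point"
  where "neg Infinity = Infinity" | "neg (Affine x y) = Affine x (\<ominus> y)"

lemma sq_eq_zero: "x \<in> carrier R \<Longrightarrow> x \<otimes> x = \<zero> \<longleftrightarrow> x = \<zero>"
  by (simp add: integral_iff)

lemma self_neg: "x \<in> carrier R \<Longrightarrow> x = \<ominus> x \<longleftrightarrow> x = \<zero>"
proof
  assume x: "x \<in> carrier R" and "x = \<ominus> x"
  then have "x \<oplus> x = \<zero>" by (metis r_neg)
  moreover have "x \<oplus> x = (\<one> \<oplus> \<one>) \<otimes> x" using x by algebra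
  ultimately show "x = \<zero>" using x two_nz by (metis add.m_closed integral one_closed)
qed simp

lemma sq_eq_iff: "x \<in> carrier R \<Longrightarrow> y \<in> carrier R \<Longrightarrow> x \<otimes> x = y \<otimes> y \<longleftrightarrow> x = y \<or> x = \<ominus> y"
proof
  assume xy: "x \<in> carrier R" "y \<in> carrier R" and eq: "x \<otimes> x = y \<otimes> y"
  have "(x \<ominus> y) \<otimes> (x \<oplus> y) = x \<otimes> x \<ominus> y \<otimes> y" using xy by algebra
  also have "\<dots> = \<zero>" using xy eq by (simp add: r_neg a_minus_def)
  finally have "x \<ominus> y = \<zero> \<or> x \<oplus> y = \<zero>" using xy by (metis add.m_closed integral minus_closed)
  then show "x = y \<or> x = \<ominus> y"
    using xy by (metis minus_equality r_right_minus_eq)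
next
  assume "x \<in> carrier R" "y \<in> carrier R" "x = y \<or> x = \<ominus> y"
  then show "x \<otimes> x = y \<otimes> y" by (auto simp: l_minus r_minus)
qed

lemma cubic_eq:
  assumes "x \<in> carrier R"
  shows "x [^] (3::nat) \<oplus> c 2 \<otimes> x [^] (2::nat) \<oplus> c 1 \<otimes> x \<oplus> c 0 = (x \<ominus> e1) \<otimes> (x \<ominus> e2) \<otimes> (x \<ominus> e3)"
proof -
  have "x [^] (3::nat) = x \<otimes> x \<otimes> x" "x [^] (2::nat) = x \<otimes> x"
    using assms by (simp_all add: numeral_3_eq_3 numeral_2_eq_2 nat_pow_Suc)
  then show ?thesis using assms e_closed unfolding c_eq by (simp only:) algebra
qed

lemma mem_E: "Affine x y \<in> carrier E \<longleftrightarrow>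
    x \<in> carrier R \<and> y \<in> carrier R \<and> y \<otimes> y = (x \<ominus> e1) \<otimes> (x \<ominus> e2) \<otimes> (x \<ominus> e3)"
proof -
  have "y [^] (2::nat) = y \<otimes> y" if "y \<in> carrier R" using that by (simp add: numeral_2_eq_2 nat_pow_Suc)
  then show ?thesis using cubic_eq by (auto simp: ec_group_def)
qed

lemma Infinity_E [simp]: "Infinity \<in> carrier E"
  by (simp add: ec_group_def)

lemma E_simps [simp]: "P \<otimes>\<^bsub>E\<^esub> Q = ec_add R c P Q" "\<one>\<^bsub>E\<^esub> = Infinity"
  by (simp_all add: ec_group_def)

lemma neg_closed: "P \<in> carrier E \<Longrightarrow> neg P \<in> carrier E"
  by (cases P) (auto simp: mem_E l_minus r_minus)

lemma ec_add_Infinity_right [simp]: "ec_add R c P Infinity = P"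
  by (cases P) auto

lemma ec_add_eq_Infinity_iff:
  assumes "P \<in> carrier E" "Q \<in> carrier E"
  shows "ec_add R c P Q = Infinity \<longleftrightarrow> Q = neg P"
  using assms by (cases P; cases Q) (auto simp: Let_def mem_E split: if_splits)

lemma inv_E:
  assumes "P \<in> carrier E" shows "inv\<^bsub>E\<^esub> P = neg P"
proof -
  have "neg (neg P) = P" using assms by (cases P) (auto simp: mem_E)
  then show ?thesis
    unfolding m_inv_def using assms neg_closed[OF assms]
    by (intro the_equality) (auto simp: ec_add_eq_Infinity_iff)
qed

text \<open>The common shape of chord and tangent: in the tangent case the condition on
  \<open>l\<close> reads \<open>0 = 0\<close>, so later arguments need not distinguish the
  two.\<close>

lemma line_through:
  assumes "Affine x1 y1 \<in> carrier E" "Affine x2 y2 \<in> carrier E"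
    and add: "ec_add R c (Affine x1 y1) (Affine x2 y2) = Affine x3 y3"
  obtains l where "l \<in> carrier R" "l \<otimes> (x1 \<ominus> x2) = y1 \<ominus> y2"
    "x3 = l \<otimes> l \<ominus> c 2 \<ominus> x1 \<ominus> x2" "y3 = l \<otimes> (x1 \<ominus> x3) \<ominus> y1"
proof -
  have [simp]: "x1 \<in> carrier R" "y1 \<in> carrier R" "x2 \<in> carrier R" "y2 \<in> carrier R"
    using assms by (auto simp: mem_E)
  have cc [simp]: "c 2 \<in> carrier R" "c 1 \<in> carrier R" by (simp_all add: c_eq del: One_nat_def)
  have sq: "l [^] (2::nat) = l \<otimes> l" if "l \<in> carrier R" for l using that by (simp add: numeral_2_eq_2 nat_pow_Suc)
  show ?thesis
  proof (cases "x1 = x2")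
    case True
    then have ne: "y1 \<noteq> \<ominus> y2" using add by (auto split: if_splits)
    have "y1 \<otimes> y1 = y2 \<otimes> y2" using assms(1,2) True by (simp add: mem_E)
    then have y12: "y1 = y2" using ne sq_eq_iff[of y1 y2] by auto
    have "[(2::nat)] \<cdot> y1 = y1 \<oplus> y1" by (simp add: numeral_2_eq_2 add.nat_pow_Suc)
    moreover have "y1 \<oplus> y1 \<noteq> \<zero>" using ne y12 by (metis \<open>y1 \<in> carrier R\<close> minus_equality)
    ultimately have i: "inv ([(2::nat)] \<cdot> y1) \<in> carrier R" using field_Units by (metis DiffI Units_inv_closed add.m_closed \<open>y1 \<in> carrier R\<close> singletonD)
    define l where "l = ([(3::nat)] \<cdot> (x1 [^] (2::nat)) \<oplus> [(2::nat)] \<cdot> (c 2 \<otimes> x1) \<oplus> c 1) \<otimes> inv ([(2::nat)] \<cdot> y1)"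
    have lc: "l \<in> carrier R" using i unfolding l_def by (simp del: One_nat_def)
    have "x3 = l \<otimes> l \<ominus> c 2 \<ominus> x1 \<ominus> x2 \<and> y3 = l \<otimes> (x1 \<ominus> x3) \<ominus> y1"
      using add True ne unfolding sq[OF lc, symmetric] unfolding l_def by (auto simp add: Let_def simp del: One_nat_def)
    then show ?thesis using that[OF lc] lc y12 True by (simp add: r_neg a_minus_def)
  next
    case False
    define l where "l = (y2 \<ominus> y1) \<otimes> inv (x2 \<ominus> x1)"
    have u: "x2 \<ominus> x1 \<in> Units R" using False field_Units by (auto simp: r_right_minus_eq)
    have lc: "l \<in> carrier R" using u unfolding l_def by simp
    have "l \<otimes> (x2 \<ominus> x1) = y2 \<ominus> y1" using u unfolding l_def by (simp add: m_assoc)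
    moreover have "l \<otimes> (x1 \<ominus> x2) = \<ominus> (l \<otimes> (x2 \<ominus> x1))"
      using lc \<open>x1 \<in> carrier R\<close> \<open>x2 \<in> carrier R\<close> by algebra
    ultimately have 1: "l \<otimes> (x1 \<ominus> x2) = y1 \<ominus> y2" by (simp add: a_minus_def minus_add a_comm)
    have "x3 = l \<otimes> l \<ominus> c 2 \<ominus> x1 \<ominus> x2 \<and> y3 = l \<otimes> (x1 \<ominus> x3) \<ominus> y1"
      using add False unfolding sq[OF lc, symmetric] by (auto simp add: Let_def l_def[symmetric])
    then show ?thesis using that[OF lc 1] by simp
  qed
qed

lemma minus_swap: "a = b \<ominus> d \<Longrightarrow> b \<in> carrier R \<Longrightarrow> d \<in> carrier R \<Longrightarrow> d = b \<ominus> a"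
  by (simp add: a_minus_def minus_add r_neg2)

lemma mcancel: "a \<in> carrier R \<Longrightarrow> b \<in> carrier R \<Longrightarrow> k \<in> carrier R \<Longrightarrow> k \<noteq> \<zero> \<Longrightarrow> k \<otimes> a = k \<otimes> b \<Longrightarrow> a = b"
  using m_lcancel by blast

text \<open>With \<open>A_i = y / (x - e_i)\<close> the equation of the curve turns into
  \<open>A_j A_k = x - e_i\<close>. If the point is the half attached to \<open>s1\<close>,
  \<open>s2\<close>, \<open>s3\<close>, then \<open>A_1 = s2 + s3\<close> and so on; this is why
  translation by two-torsion acts linearly on the \<open>A_i\<close>.\<close>

lemma halving_coordinates:
  assumes "Affine x y \<in> carrier E" "y \<noteq> \<zero>"
  obtains A1 A2 A3 where "A1 \<in> carrier R" "A2 \<in> carrier R" "A3 \<in> carrier R"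
    "A1 \<noteq> \<zero>" "A2 \<noteq> \<zero>" "A3 \<noteq> \<zero>"
    "x \<ominus> e1 = A2 \<otimes> A3" "x \<ominus> e2 = A1 \<otimes> A3" "x \<ominus> e3 = A1 \<otimes> A2" "y = A1 \<otimes> A2 \<otimes> A3"
    "A1 = y \<otimes> inv (x \<ominus> e1)" "A2 = y \<otimes> inv (x \<ominus> e2)" "A3 = y \<otimes> inv (x \<ominus> e3)"
proof -
  have [simp]: "x \<in> carrier R" "y \<in> carrier R" using assms by (auto simp: mem_E)
  define u1 u2 u3 where "u1 = x \<ominus> e1" and "u2 = x \<ominus> e2" and "u3 = x \<ominus> e3"
  have [simp]: "u1 \<in> carrier R" "u2 \<in> carrier R" "u3 \<in> carrier R" by (simp_all add: u1_def u2_def u3_def)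
  have yy: "y \<otimes> y = u1 \<otimes> u2 \<otimes> u3" using assms by (simp add: mem_E u1_def u2_def u3_def)
  then have nz: "u1 \<noteq> \<zero>" "u2 \<noteq> \<zero>" "u3 \<noteq> \<zero>" using assms(2) sq_eq_zero[of y] by auto
  then have U: "u1 \<in> Units R" "u2 \<in> Units R" "u3 \<in> Units R" using field_Units by auto
  note [simp] = U[THEN Units_inv_closed] U[THEN Units_r_inv]
  have i: "u1 \<otimes> (inv u1 \<otimes> k) = k" "u2 \<otimes> (inv u2 \<otimes> k) = k" "u3 \<otimes> (inv u3 \<otimes> k) = k" if "k \<in> carrier R" for k
    using that by (simp_all flip: m_assoc)
  have prod: "(y \<otimes> inv a) \<otimes> (y \<otimes> inv b) = d"
    if abd: "y \<otimes> y = d \<otimes> (a \<otimes> b)" "a \<in> Units R" "b \<in> Units R" "d \<in> carrier R" for a b d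
  proof -
    have [simp]: "a \<in> carrier R" "b \<in> carrier R" "inv a \<in> carrier R" "inv b \<in> carrier R" using abd by auto
    have "(y \<otimes> inv a) \<otimes> (y \<otimes> inv b) = (y \<otimes> y) \<otimes> (inv a \<otimes> inv b)" by (simp add: m_ac)
    also have "\<dots> = d \<otimes> ((a \<otimes> inv a) \<otimes> (b \<otimes> inv b))" unfolding abd(1) using abd(4) by (simp add: m_ac)
    finally show ?thesis using abd by simp
  qed
  define A1 A2 A3 where "A1 = y \<otimes> inv u1" and "A2 = y \<otimes> inv u2" and "A3 = y \<otimes> inv u3"
  have A [simp]: "A1 \<in> carrier R" "A2 \<in> carrier R" "A3 \<in> carrier R" by (simp_all add: A1_def A2_def A3_def)
  have p: "A2 \<otimes> A3 = u1" "A1 \<otimes> A3 = u2" "A1 \<otimes> A2 = u3"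
    unfolding A1_def A2_def A3_def by (rule prod; use U yy in \<open>simp add: m_ac\<close>)+
  have "A1 \<otimes> A2 \<otimes> A3 = A1 \<otimes> u1" using p(1) by (simp add: m_assoc)
  also have "\<dots> = y" using U by (simp add: A1_def m_assoc)
  finally have y: "y = A1 \<otimes> A2 \<otimes> A3" by simp
  have "A1 \<noteq> \<zero>" "A2 \<noteq> \<zero>" "A3 \<noteq> \<zero>" using y assms(2) by auto
  then show ?thesis
    using that[OF A _ _ _ p(1)[symmetric, unfolded u1_def] p(2)[symmetric, unfolded u2_def] p(3)[symmetric, unfolded u3_def] y
        A1_def[unfolded u1_def] A2_def[unfolded u2_def] A3_def[unfolded u3_def]] by blast
qed

text \<open>The three points on the line include \<open>(e1, 0)\<close>, so its slope is at once
  \<open>y' / (x' - e1)\<close> and \<open>- y / (x - e1)\<close>, that is \<open>B1\<close> and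
  \<open>- A1\<close>. The other two relations come from the sum of the three
  \<open>x\<close>-coordinates.\<close>

lemma translate_coordinates:
  assumes A: "A1 \<in> carrier R" "A2 \<in> carrier R" "A3 \<in> carrier R" "A1 \<noteq> \<zero>" "A2 \<noteq> \<zero>" "A3 \<noteq> \<zero>"
    and x: "x \<ominus> e1 = A2 \<otimes> A3" "x \<ominus> e2 = A1 \<otimes> A3" "x \<ominus> e3 = A1 \<otimes> A2" "y = A1 \<otimes> A2 \<otimes> A3"
    and B: "B1 \<in> carrier R" "B2 \<in> carrier R" "B3 \<in> carrier R" "B1 \<noteq> \<zero>" "B2 \<noteq> \<zero>" "B3 \<noteq> \<zero>"
    and x': "x' \<ominus> e1 = B2 \<otimes> B3" "x' \<ominus> e2 = B1 \<otimes> B3" "x' \<ominus> e3 = B1 \<otimes> B2" "y' = B1 \<otimes> B2 \<otimes> B3"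
    and on: "Affine x y \<in> carrier E" "Affine x' y' \<in> carrier E"
    and add: "ec_add R c (Affine x' y') (neg (Affine x y)) = Affine e1 \<zero>"
  shows "B1 = \<ominus> A1" "B2 = A3 \<ominus> A1" "B3 = A2 \<ominus> A1"
proof -
  have [simp]: "x \<in> carrier R" "y \<in> carrier R" "x' \<in> carrier R" "y' \<in> carrier R" using on by (auto simp: mem_E)
  obtain l where l [simp]: "l \<in> carrier R" and l1: "l \<otimes> (x' \<ominus> x) = y' \<ominus> (\<ominus> y)"
    and l2: "e1 = l \<otimes> l \<ominus> c 2 \<ominus> x' \<ominus> x" and l3: "\<zero> = l \<otimes> (x' \<ominus> e1) \<ominus> y'"
    using line_through[OF on(2), of x "\<ominus> y" e1 \<zero>] neg_closed[OF on(1)] add by (metis neg.simps(2))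
  have xc: "x \<in> carrier R" "y \<in> carrier R" "x' \<in> carrier R" "y' \<in> carrier R" by simp_all
  note [simp] = A(1-3) B(1-3)
  note cl = A(1-3) B(1-3) l e_closed xc
  have "l \<otimes> (x' \<ominus> e1) = y'"
  proof -
    have "l \<otimes> (x' \<ominus> e1) = \<zero> \<oplus> y'" unfolding l3 using cl by algebra
    then show ?thesis by simp
  qed
  note l3' = this
  have "(B2 \<otimes> B3) \<otimes> l = (B2 \<otimes> B3) \<otimes> B1" using l3' unfolding x' by (simp add: m_ac)
  then have lB: "l = B1" using B by (auto simp: m_lcancel integral_iff)
  have "l \<otimes> (x \<ominus> e1) = l \<otimes> (x' \<ominus> e1) \<ominus> l \<otimes> (x' \<ominus> x)" using cl by algebra
  also have "\<dots> = \<ominus> y" unfolding l1 l3' using cl by algebra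
  finally have "(A2 \<otimes> A3) \<otimes> l = (A2 \<otimes> A3) \<otimes> (\<ominus> A1)" unfolding x by (simp add: m_ac r_minus)
  then have lA: "l = \<ominus> A1" using A by (auto simp: m_lcancel integral_iff)
  show B1: "B1 = \<ominus> A1" using lA lB by simp
  have ll: "l \<otimes> l = A1 \<otimes> A1" unfolding lA by (simp add: l_minus r_minus)
  have "l \<otimes> l = (l \<otimes> l \<ominus> c 2 \<ominus> x' \<ominus> x) \<oplus> c 2 \<oplus> x' \<oplus> x" unfolding c_eq using cl by algebra
  then have s: "A1 \<otimes> A1 = e1 \<oplus> c 2 \<oplus> x' \<oplus> x" unfolding ll using l2 ll by simp
  also have "\<dots> = (x \<ominus> e2) \<oplus> (x' \<ominus> e3)" unfolding c_eq using cl by algebra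
  also have "\<dots> = A1 \<otimes> (A3 \<ominus> B2)" unfolding x x' B1 using cl by algebra
  finally have "A1 = A3 \<ominus> B2" by (rule mcancel[rotated -1]) (use A in auto)
  then show "B2 = A3 \<ominus> A1" by (rule minus_swap) simp_all
  have "A1 \<otimes> A1 = (x \<ominus> e3) \<oplus> (x' \<ominus> e2)" unfolding s c_eq using cl by algebra
  also have "\<dots> = A1 \<otimes> (A2 \<ominus> B3)" unfolding x x' B1 using cl by algebra
  finally have "A1 = A2 \<ominus> B3" by (rule mcancel[rotated -1]) (use A in auto)
  then show "B3 = A2 \<ominus> A1" by (rule minus_swap) simp_all
qed

text \<open>The classical halving formula: if \<open>s_i^2 = W - e_i\<close>, this is a point whose
  double has \<open>x\<close>-coordinate \<open>W\<close>. Different signs give different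
  halves.\<close>

definition half :: "'a \<Rightarrow> 'a \<Rightarrow> 'a \<Rightarrow> 'a \<Rightarrow> 'a point"
  where "half W s1 s2 s3 = Affine (W \<oplus> s1 \<otimes> s2 \<oplus> s1 \<otimes> s3 \<oplus> s2 \<otimes> s3) ((s1 \<oplus> s2) \<otimes> (s1 \<oplus> s3) \<otimes> (s2 \<oplus> s3))"

lemma half_on_curve:
  assumes s: "s1 \<in> carrier R" "s2 \<in> carrier R" "s3 \<in> carrier R" "W \<in> carrier R"
    and W: "W \<ominus> e1 = s1 \<otimes> s1" "W \<ominus> e2 = s2 \<otimes> s2" "W \<ominus> e3 = s3 \<otimes> s3"
  shows "half W s1 s2 s3 \<in> carrier E"
proof -
  let ?x = "W \<oplus> s1 \<otimes> s2 \<oplus> s1 \<otimes> s3 \<oplus> s2 \<otimes> s3"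
  have "?x \<ominus> e1 = (W \<ominus> e1) \<oplus> s1 \<otimes> s2 \<oplus> s1 \<otimes> s3 \<oplus> s2 \<otimes> s3" using s e_closed by algebra
  also have "\<dots> = (s1 \<oplus> s2) \<otimes> (s1 \<oplus> s3)" unfolding W using s by algebra
  finally have 1: "?x \<ominus> e1 = (s1 \<oplus> s2) \<otimes> (s1 \<oplus> s3)" .
  have "?x \<ominus> e2 = (W \<ominus> e2) \<oplus> s1 \<otimes> s2 \<oplus> s1 \<otimes> s3 \<oplus> s2 \<otimes> s3" using s e_closed by algebra
  also have "\<dots> = (s1 \<oplus> s2) \<otimes> (s2 \<oplus> s3)" unfolding W using s by algebra
  finally have 2: "?x \<ominus> e2 = (s1 \<oplus> s2) \<otimes> (s2 \<oplus> s3)" .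
  have "?x \<ominus> e3 = (W \<ominus> e3) \<oplus> s1 \<otimes> s2 \<oplus> s1 \<otimes> s3 \<oplus> s2 \<otimes> s3" using s e_closed by algebra
  also have "\<dots> = (s1 \<oplus> s3) \<otimes> (s2 \<oplus> s3)" unfolding W using s by algebra
  finally have 3: "?x \<ominus> e3 = (s1 \<oplus> s3) \<otimes> (s2 \<oplus> s3)" .
  show ?thesis unfolding half_def mem_E 1 2 3 using s by (simp add: m_ac)
qed

text \<open>The chord from one half to the negative of the other has slope
  \<open>- (s2 + s3)\<close>. It is a genuine chord because \<open>s1\<close> and
  \<open>(s2 - s3) (s2 + s3) = e3 - e2\<close> are nonzero.\<close>

lemma half_translate:
  assumes s: "s1 \<in> carrier R" "s2 \<in> carrier R" "s3 \<in> carrier R" "W \<in> carrier R" "s1 \<noteq> \<zero>"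
    and W: "W \<ominus> e1 = s1 \<otimes> s1" "W \<ominus> e2 = s2 \<otimes> s2" "W \<ominus> e3 = s3 \<otimes> s3"
  shows "ec_add R c (half W s1 (\<ominus> s2) (\<ominus> s3)) (neg (half W s1 s2 s3)) = Affine e1 \<zero>"
proof -
  note [simp] = s(1-4)
  note cl = s(1-4) e_closed
  define m where "m = s2 \<oplus> s3"
  have [simp]: "m \<in> carrier R" by (simp add: m_def)
  have m0: "m \<noteq> \<zero>"
  proof
    assume "m = \<zero>"
    then have "(s2 \<ominus> s3) \<otimes> m = \<zero>" by simp
    moreover have "(s2 \<ominus> s3) \<otimes> m = s2 \<otimes> s2 \<ominus> s3 \<otimes> s3" unfolding m_def using cl by algebra
    moreover have "s2 \<otimes> s2 \<ominus> s3 \<otimes> s3 = e3 \<ominus> e2" unfolding W[symmetric] using cl by algebra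
    ultimately show False using e_distinct by (simp add: r_right_minus_eq)
  qed
  define x x' y y' where "x = W \<oplus> s1 \<otimes> s2 \<oplus> s1 \<otimes> s3 \<oplus> s2 \<otimes> s3"
    and "x' = W \<oplus> s1 \<otimes> (\<ominus> s2) \<oplus> s1 \<otimes> (\<ominus> s3) \<oplus> (\<ominus> s2) \<otimes> (\<ominus> s3)"
    and "y = (s1 \<oplus> s2) \<otimes> (s1 \<oplus> s3) \<otimes> (s2 \<oplus> s3)"
    and "y' = (s1 \<oplus> (\<ominus> s2)) \<otimes> (s1 \<oplus> (\<ominus> s3)) \<otimes> ((\<ominus> s2) \<oplus> (\<ominus> s3))"
  have [simp]: "x \<in> carrier R" "x' \<in> carrier R" "y \<in> carrier R" "y' \<in> carrier R"
    by (simp_all add: x_def x'_def y_def y'_def)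
  have xc: "x \<in> carrier R" "y \<in> carrier R" "x' \<in> carrier R" "y' \<in> carrier R" by simp_all
  define d where "d = x \<ominus> x'"
  have [simp]: "d \<in> carrier R" by (simp add: d_def)
  have d: "d = (\<one> \<oplus> \<one>) \<otimes> (s1 \<otimes> m)" unfolding d_def x_def x'_def m_def using cl by algebra
  have d0: "d \<noteq> \<zero>" unfolding d using m0 s(5) two_nz by (simp add: integral_iff)
  then have xx: "x' \<noteq> x" by (auto simp: d_def r_neg a_minus_def)
  have dU: "d \<in> Units R" using d0 field_Units by auto
  have "(\<ominus> y) \<ominus> y' = (\<ominus> m) \<otimes> d"
  proof -
    define k n where "k = s1 \<otimes> s1 \<oplus> s2 \<otimes> s3" and "n = s1 \<otimes> m"
    have knm: "k \<in> carrier R" "n \<in> carrier R" "m \<in> carrier R" by (simp_all add: k_def n_def)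
    have "(s1 \<oplus> s2) \<otimes> (s1 \<oplus> s3) = k \<oplus> n" unfolding k_def n_def m_def using cl by algebra
    then have 1: "y = (k \<oplus> n) \<otimes> m" by (simp add: y_def m_def)
    have "(s1 \<oplus> (\<ominus> s2)) \<otimes> (s1 \<oplus> (\<ominus> s3)) = k \<ominus> n" "(\<ominus> s2) \<oplus> (\<ominus> s3) = \<ominus> m"
      unfolding k_def n_def m_def using cl by algebra+
    then have 2: "y' = (k \<ominus> n) \<otimes> (\<ominus> m)" by (simp add: y'_def)
    show ?thesis unfolding 1 2 d n_def[symmetric] using knm by algebra
  qed
  then have l: "((\<ominus> y) \<ominus> y') \<otimes> inv (x \<ominus> x') = \<ominus> m"
    using dU unfolding d_def[symmetric] by (simp add: m_assoc)
  have W': "W = e1 \<oplus> s1 \<otimes> s1" unfolding W(1)[symmetric] using cl by algebra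
  have c2: "c 2 \<in> carrier R" using c_eq by simp
  have "(\<ominus> m) [^] (2::nat) = m \<otimes> m" by (simp add: numeral_2_eq_2 nat_pow_Suc l_minus r_minus)
  then have "(\<ominus> m) [^] (2::nat) \<ominus> c 2 \<ominus> x' \<ominus> x = m \<otimes> m \<ominus> c 2 \<ominus> x' \<ominus> x" by simp
  also have "\<dots> = (s2 \<otimes> s2 \<ominus> (W \<ominus> e2)) \<oplus> (s3 \<otimes> s3 \<ominus> (W \<ominus> e3)) \<oplus> e1"
    unfolding c_eq m_def x_def x'_def using cl by algebra
  also have "\<dots> = e1" unfolding W by (simp add: r_neg a_minus_def)
  finally have x3: "(\<ominus> m) [^] (2::nat) \<ominus> c 2 \<ominus> x' \<ominus> x = e1" .
  have x'1: "x' \<ominus> e1 = (W \<ominus> e1) \<oplus> s1 \<otimes> (\<ominus> s2) \<oplus> s1 \<otimes> (\<ominus> s3) \<oplus> (\<ominus> s2) \<otimes> (\<ominus> s3)"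
    unfolding x'_def using cl by algebra
  have "x' \<ominus> e1 = (s1 \<oplus> (\<ominus> s2)) \<otimes> (s1 \<oplus> (\<ominus> s3))" unfolding x'1 W using cl by algebra
  moreover have "(\<ominus> s2) \<oplus> (\<ominus> s3) = \<ominus> m" unfolding m_def using cl by algebra
  ultimately have "y' = (\<ominus> m) \<otimes> (x' \<ominus> e1)" by (simp add: y'_def m_comm)
  then have y3: "(\<ominus> m) \<otimes> (x' \<ominus> e1) \<ominus> y' = \<zero>" by (simp add: r_neg a_minus_def)
  show ?thesis
    unfolding half_def x_def[symmetric] x'_def[symmetric] y_def[symmetric] y'_def[symmetric]
    using xx by (simp add: Let_def l x3 y3)
qed

end

section \<open>Two-descent over a field of characteristic zero\<close>

locale two_descent = gal_field0 F for F :: "'a ring" +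
  fixes e1 e2 e3 :: 'a and c :: "nat \<Rightarrow> 'a"
  assumes sc: "split_cubic F e1 e2 e3 c"
begin

sublocale B: split_cubic F e1 e2 e3 c by (rule sc)

lemma emb_closed [simp]: "a \<in> carrier F \<Longrightarrow> emb a \<in> carrier Om"
  by auto

lemma emb_eq_iff: "a \<in> carrier F \<Longrightarrow> b \<in> carrier F \<Longrightarrow> emb a = emb b \<longleftrightarrow> a = b"
  using emb_inj by (auto dest: inj_onD)

lemma emb_eq_zero_iff: "a \<in> carrier F \<Longrightarrow> emb a = \<zero>\<^bsub>Om\<^esub> \<longleftrightarrow> a = \<zero>\<^bsub>F\<^esub>"
  using emb_eq_iff[of a "\<zero>\<^bsub>F\<^esub>"] emb.hom_zero by auto

abbreviation "cc \<equiv> \<lambda>i. emb (c i)"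

lemma sc_Om: "split_cubic Om (emb e1) (emb e2) (emb e3) cc"
proof
  show "emb e1 \<in> carrier Om" "emb e2 \<in> carrier Om" "emb e3 \<in> carrier Om" by simp_all
  show "emb e1 \<noteq> emb e2" "emb e1 \<noteq> emb e3" "emb e2 \<noteq> emb e3"
    using B.e_distinct by (simp_all add: emb_eq_iff)
  have "emb (\<one>\<^bsub>F\<^esub> \<oplus>\<^bsub>F\<^esub> \<one>\<^bsub>F\<^esub>) \<noteq> \<zero>\<^bsub>Om\<^esub>" using B.two_nz by (simp only: emb_eq_zero_iff F.add.m_closed F.one_closed) auto
  then show "\<one>\<^bsub>Om\<^esub> \<oplus>\<^bsub>Om\<^esub> \<one>\<^bsub>Om\<^esub> \<noteq> \<zero>\<^bsub>Om\<^esub>" by simp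
  show "cc 2 = \<ominus>\<^bsub>Om\<^esub> (emb e1 \<oplus>\<^bsub>Om\<^esub> emb e2 \<oplus>\<^bsub>Om\<^esub> emb e3)"
    "cc 1 = emb e1 \<otimes>\<^bsub>Om\<^esub> emb e2 \<oplus>\<^bsub>Om\<^esub> emb e1 \<otimes>\<^bsub>Om\<^esub> emb e3 \<oplus>\<^bsub>Om\<^esub> emb e2 \<otimes>\<^bsub>Om\<^esub> emb e3"
    "cc 0 = \<ominus>\<^bsub>Om\<^esub> (emb e1 \<otimes>\<^bsub>Om\<^esub> emb e2 \<otimes>\<^bsub>Om\<^esub> emb e3)"
    using B.c_eq by simp_all
qed

sublocale S: split_cubic "alg_clos F" "clos_emb F e1" "clos_emb F e2" "clos_emb F e3" "\<lambda>i. clos_emb F (c i)"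
  by (rule sc_Om)
sublocale S2: split_cubic "alg_clos F" "clos_emb F e2" "clos_emb F e1" "clos_emb F e3" "\<lambda>i. clos_emb F (c i)"
  by (rule S.perm)
sublocale S3: split_cubic "alg_clos F" "clos_emb F e3" "clos_emb F e1" "clos_emb F e2" "\<lambda>i. clos_emb F (c i)"
  by (rule S.perm)

text \<open>The booleans are the signs by which translation by the point acts on \<open>s1\<close>
  and \<open>s2\<close>, with \<open>True\<close> for \<open>+1\<close>; the sign on
  \<open>s3\<close> is their product, the truth value of \<open>b1 = b2\<close>. Addition of points
  is then equality of booleans, see \<open>pt_add\<close>.\<close>

definition pt :: "bool \<Rightarrow> bool \<Rightarrow> 'a clos point"
  where "pt b1 b2 = (if b1 then if b2 then Infinity else Affine (emb e1) \<zero>\<^bsub>Om\<^esub>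
     else if b2 then Affine (emb e2) \<zero>\<^bsub>Om\<^esub> else Affine (emb e3) \<zero>\<^bsub>Om\<^esub>)"

lemma pt_inj: "pt b1 b2 = pt b1' b2' \<longleftrightarrow> b1 = b1' \<and> b2 = b2'"
  using S.e_distinct by (auto simp: pt_def)

lemma pt_Infinity: "pt b1 b2 = Infinity \<longleftrightarrow> b1 \<and> b2"
  by (auto simp: pt_def)

definition sqrt_of :: "'a clos \<Rightarrow> 'a \<Rightarrow> bool"
  where "sqrt_of r d \<longleftrightarrow> r \<in> carrier Om \<and> d \<in> carrier F \<and> d \<noteq> \<zero>\<^bsub>F\<^esub> \<and> r \<otimes>\<^bsub>Om\<^esub> r = emb d"

lemma sqrt_of_closed: "sqrt_of r d \<Longrightarrow> r \<in> carrier Om" "sqrt_of r d \<Longrightarrow> d \<in> carrier F"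
  by (simp_all add: sqrt_of_def)

lemma sqrt_of_nz: "sqrt_of r d \<Longrightarrow> r \<noteq> \<zero>\<^bsub>Om\<^esub>"
proof
  assume "sqrt_of r d" "r = \<zero>\<^bsub>Om\<^esub>"
  then have "emb d = \<zero>\<^bsub>Om\<^esub>" "d \<in> carrier F" "d \<noteq> \<zero>\<^bsub>F\<^esub>" unfolding sqrt_of_def by simp_all
  then show False using emb_eq_zero_iff by blast
qed

lemma gal_ring_hom: "\<sigma> \<in> G \<Longrightarrow> ring_hom_ring Om Om \<sigma>"
  by (rule ring_hom_ringI2) (auto intro: O.ring_axioms gal_hom)

lemma gal_sqrt:
  assumes "sqrt_of r d" "\<sigma> \<in> G"
  shows "\<sigma> r = r \<or> \<sigma> r = \<ominus>\<^bsub>Om\<^esub> r" "\<ominus>\<^bsub>Om\<^esub> r \<noteq> r"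
proof -
  have r: "r \<in> carrier Om" using assms(1) by (rule sqrt_of_closed)
  have "\<sigma> r \<otimes>\<^bsub>Om\<^esub> \<sigma> r = r \<otimes>\<^bsub>Om\<^esub> r"
    using ring_hom_mult[OF gal_hom[OF assms(2)] r r] assms gal_fix[OF assms(2)] by (simp add: sqrt_of_def)
  then show "\<sigma> r = r \<or> \<sigma> r = \<ominus>\<^bsub>Om\<^esub> r"
    using S.sq_eq_iff[of "\<sigma> r" r] assms r by auto
  show "\<ominus>\<^bsub>Om\<^esub> r \<noteq> r" using S.self_neg[OF r] sqrt_of_nz[OF assms(1)] by metis
qed

lemma sqrt_of_mult:
  assumes "sqrt_of r d" "sqrt_of r' d'" shows "sqrt_of (r \<otimes>\<^bsub>Om\<^esub> r') (d \<otimes>\<^bsub>F\<^esub> d')"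
proof -
  note [simp] = sqrt_of_closed[OF assms(1)] sqrt_of_closed[OF assms(2)]
  have "r \<otimes>\<^bsub>Om\<^esub> r' \<otimes>\<^bsub>Om\<^esub> (r \<otimes>\<^bsub>Om\<^esub> r') = (r \<otimes>\<^bsub>Om\<^esub> r) \<otimes>\<^bsub>Om\<^esub> (r' \<otimes>\<^bsub>Om\<^esub> r')"
    using assms by (simp add: O.m_ac)
  then show ?thesis using assms by (auto simp: sqrt_of_def F.integral_iff)
qed

lemma gal_sqrt_mult:
  assumes "sqrt_of r d" "sqrt_of r' d'" "\<sigma> \<in> G"
  shows "\<sigma> (r \<otimes>\<^bsub>Om\<^esub> r') = r \<otimes>\<^bsub>Om\<^esub> r' \<longleftrightarrow> (\<sigma> r = r \<longleftrightarrow> \<sigma> r' = r')"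
proof -
  have rr: "r \<in> carrier Om" "r' \<in> carrier Om" using sqrt_of_closed(1)[OF assms(1)] sqrt_of_closed(1)[OF assms(2)] .
  have m: "\<sigma> (r \<otimes>\<^bsub>Om\<^esub> r') = \<sigma> r \<otimes>\<^bsub>Om\<^esub> \<sigma> r'" using ring_hom_mult[OF gal_hom[OF assms(3)] rr] .
  have n: "\<ominus>\<^bsub>Om\<^esub> (r \<otimes>\<^bsub>Om\<^esub> r') \<noteq> r \<otimes>\<^bsub>Om\<^esub> r'" using gal_sqrt(2)[OF sqrt_of_mult[OF assms(1,2)] assms(3)] .
  consider "\<sigma> r = r" "\<sigma> r' = r'" | "\<sigma> r = r" "\<sigma> r' = \<ominus>\<^bsub>Om\<^esub> r'" | "\<sigma> r = \<ominus>\<^bsub>Om\<^esub> r" "\<sigma> r' = r'"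
    | "\<sigma> r = \<ominus>\<^bsub>Om\<^esub> r" "\<sigma> r' = \<ominus>\<^bsub>Om\<^esub> r'"
    using gal_sqrt(1)[OF assms(1,3)] gal_sqrt(1)[OF assms(2,3)] by blast
  then show ?thesis
  proof cases
    case 1 then show ?thesis using m by simp
  next
    case 2
    have "\<sigma> (r \<otimes>\<^bsub>Om\<^esub> r') \<noteq> r \<otimes>\<^bsub>Om\<^esub> r'" unfolding m 2 O.r_minus[OF rr] by (rule n)
    then show ?thesis using 2 gal_sqrt(2)[OF assms(2,3)] by simp
  next
    case 3
    have "\<sigma> (r \<otimes>\<^bsub>Om\<^esub> r') \<noteq> r \<otimes>\<^bsub>Om\<^esub> r'" unfolding m 3 O.l_minus[OF rr] by (rule n)
    then show ?thesis using 3 gal_sqrt(2)[OF assms(1,3)] by simp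
  next
    case 4
    have "\<sigma> (r \<otimes>\<^bsub>Om\<^esub> r') = r \<otimes>\<^bsub>Om\<^esub> r'"
      unfolding m 4 using rr by (simp add: O.l_minus O.r_minus)
    then show ?thesis using 4 gal_sqrt(2)[OF assms(1,3)] gal_sqrt(2)[OF assms(2,3)] by simp
  qed
qed

text \<open>The quotient of \<open>s\<close> by \<open>r\<close> is fixed by the group, hence lies
  in the base field.\<close>

lemma same_character:
  assumes r: "sqrt_of r d" and s: "s \<in> carrier Om"
    and eq: "\<And>\<sigma>. \<sigma> \<in> G \<Longrightarrow> \<sigma> s = (if \<sigma> r = r then s else \<ominus>\<^bsub>Om\<^esub> s)"
  obtains z where "z \<in> carrier F" "s = emb z \<otimes>\<^bsub>Om\<^esub> r"
proof -
  note [simp] = sqrt_of_closed[OF r]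
  have rU: "r \<in> Units Om" using r sqrt_of_nz[OF r] O.field_Units by auto
  define k where "k = s \<otimes>\<^bsub>Om\<^esub> inv\<^bsub>Om\<^esub> r"
  have kc: "k \<in> carrier Om" using s rU by (simp add: k_def)
  have kr: "k \<otimes>\<^bsub>Om\<^esub> r = s" using s rU r by (simp add: k_def O.m_assoc)
  have "k \<in> KF"
  proof (rule fixed_field[OF kc])
    fix \<sigma> assume \<sigma>: "\<sigma> \<in> G"
    have "\<sigma> k \<otimes>\<^bsub>Om\<^esub> \<sigma> r = \<sigma> s" using ring_hom_mult[OF gal_hom[OF \<sigma>] kc, of r] r kr by simp
    then have "\<sigma> k \<otimes>\<^bsub>Om\<^esub> r = k \<otimes>\<^bsub>Om\<^esub> r"
    proof (cases "\<sigma> r = r")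
      case True then show ?thesis using \<open>\<sigma> k \<otimes>\<^bsub>Om\<^esub> \<sigma> r = \<sigma> s\<close> eq[OF \<sigma>] kr by simp
    next
      case False
      then have "\<sigma> r = \<ominus>\<^bsub>Om\<^esub> r" using gal_sqrt(1)[OF r \<sigma>] by simp
      then have "\<ominus>\<^bsub>Om\<^esub> (\<sigma> k \<otimes>\<^bsub>Om\<^esub> r) = \<ominus>\<^bsub>Om\<^esub> s"
        using \<open>\<sigma> k \<otimes>\<^bsub>Om\<^esub> \<sigma> r = \<sigma> s\<close> eq[OF \<sigma>] False kc \<sigma> r by (simp add: O.r_minus)
      from arg_cong[OF this, of "a_inv Om"] show ?thesis using kr s kc \<sigma> r by simp
    qed
    then show "\<sigma> k = k" using rU kc \<sigma> O.m_rcancel[of r] sqrt_of_nz[OF r] r by (simp add: O.m_rcancel)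
  qed
  then show ?thesis using that kr by auto
qed

lemma map_point_E:
  assumes "\<sigma> \<in> G" "Affine x y \<in> carrier S.E"
  shows "Affine (\<sigma> x) (\<sigma> y) \<in> carrier S.E"
proof -
  interpret \<sigma>: ring_hom_ring Om Om \<sigma> by (rule gal_ring_hom[OF assms(1)])
  have *: "x \<in> carrier Om" "y \<in> carrier Om"
    "y \<otimes>\<^bsub>Om\<^esub> y = (x \<ominus>\<^bsub>Om\<^esub> emb e1) \<otimes>\<^bsub>Om\<^esub> (x \<ominus>\<^bsub>Om\<^esub> emb e2) \<otimes>\<^bsub>Om\<^esub> (x \<ominus>\<^bsub>Om\<^esub> emb e3)"
    using assms(2) by (auto simp: S.mem_E)
  have "\<sigma> (y \<otimes>\<^bsub>Om\<^esub> y) = (\<sigma> x \<ominus>\<^bsub>Om\<^esub> emb e1) \<otimes>\<^bsub>Om\<^esub> (\<sigma> x \<ominus>\<^bsub>Om\<^esub> emb e2) \<otimes>\<^bsub>Om\<^esub> (\<sigma> x \<ominus>\<^bsub>Om\<^esub> emb e3)"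
    unfolding *(3) using *(1) by (simp add: a_minus_def gal_fix[OF assms(1)])
  moreover have "\<sigma> (y \<otimes>\<^bsub>Om\<^esub> y) = \<sigma> y \<otimes>\<^bsub>Om\<^esub> \<sigma> y" using *(2) by simp
  ultimately show ?thesis using *(1,2) unfolding S.mem_E by simp
qed

lemma two_torsion_x:
  assumes "Affine x \<zero>\<^bsub>Om\<^esub> \<in> carrier S.E"
  shows "x = emb e1 \<or> x = emb e2 \<or> x = emb e3"
proof -
  have x: "x \<in> carrier Om" "\<zero>\<^bsub>Om\<^esub> = (x \<ominus>\<^bsub>Om\<^esub> emb e1) \<otimes>\<^bsub>Om\<^esub> (x \<ominus>\<^bsub>Om\<^esub> emb e2) \<otimes>\<^bsub>Om\<^esub> (x \<ominus>\<^bsub>Om\<^esub> emb e3)"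
    using assms by (auto simp: S.mem_E)
  then have "x \<ominus>\<^bsub>Om\<^esub> emb e1 = \<zero>\<^bsub>Om\<^esub> \<or> x \<ominus>\<^bsub>Om\<^esub> emb e2 = \<zero>\<^bsub>Om\<^esub> \<or> x \<ominus>\<^bsub>Om\<^esub> emb e3 = \<zero>\<^bsub>Om\<^esub>"
    using O.integral_iff[of "(x \<ominus>\<^bsub>Om\<^esub> emb e1) \<otimes>\<^bsub>Om\<^esub> (x \<ominus>\<^bsub>Om\<^esub> emb e2)" "x \<ominus>\<^bsub>Om\<^esub> emb e3"]
      O.integral_iff[of "x \<ominus>\<^bsub>Om\<^esub> emb e1" "x \<ominus>\<^bsub>Om\<^esub> emb e2"] by auto
  then show ?thesis using x(1) by (auto simp: O.r_right_minus_eq)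
qed

lemma halving_sums:
  assumes s: "A1 \<in> carrier Om" "A2 \<in> carrier Om" "A3 \<in> carrier Om"
    and H: "H \<in> carrier Om" "(\<one>\<^bsub>Om\<^esub> \<oplus>\<^bsub>Om\<^esub> \<one>\<^bsub>Om\<^esub>) \<otimes>\<^bsub>Om\<^esub> H = \<one>\<^bsub>Om\<^esub>"
  shows "H \<otimes>\<^bsub>Om\<^esub> (A1 \<oplus>\<^bsub>Om\<^esub> A3 \<ominus>\<^bsub>Om\<^esub> A2) \<oplus>\<^bsub>Om\<^esub> H \<otimes>\<^bsub>Om\<^esub> (A1 \<oplus>\<^bsub>Om\<^esub> A2 \<ominus>\<^bsub>Om\<^esub> A3) = A1"
proof -
  have "H \<otimes>\<^bsub>Om\<^esub> (A1 \<oplus>\<^bsub>Om\<^esub> A3 \<ominus>\<^bsub>Om\<^esub> A2) \<oplus>\<^bsub>Om\<^esub> H \<otimes>\<^bsub>Om\<^esub> (A1 \<oplus>\<^bsub>Om\<^esub> A2 \<ominus>\<^bsub>Om\<^esub> A3)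
     = ((\<one>\<^bsub>Om\<^esub> \<oplus>\<^bsub>Om\<^esub> \<one>\<^bsub>Om\<^esub>) \<otimes>\<^bsub>Om\<^esub> H) \<otimes>\<^bsub>Om\<^esub> A1" using s H(1) O.one_closed by algebra
  then show ?thesis using H s by simp
qed

text \<open>The half-sums \<open>s1\<close>, \<open>s2\<close>, \<open>s3\<close> of the halving
  coordinates of \<open>P\<close> change only by signs under the group, and the cocycle prescribes
  the signs; so they are base field multiples of \<open>r1\<close>, \<open>r2\<close>,
  \<open>r1 r2\<close>. All the \<open>s_i^2 + e_i\<close> equal the \<open>x\<close>-coordinate of
  the double of \<open>P\<close>, whence the equations. If \<open>P\<close> itself is two-torsion,
  the cocycle vanishes: this is the first alternative.\<close>

theorem descent_necessary:
  assumes r1: "sqrt_of r1 d1" and r2: "sqrt_of r2 d2" and P: "P \<in> carrier S.E"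
    and cob: "\<And>\<tau>. \<tau> \<in> G \<Longrightarrow> pt (\<tau> r1 = r1) (\<tau> r2 = r2) = map_point \<tau> P \<otimes>\<^bsub>S.E\<^esub> inv\<^bsub>S.E\<^esub> P"
  shows "(r1 \<in> KF \<and> r2 \<in> KF) \<or> (\<exists>z1\<in>carrier F. \<exists>z2\<in>carrier F. \<exists>z3\<in>carrier F.
     d1 \<otimes>\<^bsub>F\<^esub> (z1 \<otimes>\<^bsub>F\<^esub> z1) \<oplus>\<^bsub>F\<^esub> e1 = d2 \<otimes>\<^bsub>F\<^esub> (z2 \<otimes>\<^bsub>F\<^esub> z2) \<oplus>\<^bsub>F\<^esub> e2 \<and>
     d1 \<otimes>\<^bsub>F\<^esub> (z1 \<otimes>\<^bsub>F\<^esub> z1) \<oplus>\<^bsub>F\<^esub> e1 = d1 \<otimes>\<^bsub>F\<^esub> d2 \<otimes>\<^bsub>F\<^esub> (z3 \<otimes>\<^bsub>F\<^esub> z3) \<oplus>\<^bsub>F\<^esub> e3)"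
proof -
  have cob': "pt (\<tau> r1 = r1) (\<tau> r2 = r2) = ec_add Om cc (map_point \<tau> P) (S.neg P)" if "\<tau> \<in> G" for \<tau>
    using cob[OF that] S.inv_E[OF P] by simp
  have triv: ?thesis if "\<And>\<tau>. \<tau> \<in> G \<Longrightarrow> map_point \<tau> P = P"
  proof -
    have "\<tau> r1 = r1 \<and> \<tau> r2 = r2" if "\<tau> \<in> G" for \<tau>
      using cob'[OF that] \<open>\<And>\<tau>. \<tau> \<in> G \<Longrightarrow> map_point \<tau> P = P\<close>[OF that] S.ec_add_eq_Infinity_iff[OF P S.neg_closed[OF P]]
      by (simp add: pt_Infinity)
    then show ?thesis using fixed_field sqrt_of_closed(1)[OF r1] sqrt_of_closed(1)[OF r2] by blast
  qed
  show ?thesis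
  proof (cases P)
    case Infinity then show ?thesis by (intro triv) simp
  next
    case (Affine x y)
    have xy: "x \<in> carrier Om" "y \<in> carrier Om" using P Affine by (auto simp: S.mem_E)
    show ?thesis
    proof (cases "y = \<zero>\<^bsub>Om\<^esub>")
      case True
      show ?thesis
      proof (rule triv)
        fix \<tau> assume \<tau>: "\<tau> \<in> G"
        interpret \<tau>: ring_hom_ring Om Om \<tau> by (rule gal_ring_hom[OF \<tau>])
        have "\<tau> x = x" using two_torsion_x[of x] P Affine True gal_fix[OF \<tau>] by auto
        then show "map_point \<tau> P = P" using Affine True by simp
      qed
    next
      case False
      obtain A1 A2 A3 where A: "A1 \<in> carrier Om" "A2 \<in> carrier Om" "A3 \<in> carrier Om"
        "A1 \<noteq> \<zero>\<^bsub>Om\<^esub>" "A2 \<noteq> \<zero>\<^bsub>Om\<^esub>" "A3 \<noteq> \<zero>\<^bsub>Om\<^esub>"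
        and xA: "x \<ominus>\<^bsub>Om\<^esub> emb e1 = A2 \<otimes>\<^bsub>Om\<^esub> A3" "x \<ominus>\<^bsub>Om\<^esub> emb e2 = A1 \<otimes>\<^bsub>Om\<^esub> A3" "x \<ominus>\<^bsub>Om\<^esub> emb e3 = A1 \<otimes>\<^bsub>Om\<^esub> A2"
        and yA: "y = A1 \<otimes>\<^bsub>Om\<^esub> A2 \<otimes>\<^bsub>Om\<^esub> A3"
        by (rule S.halving_coordinates[OF P[unfolded Affine] False]) (rule that)
      define H where "H = inv\<^bsub>Om\<^esub> (\<one>\<^bsub>Om\<^esub> \<oplus>\<^bsub>Om\<^esub> \<one>\<^bsub>Om\<^esub>)"
      have twoU: "\<one>\<^bsub>Om\<^esub> \<oplus>\<^bsub>Om\<^esub> \<one>\<^bsub>Om\<^esub> \<in> Units Om" using S.two_nz O.field_Units by auto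
      have H: "H \<in> carrier Om" "(\<one>\<^bsub>Om\<^esub> \<oplus>\<^bsub>Om\<^esub> \<one>\<^bsub>Om\<^esub>) \<otimes>\<^bsub>Om\<^esub> H = \<one>\<^bsub>Om\<^esub>"
        using twoU by (simp_all add: H_def)
      define s1 s2 s3 where "s1 = H \<otimes>\<^bsub>Om\<^esub> (A2 \<oplus>\<^bsub>Om\<^esub> A3 \<ominus>\<^bsub>Om\<^esub> A1)"
        and "s2 = H \<otimes>\<^bsub>Om\<^esub> (A1 \<oplus>\<^bsub>Om\<^esub> A3 \<ominus>\<^bsub>Om\<^esub> A2)" and "s3 = H \<otimes>\<^bsub>Om\<^esub> (A1 \<oplus>\<^bsub>Om\<^esub> A2 \<ominus>\<^bsub>Om\<^esub> A3)"
      have s: "s1 \<in> carrier Om" "s2 \<in> carrier Om" "s3 \<in> carrier Om"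
        using A H by (simp_all add: s1_def s2_def s3_def)
      have sums: "s2 \<oplus>\<^bsub>Om\<^esub> s3 = A1" "s1 \<oplus>\<^bsub>Om\<^esub> s3 = A2" "s1 \<oplus>\<^bsub>Om\<^esub> s2 = A3"
        unfolding s1_def s2_def s3_def
        using halving_sums[OF A(1,2,3) H] halving_sums[OF A(2,1,3) H] halving_sums[OF A(3,1,2) H] A
        by (simp_all add: O.a_comm)
      have act: "\<tau> s1 = (if \<tau> r1 = r1 then s1 else \<ominus>\<^bsub>Om\<^esub> s1) \<and> \<tau> s2 = (if \<tau> r2 = r2 then s2 else \<ominus>\<^bsub>Om\<^esub> s2) \<and>
          \<tau> s3 = (if \<tau> r1 = r1 \<longleftrightarrow> \<tau> r2 = r2 then s3 else \<ominus>\<^bsub>Om\<^esub> s3)" if \<tau>: "\<tau> \<in> G" for \<tau>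
      proof -
        interpret \<tau>: ring_hom_ring Om Om \<tau> by (rule gal_ring_hom[OF \<tau>])
        have \<tau>H: "\<tau> H = H"
        proof -
          have "(\<one>\<^bsub>Om\<^esub> \<oplus>\<^bsub>Om\<^esub> \<one>\<^bsub>Om\<^esub>) \<otimes>\<^bsub>Om\<^esub> \<tau> H = \<one>\<^bsub>Om\<^esub>"
            using arg_cong[OF H(2), of \<tau>] H(1) by simp
          then show ?thesis using H twoU by (metis O.Units_l_cancel O.Units_closed \<tau>.hom_closed)
        qed
        define B1 B2 B3 where "B1 = \<tau> A1" and "B2 = \<tau> A2" and "B3 = \<tau> A3"
        have B: "B1 \<in> carrier Om" "B2 \<in> carrier Om" "B3 \<in> carrier Om"
          "B1 \<noteq> \<zero>\<^bsub>Om\<^esub>" "B2 \<noteq> \<zero>\<^bsub>Om\<^esub>" "B3 \<noteq> \<zero>\<^bsub>Om\<^esub>"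
          using A non_trivial_field_hom_is_inj[OF gal_hom[OF \<tau>] O.field_axioms O.field_axioms]
          unfolding B1_def B2_def B3_def by (auto dest: inj_onD[of _ _ _ "\<zero>\<^bsub>Om\<^esub>"])
        have "\<tau> (x \<ominus>\<^bsub>Om\<^esub> emb e) = \<tau> x \<ominus>\<^bsub>Om\<^esub> emb e" if "e \<in> carrier F" for e
          using that xy by (simp add: a_minus_def gal_fix[OF \<tau>])
        then have xB: "\<tau> x \<ominus>\<^bsub>Om\<^esub> emb e1 = B2 \<otimes>\<^bsub>Om\<^esub> B3" "\<tau> x \<ominus>\<^bsub>Om\<^esub> emb e2 = B1 \<otimes>\<^bsub>Om\<^esub> B3" "\<tau> x \<ominus>\<^bsub>Om\<^esub> emb e3 = B1 \<otimes>\<^bsub>Om\<^esub> B2"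
          using xA A \<tau>.hom_mult unfolding B1_def B2_def B3_def by (metis B.e_closed)+
        have yB: "\<tau> y = B1 \<otimes>\<^bsub>Om\<^esub> B2 \<otimes>\<^bsub>Om\<^esub> B3" using yA A by (simp add: B1_def B2_def B3_def)
        have onP: "Affine x y \<in> carrier S.E" "Affine (\<tau> x) (\<tau> y) \<in> carrier S.E"
          using P Affine map_point_E[OF \<tau>] by auto
        have \<tau>s: "\<tau> s1 = H \<otimes>\<^bsub>Om\<^esub> (B2 \<oplus>\<^bsub>Om\<^esub> B3 \<ominus>\<^bsub>Om\<^esub> B1)" "\<tau> s2 = H \<otimes>\<^bsub>Om\<^esub> (B1 \<oplus>\<^bsub>Om\<^esub> B3 \<ominus>\<^bsub>Om\<^esub> B2)"
          "\<tau> s3 = H \<otimes>\<^bsub>Om\<^esub> (B1 \<oplus>\<^bsub>Om\<^esub> B2 \<ominus>\<^bsub>Om\<^esub> B3)"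
          using A H \<tau>H by (simp_all add: s1_def s2_def s3_def B1_def B2_def B3_def a_minus_def)
        note cob2 = cob'[OF \<tau>, unfolded Affine, simplified]
        note AH = A(1-3) H(1)
        consider "\<tau> r1 = r1" "\<tau> r2 = r2" | "\<tau> r1 = r1" "\<tau> r2 \<noteq> r2" | "\<tau> r1 \<noteq> r1" "\<tau> r2 = r2" | "\<tau> r1 \<noteq> r1" "\<tau> r2 \<noteq> r2"
          by blast
        then show ?thesis
        proof cases
          case 1
          then have "ec_add Om cc (Affine (\<tau> x) (\<tau> y)) (S.neg (Affine x y)) = Infinity" using cob2 by (simp add: pt_def)
          then have "S.neg (Affine x y) = S.neg (Affine (\<tau> x) (\<tau> y))"
            using S.ec_add_eq_Infinity_iff[OF onP(2) S.neg_closed[OF onP(1)]] by simp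
          then have eq: "\<tau> x = x" "\<tau> y = y" using xy by (auto simp: O.minus_minus dest: arg_cong[of _ _ "a_inv Om"])
          have p: "A2 \<otimes>\<^bsub>Om\<^esub> A3 = B2 \<otimes>\<^bsub>Om\<^esub> B3" "A1 \<otimes>\<^bsub>Om\<^esub> A3 = B1 \<otimes>\<^bsub>Om\<^esub> B3" "A1 \<otimes>\<^bsub>Om\<^esub> A2 = B1 \<otimes>\<^bsub>Om\<^esub> B2"
            using xB unfolding eq(1) xA by simp_all
          have q: "A1 \<otimes>\<^bsub>Om\<^esub> A2 \<otimes>\<^bsub>Om\<^esub> A3 = B1 \<otimes>\<^bsub>Om\<^esub> B2 \<otimes>\<^bsub>Om\<^esub> B3"
            using yA yB eq(2) by simp
          have q': "A1 \<otimes>\<^bsub>Om\<^esub> (A2 \<otimes>\<^bsub>Om\<^esub> A3) = B1 \<otimes>\<^bsub>Om\<^esub> (B2 \<otimes>\<^bsub>Om\<^esub> B3)"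
            "A2 \<otimes>\<^bsub>Om\<^esub> (A1 \<otimes>\<^bsub>Om\<^esub> A3) = B2 \<otimes>\<^bsub>Om\<^esub> (B1 \<otimes>\<^bsub>Om\<^esub> B3)"
            "A3 \<otimes>\<^bsub>Om\<^esub> (A1 \<otimes>\<^bsub>Om\<^esub> A2) = B3 \<otimes>\<^bsub>Om\<^esub> (B1 \<otimes>\<^bsub>Om\<^esub> B2)"
            using q A B by (simp_all add: O.m_ac)
          have nzp: "u \<otimes>\<^bsub>Om\<^esub> v \<noteq> \<zero>\<^bsub>Om\<^esub>" if "u \<in> carrier Om" "v \<in> carrier Om" "u \<noteq> \<zero>\<^bsub>Om\<^esub>" "v \<noteq> \<zero>\<^bsub>Om\<^esub>" for u v
            using that O.integral by blast
          have 1: "B1 = A1" using q'(1)[unfolded p] O.m_rcancel[of "B2 \<otimes>\<^bsub>Om\<^esub> B3" A1 B1] A B nzp[of B2 B3] by simp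
          have 2: "B2 = A2" using q'(2)[unfolded p] O.m_rcancel[of "B1 \<otimes>\<^bsub>Om\<^esub> B3" A2 B2] A B nzp[of B1 B3] by simp
          have 3: "B3 = A3" using q'(3)[unfolded p] O.m_rcancel[of "B1 \<otimes>\<^bsub>Om\<^esub> B2" A3 B3] A B nzp[of B1 B2] by simp
          show ?thesis using \<tau>s \<open>\<tau> r1 = r1\<close> \<open>\<tau> r2 = r2\<close> unfolding 1 2 3 by (simp add: s1_def s2_def s3_def)
        next
          case 2
          then have "ec_add Om cc (Affine (\<tau> x) (\<tau> y)) (S.neg (Affine x y)) = Affine (emb e1) \<zero>\<^bsub>Om\<^esub>"
            using cob2 by (simp add: pt_def)
          from S.translate_coordinates[OF A xA yA B xB yB onP this]
          have t: "B1 = \<ominus>\<^bsub>Om\<^esub> A1" "B2 = A3 \<ominus>\<^bsub>Om\<^esub> A1" "B3 = A2 \<ominus>\<^bsub>Om\<^esub> A1" .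
          have "\<tau> s1 = s1" unfolding \<tau>s t unfolding s1_def using AH by algebra
          moreover have "\<tau> s2 = \<ominus>\<^bsub>Om\<^esub> s2" unfolding \<tau>s t unfolding s2_def using AH by algebra
          moreover have "\<tau> s3 = \<ominus>\<^bsub>Om\<^esub> s3" unfolding \<tau>s t unfolding s3_def using AH by algebra
          ultimately show ?thesis using 2 by simp
        next
          case 3
          then have *: "ec_add Om cc (Affine (\<tau> x) (\<tau> y)) (S2.neg (Affine x y)) = Affine (emb e2) \<zero>\<^bsub>Om\<^esub>"
            using cob2 by (simp add: pt_def)
          have y2: "y = A2 \<otimes>\<^bsub>Om\<^esub> A1 \<otimes>\<^bsub>Om\<^esub> A3" "\<tau> y = B2 \<otimes>\<^bsub>Om\<^esub> B1 \<otimes>\<^bsub>Om\<^esub> B3"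
            "x \<ominus>\<^bsub>Om\<^esub> emb e3 = A2 \<otimes>\<^bsub>Om\<^esub> A1" "\<tau> x \<ominus>\<^bsub>Om\<^esub> emb e3 = B2 \<otimes>\<^bsub>Om\<^esub> B1"
            using yA yB xA xB A B by (simp_all add: O.m_ac)
          from S2.translate_coordinates[OF A(2,1,3,5,4,6) xA(2,1) y2(3,1) B(2,1,3,5,4,6) xB(2,1) y2(4,2) onP *]
          have t: "B2 = \<ominus>\<^bsub>Om\<^esub> A2" "B1 = A3 \<ominus>\<^bsub>Om\<^esub> A2" "B3 = A1 \<ominus>\<^bsub>Om\<^esub> A2" .
          have "\<tau> s1 = \<ominus>\<^bsub>Om\<^esub> s1" unfolding \<tau>s t unfolding s1_def using AH by algebra
          moreover have "\<tau> s2 = s2" unfolding \<tau>s t unfolding s2_def using AH by algebra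
          moreover have "\<tau> s3 = \<ominus>\<^bsub>Om\<^esub> s3" unfolding \<tau>s t unfolding s3_def using AH by algebra
          ultimately show ?thesis using 3 by simp
        next
          case 4
          then have *: "ec_add Om cc (Affine (\<tau> x) (\<tau> y)) (S3.neg (Affine x y)) = Affine (emb e3) \<zero>\<^bsub>Om\<^esub>"
            using cob2 by (simp add: pt_def)
          have y2: "y = A3 \<otimes>\<^bsub>Om\<^esub> A1 \<otimes>\<^bsub>Om\<^esub> A2" "\<tau> y = B3 \<otimes>\<^bsub>Om\<^esub> B1 \<otimes>\<^bsub>Om\<^esub> B2"
            "x \<ominus>\<^bsub>Om\<^esub> emb e1 = A3 \<otimes>\<^bsub>Om\<^esub> A2" "\<tau> x \<ominus>\<^bsub>Om\<^esub> emb e1 = B3 \<otimes>\<^bsub>Om\<^esub> B2"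
            "x \<ominus>\<^bsub>Om\<^esub> emb e2 = A3 \<otimes>\<^bsub>Om\<^esub> A1" "\<tau> x \<ominus>\<^bsub>Om\<^esub> emb e2 = B3 \<otimes>\<^bsub>Om\<^esub> B1"
            using yA yB xA xB A B by (simp_all add: O.m_ac)
          from S3.translate_coordinates[OF A(3,1,2,6,4,5) xA(3) y2(3,5,1) B(3,1,2,6,4,5) xB(3) y2(4,6,2) onP *]
          have t: "B3 = \<ominus>\<^bsub>Om\<^esub> A3" "B1 = A2 \<ominus>\<^bsub>Om\<^esub> A3" "B2 = A1 \<ominus>\<^bsub>Om\<^esub> A3" .
          have "\<tau> s1 = \<ominus>\<^bsub>Om\<^esub> s1" unfolding \<tau>s t unfolding s1_def using AH by algebra
          moreover have "\<tau> s2 = \<ominus>\<^bsub>Om\<^esub> s2" unfolding \<tau>s t unfolding s2_def using AH by algebra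
          moreover have "\<tau> s3 = s3" unfolding \<tau>s t unfolding s3_def using AH by algebra
          ultimately show ?thesis using 4 by simp
        qed
      qed
      obtain z1 where z1: "z1 \<in> carrier F" "s1 = emb z1 \<otimes>\<^bsub>Om\<^esub> r1"
        using same_character[OF r1 s(1)] act by blast
      obtain z2 where z2: "z2 \<in> carrier F" "s2 = emb z2 \<otimes>\<^bsub>Om\<^esub> r2"
        using same_character[OF r2 s(2)] act by blast
      obtain z3 where z3: "z3 \<in> carrier F" "s3 = emb z3 \<otimes>\<^bsub>Om\<^esub> (r1 \<otimes>\<^bsub>Om\<^esub> r2)"
        using same_character[OF sqrt_of_mult[OF r1 r2] s(3)] act gal_sqrt_mult[OF r1 r2] by (metis (no_types, lifting))
      have sq: "emb (d \<otimes>\<^bsub>F\<^esub> (z \<otimes>\<^bsub>F\<^esub> z) \<oplus>\<^bsub>F\<^esub> e) = t \<otimes>\<^bsub>Om\<^esub> t \<oplus>\<^bsub>Om\<^esub> emb e"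
        if rd: "sqrt_of r d" and "z \<in> carrier F" "t = emb z \<otimes>\<^bsub>Om\<^esub> r" "e \<in> carrier F" for r d z t e
      proof -
        note [simp] = sqrt_of_closed[OF rd]
        have "t \<otimes>\<^bsub>Om\<^esub> t = (r \<otimes>\<^bsub>Om\<^esub> r) \<otimes>\<^bsub>Om\<^esub> (emb z \<otimes>\<^bsub>Om\<^esub> emb z)" using that by (simp add: O.m_ac)
        then show ?thesis using that by (simp add: sqrt_of_def)
      qed
      \<comment> \<open>\<open>x - k\<close> is the common value of the \<open>s_i^2 + e_i\<close>,
        because \<open>x - e1 = (s1 + s2) (s1 + s3)\<close> and similarly for the other
        roots.\<close>
      define k where "k = s1 \<otimes>\<^bsub>Om\<^esub> s2 \<oplus>\<^bsub>Om\<^esub> s1 \<otimes>\<^bsub>Om\<^esub> s3 \<oplus>\<^bsub>Om\<^esub> s2 \<otimes>\<^bsub>Om\<^esub> s3"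
      have k: "k \<in> carrier Om" using s by (simp add: k_def)
      have q: "t \<otimes>\<^bsub>Om\<^esub> t \<oplus>\<^bsub>Om\<^esub> e = x \<ominus>\<^bsub>Om\<^esub> k"
        if "x \<ominus>\<^bsub>Om\<^esub> e = t \<otimes>\<^bsub>Om\<^esub> t \<oplus>\<^bsub>Om\<^esub> k" "e \<in> carrier Om" "t \<in> carrier Om" for t e
      proof -
        have "x \<ominus>\<^bsub>Om\<^esub> k = (x \<ominus>\<^bsub>Om\<^esub> e) \<oplus>\<^bsub>Om\<^esub> e \<ominus>\<^bsub>Om\<^esub> k" using xy k that(2) by algebra
        also have "\<dots> = t \<otimes>\<^bsub>Om\<^esub> t \<oplus>\<^bsub>Om\<^esub> e" unfolding that(1) using k that(2,3) by algebra
        finally show ?thesis by simp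
      qed
      have "x \<ominus>\<^bsub>Om\<^esub> emb e1 = s1 \<otimes>\<^bsub>Om\<^esub> s1 \<oplus>\<^bsub>Om\<^esub> k" "x \<ominus>\<^bsub>Om\<^esub> emb e2 = s2 \<otimes>\<^bsub>Om\<^esub> s2 \<oplus>\<^bsub>Om\<^esub> k"
        "x \<ominus>\<^bsub>Om\<^esub> emb e3 = s3 \<otimes>\<^bsub>Om\<^esub> s3 \<oplus>\<^bsub>Om\<^esub> k"
        unfolding xA sums[symmetric] k_def using s by algebra+
      then have q3: "s1 \<otimes>\<^bsub>Om\<^esub> s1 \<oplus>\<^bsub>Om\<^esub> emb e1 = x \<ominus>\<^bsub>Om\<^esub> k" "s2 \<otimes>\<^bsub>Om\<^esub> s2 \<oplus>\<^bsub>Om\<^esub> emb e2 = x \<ominus>\<^bsub>Om\<^esub> k"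
        "s3 \<otimes>\<^bsub>Om\<^esub> s3 \<oplus>\<^bsub>Om\<^esub> emb e3 = x \<ominus>\<^bsub>Om\<^esub> k" using q s by auto
      have dd: "d1 \<in> carrier F" "d2 \<in> carrier F" using sqrt_of_closed(2)[OF r1] sqrt_of_closed(2)[OF r2] .
      have "emb (d1 \<otimes>\<^bsub>F\<^esub> (z1 \<otimes>\<^bsub>F\<^esub> z1) \<oplus>\<^bsub>F\<^esub> e1) = emb (d2 \<otimes>\<^bsub>F\<^esub> (z2 \<otimes>\<^bsub>F\<^esub> z2) \<oplus>\<^bsub>F\<^esub> e2)"
        unfolding sq[OF r1 z1 B.e_closed(1)] sq[OF r2 z2 B.e_closed(2)] q3 ..
      moreover have "emb (d1 \<otimes>\<^bsub>F\<^esub> (z1 \<otimes>\<^bsub>F\<^esub> z1) \<oplus>\<^bsub>F\<^esub> e1) = emb (d1 \<otimes>\<^bsub>F\<^esub> d2 \<otimes>\<^bsub>F\<^esub> (z3 \<otimes>\<^bsub>F\<^esub> z3) \<oplus>\<^bsub>F\<^esub> e3)"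
        unfolding sq[OF r1 z1 B.e_closed(1)] sq[OF sqrt_of_mult[OF r1 r2] z3 B.e_closed(3)] q3 ..
      ultimately have "d1 \<otimes>\<^bsub>F\<^esub> (z1 \<otimes>\<^bsub>F\<^esub> z1) \<oplus>\<^bsub>F\<^esub> e1 = d2 \<otimes>\<^bsub>F\<^esub> (z2 \<otimes>\<^bsub>F\<^esub> z2) \<oplus>\<^bsub>F\<^esub> e2"
        "d1 \<otimes>\<^bsub>F\<^esub> (z1 \<otimes>\<^bsub>F\<^esub> z1) \<oplus>\<^bsub>F\<^esub> e1 = d1 \<otimes>\<^bsub>F\<^esub> d2 \<otimes>\<^bsub>F\<^esub> (z3 \<otimes>\<^bsub>F\<^esub> z3) \<oplus>\<^bsub>F\<^esub> e3"
        by (simp_all only: emb_eq_iff F.m_closed F.add.m_closed dd z1(1) z2(1) z3(1) B.e_closed)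
      then show ?thesis using z1(1) z2(1) z3(1) by blast
    qed
  qed
qed

end

context two_descent
begin

lemma half_perm2:
  assumes "s1 \<in> carrier Om" "s2 \<in> carrier Om" "s3 \<in> carrier Om" "W \<in> carrier Om"
  shows "S2.half W s2 s1 s3 = S.half W s1 s2 s3"
  unfolding S.half_def S2.half_def using assms by (simp add: O.m_ac O.a_ac)

lemma half_perm3:
  assumes "s1 \<in> carrier Om" "s2 \<in> carrier Om" "s3 \<in> carrier Om" "W \<in> carrier Om"
  shows "S3.half W s3 s1 s2 = S.half W s1 s2 s3"
  unfolding S.half_def S3.half_def using assms by (simp add: O.m_ac O.a_ac)

text \<open>\<open>P\<close> is the half of a point above the common value \<open>W\<close>, formed
  with \<open>s1 = z1 r1\<close>, \<open>s2 = z2 r2\<close>, \<open>s3 = z3 r1 r2\<close>. All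
  \<open>z_i\<close> must be nonzero, since \<open>half_translate\<close> needs this of whichever
  root keeps its sign.\<close>

theorem descent_sufficient:
  assumes r1: "sqrt_of r1 d1" and r2: "sqrt_of r2 d2"
    and z: "z1 \<in> carrier F" "z2 \<in> carrier F" "z3 \<in> carrier F" "z1 \<noteq> \<zero>\<^bsub>F\<^esub>" "z2 \<noteq> \<zero>\<^bsub>F\<^esub>" "z3 \<noteq> \<zero>\<^bsub>F\<^esub>"
    and eq2: "d1 \<otimes>\<^bsub>F\<^esub> (z1 \<otimes>\<^bsub>F\<^esub> z1) \<oplus>\<^bsub>F\<^esub> e1 = d2 \<otimes>\<^bsub>F\<^esub> (z2 \<otimes>\<^bsub>F\<^esub> z2) \<oplus>\<^bsub>F\<^esub> e2"
    and eq3: "d1 \<otimes>\<^bsub>F\<^esub> (z1 \<otimes>\<^bsub>F\<^esub> z1) \<oplus>\<^bsub>F\<^esub> e1 = d1 \<otimes>\<^bsub>F\<^esub> d2 \<otimes>\<^bsub>F\<^esub> (z3 \<otimes>\<^bsub>F\<^esub> z3) \<oplus>\<^bsub>F\<^esub> e3"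
  shows "\<exists>P\<in>carrier S.E. \<forall>\<tau>\<in>G. pt (\<tau> r1 = r1) (\<tau> r2 = r2) = map_point \<tau> P \<otimes>\<^bsub>S.E\<^esub> inv\<^bsub>S.E\<^esub> P"
proof -
  have dd: "d1 \<in> carrier F" "d2 \<in> carrier F" using sqrt_of_closed(2)[OF r1] sqrt_of_closed(2)[OF r2] .
  have rr: "r1 \<in> carrier Om" "r2 \<in> carrier Om" using sqrt_of_closed(1)[OF r1] sqrt_of_closed(1)[OF r2] .
  define W where "W = emb (d1 \<otimes>\<^bsub>F\<^esub> (z1 \<otimes>\<^bsub>F\<^esub> z1) \<oplus>\<^bsub>F\<^esub> e1)"
  have W: "W \<in> carrier Om" using z dd by (simp add: W_def)
  define s1 s2 s3 where "s1 = emb z1 \<otimes>\<^bsub>Om\<^esub> r1" and "s2 = emb z2 \<otimes>\<^bsub>Om\<^esub> r2" and "s3 = emb z3 \<otimes>\<^bsub>Om\<^esub> (r1 \<otimes>\<^bsub>Om\<^esub> r2)"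
  have s: "s1 \<in> carrier Om" "s2 \<in> carrier Om" "s3 \<in> carrier Om" using z rr by (simp_all add: s1_def s2_def s3_def)
  have nz: "u \<otimes>\<^bsub>Om\<^esub> v \<noteq> \<zero>\<^bsub>Om\<^esub>" if "u \<in> carrier Om" "v \<in> carrier Om" "u \<noteq> \<zero>\<^bsub>Om\<^esub>" "v \<noteq> \<zero>\<^bsub>Om\<^esub>" for u v
    using that O.integral by blast
  have s0: "s1 \<noteq> \<zero>\<^bsub>Om\<^esub>" "s2 \<noteq> \<zero>\<^bsub>Om\<^esub>" "s3 \<noteq> \<zero>\<^bsub>Om\<^esub>"
    unfolding s1_def s2_def s3_def
    using z rr sqrt_of_nz[OF r1] sqrt_of_nz[OF r2] nz by (simp_all add: emb_eq_zero_iff)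
  have sq: "emb (d \<otimes>\<^bsub>F\<^esub> (z \<otimes>\<^bsub>F\<^esub> z) \<oplus>\<^bsub>F\<^esub> e) \<ominus>\<^bsub>Om\<^esub> emb e = (emb z \<otimes>\<^bsub>Om\<^esub> r) \<otimes>\<^bsub>Om\<^esub> (emb z \<otimes>\<^bsub>Om\<^esub> r)"
    if rd: "sqrt_of r d" and "z \<in> carrier F" "e \<in> carrier F" for r d z e
  proof -
    note [simp] = sqrt_of_closed[OF rd]
    have a: "(a \<oplus>\<^bsub>Om\<^esub> b) \<ominus>\<^bsub>Om\<^esub> b = a" if "a \<in> carrier Om" "b \<in> carrier Om" for a b
      using that by algebra
    have "(emb z \<otimes>\<^bsub>Om\<^esub> r) \<otimes>\<^bsub>Om\<^esub> (emb z \<otimes>\<^bsub>Om\<^esub> r) = (r \<otimes>\<^bsub>Om\<^esub> r) \<otimes>\<^bsub>Om\<^esub> (emb z \<otimes>\<^bsub>Om\<^esub> emb z)" using that(2) by (simp add: O.m_ac)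
    moreover have "r \<otimes>\<^bsub>Om\<^esub> r = emb d" using rd by (simp add: sqrt_of_def)
    ultimately show ?thesis using that(2,3) a by simp
  qed
  have Ws: "W \<ominus>\<^bsub>Om\<^esub> emb e1 = s1 \<otimes>\<^bsub>Om\<^esub> s1" "W \<ominus>\<^bsub>Om\<^esub> emb e2 = s2 \<otimes>\<^bsub>Om\<^esub> s2" "W \<ominus>\<^bsub>Om\<^esub> emb e3 = s3 \<otimes>\<^bsub>Om\<^esub> s3"
    using sq[OF r1 z(1) B.e_closed(1)] sq[OF r2 z(2) B.e_closed(2)] sq[OF sqrt_of_mult[OF r1 r2] z(3) B.e_closed(3)] eq2 eq3
    unfolding W_def s1_def s2_def s3_def by simp_all
  define P where "P = S.half W s1 s2 s3"
  have P: "P \<in> carrier S.E" unfolding P_def by (rule S.half_on_curve[OF s W Ws])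
  have "pt (\<tau> r1 = r1) (\<tau> r2 = r2) = ec_add Om cc (map_point \<tau> P) (S.neg P)" if \<tau>: "\<tau> \<in> G" for \<tau>
  proof -
    interpret \<tau>: ring_hom_ring Om Om \<tau> by (rule gal_ring_hom[OF \<tau>])
    have "\<tau> W = W" unfolding W_def by (rule gal_fix[OF \<tau>]) (use z dd in simp)
    then have mp: "map_point \<tau> P = S.half W (\<tau> s1) (\<tau> s2) (\<tau> s3)" using s W by (simp add: P_def S.half_def)
    have ts: "\<tau> (emb z \<otimes>\<^bsub>Om\<^esub> r) = (if \<tau> r = r then emb z \<otimes>\<^bsub>Om\<^esub> r else \<ominus>\<^bsub>Om\<^esub> (emb z \<otimes>\<^bsub>Om\<^esub> r))"
      if rd: "sqrt_of r d" and zz: "z \<in> carrier F" for z r d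
    proof -
      have rc: "r \<in> carrier Om" by (rule sqrt_of_closed(1)[OF rd])
      have "\<tau> (emb z \<otimes>\<^bsub>Om\<^esub> r) = emb z \<otimes>\<^bsub>Om\<^esub> \<tau> r" using rc zz gal_fix[OF \<tau> zz] by simp
      moreover have "emb z \<otimes>\<^bsub>Om\<^esub> (\<ominus>\<^bsub>Om\<^esub> r) = \<ominus>\<^bsub>Om\<^esub> (emb z \<otimes>\<^bsub>Om\<^esub> r)"
        by (rule O.r_minus) (use rc zz in simp_all)
      ultimately show ?thesis using gal_sqrt(1)[OF rd \<tau>] by metis
    qed
    have t1: "\<tau> s1 = (if \<tau> r1 = r1 then s1 else \<ominus>\<^bsub>Om\<^esub> s1)" using ts[OF r1 z(1)] by (simp add: s1_def)
    have t2: "\<tau> s2 = (if \<tau> r2 = r2 then s2 else \<ominus>\<^bsub>Om\<^esub> s2)" using ts[OF r2 z(2)] by (simp add: s2_def)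
    have t3: "\<tau> s3 = (if \<tau> r1 = r1 \<longleftrightarrow> \<tau> r2 = r2 then s3 else \<ominus>\<^bsub>Om\<^esub> s3)"
      using ts[OF sqrt_of_mult[OF r1 r2] z(3)] gal_sqrt_mult[OF r1 r2 \<tau>] by (simp add: s3_def)
    have m: "\<ominus>\<^bsub>Om\<^esub> s1 \<in> carrier Om" "\<ominus>\<^bsub>Om\<^esub> s2 \<in> carrier Om" "\<ominus>\<^bsub>Om\<^esub> s3 \<in> carrier Om" using s by simp_all
    consider "\<tau> r1 = r1" "\<tau> r2 = r2" | "\<tau> r1 = r1" "\<tau> r2 \<noteq> r2" | "\<tau> r1 \<noteq> r1" "\<tau> r2 = r2" | "\<tau> r1 \<noteq> r1" "\<tau> r2 \<noteq> r2"
      by blast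
    then show ?thesis
    proof cases
      case 1
      then have "map_point \<tau> P = P" unfolding mp t1 t2 t3 unfolding P_def by simp
      then show ?thesis using 1 S.ec_add_eq_Infinity_iff[OF P S.neg_closed[OF P]] by (simp add: pt_def)
    next
      case 2
      then have "map_point \<tau> P = S.half W s1 (\<ominus>\<^bsub>Om\<^esub> s2) (\<ominus>\<^bsub>Om\<^esub> s3)" unfolding mp t1 t2 t3 by simp
      then show ?thesis using 2 S.half_translate[OF s W s0(1) Ws] by (simp add: pt_def P_def)
    next
      case 3
      then have "map_point \<tau> P = S2.half W s2 (\<ominus>\<^bsub>Om\<^esub> s1) (\<ominus>\<^bsub>Om\<^esub> s3)"
        unfolding mp t1 t2 t3 half_perm2[OF m(1) s(2) m(3) W] by simp
      then show ?thesis
        using 3 S2.half_translate[OF s(2,1,3) W s0(2) Ws(2,1,3)] half_perm2[OF s W] by (simp add: pt_def P_def)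
    next
      case 4
      then have "map_point \<tau> P = S3.half W s3 (\<ominus>\<^bsub>Om\<^esub> s1) (\<ominus>\<^bsub>Om\<^esub> s2)"
        unfolding mp t1 t2 t3 half_perm3[OF m(1,2) s(3) W] by simp
      then show ?thesis
        using 4 S3.half_translate[OF s(3,1,2) W s0(3) Ws(3,1,2)] half_perm3[OF s W] by (simp add: pt_def P_def)
    qed
  qed
  then show ?thesis using P S.inv_E[OF P] by (intro bexI[of _ P]) auto
qed

lemma descent_trivial:
  assumes "r1 \<in> KF" "r2 \<in> KF" "\<tau> \<in> G"
  shows "pt (\<tau> r1 = r1) (\<tau> r2 = r2) = map_point \<tau> Infinity \<otimes>\<^bsub>S.E\<^esub> inv\<^bsub>S.E\<^esub> Infinity"
proof -
  have "\<tau> r1 = r1" "\<tau> r2 = r2" using assms gal_fix by auto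
  then show ?thesis using S.inv_E[of Infinity] by (simp add: pt_def)
qed

section \<open>Cocycles with values in the rational two-torsion\<close>

abbreviation "T2M \<equiv> torsion 2 S.E"

lemma pt_E: "pt b1 b2 \<in> carrier S.E"
  by (auto simp: pt_def S.mem_E O.r_neg a_minus_def)

lemma slope_zero:
  assumes "a \<in> carrier Om" "b \<in> carrier Om" "a \<noteq> b"
  shows "(\<zero>\<^bsub>Om\<^esub> \<ominus>\<^bsub>Om\<^esub> \<zero>\<^bsub>Om\<^esub>) \<otimes>\<^bsub>Om\<^esub> inv\<^bsub>Om\<^esub> (b \<ominus>\<^bsub>Om\<^esub> a) = \<zero>\<^bsub>Om\<^esub>"
proof -
  have "b \<ominus>\<^bsub>Om\<^esub> a \<in> Units Om" using assms O.field_Units by (auto simp: O.r_right_minus_eq)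
  then show ?thesis by (simp add: O.r_neg a_minus_def)
qed

text \<open>The chord through two two-torsion points is the \<open>x\<close>-axis, of slope
  \<open>0\<close>; the third root then comes from \<open>c 2\<close>.\<close>

lemma add_torsion:
  assumes "a \<in> carrier Om" "b \<in> carrier Om" "d \<in> carrier Om" "a \<noteq> b" "cc 2 = \<ominus>\<^bsub>Om\<^esub> (a \<oplus>\<^bsub>Om\<^esub> b \<oplus>\<^bsub>Om\<^esub> d)"
  shows "ec_add Om cc (Affine a \<zero>\<^bsub>Om\<^esub>) (Affine b \<zero>\<^bsub>Om\<^esub>) = Affine d \<zero>\<^bsub>Om\<^esub>"
proof -
  have "\<zero>\<^bsub>Om\<^esub> [^]\<^bsub>Om\<^esub> (2::nat) = \<zero>\<^bsub>Om\<^esub>" by (simp add: numeral_2_eq_2)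
  moreover have "\<zero>\<^bsub>Om\<^esub> \<ominus>\<^bsub>Om\<^esub> (\<ominus>\<^bsub>Om\<^esub> (a \<oplus>\<^bsub>Om\<^esub> b \<oplus>\<^bsub>Om\<^esub> d)) \<ominus>\<^bsub>Om\<^esub> a \<ominus>\<^bsub>Om\<^esub> b = d"
    using assms(1-3) by algebra
  moreover have "\<zero>\<^bsub>Om\<^esub> \<otimes>\<^bsub>Om\<^esub> (a \<ominus>\<^bsub>Om\<^esub> d) \<ominus>\<^bsub>Om\<^esub> \<zero>\<^bsub>Om\<^esub> = \<zero>\<^bsub>Om\<^esub>" using assms by algebra
  ultimately show ?thesis using assms slope_zero[OF assms(1,2,4)] by (simp add: Let_def)
qed

lemma pt_add: "ec_add Om cc (pt a b) (pt a' b') = pt (a = a') (b = b')"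
proof -
  note c2 = S.c_eq(1)
  have p: "emb e1 \<oplus>\<^bsub>Om\<^esub> emb e2 \<oplus>\<^bsub>Om\<^esub> emb e3 = emb e2 \<oplus>\<^bsub>Om\<^esub> emb e1 \<oplus>\<^bsub>Om\<^esub> emb e3"
    "emb e1 \<oplus>\<^bsub>Om\<^esub> emb e2 \<oplus>\<^bsub>Om\<^esub> emb e3 = emb e1 \<oplus>\<^bsub>Om\<^esub> emb e3 \<oplus>\<^bsub>Om\<^esub> emb e2"
    "emb e1 \<oplus>\<^bsub>Om\<^esub> emb e2 \<oplus>\<^bsub>Om\<^esub> emb e3 = emb e3 \<oplus>\<^bsub>Om\<^esub> emb e1 \<oplus>\<^bsub>Om\<^esub> emb e2"
    "emb e1 \<oplus>\<^bsub>Om\<^esub> emb e2 \<oplus>\<^bsub>Om\<^esub> emb e3 = emb e2 \<oplus>\<^bsub>Om\<^esub> emb e3 \<oplus>\<^bsub>Om\<^esub> emb e1"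
    "emb e1 \<oplus>\<^bsub>Om\<^esub> emb e2 \<oplus>\<^bsub>Om\<^esub> emb e3 = emb e3 \<oplus>\<^bsub>Om\<^esub> emb e2 \<oplus>\<^bsub>Om\<^esub> emb e1"
    using S.e_closed by (simp_all add: O.a_ac del: emb.hom_add)
  note e = S.e_closed and ne = S.e_distinct S.e_distinct[symmetric]
  show ?thesis
    using add_torsion[OF e(1,2,3) ne(1) c2] add_torsion[OF e(2,1,3) ne(4) c2[unfolded p(1)]]
      add_torsion[OF e(1,3,2) ne(2) c2[unfolded p(2)]] add_torsion[OF e(3,1,2) ne(5) c2[unfolded p(3)]]
      add_torsion[OF e(2,3,1) ne(3) c2[unfolded p(4)]] add_torsion[OF e(3,2,1) ne(6) c2[unfolded p(5)]]
    by (cases a; cases b; cases a'; cases b') (simp_all add: pt_def)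
qed

lemma carrier_T2M: "P \<in> carrier T2M \<longleftrightarrow> (\<exists>a b. P = pt a b)"
proof -
  have "P [^]\<^bsub>S.E\<^esub> (2::nat) = ec_add Om cc P P" by (cases P) (simp_all add: numeral_2_eq_2)
  then have *: "P \<in> carrier T2M \<longleftrightarrow> P \<in> carrier S.E \<and> ec_add Om cc P P = Infinity"
    by (simp add: torsion_def)
  show ?thesis
  proof
    assume "P \<in> carrier T2M"
    then have P: "P \<in> carrier S.E" "P = S.neg P" using * S.ec_add_eq_Infinity_iff[of P P] by auto
    show "\<exists>a b. P = pt a b"
    proof (cases P)
      case Infinity
      then show ?thesis by (metis pt_def)
    next
      case (Affine x y)
      then have "y = \<zero>\<^bsub>Om\<^esub>" using P S.self_neg[of y] by (auto simp: S.mem_E)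
      then show ?thesis using two_torsion_x[of x] P Affine by (metis pt_def)
    qed
  next
    assume "\<exists>a b. P = pt a b"
    then show "P \<in> carrier T2M" using * pt_E pt_add by (auto simp: pt_def)
  qed
qed

lemma T2M_simps [simp]: "P \<otimes>\<^bsub>T2M\<^esub> Q = ec_add Om cc P Q" "\<one>\<^bsub>T2M\<^esub> = Infinity"
  by (simp_all add: torsion_def)

lemma inv_T2M: "inv\<^bsub>T2M\<^esub> (pt a b) = pt a b"
  unfolding m_inv_def
proof (rule the_equality)
  show "pt a b \<in> carrier T2M \<and> pt a b \<otimes>\<^bsub>T2M\<^esub> pt a b = \<one>\<^bsub>T2M\<^esub> \<and> pt a b \<otimes>\<^bsub>T2M\<^esub> pt a b = \<one>\<^bsub>T2M\<^esub>"
    using carrier_T2M pt_add[of a b a b] by (auto simp: pt_def)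
  fix y assume y: "y \<in> carrier T2M \<and> pt a b \<otimes>\<^bsub>T2M\<^esub> y = \<one>\<^bsub>T2M\<^esub> \<and> y \<otimes>\<^bsub>T2M\<^esub> pt a b = \<one>\<^bsub>T2M\<^esub>"
  then have "\<exists>a' b'. y = pt a' b'" using carrier_T2M[of y] by blast
  then obtain a' b' where y': "y = pt a' b'" by blast
  have "ec_add Om cc (pt a b) y = Infinity" using y by (simp only: T2M_simps)
  then have "a = a' \<and> b = b'" unfolding y' pt_add pt_Infinity .
  then show "y = pt a b" by (simp only: y')
qed

lemma gal_pt: "\<sigma> \<in> G \<Longrightarrow> map_point \<sigma> (pt a b) = pt a b"
proof -
  assume \<sigma>: "\<sigma> \<in> G"
  interpret \<sigma>: ring_hom_ring Om Om \<sigma> by (rule gal_ring_hom[OF \<sigma>])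
  show ?thesis by (auto simp: pt_def gal_fix[OF \<sigma>])
qed

definition trivial_cocycle :: "('a clos \<Rightarrow> 'a clos) \<Rightarrow> 'a clos point"
  where "trivial_cocycle = (\<lambda>\<sigma>\<in>G. Infinity)"

text \<open>All two-torsion is rational, so every difference \<open>\<sigma> P - P\<close> is
  zero.\<close>

lemma coboundaries_T2M: "coboundaries F T2M map_point = {trivial_cocycle}"
proof -
  have *: "(\<lambda>\<sigma>\<in>G. map_point \<sigma> (pt a b) \<otimes>\<^bsub>T2M\<^esub> inv\<^bsub>T2M\<^esub> (pt a b)) = trivial_cocycle" for a b
    unfolding trivial_cocycle_def
    by (rule restrict_ext) (auto simp: gal_pt inv_T2M pt_add, simp add: pt_def)
  have cT: "pt True True \<in> carrier T2M" using carrier_T2M by blast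
  show ?thesis
  proof (rule equalityI)
    show "coboundaries F T2M map_point \<subseteq> {trivial_cocycle}"
    proof
      fix \<xi> assume "\<xi> \<in> coboundaries F T2M map_point"
      then obtain P where P: "P \<in> carrier T2M" "\<xi> = (\<lambda>\<sigma>\<in>G. map_point \<sigma> P \<otimes>\<^bsub>T2M\<^esub> inv\<^bsub>T2M\<^esub> P)"
        unfolding coboundaries_def by blast
      then obtain a b where "P = pt a b" using carrier_T2M[of P] by blast
      then show "\<xi> \<in> {trivial_cocycle}" using P(2) *[of a b] by simp
    qed
    show "{trivial_cocycle} \<subseteq> coboundaries F T2M map_point"
      unfolding coboundaries_def using cT *[of True True]
      by (intro subsetI CollectI exI[of _ "pt True True"] conjI) (simp_all only: singleton_iff)
  qed
qed

abbreviation "Z1 \<equiv> carrier (cocycles F T2M map_point)"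

text \<open>Cosets of a trivial group of coboundaries are singletons, so that cohomology classes can
  be counted as cocycles.\<close>

lemma H1_T2M: "carrier (H1 F T2M map_point) = (\<lambda>\<xi>. {\<xi>}) ` Z1"
proof -
  have "coboundaries F T2M map_point #>\<^bsub>cocycles F T2M map_point\<^esub> \<xi> = {\<xi>}" if "\<xi> \<in> Z1" for \<xi>
  proof -
    have ext: "\<xi> \<in> extensional G" using that by (auto simp: cocycles_def PiE_def)
    have "(\<lambda>\<sigma>\<in>G. ec_add Om cc (trivial_cocycle \<sigma>) (\<xi> \<sigma>)) = \<xi>"
      by (rule extensionalityI[OF _ ext]) (auto simp: trivial_cocycle_def)
    then show ?thesis unfolding coboundaries_T2M r_coset_def by (simp add: cocycles_def)
  qed
  then show ?thesis unfolding H1_def FactGroup_def RCOSETS_def by auto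
qed

definition kummer_cocycle :: "'a clos \<Rightarrow> 'a clos \<Rightarrow> ('a clos \<Rightarrow> 'a clos) \<Rightarrow> 'a clos point"
  where "kummer_cocycle r1 r2 = (\<lambda>\<sigma>\<in>G. pt (\<sigma> r1 = r1) (\<sigma> r2 = r2))"

lemma gal_sqrt_comp:
  assumes "sqrt_of r d" "\<sigma> \<in> G" "\<tau> \<in> G"
  shows "(\<sigma> \<otimes>\<^bsub>abs_gal F\<^esub> \<tau>) r = r \<longleftrightarrow> (\<sigma> r = r \<longleftrightarrow> \<tau> r = r)"
proof -
  have r: "r \<in> carrier Om" by (rule sqrt_of_closed(1)[OF assms(1)])
  interpret \<sigma>: ring_hom_ring Om Om \<sigma> by (rule gal_ring_hom[OF assms(2)])
  have m: "(\<sigma> \<otimes>\<^bsub>abs_gal F\<^esub> \<tau>) r = \<sigma> (\<tau> r)" by (rule gal_mult_apply[OF assms(2,3) r])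
  have n: "\<sigma> (\<ominus>\<^bsub>Om\<^esub> r) = \<ominus>\<^bsub>Om\<^esub> \<sigma> r" using r by simp
  have mm: "\<ominus>\<^bsub>Om\<^esub> (\<ominus>\<^bsub>Om\<^esub> r) = r" using r by simp
  show ?thesis
    unfolding m using gal_sqrt[OF assms(1,2)] gal_sqrt(1)[OF assms(1,3)] n mm by metis
qed

lemma kummer_cocycle_Z1:
  assumes "sqrt_of r1 d1" "sqrt_of r2 d2"
  shows "kummer_cocycle r1 r2 \<in> Z1"
proof -
  have rr: "r1 \<in> carrier Om" "r2 \<in> carrier Om" using sqrt_of_closed(1)[OF assms(1)] sqrt_of_closed(1)[OF assms(2)] .
  have "continuous_cochain F (kummer_cocycle r1 r2)"
    unfolding continuous_cochain_def
    by (intro ballI exI[of _ "{r1, r2}"]) (use rr in \<open>auto simp: kummer_cocycle_def\<close>)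
  moreover have "kummer_cocycle r1 r2 (\<sigma> \<otimes>\<^bsub>abs_gal F\<^esub> \<tau>) =
      ec_add Om cc (kummer_cocycle r1 r2 \<sigma>) (map_point \<sigma> (kummer_cocycle r1 r2 \<tau>))"
    if "\<sigma> \<in> G" "\<tau> \<in> G" for \<sigma> \<tau>
    using that gal_mult_closed[OF that] gal_sqrt_comp[OF assms(1) that] gal_sqrt_comp[OF assms(2) that]
    by (simp add: kummer_cocycle_def gal_pt pt_add)
  moreover have "kummer_cocycle r1 r2 \<in> G \<rightarrow>\<^sub>E carrier T2M"
    unfolding kummer_cocycle_def by (rule restrict_PiE_iff[THEN iffD2]) (use carrier_T2M in blast)
  ultimately show ?thesis by (simp add: cocycles_def)
qed

text \<open>With trivial action a cocycle is a homomorphism, here a pair of quadratic characters.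
  Continuity at the identity supplies the finite set that \<open>kummer\<close> asks for.\<close>

theorem Z1_kummer:
  assumes "\<xi> \<in> Z1"
  obtains r1 d1 r2 d2 where "sqrt_of r1 d1" "sqrt_of r2 d2" "\<xi> = kummer_cocycle r1 r2"
proof -
  have \<xi>: "\<xi> \<in> G \<rightarrow>\<^sub>E carrier T2M" "continuous_cochain F \<xi>"
    "\<And>\<sigma> \<tau>. \<sigma> \<in> G \<Longrightarrow> \<tau> \<in> G \<Longrightarrow> \<xi> (\<sigma> \<otimes>\<^bsub>abs_gal F\<^esub> \<tau>) = ec_add Om cc (\<xi> \<sigma>) (map_point \<sigma> (\<xi> \<tau>))"
    using assms by (auto simp: cocycles_def)
  have "\<exists>a b. \<xi> \<sigma> = pt a b" if "\<sigma> \<in> G" for \<sigma>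
    using PiE_mem[OF \<xi>(1) that] carrier_T2M[of "\<xi> \<sigma>"] by blast
  then obtain \<chi>1 \<chi>2 where \<chi>: "\<And>\<sigma>. \<sigma> \<in> G \<Longrightarrow> \<xi> \<sigma> = pt (\<chi>1 \<sigma>) (\<chi>2 \<sigma>)" by metis
  have h: "\<chi>1 (\<sigma> \<otimes>\<^bsub>abs_gal F\<^esub> \<tau>) = (\<chi>1 \<sigma> = \<chi>1 \<tau>) \<and> \<chi>2 (\<sigma> \<otimes>\<^bsub>abs_gal F\<^esub> \<tau>) = (\<chi>2 \<sigma> = \<chi>2 \<tau>)"
    if "\<sigma> \<in> G" "\<tau> \<in> G" for \<sigma> \<tau>
    using \<xi>(3)[OF that] \<chi>[OF that(1)] \<chi>[OF that(2)] \<chi>[OF gal_mult_closed[OF that]]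
    by (simp add: gal_pt[OF that(1)] pt_add pt_inj)
  define i where "i = (\<lambda>x\<in>carrier Om. x)"
  have i: "i \<in> G" unfolding i_def by (rule gal_id)
  have "i \<otimes>\<^bsub>abs_gal F\<^esub> i = i" by (rule gal_eqI[OF gal_mult_closed[OF i i] i]) (simp add: gal_mult_apply i, simp add: i_def)
  then have i1: "\<chi>1 i" "\<chi>2 i" using h[OF i i] by auto
  obtain S where S: "finite S" "S \<subseteq> carrier Om" "\<And>\<tau>. \<tau> \<in> G \<Longrightarrow> \<forall>x\<in>S. \<tau> x = i x \<Longrightarrow> \<xi> \<tau> = \<xi> i"
    using \<xi>(2) i unfolding continuous_cochain_def by meson
  have triv: "\<chi>1 \<tau> \<and> \<chi>2 \<tau>" if t: "\<tau> \<in> G" and st: "\<And>x. x \<in> S \<Longrightarrow> \<tau> x = x" for \<tau>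
  proof -
    have "\<forall>x\<in>S. \<tau> x = i x" using st S(2) by (auto simp: i_def)
    then have "pt (\<chi>1 \<tau>) (\<chi>2 \<tau>) = pt True True" using S(3)[OF t] \<chi>[OF t] \<chi>[OF i] i1 by simp
    then show ?thesis by (simp add: pt_inj)
  qed
  obtain r1 d1 where r1: "r1 \<in> carrier Om" "r1 \<noteq> \<zero>\<^bsub>Om\<^esub>" "d1 \<in> carrier F" "d1 \<noteq> \<zero>\<^bsub>F\<^esub>" "r1 \<otimes>\<^bsub>Om\<^esub> r1 = emb d1"
    "\<And>\<sigma>. \<sigma> \<in> G \<Longrightarrow> \<sigma> r1 = (if \<chi>1 \<sigma> then r1 else \<ominus>\<^bsub>Om\<^esub> r1)"
    by (rule kummer[of \<chi>1 S]) (use h S triv in blast)+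
  obtain r2 d2 where r2: "r2 \<in> carrier Om" "r2 \<noteq> \<zero>\<^bsub>Om\<^esub>" "d2 \<in> carrier F" "d2 \<noteq> \<zero>\<^bsub>F\<^esub>" "r2 \<otimes>\<^bsub>Om\<^esub> r2 = emb d2"
    "\<And>\<sigma>. \<sigma> \<in> G \<Longrightarrow> \<sigma> r2 = (if \<chi>2 \<sigma> then r2 else \<ominus>\<^bsub>Om\<^esub> r2)"
    by (rule kummer[of \<chi>2 S]) (use h S triv in blast)+
  have s: "sqrt_of r1 d1" "sqrt_of r2 d2" using r1 r2 unfolding sqrt_of_def by blast+
  have "\<xi> = kummer_cocycle r1 r2"
  proof (rule extensionalityI)
    show "\<xi> \<in> extensional G" using \<xi>(1) by (auto simp: PiE_def)
    show "kummer_cocycle r1 r2 \<in> extensional G" by (simp add: kummer_cocycle_def)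
    fix \<sigma> assume \<sigma>: "\<sigma> \<in> G"
    have "\<sigma> r1 = r1 \<longleftrightarrow> \<chi>1 \<sigma>" "\<sigma> r2 = r2 \<longleftrightarrow> \<chi>2 \<sigma>"
      using r1(6)[OF \<sigma>] r2(6)[OF \<sigma>] gal_sqrt(2)[OF s(1) \<sigma>] gal_sqrt(2)[OF s(2) \<sigma>] by auto
    then show "\<xi> \<sigma> = kummer_cocycle r1 r2 \<sigma>" using \<chi>[OF \<sigma>] \<sigma> by (simp add: kummer_cocycle_def)
  qed
  then show ?thesis using s that by blast
qed

text \<open>The product \<open>r r'\<close> is fixed by every automorphism exactly if it lies in the
  base field. Equality modulo squares is expressed by \<open>d d'\<close> being a square, which for
  nonzero elements is equivalent and avoids a quotient group.\<close>

lemma same_stabiliser_iff: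
  assumes "sqrt_of r d" "sqrt_of r' d'"
  shows "(\<forall>\<sigma>\<in>G. \<sigma> r = r \<longleftrightarrow> \<sigma> r' = r') \<longleftrightarrow> (\<exists>q\<in>carrier F. d \<otimes>\<^bsub>F\<^esub> d' = q \<otimes>\<^bsub>F\<^esub> q)"
proof -
  note rr = sqrt_of_mult[OF assms]
  note cl = sqrt_of_closed(1)[OF rr] sqrt_of_closed(2)[OF rr]
  have sq: "r \<otimes>\<^bsub>Om\<^esub> r' \<otimes>\<^bsub>Om\<^esub> (r \<otimes>\<^bsub>Om\<^esub> r') = emb (d \<otimes>\<^bsub>F\<^esub> d')" using rr unfolding sqrt_of_def by blast
  have "(\<forall>\<sigma>\<in>G. \<sigma> r = r \<longleftrightarrow> \<sigma> r' = r') \<longleftrightarrow> (\<forall>\<sigma>\<in>G. \<sigma> (r \<otimes>\<^bsub>Om\<^esub> r') = r \<otimes>\<^bsub>Om\<^esub> r')"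
    using gal_sqrt_mult[OF assms] by blast
  also have "\<dots> \<longleftrightarrow> r \<otimes>\<^bsub>Om\<^esub> r' \<in> KF" using fixed_field[OF cl(1)] gal_fix by auto
  also have "\<dots> \<longleftrightarrow> (\<exists>q\<in>carrier F. d \<otimes>\<^bsub>F\<^esub> d' = q \<otimes>\<^bsub>F\<^esub> q)"
  proof
    assume "r \<otimes>\<^bsub>Om\<^esub> r' \<in> KF"
    then obtain q where q: "q \<in> carrier F" "r \<otimes>\<^bsub>Om\<^esub> r' = emb q" by auto
    then have "emb (q \<otimes>\<^bsub>F\<^esub> q) = emb (d \<otimes>\<^bsub>F\<^esub> d')" using sq by simp
    then have "q \<otimes>\<^bsub>F\<^esub> q = d \<otimes>\<^bsub>F\<^esub> d'" by (simp only: emb_eq_iff F.m_closed q(1) cl(2))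
    then show "\<exists>q\<in>carrier F. d \<otimes>\<^bsub>F\<^esub> d' = q \<otimes>\<^bsub>F\<^esub> q" using q(1) by (metis (no_types))
  next
    assume "\<exists>q\<in>carrier F. d \<otimes>\<^bsub>F\<^esub> d' = q \<otimes>\<^bsub>F\<^esub> q"
    then obtain q where q: "q \<in> carrier F" "d \<otimes>\<^bsub>F\<^esub> d' = q \<otimes>\<^bsub>F\<^esub> q" by auto
    then have "r \<otimes>\<^bsub>Om\<^esub> r' \<otimes>\<^bsub>Om\<^esub> (r \<otimes>\<^bsub>Om\<^esub> r') = emb q \<otimes>\<^bsub>Om\<^esub> emb q" using sq by simp
    then have "r \<otimes>\<^bsub>Om\<^esub> r' = emb q \<or> r \<otimes>\<^bsub>Om\<^esub> r' = emb (\<ominus>\<^bsub>F\<^esub> q)"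
      using S.sq_eq_iff[OF cl(1) emb_closed[OF q(1)]] q(1) by simp
    moreover have "\<ominus>\<^bsub>F\<^esub> q \<in> carrier F" using q(1) by simp
    ultimately show "r \<otimes>\<^bsub>Om\<^esub> r' \<in> KF" using q(1) by (metis (no_types) imageI)
  qed
  finally show ?thesis .
qed

lemma kummer_cocycle_eq_iff:
  assumes "sqrt_of r1 d1" "sqrt_of r2 d2" "sqrt_of r1' d1'" "sqrt_of r2' d2'"
  shows "kummer_cocycle r1 r2 = kummer_cocycle r1' r2' \<longleftrightarrow>
    (\<exists>q\<in>carrier F. d1 \<otimes>\<^bsub>F\<^esub> d1' = q \<otimes>\<^bsub>F\<^esub> q) \<and> (\<exists>q\<in>carrier F. d2 \<otimes>\<^bsub>F\<^esub> d2' = q \<otimes>\<^bsub>F\<^esub> q)"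
proof -
  have "kummer_cocycle r1 r2 = kummer_cocycle r1' r2' \<longleftrightarrow>
    (\<forall>\<sigma>\<in>G. pt (\<sigma> r1 = r1) (\<sigma> r2 = r2) = pt (\<sigma> r1' = r1') (\<sigma> r2' = r2'))"
    unfolding kummer_cocycle_def by (auto simp: fun_eq_iff restrict_def)
  then show ?thesis
    using same_stabiliser_iff[OF assms(1,3)] same_stabiliser_iff[OF assms(2,4)] by (auto simp: pt_inj)
qed

end

section \<open>The places of the rationals\<close>

text \<open>At \<open>0\<close> the value is \<open>0\<close> and not infinity; hence the nonzero
  hypotheses below and the separate clause in \<open>small\<close>.\<close>

definition pval :: "nat \<Rightarrow> rat \<Rightarrow> int"
  where "pval p x = int (multiplicity (int p) (fst (quotient_of x))) - int (multiplicity (int p) (snd (quotient_of x)))"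

lemma padic_abs_pval: "padic_abs p x = (if x = 0 then 0 else real p powi (- pval p x))"
  by (simp add: padic_abs_def pval_def)

context
  fixes p :: nat
  assumes p: "Factorial_Ring.prime p"
begin

lemma prime_elem_int: "prime_elem (int p)"
  using p by (simp add: prime_int_nat_transfer)

lemma pval_divide:
  assumes "a \<noteq> 0" "b \<noteq> 0"
  shows "pval p (of_int a / of_int b) = int (multiplicity (int p) a) - int (multiplicity (int p) b)"
proof -
  obtain n d where q: "quotient_of (of_int a / of_int b) = (n, d)" by (cases "quotient_of (of_int a / of_int b)")
  have d: "d > 0" using quotient_of_denom_pos[OF q] .
  have "of_int a / of_int b = (of_int n / of_int d :: rat)" using quotient_of_div[OF q] .
  then have "(of_int (a * d) :: rat) = of_int (n * b)" using d assms by (simp add: field_simps)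
  then have eq: "a * d = n * b" by (simp only: of_int_eq_iff)
  have n0: "n \<noteq> 0" using eq assms d by auto
  have "multiplicity (int p) a + multiplicity (int p) d = multiplicity (int p) n + multiplicity (int p) b"
    using arg_cong[OF eq, of "multiplicity (int p)"] assms d n0
    by (simp add: prime_elem_multiplicity_mult_distrib[OF prime_elem_int])
  then show ?thesis using q by (simp add: pval_def)
qed

lemma pval_of_int: "a \<noteq> 0 \<Longrightarrow> pval p (of_int a) = int (multiplicity (int p) a)"
  using pval_divide[of a 1] by simp

lemma rat_fraction: obtains a b where "(x :: rat) = of_int a / of_int b" "(b :: int) \<noteq> 0" "x \<noteq> 0 \<Longrightarrow> a \<noteq> 0"
proof (cases x)
  case (Fract a b)
  then show ?thesis using that[of a b] by (auto simp: Fract_of_int_quotient)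
qed

lemma pval_mult:
  assumes "x \<noteq> 0" "y \<noteq> 0" shows "pval p (x * y) = pval p x + pval p y"
proof -
  obtain a b where x: "x = of_int a / of_int b" "b \<noteq> 0" "a \<noteq> 0" using rat_fraction[of x] assms by metis
  obtain c d where y: "y = of_int c / of_int d" "d \<noteq> 0" "c \<noteq> 0" using rat_fraction[of y] assms by metis
  have "x * y = of_int (a * c) / of_int (b * d)" using x y by simp
  then show ?thesis
    using x y pval_divide[of "a * c" "b * d"] pval_divide[of a b] pval_divide[of c d]
    by (simp add: prime_elem_multiplicity_mult_distrib[OF prime_elem_int])
qed

lemma pval_one [simp]: "pval p 1 = 0"
  using pval_of_int[of 1] by simp

lemma pval_minus [simp]: "pval p (- x) = pval p x"
proof (cases "x = 0")
  case False
  have "pval p (-1) = 0" using pval_of_int[of "-1"] by simp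
  then show ?thesis using pval_mult[of "-1" x] False by simp
qed simp

lemma pval_inverse: "x \<noteq> 0 \<Longrightarrow> pval p (inverse x) = - pval p x"
  using pval_mult[of x "inverse x"] by simp

lemma pval_div: "x \<noteq> 0 \<Longrightarrow> y \<noteq> 0 \<Longrightarrow> pval p (x / y) = pval p x - pval p y"
  using pval_mult[of x "inverse y"] pval_inverse[of y] by (simp add: divide_inverse)

lemma pval_power: "x \<noteq> 0 \<Longrightarrow> pval p (x ^ n) = int n * pval p x"
  by (induction n) (auto simp: pval_mult algebra_simps)

lemma pval_p [simp]: "pval p (of_nat p) = 1"
  using pval_of_int[of "int p"] p by (simp add: multiplicity_prime)

lemma pval_ge_iff:
  assumes "x \<noteq> 0"
  shows "pval p x \<ge> int k \<longleftrightarrow> (\<exists>a b. x = of_nat p ^ k * of_int a / of_int b \<and> \<not> int p dvd b)"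
proof
  assume k: "pval p x \<ge> int k"
  obtain n d where q: "quotient_of x = (n, d)" by (cases "quotient_of x")
  have xd: "x = of_int n / of_int d" and cop: "coprime n d" and d: "d > 0"
    using quotient_of_div[OF q] quotient_of_coprime[OF q] quotient_of_denom_pos[OF q] .
  have n0: "n \<noteq> 0" using xd assms by auto
  show "\<exists>a b. x = of_nat p ^ k * of_int a / of_int b \<and> \<not> int p dvd b"
  proof (cases "k = 0")
    case True
    obtain t where "n = int p ^ multiplicity (int p) n * t" using multiplicity_dvd by blast
    show ?thesis
    proof (cases "int p dvd d")
      case False
      then have "x = of_nat p ^ k * of_int n / of_int d \<and> \<not> int p dvd d" using xd True by simp
      then show ?thesis by blast
    next
      case dvd: True
      then have "\<not> int p dvd n" using cop prime_elem_int by (metis coprime_common_divisor prime_elem_not_unit)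
      then have "multiplicity (int p) n = 0" "multiplicity (int p) d > 0"
        using dvd d prime_elem_int by (auto simp: not_dvd_imp_multiplicity_0 prime_multiplicity_gt_zero_iff multiplicity_gt_zero_iff)
      then show ?thesis using k q True by (simp add: pval_def)
    qed
  next
    case False
    have "multiplicity (int p) n \<ge> k" using k q by (simp add: pval_def)
    then have "int p ^ k dvd n" using n0 by (metis multiplicity_dvd')
    then obtain a where a: "n = int p ^ k * a" by auto
    then have "int p dvd n" using False by (simp add: dvd_power)
    then have "\<not> int p dvd d" using cop prime_elem_int by (metis coprime_common_divisor prime_elem_not_unit)
    then have "x = of_nat p ^ k * of_int a / of_int d \<and> \<not> int p dvd d" using xd a by simp
    then show ?thesis by blast
  qed
next
  assume "\<exists>a b. x = of_nat p ^ k * of_int a / of_int b \<and> \<not> int p dvd b"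
  then obtain a b where x: "x = of_nat p ^ k * of_int a / of_int b" and b: "\<not> int p dvd b" by blast
  have "a \<noteq> 0" "b \<noteq> 0" using x assms b by auto
  moreover have "p \<noteq> 0" using p by auto
  moreover have "x = of_nat p ^ k * (of_int a / of_int b)" using x by simp
  ultimately have "pval p x = int k + pval p (of_int a / of_int b)"
    by (simp add: pval_mult pval_power del: times_divide_eq_right)
  then show "pval p x \<ge> int k"
    using pval_divide[of a b] \<open>a \<noteq> 0\<close> \<open>b \<noteq> 0\<close> b by (simp add: not_dvd_imp_multiplicity_0)
qed

lemma pval_scale: "x \<noteq> 0 \<Longrightarrow> pval p (of_nat p ^ n * x) = int n + pval p x"
  using p by (subst pval_mult) (auto simp: pval_power)

text \<open>Multiplication by a power of \<open>p\<close> makes the bound a natural number, where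
  \<open>pval_ge_iff\<close> reduces the claim to adding fractions with denominators prime to
  \<open>p\<close>.\<close>

lemma pval_add:
  assumes "x \<noteq> 0" "y \<noteq> 0" "x + y \<noteq> 0" "pval p x \<ge> k" "pval p y \<ge> k"
  shows "pval p (x + y) \<ge> k"
proof -
  obtain n where n: "int n + k \<ge> 0" by (rule that[of "nat (- k)"]) simp
  define j where "j = nat (int n + k)"
  have j: "int j = int n + k" using n by (simp add: j_def)
  have p0: "(of_nat p :: rat) ^ n \<noteq> 0" using p by auto
  define U V where "U = of_nat p ^ n * x" and "V = of_nat p ^ n * y"
  have UV: "U \<noteq> 0" "V \<noteq> 0" "U + V \<noteq> 0" using assms p0 by (auto simp: U_def V_def distrib_left[symmetric])
  have "pval p U \<ge> int j" "pval p V \<ge> int j" using assms j by (simp_all add: U_def V_def pval_scale)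
  then obtain a b c d where U: "U = of_nat p ^ j * of_int a / of_int b" "\<not> int p dvd b"
    and V: "V = of_nat p ^ j * of_int c / of_int d" "\<not> int p dvd d"
    using pval_ge_iff[OF UV(1), of j] pval_ge_iff[OF UV(2), of j] by blast
  have "b \<noteq> 0" "d \<noteq> 0" using U V by auto
  then have "U + V = of_nat p ^ j * of_int (a * d + c * b) / of_int (b * d)"
    using U V by (simp add: field_simps)
  moreover have "\<not> int p dvd b * d" using U V prime_elem_int by (simp add: prime_elem_dvd_mult_iff)
  ultimately have "pval p (U + V) \<ge> int j" using pval_ge_iff[OF UV(3), of j] by blast
  moreover have "U + V = of_nat p ^ n * (x + y)" by (simp add: U_def V_def distrib_left)
  ultimately show ?thesis using assms j by (simp add: pval_scale)
qed

lemma pval_add_eq: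
  assumes "x \<noteq> 0" "y = 0 \<or> pval p y > pval p x"
  shows "x + y \<noteq> 0" "pval p (x + y) = pval p x"
proof -
  show *: "x + y \<noteq> 0"
  proof
    assume "x + y = 0"
    then have "y = - x" by (simp add: eq_neg_iff_add_eq_0 add.commute)
    then show False using assms by auto
  qed
  show "pval p (x + y) = pval p x"
  proof (cases "y = 0")
    case False
    then have y: "pval p y > pval p x" using assms by auto
    have 1: "pval p (x + y) \<ge> pval p x" by (rule pval_add) (use assms False * y in auto)
    show ?thesis
    proof (rule ccontr)
      assume "\<not> ?thesis"
      then have "pval p (x + y) \<ge> pval p x + 1" using 1 by simp
      then have c: "pval p ((x + y) + (- y)) \<ge> pval p x + 1"
        by (intro pval_add[of "x + y" "- y"]) (use assms False * y in auto)
      have "(x + y) + (- y) = x" by simp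
      from c[unfolded this] show False by simp
    qed
  qed simp
qed

lemma padic_abs_value: "abs_value (padic_abs p)"
proof
  have p1: "real p > 1" using p prime_gt_1_nat by (metis of_nat_1 of_nat_less_iff)
  show "padic_abs p (x * y) = padic_abs p x * padic_abs p y" for x y
    using p1 by (auto simp: padic_abs_pval pval_mult power_int_add[symmetric])
  show nn: "padic_abs p x \<ge> 0" for x using p1 by (simp add: padic_abs_pval)
  show "padic_abs p x = 0 \<longleftrightarrow> x = 0" for x using p1 by (simp add: padic_abs_pval)
  show "padic_abs p (x + y) \<le> padic_abs p x + padic_abs p y" for x y
  proof (cases "x = 0 \<or> y = 0 \<or> x + y = 0")
    case True then show ?thesis using nn[of x] nn[of y] by (auto simp: padic_abs_pval)
  next
    case False
    have le: "padic_abs p u \<le> padic_abs p w" if "u \<noteq> 0" "w \<noteq> 0" "pval p w \<le> pval p u" for u w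
      using that p1 by (simp add: padic_abs_pval power_int_increasing)
    show ?thesis
    proof (cases "pval p x \<le> pval p y")
      case True
      then have "padic_abs p (x + y) \<le> padic_abs p x" using False by (intro le pval_add) auto
      then show ?thesis using nn[of y] by simp
    next
      case f: False
      then have "padic_abs p (x + y) \<le> padic_abs p y" using False by (intro le pval_add) auto
      then show ?thesis using nn[of x] by simp
    qed
  qed
qed

end

lemma real_abs_value: "abs_value (\<lambda>x. real_of_rat \<bar>x\<bar>)"
  by unfold_locales (auto simp: abs_mult of_rat_mult of_rat_less_eq simp flip: of_rat_add)

lemma places_abs_value: "v \<in> places \<Longrightarrow> abs_value v"
  using real_abs_value padic_abs_value by (auto simp: places_def)

section \<open>Localisation of Kummer cocycles\<close>

lemma split_cubic_hom:
  assumes "split_cubic F e1 e2 e3 c" "field F'" "h \<in> ring_hom F F'"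
  shows "split_cubic F' (h e1) (h e2) (h e3) (\<lambda>i. h (c i))"
proof -
  interpret B: split_cubic F e1 e2 e3 c by fact
  interpret F': field F' by fact
  interpret h: ring_hom_ring F F' h by (rule ring_hom_ringI2) (use assms in \<open>auto intro: B.ring_axioms F'.ring_axioms\<close>)
  have inj: "inj_on h (carrier F)" by (rule non_trivial_field_hom_is_inj[OF assms(3) B.field_axioms assms(2)])
  have iff: "h a = h b \<longleftrightarrow> a = b" if "a \<in> carrier F" "b \<in> carrier F" for a b
    using inj that by (auto dest: inj_onD)
  show ?thesis
  proof
    show "h e1 \<in> carrier F'" "h e2 \<in> carrier F'" "h e3 \<in> carrier F'" by simp_all
    show "h e1 \<noteq> h e2" "h e1 \<noteq> h e3" "h e2 \<noteq> h e3" using B.e_distinct by (simp_all add: iff)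
    have "h (\<one>\<^bsub>F\<^esub> \<oplus>\<^bsub>F\<^esub> \<one>\<^bsub>F\<^esub>) \<noteq> h \<zero>\<^bsub>F\<^esub>"
      using iff[of "\<one>\<^bsub>F\<^esub> \<oplus>\<^bsub>F\<^esub> \<one>\<^bsub>F\<^esub>" "\<zero>\<^bsub>F\<^esub>"] B.two_nz by blast
    then show "\<one>\<^bsub>F'\<^esub> \<oplus>\<^bsub>F'\<^esub> \<one>\<^bsub>F'\<^esub> \<noteq> \<zero>\<^bsub>F'\<^esub>" by simp
    show "h (c 2) = \<ominus>\<^bsub>F'\<^esub> (h e1 \<oplus>\<^bsub>F'\<^esub> h e2 \<oplus>\<^bsub>F'\<^esub> h e3)"
      "h (c 1) = h e1 \<otimes>\<^bsub>F'\<^esub> h e2 \<oplus>\<^bsub>F'\<^esub> h e1 \<otimes>\<^bsub>F'\<^esub> h e3 \<oplus>\<^bsub>F'\<^esub> h e2 \<otimes>\<^bsub>F'\<^esub> h e3"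
      "h (c 0) = \<ominus>\<^bsub>F'\<^esub> (h e1 \<otimes>\<^bsub>F'\<^esub> h e2 \<otimes>\<^bsub>F'\<^esub> h e3)"
      using B.c_eq by simp_all
  qed
qed

lemma field_rat_ring: "field rat_ring"
  by (rule field_from_type_algebra)

lemma rat_ring_simps [simp]:
  "carrier rat_ring = UNIV" "x \<otimes>\<^bsub>rat_ring\<^esub> y = x * y" "x \<oplus>\<^bsub>rat_ring\<^esub> y = x + y"
  "\<one>\<^bsub>rat_ring\<^esub> = 1" "\<zero>\<^bsub>rat_ring\<^esub> = 0"
  by (simp_all add: ring_of_type_algebra_def)

lemma rat_ring_minus: "\<ominus>\<^bsub>rat_ring\<^esub> x = - x"
proof -
  interpret field rat_ring by (rule field_rat_ring)
  show ?thesis by (rule minus_equality) simp_all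
qed

lemma gal_field0_rat: "gal_field0 rat_ring"
proof -
  interpret field rat_ring by (rule field_rat_ring)
  have "[n] \<cdot>\<^bsub>rat_ring\<^esub> \<one>\<^bsub>rat_ring\<^esub> = of_nat n" for n :: nat
    by (induction n) (simp_all add: add.nat_pow_Suc)
  then show ?thesis
    by (intro gal_field0.intro gal_field.intro field_rat_ring gal_field0_axioms.intro) simp
qed

lemma (in completed) gal_field0_completion: "gal_field0 QV"
proof -
  interpret Q: field QV by (rule field_QV)
  note h = completion_emb_hom
  have "[n] \<cdot>\<^bsub>QV\<^esub> \<one>\<^bsub>QV\<^esub> = completion_emb v (of_nat n)" for n :: nat
  proof (induction n)
    case 0
    then show ?case by (simp add: completion_emb_eq cls_zero)
  next
    case (Suc n)
    have "completion_emb v (of_nat n + 1) = completion_emb v (of_nat n) \<oplus>\<^bsub>QV\<^esub> \<one>\<^bsub>QV\<^esub>"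
      using ring_hom_add[OF h, of "of_nat n" 1] ring_hom_one[OF h] by simp
    then show ?case using Suc by (simp add: Q.add.nat_pow_Suc add.commute)
  qed
  moreover have "completion_emb v (of_nat n) \<noteq> \<zero>\<^bsub>QV\<^esub>" if "n > 0" for n :: nat
    using completion_emb_inj[of "of_nat n" 0] that by (simp add: completion_emb_eq cls_zero)
  ultimately show ?thesis
    by (intro gal_field0.intro gal_field.intro field_QV gal_field0_axioms.intro) simp
qed

text \<open>An algebraically closed field has no proper algebraic extension. The inverse of
  \<open>i\<close> extends to a homomorphism from \<open>L(y)\<close> to \<open>B\<close>; it takes
  the same value \<open>w\<close> at \<open>y\<close> and at \<open>i w\<close>, and it is
  injective.\<close>

lemma image_of_alg_closed:
  assumes "field A" "algebraically_closed B" "i \<in> ring_hom B A"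
    and y: "y \<in> carrier A" "(ring.algebraic A over (i ` carrier B)) y"
  shows "y \<in> i ` carrier B"
proof -
  interpret A: field A by fact
  interpret B: algebraically_closed B by fact
  interpret i: ring_hom_ring B A i by (rule ring_hom_ringI2) (use assms in \<open>auto intro: A.ring_axioms B.ring_axioms\<close>)
  define L where "L = i ` carrier B"
  have L: "subfield L A"
    unfolding L_def by (rule i.img_is_subfield(2)[OF B.carrier_is_subfield A.one_not_zero])
  have inj: "inj_on i (carrier B)" by (rule non_trivial_field_hom_is_inj[OF assms(3) B.field_axioms A.field_axioms])
  have "i \<in> ring_iso B (A\<lparr>carrier := L\<rparr>)"
    using inj by (auto simp: ring_iso_def ring_hom_def L_def bij_betw_def)
  then have "inv_into (carrier B) i \<in> ring_iso (A\<lparr>carrier := L\<rparr>) B"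
    by (rule ring_iso_set_sym[OF B.ring_axioms])
  then have j: "inv_into (carrier B) i \<in> ring_hom (A\<lparr>carrier := L\<rparr>) B" (is "?j \<in> _") by (simp add: ring_iso_def)
  have yL: "(A.algebraic over L) y" using y(2) by (simp add: L_def)
  define p where "p = A.Irr L y"
  note p = A.IrrE[OF L y(1) yL, folded p_def]
  have fL: "field (A\<lparr>carrier := L\<rparr>)" using A.subfield_iff(2)[OF L] .
  have "p \<in> carrier (poly_ring (A\<lparr>carrier := L\<rparr>))"
    using p(1) A.univ_poly_consistent[OF subfieldE(1)[OF L]] by simp
  then have mp: "map ?j p \<in> carrier (poly_ring B)" by (rule polynomial_hom[OF j fL B.field_axioms])
  have "Polynomials.degree p \<ge> 1" using A.pirreducible_degree[OF L p(1,2)] .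
  then have "B.roots (map ?j p) \<noteq> {#}"
    using B.roots_over_carrier[OF mp] unfolding B.splitted_def by auto
  then obtain w where "B.is_root (map ?j p) w" using B.roots_mem_iff_is_root[OF mp] by blast
  then have w: "w \<in> carrier B" "B.eval (map ?j p) w = \<zero>\<^bsub>B\<^esub>" by (auto simp: B.is_root_def)
  obtain g where g: "hom_graph A B g" "(\<lambda>x. (x, ?j x)) ` L \<subseteq> g" "(y, w) \<in> g"
    using hom_graph_step[OF assms(1) B.field_axioms L j y(1) yL w(1) w(2)[unfolded p_def]] by auto
  obtain \<psi> where \<psi>: "subfield (Domain g) A" "\<psi> \<in> ring_hom (A\<lparr>carrier := Domain g\<rparr>) B"
    and geq: "g = (\<lambda>x. (x, \<psi> x)) ` Domain g"
    by (rule hom_graphE[OF g(1) assms(1)])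
  have inj\<psi>: "inj_on \<psi> (Domain g)"
    using non_trivial_field_hom_is_inj[OF \<psi>(2) _ B.field_axioms] A.subfield_iff(2)[OF \<psi>(1)] by simp
  have "?j (i w) = w" by (rule inv_into_f_f[OF inj w(1)])
  then have "(i w, w) \<in> g" using g(2) w(1) by (force simp: L_def)
  have gm: "\<psi> a = b \<and> a \<in> Domain g" if "(a, b) \<in> g" for a b
    using that by (subst (asm) geq) auto
  from gm[OF \<open>(i w, w) \<in> g\<close>] gm[OF g(3)] have "\<psi> (i w) = w" "\<psi> y = w" "i w \<in> Domain g" "y \<in> Domain g" by auto
  then have "y = i w" using inj_onD[OF inj\<psi>, of y "i w"] by simp
  then show ?thesis using w(1) by blast
qed

section \<open>Local solubility and the localisation map\<close>

context abs_value
begin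

text \<open>Squares of the completion, expressed by rational Cauchy sequences so that local
  arithmetic stays within the rationals; \<open>vsq_iff\<close> is the link to the completed
  field.\<close>

definition vsq :: "rat \<Rightarrow> bool"
  where "vsq t \<longleftrightarrow> (\<exists>s. cauchy s \<and> null (\<lambda>n. s n * s n - t))"

text \<open>
  \<open>soluble\<close> says that the two-covering attached to \<open>(d\<^sub>1, d\<^sub>2)\<close> has a point over the completion,
  given by Cauchy sequences; \<open>visibly_soluble\<close> exhibits such a point with rational
  \<open>x\<close>-coordinate.
\<close>

definition soluble :: "rat \<Rightarrow> rat \<Rightarrow> rat \<Rightarrow> rat \<Rightarrow> rat \<Rightarrow> bool"
  where "soluble e1 e2 e3 d1 d2 \<longleftrightarrow> (vsq d1 \<and> vsq d2) \<or>
    (\<exists>s1 s2 s3. cauchy s1 \<and> cauchy s2 \<and> cauchy s3 \<and>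
      null (\<lambda>n. (d1 * (s1 n)\<^sup>2 + e1) - (d2 * (s2 n)\<^sup>2 + e2)) \<and>
      null (\<lambda>n. (d1 * (s1 n)\<^sup>2 + e1) - (d1 * d2 * (s3 n)\<^sup>2 + e3)))"

definition visibly_soluble :: "rat \<Rightarrow> rat \<Rightarrow> rat \<Rightarrow> rat \<Rightarrow> rat \<Rightarrow> bool"
  where "visibly_soluble e1 e2 e3 d1 d2 \<longleftrightarrow> (vsq d1 \<and> vsq d2) \<or>
    (\<exists>x. x \<noteq> e1 \<and> x \<noteq> e2 \<and> x \<noteq> e3 \<and>
       vsq ((x - e1) * d1) \<and> vsq ((x - e2) * d2) \<and> vsq ((x - e3) * (d1 * d2)))"

end

locale localisation = completed v for v
begin

sublocale Q: gal_field0 rat_ring by (rule gal_field0_rat)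
sublocale V: gal_field0 "completion v" by (rule gal_field0_completion)

abbreviation "cemb \<equiv> completion_emb v"
abbreviation "io \<equiv> closure_emb v"

lemma cemb_closed [simp]: "cemb q \<in> carrier QV"
  using ring_hom_closed[OF completion_emb_hom, of q] by simp

text \<open>The identity of the rationals extends to the closures, so the choice in the definition
  is a genuine one. It enters later only through these two properties.\<close>

lemma closure_emb: "io \<in> ring_hom Q.Om V.Om" "io (Q.emb q) = V.emb (cemb q)"
proof -
  have h: "(\<lambda>q. V.emb (cemb q)) \<in> ring_hom rat_ring V.Om"
    using ring_hom_trans[OF completion_emb_hom V.emb_hom] by (simp add: comp_def)
  have g: "hom_graph Q.Om V.Om ((\<lambda>q. (Q.emb q, V.emb (cemb q))) ` carrier rat_ring)"
    by (rule graph_of_const[OF field_rat_ring Q.O.field_axioms V.O.field_axioms Q.emb_hom h])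
  have alg: "(Q.O.algebraic over (Domain ((\<lambda>q. (Q.emb q, V.emb (cemb q))) ` carrier rat_ring))) x"
    if "x \<in> carrier Q.Om" for x
    by (rule Q.algebraic_KF[OF that]) force
  obtain \<psi> where \<psi>: "\<psi> \<in> ring_hom Q.Om V.Om"
    "\<And>x y. (x, y) \<in> (\<lambda>q. (Q.emb q, V.emb (cemb q))) ` carrier rat_ring \<Longrightarrow> \<psi> x = y"
    using hom_graph_extend[OF Q.O.field_axioms V.O.algebraically_closed_axioms g alg] by blast
  have "\<psi> \<in> ring_hom Q.Om V.Om \<and> (\<forall>q. \<psi> (Q.emb q) = V.emb (cemb q))"
  proof (intro conjI allI)
    fix q
    have "(Q.emb q, V.emb (cemb q)) \<in> (\<lambda>q. (Q.emb q, V.emb (cemb q))) ` carrier rat_ring" by simp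
    then show "\<psi> (Q.emb q) = V.emb (cemb q)" by (rule \<psi>(2))
  qed (rule \<psi>(1))
  then have "\<exists>\<iota>. \<iota> \<in> ring_hom Q.Om V.Om \<and> (\<forall>q. \<iota> (Q.emb q) = V.emb (cemb q))" by blast
  from someI_ex[OF this] have "io \<in> ring_hom Q.Om V.Om \<and> (\<forall>q. io (Q.emb q) = V.emb (cemb q))"
    unfolding closure_emb_def .
  then show "io \<in> ring_hom Q.Om V.Om" "io (Q.emb q) = V.emb (cemb q)" by auto
qed

sublocale io: ring_hom_ring "alg_clos rat_ring" "alg_clos (completion v)" "closure_emb v"
  by (rule ring_hom_ringI2[OF Q.O.ring_axioms V.O.ring_axioms closure_emb(1)])

lemma io_inj: "inj_on io (carrier Q.Om)"
  by (rule non_trivial_field_hom_is_inj[OF closure_emb(1) Q.O.field_axioms V.O.field_axioms])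

text \<open>The \<open>inv_into\<close> in the definition is meaningful because
  \<open>\<tau>\<close> maps the copy of the closure of the rationals into itself: the image of an
  element is algebraic over that copy, and \<open>image_of_alg_closed\<close> applies.\<close>

lemma gal_restrict:
  assumes \<tau>: "\<tau> \<in> V.G"
  shows "gal_restrict v \<tau> \<in> Q.G" "x \<in> carrier Q.Om \<Longrightarrow> io (gal_restrict v \<tau> x) = \<tau> (io x)"
proof -
  have th: "\<tau> \<in> ring_hom V.Om V.Om" by (rule V.gal_hom[OF \<tau>])
  have h: "\<tau> \<circ> io \<in> ring_hom Q.Om V.Om" by (rule ring_hom_trans[OF closure_emb(1) th])
  have const: "\<tau> (io (Q.emb q)) = io (Q.emb q)" for q
    using V.gal_fix[OF \<tau>, of "cemb q"] closure_emb(2) by simp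
  have mem: "\<tau> (io x) \<in> io ` carrier Q.Om" if x: "x \<in> carrier Q.Om" for x
  proof (rule image_of_alg_closed[OF V.O.field_axioms Q.O.algebraically_closed_axioms closure_emb(1)])
    show "\<tau> (io x) \<in> carrier V.Om" using \<tau> x by simp
    have "(V.O.algebraic over ((\<tau> \<circ> io) ` Q.KF)) ((\<tau> \<circ> io) x)"
      by (rule algebraic_hom[OF h Q.O.field_axioms V.O.field_axioms Q.subfield_KF x Q.O.algebraic_extension[OF x]])
    moreover have "(\<tau> \<circ> io) ` Q.KF \<subseteq> io ` carrier Q.Om" using const by auto
    ultimately show "(V.O.algebraic over (io ` carrier Q.Om)) (\<tau> (io x))"
      using V.O.algebraic_mono by fastforce
  qed
  define \<psi> where "\<psi> x = inv_into (carrier Q.Om) io (\<tau> (io x))" for x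
  have \<psi>: "\<psi> x \<in> carrier Q.Om" "io (\<psi> x) = \<tau> (io x)" if "x \<in> carrier Q.Om" for x
    using mem[OF that] by (simp_all add: \<psi>_def inv_into_into f_inv_into_f)
  have eqI: "a = b" if "io a = io b" "a \<in> carrier Q.Om" "b \<in> carrier Q.Om" for a b
    using io_inj that by (auto dest: inj_onD)
  have "\<psi> \<in> ring_hom Q.Om Q.Om"
  proof (rule ring_hom_memI)
    fix x y assume xy: "x \<in> carrier Q.Om" "y \<in> carrier Q.Om"
    show "\<psi> x \<in> carrier Q.Om" by (rule \<psi>(1)[OF xy(1)])
    show "\<psi> (x \<otimes>\<^bsub>Q.Om\<^esub> y) = \<psi> x \<otimes>\<^bsub>Q.Om\<^esub> \<psi> y"
      by (rule eqI) (use xy \<psi> ring_hom_mult[OF th] in simp_all)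
    show "\<psi> (x \<oplus>\<^bsub>Q.Om\<^esub> y) = \<psi> x \<oplus>\<^bsub>Q.Om\<^esub> \<psi> y"
      by (rule eqI) (use xy \<psi> ring_hom_add[OF th] in simp_all)
  next
    show "\<psi> \<one>\<^bsub>Q.Om\<^esub> = \<one>\<^bsub>Q.Om\<^esub>" by (rule eqI) (use \<psi> ring_hom_one[OF th] in simp_all)
  qed
  moreover have "\<psi> (Q.emb q) = Q.emb q" for q
    by (rule eqI) (use \<psi>[of "Q.emb q"] const in simp_all)
  ultimately have "restrict \<psi> (carrier Q.Om) \<in> Q.G" by (intro Q.hom_in_gal) simp_all
  moreover have r: "gal_restrict v \<tau> = restrict \<psi> (carrier Q.Om)"
    unfolding gal_restrict_def \<psi>_def by simp
  ultimately show "gal_restrict v \<tau> \<in> Q.G" by simp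
  show "x \<in> carrier Q.Om \<Longrightarrow> io (gal_restrict v \<tau> x) = \<tau> (io x)" using \<psi> by (simp add: r)
qed

end

locale localised_cubic = localisation v + two_descent rat_ring e1 e2 e3 c
  for v and e1 e2 e3 :: rat and c
begin

sublocale W: two_descent "completion v" "completion_emb v e1" "completion_emb v e2" "completion_emb v e3"
  "\<lambda>i. completion_emb v (c i)"
  by (intro two_descent.intro V.gal_field0_axioms two_descent_axioms.intro
      split_cubic_hom[OF sc field_QV completion_emb_hom])

lemma io_sqrt: "sqrt_of r d \<Longrightarrow> W.sqrt_of (io r) (cemb d)"
proof -
  assume r: "sqrt_of r d"
  note rc = sqrt_of_closed(1)[OF r]
  have "io r \<otimes>\<^bsub>V.Om\<^esub> io r = io (r \<otimes>\<^bsub>Q.Om\<^esub> r)" using rc by simp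
  also have "r \<otimes>\<^bsub>Q.Om\<^esub> r = Q.emb d" using r by (simp add: sqrt_of_def)
  finally have "io r \<otimes>\<^bsub>V.Om\<^esub> io r = V.emb (cemb d)" by (simp add: closure_emb)
  moreover have "cemb d \<noteq> \<zero>\<^bsub>QV\<^esub>"
    using r completion_emb_inj[of d 0] by (simp add: sqrt_of_def completion_emb_eq cls_zero)
  ultimately show ?thesis using rc by (simp add: W.sqrt_of_def)
qed

text \<open>By injectivity of the embedding, a local automorphism fixes \<open>io r\<close> exactly
  if its restriction fixes \<open>r\<close>. So localisation sends Kummer cocycles to Kummer
  cocycles.\<close>

lemma localize_kummer:
  assumes "sqrt_of r1 d1" "sqrt_of r2 d2"
  shows "localize v (kummer_cocycle r1 r2) = (\<lambda>\<tau>\<in>V.G. W.pt (\<tau> (io r1) = io r1) (\<tau> (io r2) = io r2))"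
  unfolding localize_def
proof (rule restrict_ext)
  fix \<tau> assume \<tau>: "\<tau> \<in> V.G"
  have eq: "gal_restrict v \<tau> r = r \<longleftrightarrow> \<tau> (io r) = io r" if "sqrt_of r d" for r d
    using gal_restrict(2)[OF \<tau> sqrt_of_closed(1)[OF that]] sqrt_of_closed(1)[OF that]
      io_inj Q.gal_closed[OF gal_restrict(1)[OF \<tau>] sqrt_of_closed(1)[OF that]]
    by (metis inj_onD)
  have "map_point io (pt a b) = W.pt a b" for a b
    by (auto simp: pt_def W.pt_def closure_emb)
  then show "map_point io (kummer_cocycle r1 r2 (gal_restrict v \<tau>)) = W.pt (\<tau> (io r1) = io r1) (\<tau> (io r2) = io r2)"
    using gal_restrict(1)[OF \<tau>] eq[OF assms(1)] eq[OF assms(2)] by (simp add: kummer_cocycle_def)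
qed

abbreviation "Bv \<equiv> coboundaries QV W.S.E map_point"

lemma localize_in_coboundaries:
  assumes "sqrt_of r1 d1" "sqrt_of r2 d2"
  shows "localize v (kummer_cocycle r1 r2) \<in> Bv \<longleftrightarrow>
    (\<exists>P\<in>carrier W.S.E. \<forall>\<tau>\<in>V.G. W.pt (\<tau> (io r1) = io r1) (\<tau> (io r2) = io r2) = map_point \<tau> P \<otimes>\<^bsub>W.S.E\<^esub> inv\<^bsub>W.S.E\<^esub> P)"
proof -
  have *: "(\<lambda>\<tau>\<in>V.G. f \<tau>) = (\<lambda>\<tau>\<in>V.G. g \<tau>) \<longleftrightarrow> (\<forall>\<tau>\<in>V.G. f \<tau> = g \<tau>)"
    for f g :: "_ \<Rightarrow> (nat \<Rightarrow> rat) set clos point"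
    by (auto simp: fun_eq_iff restrict_def)
  show ?thesis
    unfolding localize_kummer[OF assms] coboundaries_def mem_Collect_eq * Bex_def by (simp only: conj_commute)
qed

lemma vsq_iff: "vsq t \<longleftrightarrow> (\<exists>z\<in>carrier QV. cemb t = z \<otimes>\<^bsub>QV\<^esub> z)"
proof
  assume "vsq t"
  then obtain s where s: "cauchy s" "null (\<lambda>n. s n * s n - t)" by (auto simp: vsq_def)
  then have "cls s \<otimes>\<^bsub>QV\<^esub> cls s = cemb t"
    by (simp add: cls_mult completion_emb_eq cls_eq_iff cauchy_mult cauchy_const)
  then show "\<exists>z\<in>carrier QV. cemb t = z \<otimes>\<^bsub>QV\<^esub> z" using cls_closed[OF s(1)] by metis
next
  assume "\<exists>z\<in>carrier QV. cemb t = z \<otimes>\<^bsub>QV\<^esub> z"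
  then obtain s where "cauchy s" "cemb t = cls s \<otimes>\<^bsub>QV\<^esub> cls s" by (auto simp: carrier_QV)
  then have "cauchy s" "cls (\<lambda>n. s n * s n) = cls (\<lambda>n. t)" by (simp_all add: cls_mult completion_emb_eq)
  then show "vsq t" by (auto simp: vsq_def cls_eq_iff cauchy_mult cauchy_const)
qed

lemma sqrt_rational_iff:
  assumes "W.sqrt_of r (cemb d)" shows "r \<in> V.KF \<longleftrightarrow> vsq d"
proof -
  have rr: "r \<in> carrier V.Om" "r \<otimes>\<^bsub>V.Om\<^esub> r = V.emb (cemb d)" using assms by (simp_all add: W.sqrt_of_def)
  show ?thesis
  proof
    assume "r \<in> V.KF"
    then obtain z where z: "z \<in> carrier QV" "r = V.emb z" by auto
    then have "V.emb (z \<otimes>\<^bsub>QV\<^esub> z) = V.emb (cemb d)" using rr by simp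
    then have "z \<otimes>\<^bsub>QV\<^esub> z = cemb d" using z(1) by (simp only: W.emb_eq_iff cemb_closed V.F.m_closed)
    then show "vsq d" unfolding vsq_iff using z(1) by metis
  next
    assume "vsq d"
    then obtain z where z: "z \<in> carrier QV" "cemb d = z \<otimes>\<^bsub>QV\<^esub> z" by (auto simp: vsq_iff)
    then have "r \<otimes>\<^bsub>V.Om\<^esub> r = V.emb z \<otimes>\<^bsub>V.Om\<^esub> V.emb z" using rr by simp
    then have "r = V.emb z \<or> r = V.emb (\<ominus>\<^bsub>QV\<^esub> z)"
      using W.S.sq_eq_iff[OF rr(1) W.emb_closed[OF z(1)]] z(1) by simp
    moreover have "\<ominus>\<^bsub>QV\<^esub> z \<in> carrier QV" using z(1) by simp
    ultimately show "r \<in> V.KF" using z(1) by (metis (no_types) imageI)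
  qed
qed

theorem locally_trivial_imp:
  assumes "sqrt_of r1 d1" "sqrt_of r2 d2" "localize v (kummer_cocycle r1 r2) \<in> Bv"
  shows "soluble e1 e2 e3 d1 d2"
proof -
  note i1 = io_sqrt[OF assms(1)] and i2 = io_sqrt[OF assms(2)]
  obtain P where P: "P \<in> carrier W.S.E"
    "\<And>\<tau>. \<tau> \<in> V.G \<Longrightarrow> W.pt (\<tau> (io r1) = io r1) (\<tau> (io r2) = io r2) = map_point \<tau> P \<otimes>\<^bsub>W.S.E\<^esub> inv\<^bsub>W.S.E\<^esub> P"
    using assms(3) unfolding localize_in_coboundaries[OF assms(1,2)] by (elim bexE) (rule that, auto)
  from W.descent_necessary[OF i1 i2 P] show ?thesis
  proof
    assume "io r1 \<in> V.KF \<and> io r2 \<in> V.KF"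
    then show ?thesis using sqrt_rational_iff[OF i1] sqrt_rational_iff[OF i2] by (simp add: soluble_def)
  next
    assume "\<exists>z1\<in>carrier QV. \<exists>z2\<in>carrier QV. \<exists>z3\<in>carrier QV.
     cemb d1 \<otimes>\<^bsub>QV\<^esub> (z1 \<otimes>\<^bsub>QV\<^esub> z1) \<oplus>\<^bsub>QV\<^esub> cemb e1 = cemb d2 \<otimes>\<^bsub>QV\<^esub> (z2 \<otimes>\<^bsub>QV\<^esub> z2) \<oplus>\<^bsub>QV\<^esub> cemb e2 \<and>
     cemb d1 \<otimes>\<^bsub>QV\<^esub> (z1 \<otimes>\<^bsub>QV\<^esub> z1) \<oplus>\<^bsub>QV\<^esub> cemb e1 = cemb d1 \<otimes>\<^bsub>QV\<^esub> cemb d2 \<otimes>\<^bsub>QV\<^esub> (z3 \<otimes>\<^bsub>QV\<^esub> z3) \<oplus>\<^bsub>QV\<^esub> cemb e3"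
    then obtain z1 z2 z3 where z: "z1 \<in> carrier QV" "z2 \<in> carrier QV" "z3 \<in> carrier QV"
      and zeq: "cemb d1 \<otimes>\<^bsub>QV\<^esub> (z1 \<otimes>\<^bsub>QV\<^esub> z1) \<oplus>\<^bsub>QV\<^esub> cemb e1 = cemb d2 \<otimes>\<^bsub>QV\<^esub> (z2 \<otimes>\<^bsub>QV\<^esub> z2) \<oplus>\<^bsub>QV\<^esub> cemb e2"
       "cemb d1 \<otimes>\<^bsub>QV\<^esub> (z1 \<otimes>\<^bsub>QV\<^esub> z1) \<oplus>\<^bsub>QV\<^esub> cemb e1 = cemb d1 \<otimes>\<^bsub>QV\<^esub> cemb d2 \<otimes>\<^bsub>QV\<^esub> (z3 \<otimes>\<^bsub>QV\<^esub> z3) \<oplus>\<^bsub>QV\<^esub> cemb e3"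
      by (elim bexE conjE) (rule that)
    obtain s1 where s1: "cauchy s1" "z1 = cls s1" using z(1) unfolding carrier_QV by (elim exE conjE) (rule that)
    obtain s2 where s2: "cauchy s2" "z2 = cls s2" using z(2) unfolding carrier_QV by (elim exE conjE) (rule that)
    obtain s3 where s3: "cauchy s3" "z3 = cls s3" using z(3) unfolding carrier_QV by (elim exE conjE) (rule that)
    note s = s1(1) s2(1) s3(1)
    note eq = zeq[unfolded s1(2) s2(2) s3(2)]
    have "null (\<lambda>n. (d1 * (s1 n)\<^sup>2 + e1) - (d2 * (s2 n)\<^sup>2 + e2))" "null (\<lambda>n. (d1 * (s1 n)\<^sup>2 + e1) - (d1 * d2 * (s3 n)\<^sup>2 + e3))"
      using eq s by (simp_all add: completion_emb_eq cls_mult cls_add cls_eq_iff cauchy_mult cauchy_add cauchy_const power2_eq_square)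
    then show ?thesis using s unfolding soluble_def by blast
  qed
qed

theorem locally_trivialI:
  assumes r: "sqrt_of r1 d1" "sqrt_of r2 d2"
    and "visibly_soluble e1 e2 e3 d1 d2"
  shows "localize v (kummer_cocycle r1 r2) \<in> Bv"
proof -
  note i1 = io_sqrt[OF r(1)] and i2 = io_sqrt[OF r(2)]
  have d0: "d1 \<noteq> 0" "d2 \<noteq> 0" using r by (simp_all add: sqrt_of_def)
  note h = ring_hom_mult[OF completion_emb_hom, simplified] ring_hom_add[OF completion_emb_hom, simplified]
  from assms(3)[unfolded visibly_soluble_def] show ?thesis
  proof
    assume "vsq d1 \<and> vsq d2"
    then have "io r1 \<in> V.KF" "io r2 \<in> V.KF" using sqrt_rational_iff[OF i1] sqrt_rational_iff[OF i2] by simp_all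
    then show ?thesis unfolding localize_in_coboundaries[OF r]
      using W.descent_trivial W.S.Infinity_E by blast
  next
    assume "\<exists>x. x \<noteq> e1 \<and> x \<noteq> e2 \<and> x \<noteq> e3 \<and> vsq ((x - e1) * d1) \<and> vsq ((x - e2) * d2) \<and> vsq ((x - e3) * (d1 * d2))"
    then obtain x where x: "x \<noteq> e1" "x \<noteq> e2" "x \<noteq> e3"
      "vsq ((x - e1) * d1)" "vsq ((x - e2) * d2)" "vsq ((x - e3) * (d1 * d2))" by blast
    have root: "\<exists>z\<in>carrier QV. z \<noteq> \<zero>\<^bsub>QV\<^esub> \<and> cemb d \<otimes>\<^bsub>QV\<^esub> (z \<otimes>\<^bsub>QV\<^esub> z) \<oplus>\<^bsub>QV\<^esub> cemb e = cemb x"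
      if prem: "vsq ((x - e) * d)" "d \<noteq> 0" "x \<noteq> e" for d e
    proof -
      obtain t where t: "t \<in> carrier QV" "cemb ((x - e) * d) = t \<otimes>\<^bsub>QV\<^esub> t" using prem(1) by (auto simp: vsq_iff)
      \<comment> \<open>With \<open>t\<close> a square root of \<open>(x - e) d\<close>, the
        quotient \<open>t / d\<close> satisfies \<open>d (t / d)^2 = x - e\<close>.\<close>
      define z where "z = cemb (1 / d) \<otimes>\<^bsub>QV\<^esub> t"
      have zc: "z \<in> carrier QV" using t by (simp add: z_def)
      have "cemb d \<otimes>\<^bsub>QV\<^esub> (z \<otimes>\<^bsub>QV\<^esub> z) = cemb d \<otimes>\<^bsub>QV\<^esub> cemb (1 / d) \<otimes>\<^bsub>QV\<^esub> cemb (1 / d) \<otimes>\<^bsub>QV\<^esub> (t \<otimes>\<^bsub>QV\<^esub> t)"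
        using t(1) by (simp add: z_def V.F.m_ac)
      also have "\<dots> = cemb (d * (1 / d) * (1 / d) * ((x - e) * d))" by (simp only: t(2)[symmetric] h)
      also have "d * (1 / d) * (1 / d) * ((x - e) * d) = x - e" using prem(2) by (simp add: field_simps)
      finally have e: "cemb d \<otimes>\<^bsub>QV\<^esub> (z \<otimes>\<^bsub>QV\<^esub> z) = cemb (x - e)" .
      then have "cemb d \<otimes>\<^bsub>QV\<^esub> (z \<otimes>\<^bsub>QV\<^esub> z) \<oplus>\<^bsub>QV\<^esub> cemb e = cemb x" by (simp flip: h)
      moreover have "z \<noteq> \<zero>\<^bsub>QV\<^esub>"
      proof
        assume "z = \<zero>\<^bsub>QV\<^esub>"
        then have "cemb (x - e) = \<zero>\<^bsub>QV\<^esub>" using e by simp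
        then have "cemb (x - e) = cemb 0" by (simp add: completion_emb_eq cls_zero)
        then show False using prem(3) by (simp add: completion_emb_inj)
      qed
      ultimately show ?thesis using zc by blast
    qed
    obtain z1 where z1: "z1 \<in> carrier QV" "z1 \<noteq> \<zero>\<^bsub>QV\<^esub>" "cemb d1 \<otimes>\<^bsub>QV\<^esub> (z1 \<otimes>\<^bsub>QV\<^esub> z1) \<oplus>\<^bsub>QV\<^esub> cemb e1 = cemb x"
      using root[OF x(4) d0(1) x(1)] by blast
    obtain z2 where z2: "z2 \<in> carrier QV" "z2 \<noteq> \<zero>\<^bsub>QV\<^esub>" "cemb d2 \<otimes>\<^bsub>QV\<^esub> (z2 \<otimes>\<^bsub>QV\<^esub> z2) \<oplus>\<^bsub>QV\<^esub> cemb e2 = cemb x"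
      using root[OF x(5) d0(2) x(2)] by blast
    obtain z3 where z3: "z3 \<in> carrier QV" "z3 \<noteq> \<zero>\<^bsub>QV\<^esub>" "cemb (d1 * d2) \<otimes>\<^bsub>QV\<^esub> (z3 \<otimes>\<^bsub>QV\<^esub> z3) \<oplus>\<^bsub>QV\<^esub> cemb e3 = cemb x"
      using root[OF x(6) _ x(3)] d0 by auto
    show ?thesis
      unfolding localize_in_coboundaries[OF r]
      by (rule W.descent_sufficient[OF i1 i2 z1(1) z2(1) z3(1) z1(2) z2(2) z3(2)])
        (use z1(3) z2(3) z3(3) in \<open>simp_all add: h\<close>)
  qed
qed

end

section \<open>Counting the two-Selmer group\<close>

lemma (in two_descent) sqrt_of_exists:
  assumes "d \<in> carrier F" "d \<noteq> \<zero>\<^bsub>F\<^esub>" shows "\<exists>r. sqrt_of r d"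
proof -
  define p where "p = [\<one>\<^bsub>Om\<^esub>, \<zero>\<^bsub>Om\<^esub>, \<ominus>\<^bsub>Om\<^esub> emb d]"
  have p: "p \<in> carrier (poly_ring Om)" using assms by (simp add: p_def univ_poly_def polynomial_def)
  have "O.roots p \<noteq> {#}"
    using O.roots_over_carrier[OF p] unfolding O.splitted_def by (auto simp: p_def)
  then obtain r where "O.is_root p r" using O.roots_mem_iff_is_root[OF p] by blast
  then have r: "r \<in> carrier Om" "O.eval p r = \<zero>\<^bsub>Om\<^esub>" by (auto simp: O.is_root_def)
  have "O.eval p r = r \<otimes>\<^bsub>Om\<^esub> r \<ominus>\<^bsub>Om\<^esub> emb d"
    using r(1) assms by (simp add: p_def numeral_2_eq_2 a_minus_def)
  then have "r \<otimes>\<^bsub>Om\<^esub> r \<ominus>\<^bsub>Om\<^esub> emb d = \<zero>\<^bsub>Om\<^esub>" using r(2) by simp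
  then have "r \<otimes>\<^bsub>Om\<^esub> r = emb d"
    using O.r_right_minus_eq[of "r \<otimes>\<^bsub>Om\<^esub> r" "emb d"] r(1) assms(1) by simp
  then show ?thesis using r(1) assms unfolding sqrt_of_def by blast
qed

text \<open>The interface between cohomology and arithmetic: \<open>B\<close> represents, without
  repetition modulo squares, the everywhere soluble pairs. Each strength of solubility stands where
  it is cheap: the stronger is demanded of the pairs in \<open>B\<close>, and the weaker is all that
  is granted of a pair that has to be matched with one in \<open>B\<close>.\<close>

theorem selmer_card:
  fixes e1 e2 e3 :: rat and f :: "rat poly" and B :: "(rat \<times> rat) set"
  assumes distinct: "e1 \<noteq> e2" "e1 \<noteq> e3" "e2 \<noteq> e3"
    and f: "f = [:- e1, 1:] * [:- e2, 1:] * [:- e3, 1:]"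
    and nz: "\<And>d1 d2. (d1, d2) \<in> B \<Longrightarrow> d1 \<noteq> 0 \<and> d2 \<noteq> 0"
    and inj: "\<And>d1 d2 d1' d2' q1 q2. (d1, d2) \<in> B \<Longrightarrow> (d1', d2') \<in> B \<Longrightarrow>
        d1 * d1' = q1 * q1 \<Longrightarrow> d2 * d2' = q2 * q2 \<Longrightarrow> d1 = d1' \<and> d2 = d2'"
    and suff: "\<And>v d1 d2. v \<in> places \<Longrightarrow> (d1, d2) \<in> B \<Longrightarrow> abs_value.visibly_soluble v e1 e2 e3 d1 d2"
    and nec: "\<And>d1 d2. d1 \<noteq> 0 \<Longrightarrow> d2 \<noteq> 0 \<Longrightarrow> (\<And>v. v \<in> places \<Longrightarrow> abs_value.soluble v e1 e2 e3 d1 d2) \<Longrightarrow>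
        \<exists>d1' d2' q1 q2. (d1', d2') \<in> B \<and> d1 * d1' = q1 * q1 \<and> d2 * d2' = q2 * q2"
  shows "card (selmer_group 2 f) = card B"
proof -
  have "split_cubic rat_ring e1 e2 e3 (Polynomial.coeff f)"
  proof -
    interpret field rat_ring by (rule field_rat_ring)
    show ?thesis
      by unfold_locales (use distinct in \<open>simp_all add: f rat_ring_minus numeral_2_eq_2 algebra_simps\<close>)
  qed
  then have td: "two_descent rat_ring e1 e2 e3 (Polynomial.coeff f)"
    by (intro two_descent.intro gal_field0_rat two_descent_axioms.intro)
  then interpret T: two_descent rat_ring e1 e2 e3 "Polynomial.coeff f" .
  have loc: "localised_cubic v e1 e2 e3 (Polynomial.coeff f)" if "v \<in> places" for v
    using td places_abs_value[OF that] by (simp add: localised_cubic_def localisation_def completed_def)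
  define Bv where "Bv v = coboundaries (completion v) (ec_local v f) map_point" for v
  have imp: "abs_value.soluble v e1 e2 e3 d1 d2"
    if v: "v \<in> places" and r: "T.sqrt_of r1 d1" "T.sqrt_of r2 d2" and l: "localize v (T.kummer_cocycle r1 r2) \<in> Bv v"
    for v r1 r2 d1 d2
  proof -
    interpret L: localised_cubic v e1 e2 e3 "Polynomial.coeff f" by (rule loc[OF v])
    show ?thesis by (rule L.locally_trivial_imp[OF r l[unfolded Bv_def ec_local_def]])
  qed
  have conv: "localize v (T.kummer_cocycle r1 r2) \<in> Bv v"
    if v: "v \<in> places" and r: "T.sqrt_of r1 d1" "T.sqrt_of r2 d2" and l: "abs_value.visibly_soluble v e1 e2 e3 d1 d2"
    for v r1 r2 d1 d2
  proof -
    interpret L: localised_cubic v e1 e2 e3 "Polynomial.coeff f" by (rule loc[OF v])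
    show ?thesis unfolding Bv_def ec_local_def by (rule L.locally_trivialI[OF r l])
  qed
  define rt where "rt d = (SOME r. T.sqrt_of r d)" for d
  have rt: "T.sqrt_of (rt d) d" if "d \<noteq> 0" for d
    using T.sqrt_of_exists[of d] that someI_ex[of "\<lambda>r. T.sqrt_of r d"] by (simp add: rt_def)
  define K where "K = (\<lambda>(d1, d2). T.kummer_cocycle (rt d1) (rt d2))"
  define Sel where "Sel = {\<xi> \<in> T.Z1. \<forall>v\<in>places. localize v \<xi> \<in> Bv v}"
  \<comment> \<open>A class has a single cocycle as its member, so the condition on the image of the
    class is a condition on that cocycle.\<close>
  have "selmer_group 2 f = (\<lambda>\<xi>. {\<xi>}) ` Sel"
    unfolding selmer_group_def ec_Qbar_def T.H1_T2M Sel_def Bv_def by auto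
  then have "card (selmer_group 2 f) = card Sel"
    by (simp add: card_image)
  also have "Sel = K ` B"
  proof (rule equalityI; rule subsetI)
    fix \<xi> assume \<xi>: "\<xi> \<in> Sel"
    then have "\<xi> \<in> T.Z1" by (simp add: Sel_def)
    then obtain r1 d1 r2 d2 where r: "T.sqrt_of r1 d1" "T.sqrt_of r2 d2" "\<xi> = T.kummer_cocycle r1 r2"
      by (rule T.Z1_kummer)
    have d0: "d1 \<noteq> 0" "d2 \<noteq> 0" using r(1,2) by (simp_all add: T.sqrt_of_def)
    have "abs_value.soluble v e1 e2 e3 d1 d2" if "v \<in> places" for v
      using imp[OF that r(1,2)] \<xi> that unfolding Sel_def r(3) by blast
    from nec[OF d0 this] obtain d1' d2' q1 q2 where B: "(d1', d2') \<in> B" "d1 * d1' = q1 * q1" "d2 * d2' = q2 * q2"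
      by blast
    have d0': "d1' \<noteq> 0" "d2' \<noteq> 0" using nz[OF B(1)] by auto
    have "\<xi> = K (d1', d2')"
      using T.kummer_cocycle_eq_iff[OF r(1,2) rt[OF d0'(1)] rt[OF d0'(2)]] B(2,3) r(3) by (auto simp: K_def)
    then show "\<xi> \<in> K ` B" using B(1) by blast
  next
    fix \<xi> assume "\<xi> \<in> K ` B"
    then obtain d1 d2 where B: "(d1, d2) \<in> B" "\<xi> = T.kummer_cocycle (rt d1) (rt d2)" by (auto simp: K_def)
    have r: "T.sqrt_of (rt d1) d1" "T.sqrt_of (rt d2) d2" using nz[OF B(1)] rt by auto
    show "\<xi> \<in> Sel"
      unfolding Sel_def B(2) using T.kummer_cocycle_Z1[OF r] conv[OF _ r suff[OF _ B(1)]] by blast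
  qed
  also have "card (K ` B) = card B"
  proof (rule card_image, rule inj_onI, clarify)
    fix d1 d2 d1' d2' assume B: "(d1, d2) \<in> B" "(d1', d2') \<in> B" and eq: "K (d1, d2) = K (d1', d2')"
    have r: "T.sqrt_of (rt d1) d1" "T.sqrt_of (rt d2) d2" "T.sqrt_of (rt d1') d1'" "T.sqrt_of (rt d2') d2'"
      using nz[OF B(1)] nz[OF B(2)] rt by auto
    obtain q1 q2 where "d1 * d1' = q1 * q1" "d2 * d2' = q2 * q2"
      using eq T.kummer_cocycle_eq_iff[OF r] by (auto simp: K_def)
    then show "d1 = d1' \<and> d2 = d2'" using inj[OF B] by blast
  qed
  finally show ?thesis .
qed

section \<open>Local squares and local solubility\<close>

context abs_value
begin

lemma vsq_square: "vsq (r * r)"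
  unfolding vsq_def by (rule exI[of _ "\<lambda>_. r"]) (simp add: cauchy_const null_const)

lemma vsq_mult:
  assumes "vsq s" "vsq t" shows "vsq (s * t)"
proof -
  obtain f g where f: "cauchy f" "null (\<lambda>n. f n * f n - s)" and g: "cauchy g" "null (\<lambda>n. g n * g n - t)"
    using assms by (auto simp: vsq_def)
  have "null (\<lambda>n. (g n * g n) * (f n * f n - s) + s * (g n * g n - t))"
    by (intro null_add null_mult f g cauchy_mult cauchy_const)
  then have "null (\<lambda>n. (f n * g n) * (f n * g n) - s * t)" by (simp add: algebra_simps)
  then show ?thesis unfolding vsq_def using cauchy_mult[OF f(1) g(1)] by blast
qed

lemma vsq_cancel: "s \<noteq> 0 \<Longrightarrow> vsq s \<Longrightarrow> vsq (s * t) \<Longrightarrow> vsq t"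
proof -
  assume "s \<noteq> 0" "vsq s" "vsq (s * t)"
  then have "vsq (((1 / s) * (1 / s)) * (s * (s * t)))" using vsq_mult vsq_square by blast
  then show ?thesis using \<open>s \<noteq> 0\<close> by simp
qed

lemma vsq_mult_square: "r \<noteq> 0 \<Longrightarrow> vsq (t * (r * r)) \<longleftrightarrow> vsq t"
  using vsq_cancel[of "r * r" t] vsq_square[of r] vsq_mult[of t "r * r"] by (auto simp: mult.commute)

lemma vsq_trans:
  assumes "vsq (s * t)" "vsq (t * u)" "t \<noteq> 0" shows "vsq (s * u)"
  using vsq_mult[OF assms(1,2)] vsq_mult_square[of t "s * u"] assms(3) by (simp add: mult_ac)

lemma visibly_soluble_cong:
  assumes "visibly_soluble e1 e2 e3 d1 d2" "vsq (d1 * d1')" "vsq (d2 * d2')" "d1 \<noteq> 0" "d2 \<noteq> 0"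
  shows "visibly_soluble e1 e2 e3 d1' d2'"
proof -
  have 3: "vsq ((d1 * d2) * (d1' * d2'))" using vsq_mult[OF assms(2,3)] by (simp add: mult_ac)
  from assms(1) show ?thesis
    unfolding visibly_soluble_def
    using vsq_cancel[OF assms(4) _ assms(2)] vsq_cancel[OF assms(5) _ assms(3)]
      vsq_trans[OF _ assms(2,4)] vsq_trans[OF _ assms(3,5)] vsq_trans[OF _ 3] assms(4,5)
    by (metis mult_eq_0_iff)
qed

lemma visibly_soluble_perm2:
  "visibly_soluble e1 e2 e3 d1 d2 \<Longrightarrow> visibly_soluble e2 e1 e3 d2 d1"
  unfolding visibly_soluble_def by (metis mult.commute)

text \<open>The third coordinate \<open>d1 d2\<close> moves to the front; the new third coordinate
  is \<open>d1 d2^2\<close>, in the class of \<open>d1\<close>.\<close>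

lemma visibly_soluble_perm3:
  assumes "visibly_soluble e1 e2 e3 d1 d2" "d2 \<noteq> 0"
  shows "visibly_soluble e3 e2 e1 (d1 * d2) d2"
proof -
  have "vsq ((x - e1) * (d1 * d2 * d2)) \<longleftrightarrow> vsq ((x - e1) * d1)" for x
    using vsq_mult_square[OF assms(2), of "(x - e1) * d1"] by (simp add: mult_ac)
  then show ?thesis using assms(1) vsq_mult unfolding visibly_soluble_def by blast
qed

lemma soluble_perm2: "soluble e1 e2 e3 d1 d2 \<Longrightarrow> soluble e2 e1 e3 d2 d1"
proof -
  assume "soluble e1 e2 e3 d1 d2"
  then consider "vsq d1" "vsq d2" | s1 s2 s3 where "cauchy s1" "cauchy s2" "cauchy s3"
    "null (\<lambda>n. (d1 * (s1 n)\<^sup>2 + e1) - (d2 * (s2 n)\<^sup>2 + e2))"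
    "null (\<lambda>n. (d1 * (s1 n)\<^sup>2 + e1) - (d1 * d2 * (s3 n)\<^sup>2 + e3))"
    unfolding soluble_def by blast
  then show ?thesis
  proof cases
    case 2
    have a: "null (\<lambda>n. (d2 * (s2 n)\<^sup>2 + e2) - (d1 * (s1 n)\<^sup>2 + e1))" using null_minus[OF 2(4)] by simp
    have "null (\<lambda>n. (d2 * (s2 n)\<^sup>2 + e2) - (d2 * d1 * (s3 n)\<^sup>2 + e3))"
      using null_add[OF a 2(5)] by (simp add: mult.commute diff_diff_eq2 add_diff_eq diff_add_eq)
    then show ?thesis using a 2 unfolding soluble_def by blast
  qed (simp add: soluble_def)
qed

lemma soluble_perm3: "soluble e1 e2 e3 d1 d2 \<Longrightarrow> d2 \<noteq> 0 \<Longrightarrow> soluble e3 e2 e1 (d1 * d2) d2"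
proof -
  assume "soluble e1 e2 e3 d1 d2" and d2: "d2 \<noteq> 0"
  then consider "vsq d1" "vsq d2" | s1 s2 s3 where "cauchy s1" "cauchy s2" "cauchy s3"
    "null (\<lambda>n. (d1 * (s1 n)\<^sup>2 + e1) - (d2 * (s2 n)\<^sup>2 + e2))"
    "null (\<lambda>n. (d1 * (s1 n)\<^sup>2 + e1) - (d1 * d2 * (s3 n)\<^sup>2 + e3))"
    unfolding soluble_def by blast
  then show ?thesis
  proof cases
    case 1 then show ?thesis using vsq_mult by (simp add: soluble_def)
  next
    case 2
    define t where "t = (\<lambda>n. (1 / d2) * s1 n)"
    have t: "cauchy t" unfolding t_def by (intro cauchy_mult cauchy_const 2)
    have e: "d1 * d2 * d2 * (t n)\<^sup>2 = d1 * (s1 n)\<^sup>2" for n using d2 by (simp add: t_def power2_eq_square)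
    have a: "null (\<lambda>n. (d1 * d2 * (s3 n)\<^sup>2 + e3) - (d1 * (s1 n)\<^sup>2 + e1))" using null_minus[OF 2(5)] by simp
    then have b: "null (\<lambda>n. (d1 * d2 * (s3 n)\<^sup>2 + e3) - (d1 * d2 * d2 * (t n)\<^sup>2 + e1))" unfolding e .
    have "null (\<lambda>n. (d1 * d2 * (s3 n)\<^sup>2 + e3) - (d2 * (s2 n)\<^sup>2 + e2))"
      using null_add[OF a 2(4)] by (simp add: diff_diff_eq2 add_diff_eq diff_add_eq)
    then show ?thesis using b t 2 unfolding soluble_def by blast
  qed
qed

text \<open>The new coordinate \<open>y\<close> is that of the sum with \<open>(e1, 0)\<close>, and
  the two factors are the class of \<open>(e1, 0)\<close>. The identities \<open>g1\<close>,
  \<open>g2\<close>, \<open>g3\<close> display each required square as a product of given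
  squares.\<close>

lemma visibly_soluble_translate_nontrivial:
  assumes e: "e1 \<noteq> e2" "e1 \<noteq> e3"
    and x: "x \<noteq> e1" "x \<noteq> e2" "x \<noteq> e3" "vsq ((x - e1) * d1)" "vsq ((x - e2) * d2)" "vsq ((x - e3) * (d1 * d2))"
    and d: "d1 \<noteq> 0" "d2 \<noteq> 0"
  shows "visibly_soluble e1 e2 e3 (d1 * ((e1 - e2) * (e1 - e3))) (d2 * (e1 - e2))"
proof -
  have g1: "(a * b / t) * (d1 * (a * b)) = (t * d1) * ((a * b / t) * (a * b / t))" if "t \<noteq> 0" for a b t :: rat
    using that by (simp add: field_simps)
  have g2: "(t * d1) * (u * (d1 * d2)) * ((a / (t * d1)) * (a / (t * d1))) = (a * u / t) * (d2 * a)"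
    if "t \<noteq> 0" "d1 \<noteq> 0" for a t u :: rat
    using that by (simp add: field_simps)
  have g3: "(t * d1) * (u * d2) * ((a * b / t) * (a * b / t)) = (b * u / t) * (d1 * (a * b) * (d2 * a))"
    if "t \<noteq> 0" for a b t u :: rat
    using that by (simp add: field_simps)
  define y where "y = e1 + (e1 - e2) * (e1 - e3) / (x - e1)"
  have x1: "x - e1 \<noteq> 0" using x by simp
  have y1: "y - e1 = (e1 - e2) * (e1 - e3) / (x - e1)" by (simp add: y_def)
  have y2: "y - e2 = (e1 - e2) * (x - e3) / (x - e1)" using x1 by (simp add: y_def field_simps)
  have y3: "y - e3 = (e1 - e3) * (x - e2) / (x - e1)" using x1 by (simp add: y_def field_simps)
  have "y - e1 \<noteq> 0" "y - e2 \<noteq> 0" "y - e3 \<noteq> 0" unfolding y1 y2 y3 using x e by simp_all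
  then have ne: "y \<noteq> e1" "y \<noteq> e2" "y \<noteq> e3" by auto
  have "(y - e1) * (d1 * ((e1 - e2) * (e1 - e3))) =
      ((x - e1) * d1) * (((e1 - e2) * (e1 - e3) / (x - e1)) * ((e1 - e2) * (e1 - e3) / (x - e1)))"
    unfolding y1 using x1 by (rule g1)
  then have 1: "vsq ((y - e1) * (d1 * ((e1 - e2) * (e1 - e3))))" using vsq_mult[OF x(4) vsq_square] by metis
  have "((x - e1) * d1) * ((x - e3) * (d1 * d2)) * (((e1 - e2) / ((x - e1) * d1)) * ((e1 - e2) / ((x - e1) * d1)))
     = (y - e2) * (d2 * (e1 - e2))"
    unfolding y2 using x1 d by (intro g2)
  then have 2: "vsq ((y - e2) * (d2 * (e1 - e2)))"
    using vsq_mult[OF vsq_mult[OF x(4) x(6)] vsq_square] by metis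
  have "((x - e1) * d1) * ((x - e2) * d2) * (((e1 - e2) * (e1 - e3) / (x - e1)) * ((e1 - e2) * (e1 - e3) / (x - e1)))
     = (y - e3) * (d1 * ((e1 - e2) * (e1 - e3)) * (d2 * (e1 - e2)))"
    unfolding y3 using x1 by (rule g3)
  then have 3: "vsq ((y - e3) * (d1 * ((e1 - e2) * (e1 - e3)) * (d2 * (e1 - e2))))"
    using vsq_mult[OF vsq_mult[OF x(4) x(5)] vsq_square] by metis
  show ?thesis unfolding visibly_soluble_def using ne 1 2 3 by blast
qed

end

section \<open>The real place\<close>

interpretation rabs: abs_value "\<lambda>x. real_of_rat \<bar>x\<bar>"
  by (rule real_abs_value)

text \<open>The Cauchy sequence consists of rational approximations from above to the real square
  root.\<close>

lemma real_vsqI: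
  assumes "t \<ge> 0" shows "rabs.vsq t"
proof -
  define r where "r = sqrt (real_of_rat t)"
  have r: "r \<ge> 0" "r * r = real_of_rat t" using assms by (simp_all add: r_def zero_le_of_rat_iff)
  have "\<exists>q. r < real_of_rat q \<and> real_of_rat q < r + inverse (real (Suc n))" for n
    by (rule of_rat_dense) simp
  then obtain s where s: "\<And>n. r < real_of_rat (s n)" "\<And>n. real_of_rat (s n) < r + inverse (real (Suc n))"
    by metis
  have lim: "(\<lambda>n. real_of_rat (s n)) \<longlonglongrightarrow> r"
  proof (rule tendsto_sandwich[of "\<lambda>_. r" _ _ "\<lambda>n. r + inverse (real (Suc n))"])
    show "(\<lambda>n. r + inverse (real (Suc n))) \<longlonglongrightarrow> r"
      using tendsto_add[OF tendsto_const LIMSEQ_inverse_real_of_nat, of r] by simp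
  qed (use s in \<open>auto intro!: always_eventually less_imp_le\<close>)
  have ab: "real_of_rat \<bar>x\<bar> = \<bar>real_of_rat x\<bar>" for x :: rat by (auto simp: abs_if of_rat_minus)
  have "rabs.cauchy s"
    unfolding rabs.cauchy_def
  proof (intro allI impI)
    fix e :: real assume "e > 0"
    then obtain N where N: "\<forall>m\<ge>N. \<forall>n\<ge>N. dist (real_of_rat (s m)) (real_of_rat (s n)) < e"
      using LIMSEQ_imp_Cauchy[OF lim] unfolding Cauchy_def by blast
    then show "\<exists>N. \<forall>i\<ge>N. \<forall>j\<ge>N. real_of_rat \<bar>s i - s j\<bar> < e"
      by (intro exI[of _ N]) (simp add: ab dist_real_def of_rat_diff)
  qed
  moreover have "rabs.null (\<lambda>n. s n * s n - t)"
  proof -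
    have "(\<lambda>n. real_of_rat (s n) * real_of_rat (s n) - real_of_rat t) \<longlonglongrightarrow> r * r - real_of_rat t"
      by (intro tendsto_intros lim)
    then have "(\<lambda>n. \<bar>real_of_rat (s n) * real_of_rat (s n) - real_of_rat t\<bar>) \<longlonglongrightarrow> 0"
      unfolding r(2) by (auto intro: tendsto_rabs_zero)
    then show ?thesis unfolding rabs.null_def by (simp add: ab of_rat_diff of_rat_mult)
  qed
  ultimately show ?thesis unfolding rabs.vsq_def by blast
qed

lemma real_nullD:
  assumes "rabs.null s" "e > 0" shows "\<exists>N. \<forall>n\<ge>N. \<bar>s n\<bar> < e"
proof -
  have "real_of_rat e > 0" using assms(2) by simp
  then obtain N where "\<forall>n\<ge>N. real_of_rat \<bar>s n\<bar> < real_of_rat e"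
    using assms(1) unfolding rabs.null_iff by blast
  then show ?thesis by (auto simp: of_rat_less)
qed

lemma real_vsqD: "rabs.vsq t \<Longrightarrow> t \<ge> 0"
proof (rule ccontr)
  assume "rabs.vsq t" "\<not> t \<ge> 0"
  then obtain s where "rabs.null (\<lambda>n. s n * s n - t)" and t: "t < 0" by (auto simp: rabs.vsq_def)
  then obtain N where "\<forall>n\<ge>N. \<bar>s n * s n - t\<bar> < - t" using real_nullD[of "\<lambda>n. s n * s n - t" "- t"] by auto
  then have "\<bar>s N * s N - t\<bar> < - t" by blast
  then show False using zero_le_square[of "s N"] t by linarith
qed

text \<open>No real point lies to the left of the smallest root \<open>e2\<close>. With
  \<open>d2 < 0\<close> the value \<open>x - e2\<close> is at most about \<open>0\<close>, so
  \<open>x - e1\<close> and \<open>x - e3\<close> are negative, which forces both \<open>d1\<close>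
  and \<open>d1 d2\<close> to be negative.\<close>

lemma real_soluble_pos:
  assumes "rabs.soluble e1 e2 e3 d1 d2" "e2 < e1" "e2 < e3" "d1 \<noteq> 0" "d2 \<noteq> 0"
  shows "d2 > 0"
proof (rule ccontr)
  assume "\<not> d2 > 0"
  then have d2: "d2 < 0" using assms(5) by simp
  then have "\<not> rabs.vsq d2" using real_vsqD by fastforce
  then obtain s1 s2 s3 where n: "rabs.null (\<lambda>n. (d1 * (s1 n)\<^sup>2 + e1) - (d2 * (s2 n)\<^sup>2 + e2))"
    "rabs.null (\<lambda>n. (d1 * (s1 n)\<^sup>2 + e1) - (d1 * d2 * (s3 n)\<^sup>2 + e3))"
    using assms(1) unfolding rabs.soluble_def by blast
  \<comment> \<open>Half the smaller gap leaves room for the errors of both approximate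
    equations.\<close>
  define e where "e = min (e1 - e2) (e3 - e2) / 2"
  have e: "e > 0" using assms(2,3) by (simp add: e_def)
  obtain N1 N2 where N: "\<forall>n\<ge>N1. \<bar>(d1 * (s1 n)\<^sup>2 + e1) - (d2 * (s2 n)\<^sup>2 + e2)\<bar> < e"
    "\<forall>n\<ge>N2. \<bar>(d1 * (s1 n)\<^sup>2 + e1) - (d1 * d2 * (s3 n)\<^sup>2 + e3)\<bar> < e"
    using real_nullD[OF n(1) e] real_nullD[OF n(2) e] by blast
  define m where "m = max N1 N2"
  have a: "\<bar>(d1 * (s1 m)\<^sup>2 + e1) - (d2 * (s2 m)\<^sup>2 + e2)\<bar> < e" "\<bar>(d1 * (s1 m)\<^sup>2 + e1) - (d1 * d2 * (s3 m)\<^sup>2 + e3)\<bar> < e"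
    using N by (auto simp: m_def)
  have "d2 * (s2 m)\<^sup>2 \<le> 0" using d2 by (simp add: mult_nonpos_nonneg)
  moreover have "2 * e \<le> e1 - e2" "2 * e \<le> e3 - e2" by (simp_all add: e_def)
  ultimately have "d1 * (s1 m)\<^sup>2 < 0" "d1 * d2 * (s3 m)\<^sup>2 < 0" using a e by linarith+
  then have "d1 < 0" "d1 * d2 < 0" by (auto simp: mult_less_0_iff zero_less_power2 not_less)
  then show False using d2 by (simp add: mult_less_0_iff)
qed

section \<open>Squares and two-torsion classes at a finite place\<close>

context
  fixes p :: nat
  assumes p: "Factorial_Ring.prime p"
begin

interpretation P: abs_value "padic_abs p" by (rule padic_abs_value[OF p])

text \<open>Membership in \<open>p^k\<close> times the local ring at \<open>p\<close>; the first
  disjunct makes up for \<open>pval p 0 = 0\<close>.\<close>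

definition small :: "rat \<Rightarrow> int \<Rightarrow> bool"
  where "small x k \<longleftrightarrow> x = 0 \<or> pval p x \<ge> k"

lemma p_gt_1: "real p > 1"
  using p prime_gt_1_nat by (metis of_nat_1 of_nat_less_iff)

lemma small_iff: "small x k \<longleftrightarrow> padic_abs p x \<le> real p powi (- k)"
proof (cases "x = 0")
  case True then show ?thesis using p_gt_1 by (simp add: small_def padic_abs_pval)
next
  case False
  show ?thesis
  proof (cases "pval p x \<ge> k")
    case True
    then have "real p powi (- pval p x) \<le> real p powi (- k)" using p_gt_1 by (intro power_int_increasing) auto
    then show ?thesis using True False by (simp add: small_def padic_abs_pval)
  next
    case f: False
    then have "real p powi (- k) < real p powi (- pval p x)" using p_gt_1 by (intro power_int_strict_increasing) auto
    then show ?thesis using f False by (simp add: small_def padic_abs_pval)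
  qed
qed

lemma small_add: "small x k \<Longrightarrow> small y k \<Longrightarrow> small (x + y) k"
  using pval_add[OF p, of x y k] by (cases "x = 0 \<or> y = 0 \<or> x + y = 0") (auto simp: small_def)

lemma small_minus: "small x k \<Longrightarrow> small (- x) k"
  by (auto simp: small_def pval_minus[OF p])

lemma small_diff: "small x k \<Longrightarrow> small y k \<Longrightarrow> small (x - y) k"
  using small_add[of x k "- y"] small_minus[of y k] by simp

lemma small_mono: "small x k \<Longrightarrow> j \<le> k \<Longrightarrow> small x j"
  by (auto simp: small_def)

lemma small_of_int: "small (of_int a) 0"
  by (cases "a = 0") (auto simp: small_def pval_of_int[OF p])

lemma small_of_int_dvd: "int p dvd a \<Longrightarrow> small (of_int a) 1"
proof (cases "a = 0")
  case False
  assume "int p dvd a"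
  then have "multiplicity (int p) a \<ge> 1"
    using False prime_elem_int[OF p] by (metis One_nat_def Suc_leI multiplicity_gt_zero_iff prime_elem_not_unit)
  then show ?thesis using False by (simp add: small_def pval_of_int[OF p])
qed (simp add: small_def)

lemma pval_unit: "\<not> int p dvd a \<Longrightarrow> pval p (of_int a) = 0"
  using pval_of_int[OF p, of a] not_dvd_imp_multiplicity_0 by fastforce

lemma exists_power_small: "(e::real) > 0 \<Longrightarrow> \<exists>N::nat. \<forall>n\<ge>N. real p powi (- int n) < e"
proof -
  assume e: "e > 0"
  have "(\<lambda>n. (inverse (real p)) ^ n) \<longlonglongrightarrow> 0"
    by (rule LIMSEQ_power_zero) (use p_gt_1 in \<open>simp add: inverse_less_1_iff\<close>)
  then obtain N where "\<forall>n\<ge>N. (inverse (real p)) ^ n < e"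
    using e by (auto simp: lim_sequentially dist_real_def)
  then show ?thesis by (auto simp: power_int_minus power_inverse intro!: exI[of _ N])
qed

lemma padic_nullI:
  assumes "\<And>n. small (s n) (int n)" shows "P.null s"
  unfolding P.null_iff
proof (intro allI impI)
  fix e :: real assume "e > 0"
  then obtain N where N: "\<forall>n\<ge>N. real p powi (- int n) < e" using exists_power_small by blast
  then have "\<forall>n\<ge>N. padic_abs p (s n) < e" using assms by (meson small_iff le_less_trans)
  then show "\<exists>N. \<forall>n\<ge>N. padic_abs p (s n) < e" by blast
qed

lemma padic_cauchyI:
  assumes "\<And>n. small (s (Suc n) - s n) (int n)" shows "P.cauchy s"
  unfolding P.cauchy_def
proof (intro allI impI)
  fix e :: real assume "e > 0"
  then obtain N where N: "\<forall>n\<ge>N. real p powi (- int n) < e" using exists_power_small by blast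
  have *: "small (s (N + k) - s N) (int N)" for k
  proof (induction k)
    case (Suc k)
    have "small (s (Suc (N + k)) - s (N + k)) (int N)" by (rule small_mono[OF assms]) simp
    from small_add[OF this Suc] show ?case by simp
  qed (simp add: small_def)
  have "padic_abs p (s i - s j) < e" if "i \<ge> N" "j \<ge> N" for i j
  proof -
    have "small (s i - s j) (int N)"
      using small_diff[OF *[of "i - N"] *[of "j - N"]] that by simp
    then show ?thesis using N small_iff by (meson le_less_trans order_refl)
  qed
  then show "\<exists>N. \<forall>i\<ge>N. \<forall>j\<ge>N. padic_abs p (s i - s j) < e" by blast
qed

lemma padic_nullD:
  assumes "P.null s" shows "\<exists>N. \<forall>n\<ge>N. small (s n) k"
proof -
  have "real p powi (- k) > 0" using p_gt_1 by simp
  then obtain N where "\<forall>n\<ge>N. padic_abs p (s n) < real p powi (- k)" using assms unfolding P.null_iff by blast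
  then show ?thesis by (auto simp: small_iff intro: less_imp_le)
qed

text \<open>Newton's iteration \<open>s \<mapsto> (s + t / s) / 2\<close> doubles the precision of a square root.\<close>

lemma padic_newton:
  assumes s: "s \<noteq> 0" "pval p s = 0" and t: "small (s * s - t) (1 + 2 * pval p 2)"
  shows "P.vsq t"
proof -
  define \<kappa> where "\<kappa> = pval p 2"
  have \<kappa>: "\<kappa> \<ge> 0" using pval_of_int[OF p, of 2] by (simp add: \<kappa>_def)
  define f where "f = rec_nat s (\<lambda>_ u. (u + t / u) / 2)"
  have f: "f 0 = s" "\<And>n. f (Suc n) = (f n + t / f n) / 2" by (simp_all add: f_def)
  have step: "(u + t / u) / 2 \<noteq> 0 \<and> pval p ((u + t / u) / 2) = 0 \<and>
      small (((u + t / u) / 2) * ((u + t / u) / 2) - t) (int (Suc n) + 1 + 2 * \<kappa>) \<and>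
      small ((u + t / u) / 2 - u) (int n)"
    if u: "u \<noteq> 0" "pval p u = 0" "small (u * u - t) (int n + 1 + 2 * \<kappa>)" for u n
  proof -
    \<comment> \<open>The Newton increment; the new error is exactly its square. An error of
      valuation \<open>n + 1 + 2 \<kappa>\<close> gives an increment of valuation at least
      \<open>n + 1 + \<kappa>\<close>, and twice this covers the next step. Here
      \<open>\<kappa>\<close> is \<open>1\<close> at the prime \<open>2\<close> and \<open>0\<close>
      elsewhere.\<close>
    define \<delta> where "\<delta> = (t - u * u) / (2 * u)"
    have d2: "2 * u * \<delta> = t - u * u" using u(1) by (simp add: \<delta>_def)
    have e: "(u + t / u) / 2 = u + \<delta>" using u(1) by (simp add: \<delta>_def diff_divide_distrib add_divide_distrib)
    have "(u + \<delta>) * (u + \<delta>) - t = u * u + 2 * u * \<delta> + \<delta> * \<delta> - t" by (simp add: algebra_simps)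
    then have e2: "(u + \<delta>) * (u + \<delta>) - t = \<delta> * \<delta>" unfolding d2 by simp
    have pd: "small \<delta> (int n + 1 + \<kappa>)"
    proof (cases "t - u * u = 0")
      case False
      have "pval p \<delta> = pval p (t - u * u) - \<kappa>"
        using False u by (simp add: \<delta>_def pval_div[OF p] pval_mult[OF p] \<kappa>_def)
      moreover have "pval p (t - u * u) = pval p (u * u - t)" using pval_minus[OF p, of "u * u - t"] by simp
      ultimately show ?thesis using u(3) False by (auto simp: small_def)
    qed (simp add: \<delta>_def small_def)
    have *: "u + \<delta> \<noteq> 0" "pval p (u + \<delta>) = pval p u"
      by (rule pval_add_eq[OF p]; use u pd \<kappa> in \<open>auto simp: small_def\<close>)+
    have "small (\<delta> * \<delta>) (int (Suc n) + 1 + 2 * \<kappa>)"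
      using pd \<kappa> by (auto simp: small_def pval_mult[OF p])
    moreover have "small \<delta> (int n)" using small_mono[OF pd, of "int n"] \<kappa> by simp
    ultimately show ?thesis unfolding e e2 using * u by simp
  qed
  have inv: "f n \<noteq> 0 \<and> pval p (f n) = 0 \<and> small (f n * f n - t) (int n + 1 + 2 * \<kappa>)" for n
  proof (induction n)
    case 0 then show ?case using s t by (simp add: f \<kappa>_def)
  next
    case (Suc n) then show ?case using step[of "f n" n] by (simp add: f(2))
  qed
  have "P.cauchy f" by (rule padic_cauchyI) (use step inv in \<open>simp add: f(2)\<close>)
  moreover have "P.null (\<lambda>n. f n * f n - t)"
  proof (rule padic_nullI)
    fix n
    have "small (f n * f n - t) (int n + 1 + 2 * \<kappa>)" using inv by blast
    then show "small (f n * f n - t) (int n)" by (rule small_mono) (use \<kappa> in simp)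
  qed
  ultimately show ?thesis unfolding P.vsq_def by blast
qed

lemma vsq_near_one: "small u (1 + 2 * pval p 2) \<Longrightarrow> P.vsq (1 + u)"
  using padic_newton[of 1 "1 + u"] small_minus[of u] pval_one[OF p] by simp

text \<open>Square classes are open: \<open>y / x\<close> is so close to \<open>1\<close> that it is
  a square.\<close>

lemma vsq_near:
  assumes "x \<noteq> 0" "small (y - x) (pval p x + 1 + 2 * pval p 2)"
  shows "P.vsq (x * y)"
proof -
  have "small ((y - x) / x) (1 + 2 * pval p 2)"
    using assms by (auto simp: small_def pval_div[OF p])
  from vsq_near_one[OF this] have "P.vsq (y / x)" using assms(1) by (simp add: field_simps)
  then have "P.vsq ((y / x) * (x * x))" using P.vsq_mult P.vsq_square by blast
  then show ?thesis using assms(1) by (simp add: mult.commute)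
qed

lemma vsq_approx:
  assumes "P.vsq t" shows "\<exists>s. small (s * s - t) k"
proof -
  obtain s where "P.null (\<lambda>n. s n * s n - t)" using assms by (auto simp: P.vsq_def)
  from padic_nullD[OF this, of k] show ?thesis by blast
qed

lemma vsq_even_pval:
  assumes "P.vsq t" "t \<noteq> 0" shows "even (pval p t)"
proof -
  obtain s where s: "small (s * s - t) (pval p t + 1)" using vsq_approx[OF assms(1)] by blast
  have "t + (s * s - t) \<noteq> 0" "pval p (t + (s * s - t)) = pval p t"
    by (rule pval_add_eq[OF p]; use assms s in \<open>auto simp: small_def\<close>)+
  then have "s \<noteq> 0" "pval p (s * s) = pval p t" by auto
  then have "pval p t = pval p s + pval p s" by (simp add: pval_mult[OF p])
  then show ?thesis by simp
qed

text \<open>The root \<open>e1\<close> itself is not admissible as \<open>x\<close>. Instead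
  \<open>x = e1 + s\<close> is taken very near, with \<open>s\<close> in the class of
  \<open>(e1 - e2) (e1 - e3)\<close>; then \<open>x - e2\<close> and \<open>x - e3\<close> stay in
  the classes of \<open>e1 - e2\<close> and \<open>e1 - e3\<close>.\<close>

lemma visibly_soluble_two_torsion:
  assumes "e1 \<noteq> e2" "e1 \<noteq> e3"
  shows "P.visibly_soluble e1 e2 e3 ((e1 - e2) * (e1 - e3)) (e1 - e2)"
proof -
  define A where "A = (e1 - e2) * (e1 - e3)"
  have A: "A \<noteq> 0" using assms by (simp add: A_def)
  \<comment> \<open>A generous bound: \<open>pval p s\<close> then exceeds the valuation of either
    difference by the precision \<open>1 + 2 * pval p 2\<close> that \<open>vsq_near\<close>
    needs.\<close>
  define k where "k = nat (\<bar>pval p (e1 - e2)\<bar> + \<bar>pval p (e1 - e3)\<bar> + \<bar>pval p 2\<bar> + 2 + \<bar>pval p A\<bar>)"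
  have k: "int k \<ge> \<bar>pval p (e1 - e2)\<bar> + \<bar>pval p (e1 - e3)\<bar> + \<bar>pval p 2\<bar> + 2 + \<bar>pval p A\<bar>" by (simp add: k_def)
  define s where "s = A * (of_nat p ^ k * of_nat p ^ k)"
  have p0: "(of_nat p :: rat) ^ k \<noteq> 0" using p by auto
  have s0: "s \<noteq> 0" using A p0 by (simp add: s_def)
  have ps: "pval p s = pval p A + 2 * int k"
    using A p0 p by (simp add: s_def pval_mult[OF p] pval_power[OF p] pval_p[OF p])
  have near: "e1 - e + s \<noteq> 0 \<and> P.vsq ((e1 - e + s) * (e1 - e))" if "e = e2 \<or> e = e3" for e
  proof -
    have ne: "e1 - e \<noteq> 0" using that assms by auto
    have big: "pval p s \<ge> pval p (e1 - e) + 1 + 2 * pval p 2" using that ps k by auto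
    have "e1 - e + s \<noteq> 0"
      by (rule pval_add_eq[OF p ne]) (use that ps k in auto)
    moreover have "P.vsq ((e1 - e) * (e1 - e + s))"
      by (rule vsq_near[OF ne]) (use big in \<open>simp add: small_def\<close>)
    ultimately show ?thesis by (simp add: mult.commute)
  qed
  have n2: "e1 - e2 + s \<noteq> 0" "P.vsq ((e1 - e2 + s) * (e1 - e2))" using near[of e2] by auto
  have n3: "e1 - e3 + s \<noteq> 0" "P.vsq ((e1 - e3 + s) * (e1 - e3))" using near[of e3] by auto
  define x where "x = e1 + s"
  have xe: "x - e1 = s" "x - e2 = e1 - e2 + s" "x - e3 = e1 - e3 + s" by (simp_all add: x_def)
  have "x \<noteq> e1" "x \<noteq> e2" "x \<noteq> e3" using s0 n2(1) n3(1) xe by auto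
  moreover have "P.vsq ((x - e1) * A)"
    unfolding xe s_def using P.vsq_square[of "A * of_nat p ^ k"] by (simp add: mult_ac)
  moreover have "P.vsq ((x - e2) * (e1 - e2))" unfolding xe by (rule n2)
  moreover have "P.vsq ((x - e3) * (A * (e1 - e2)))"
  proof -
    have "(x - e3) * (A * (e1 - e2)) = ((e1 - e3 + s) * (e1 - e3)) * ((e1 - e2) * (e1 - e2))"
      unfolding xe A_def by (simp add: mult_ac)
    then show ?thesis using P.vsq_mult[OF n3(2) P.vsq_square] by metis
  qed
  ultimately show ?thesis unfolding P.visibly_soluble_def A_def by blast
qed

text \<open>The trivial class stands for the point at infinity, which has no \<open>x\<close>; its
  translate is the class of \<open>(e1, 0)\<close> and is treated on its own.\<close>

lemma visibly_soluble_translate1: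
  assumes "P.visibly_soluble e1 e2 e3 d1 d2" "e1 \<noteq> e2" "e1 \<noteq> e3" "d1 \<noteq> 0" "d2 \<noteq> 0"
  shows "P.visibly_soluble e1 e2 e3 (d1 * ((e1 - e2) * (e1 - e3))) (d2 * (e1 - e2))"
proof -
  consider "P.vsq d1" "P.vsq d2" | x where "x \<noteq> e1" "x \<noteq> e2" "x \<noteq> e3" "P.vsq ((x - e1) * d1)"
    "P.vsq ((x - e2) * d2)" "P.vsq ((x - e3) * (d1 * d2))"
    using assms(1) unfolding P.visibly_soluble_def by blast
  then show ?thesis
  proof cases
    case 1
    show ?thesis
    proof (rule P.visibly_soluble_cong[OF visibly_soluble_two_torsion[OF assms(2,3)]])
      show "P.vsq ((e1 - e2) * (e1 - e3) * (d1 * ((e1 - e2) * (e1 - e3))))"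
        using P.vsq_mult[OF 1(1) P.vsq_square[of "(e1 - e2) * (e1 - e3)"]] by (simp add: mult_ac)
      show "P.vsq ((e1 - e2) * (d2 * (e1 - e2)))"
        using P.vsq_mult[OF 1(2) P.vsq_square[of "e1 - e2"]] by (simp add: mult_ac)
    qed (use assms in auto)
  next
    case 2
    then show ?thesis by (rule P.visibly_soluble_translate_nontrivial[OF assms(2,3) _ _ _ _ _ _ assms(4,5)])
  qed
qed

lemma visibly_soluble_translate2:
  assumes "P.visibly_soluble e1 e2 e3 d1 d2" "e1 \<noteq> e2" "e2 \<noteq> e3" "d1 \<noteq> 0" "d2 \<noteq> 0"
  shows "P.visibly_soluble e1 e2 e3 (d1 * (e2 - e1)) (d2 * ((e2 - e1) * (e2 - e3)))"
  using visibly_soluble_translate1[OF P.visibly_soluble_perm2[OF assms(1)]] assms(2-)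
  by (auto dest: P.visibly_soluble_perm2)

text \<open>The third root is moved to the front, the translation is made there, and the roots are
  moved back; the surplus factors form squares.\<close>

lemma visibly_soluble_translate3:
  assumes "P.visibly_soluble e1 e2 e3 d1 d2" "e1 \<noteq> e3" "e2 \<noteq> e3" "d1 \<noteq> 0" "d2 \<noteq> 0"
  shows "P.visibly_soluble e1 e2 e3 (d1 * (e3 - e1)) (d2 * (e3 - e2))"
proof -
  have "P.visibly_soluble e3 e2 e1 (d1 * d2 * ((e3 - e2) * (e3 - e1))) (d2 * (e3 - e2))"
    by (rule visibly_soluble_translate1[OF P.visibly_soluble_perm3[OF assms(1,5)]]) (use assms in auto)
  from P.visibly_soluble_perm3[OF this]
  have "P.visibly_soluble e1 e2 e3 (d1 * d2 * ((e3 - e2) * (e3 - e1)) * (d2 * (e3 - e2))) (d2 * (e3 - e2))"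
    using assms by simp
  then show ?thesis
  proof (rule P.visibly_soluble_cong)
    have "d1 * d2 * ((e3 - e2) * (e3 - e1)) * (d2 * (e3 - e2)) * (d1 * (e3 - e1)) =
      (d1 * d2 * (e3 - e2) * (e3 - e1)) * (d1 * d2 * (e3 - e2) * (e3 - e1))" by (simp add: mult_ac)
    then show "P.vsq (d1 * d2 * ((e3 - e2) * (e3 - e1)) * (d2 * (e3 - e2)) * (d1 * (e3 - e1)))"
      using P.vsq_square by metis
    show "P.vsq (d2 * (e3 - e2) * (d2 * (e3 - e2)))" by (rule P.vsq_square)
  qed (use assms in auto)
qed

text \<open>Precision \<open>1\<close> is all that the arguments on parity and residues use, so one
  late term of each sequence can replace it.\<close>

lemma soluble_approx:
  assumes "P.soluble e1 e2 e3 d1 d2" "\<not> (P.vsq d1 \<and> P.vsq d2)"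
  obtains z1 z2 z3 where "small ((d1 * z1\<^sup>2 + e1) - (d2 * z2\<^sup>2 + e2)) 1"
    "small ((d1 * z1\<^sup>2 + e1) - (d1 * d2 * z3\<^sup>2 + e3)) 1"
proof -
  obtain s1 s2 s3 where s: "P.null (\<lambda>n. (d1 * (s1 n)\<^sup>2 + e1) - (d2 * (s2 n)\<^sup>2 + e2))"
    "P.null (\<lambda>n. (d1 * (s1 n)\<^sup>2 + e1) - (d1 * d2 * (s3 n)\<^sup>2 + e3))"
    using assms unfolding P.soluble_def by blast
  obtain M where M: "\<forall>n\<ge>M. small ((d1 * (s1 n)\<^sup>2 + e1) - (d2 * (s2 n)\<^sup>2 + e2)) 1" using padic_nullD[OF s(1)] by blast
  obtain N where N: "\<forall>n\<ge>N. small ((d1 * (s1 n)\<^sup>2 + e1) - (d1 * d2 * (s3 n)\<^sup>2 + e3)) 1" using padic_nullD[OF s(2)] by blast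
  show ?thesis by (rule that[of "s1 (max M N)" "s2 (max M N)" "s3 (max M N)"]) (use M N in auto)
qed

end

section \<open>Necessary conditions at a finite place\<close>

context
  fixes p :: nat
  assumes p: "Factorial_Ring.prime p"
begin

interpretation P: abs_value "padic_abs p" by (rule padic_abs_value[OF p])

lemma pval_sq_times: "d \<noteq> 0 \<Longrightarrow> z \<noteq> 0 \<Longrightarrow> pval p (d * z\<^sup>2) = pval p d + 2 * pval p z"
  by (simp add: pval_mult[OF p] pval_power[OF p])

lemma pval_of_int_unit_add:
  assumes "\<not> int p dvd a" "small p u 1"
  shows "of_int a + u \<noteq> 0" "pval p (of_int a + u) = 0"
proof -
  have "a \<noteq> 0" using assms(1) by auto
  then show "of_int a + u \<noteq> 0" "pval p (of_int a + u) = 0"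
    using pval_add_eq[OF p, of "of_int a" u] assms pval_unit[OF p assms(1)] by (auto simp: small_def[OF p])
qed

lemma small_of_int_imp_dvd: "small p (of_int n) 1 \<Longrightarrow> int p dvd n"
proof (rule ccontr)
  assume "small p (of_int n) 1" "\<not> int p dvd n"
  moreover from this have "n \<noteq> 0" by auto
  ultimately show False using pval_unit[OF p, of n] by (simp add: small_def[OF p])
qed

text \<open>
  In the following two lemmas \<open>u\<^sub>i\<close> stands for \<open>x - e\<^sub>i\<close>, where \<open>x\<close> is an approximate \<open>x\<close>-coordinate:
  either all three have the same negative valuation, or all are integral and pairwise
  congruent to the differences of the \<open>e\<^sub>i\<close>.
\<close>

lemma soluble_even_pval:
  fixes e1 e2 e3 :: int
  assumes sol: "P.soluble (of_int e1) (of_int e2) (of_int e3) d1 d2" and d: "d1 \<noteq> 0" "d2 \<noteq> 0"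
    and e: "\<not> int p dvd e1 - e2" "\<not> int p dvd e1 - e3"
  shows "even (pval p d1)"
proof (cases "P.vsq d1 \<and> P.vsq d2")
  case True then show ?thesis using vsq_even_pval[OF p _ d(1)] by blast
next
  case False
  obtain z1 z2 z3 where z: "small p ((d1 * z1\<^sup>2 + of_int e1) - (d2 * z2\<^sup>2 + of_int e2)) 1"
    "small p ((d1 * z1\<^sup>2 + of_int e1) - (d1 * d2 * z3\<^sup>2 + of_int e3)) 1"
    by (rule soluble_approx[OF p sol False])
  define u1 u2 u3 where "u1 = d1 * z1\<^sup>2" and "u2 = d2 * z2\<^sup>2" and "u3 = d1 * d2 * z3\<^sup>2"
  define r2 r3 where "r2 = (u1 + of_int e1) - (u2 + of_int e2)" and "r3 = (u1 + of_int e1) - (u3 + of_int e3)"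
  have r: "small p r2 1" "small p r3 1" using z by (simp_all add: r2_def r3_def u1_def u2_def u3_def)
  have u2: "u2 = u1 + (of_int (e1 - e2) + - r2)" and u3: "u3 = u1 + (of_int (e1 - e3) + - r3)"
    by (simp_all add: r2_def r3_def)
  have par1: "even (pval p d1) \<longleftrightarrow> even (pval p u1)" if "u1 \<noteq> 0"
    using that d by (auto simp: u1_def pval_sq_times)
  have par2: "even (pval p d2) \<longleftrightarrow> even (pval p u2)" if "u2 \<noteq> 0"
    using that d by (auto simp: u2_def pval_sq_times)
  have par3: "even (pval p (d1 * d2)) \<longleftrightarrow> even (pval p u3)" if "u3 \<noteq> 0"
    using that d by (auto simp: u3_def pval_sq_times)
  have par: "even (pval p (d1 * d2)) \<longleftrightarrow> (even (pval p d1) \<longleftrightarrow> even (pval p d2))"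
    using d by (simp add: pval_mult[OF p])
  have int2: "small p (of_int (e1 - e2) + - r2) 0" "small p (of_int (e1 - e3) + - r3) 0"
    by (rule small_add[OF p small_of_int[OF p] small_minus[OF p small_mono[OF p r(1)]]], simp,
        rule small_add[OF p small_of_int[OF p] small_minus[OF p small_mono[OF p r(2)]]], simp)
  consider "u1 = 0 \<or> pval p u1 \<ge> 1" | "u1 \<noteq> 0" "pval p u1 = 0" | "u1 \<noteq> 0" "pval p u1 < 0" by linarith
  then show ?thesis
  proof cases
    case 1
    then have s: "small p u1 1" by (auto simp: small_def[OF p])
    have "u2 = of_int (e1 - e2) + (u1 - r2)" "u3 = of_int (e1 - e3) + (u1 - r3)" by (simp_all add: u2 u3)
    then have "u2 \<noteq> 0" "pval p u2 = 0" "u3 \<noteq> 0" "pval p u3 = 0"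
      using pval_of_int_unit_add[OF e(1) small_diff[OF p s r(1)]] pval_of_int_unit_add[OF e(2) small_diff[OF p s r(2)]]
      by auto
    then show ?thesis using par par2 par3 by simp
  next
    case 2 then show ?thesis using par1 by simp
  next
    \<comment> \<open>All three valuations agree, so \<open>d1\<close>, \<open>d2\<close> and
      \<open>d1 d2\<close> have valuations of equal parity. As the third is the sum of the first
      two, all are even.\<close>
    case 3
    have "u2 \<noteq> 0" "pval p u2 = pval p u1" "u3 \<noteq> 0" "pval p u3 = pval p u1"
      using pval_add_eq[OF p 3(1), of "of_int (e1 - e2) + - r2"] pval_add_eq[OF p 3(1), of "of_int (e1 - e3) + - r3"]
        int2 3(2) unfolding u2 u3 small_def[OF p] by auto
    then show ?thesis using par par1 par2 par3 3(1) by auto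
  qed
qed

lemma soluble_vsq:
  fixes e1 e2 e3 :: int
  assumes odd: "p \<noteq> 2"
    and sol: "P.soluble (of_int e1) (of_int e2) (of_int e3) d1 d2" and d: "d1 \<noteq> 0" "d2 \<noteq> 0"
    and e: "\<not> int p dvd e1 - e2" "\<not> int p dvd e1 - e3" "int p dvd e2 - e3"
    and sq: "P.vsq (of_int (e2 - e1))"
  shows "P.vsq d1"
proof (cases "P.vsq d1 \<and> P.vsq d2")
  case False
  have "\<not> int p dvd 2"
    using odd p by (metis primes_dvd_imp_eq two_is_prime_nat int_dvd_int_iff of_nat_numeral)
  then have two: "pval p 2 = 0" using pval_unit[OF p, of 2] by simp
  obtain z1 z2 z3 where z: "small p ((d1 * z1\<^sup>2 + of_int e1) - (d2 * z2\<^sup>2 + of_int e2)) 1"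
    "small p ((d1 * z1\<^sup>2 + of_int e1) - (d1 * d2 * z3\<^sup>2 + of_int e3)) 1"
    by (rule soluble_approx[OF p sol False])
  define u1 u2 u3 where "u1 = d1 * z1\<^sup>2" and "u2 = d2 * z2\<^sup>2" and "u3 = d1 * d2 * z3\<^sup>2"
  define r2 r3 where "r2 = (u1 + of_int e1) - (u2 + of_int e2)" and "r3 = (u1 + of_int e1) - (u3 + of_int e3)"
  have r: "small p r2 1" "small p r3 1" using z by (simp_all add: r2_def r3_def u1_def u2_def u3_def)
  have u2: "u2 = u1 + (of_int (e1 - e2) + - r2)" and u3: "u3 = u1 + (of_int (e1 - e3) + - r3)"
    by (simp_all add: r2_def r3_def)
  have int2: "small p (of_int (e1 - e2) + - r2) 0" "small p (of_int (e1 - e3) + - r3) 0"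
    by (rule small_add[OF p small_of_int[OF p] small_minus[OF p small_mono[OF p r(1)]]], simp,
        rule small_add[OF p small_of_int[OF p] small_minus[OF p small_mono[OF p r(2)]]], simp)
  have near: "P.vsq (x * y)" if "x \<noteq> 0" "small p (y - x) (pval p x + 1)" for x y
    using vsq_near[OF p that(1), of y] that(2) two by simp
  have fin1: "P.vsq d1" if "P.vsq u1" "u1 \<noteq> 0"
    using that P.vsq_mult_square[of z1 d1] by (auto simp: u1_def power2_eq_square)
  \<comment> \<open>\<open>p\<close> divides \<open>e2 - e3\<close>, so \<open>u2\<close> and
    \<open>u3\<close> are close. Whenever they are close relative to their size, their product is a
    square, and this product is \<open>d1\<close> times a square.\<close>
  have fin23: "P.vsq d1" if "P.vsq (u2 * u3)" "u2 \<noteq> 0" "u3 \<noteq> 0"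
  proof -
    have "u2 * u3 = d1 * ((d2 * z2 * z3) * (d2 * z2 * z3))" by (simp add: u2_def u3_def power2_eq_square mult_ac)
    moreover have "d2 * z2 * z3 \<noteq> 0" using that d by (auto simp: u2_def u3_def)
    ultimately show ?thesis using that(1) P.vsq_mult_square by metis
  qed
  have u23: "small p (u3 - u2) 1"
  proof -
    have "u3 - u2 = of_int (e2 - e3) + (r2 - r3)" by (simp add: u2 u3)
    then show ?thesis using small_add[OF p small_of_int_dvd[OF p e(3)] small_diff[OF p r]] by simp
  qed
  have caseB: ?thesis if "u2 \<noteq> 0" "pval p u2 = 0"
  proof -
    have "P.vsq (u2 * u3)" by (rule near) (use that u23 in simp_all)
    moreover have "u3 \<noteq> 0"
      using pval_add_eq[OF p that(1), of "u3 - u2"] u23 that by (auto simp: small_def[OF p])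
    ultimately show ?thesis using fin23 that by blast
  qed
  consider "u1 = 0 \<or> pval p u1 \<ge> 1" | "u1 \<noteq> 0" "pval p u1 = 0" | "u1 \<noteq> 0" "pval p u1 < 0" by linarith
  then show ?thesis
  proof cases
    case 1
    then have s: "small p u1 1" by (auto simp: small_def[OF p])
    have "u2 = of_int (e1 - e2) + (u1 - r2)" by (simp add: u2)
    then show ?thesis using caseB pval_of_int_unit_add[OF e(1) small_diff[OF p s r(1)]] by simp
  next
    case 2
    have "small p u1 0" using 2 by (simp add: small_def[OF p])
    then have u20: "small p u2 0" using small_add[OF p _ int2(1)] u2 by simp
    show ?thesis
    proof (cases "u2 \<noteq> 0 \<and> pval p u2 = 0")
      case True then show ?thesis using caseB by blast
    next
      case False
      then have "small p u2 1" using u20 by (auto simp: small_def[OF p])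
      then have s: "small p (u2 + r2) 1" by (rule small_add[OF p _ r(1)])
      have ne: "\<not> int p dvd e2 - e1" using e(1) by (simp add: dvd_diff_commute)
      \<comment> \<open>The approximate point reduces to the node where \<open>e2\<close> and
        \<open>e3\<close> meet. There \<open>x - e1\<close> is near \<open>e2 - e1\<close>, a square
        by hypothesis.\<close>
      have "P.vsq (of_int (e2 - e1) * u1)"
      proof (rule near)
        show "of_int (e2 - e1) \<noteq> (0::rat)" using ne by (metis dvd_0_right of_int_eq_0_iff)
        have "u1 - of_int (e2 - e1) = u2 + r2" by (simp add: u2)
        then show "small p (u1 - of_int (e2 - e1)) (pval p (of_int (e2 - e1)) + 1)"
          using s pval_unit[OF p ne] by simp
      qed
      moreover have "of_int (e2 - e1) \<noteq> (0::rat)" using ne by (metis dvd_0_right of_int_eq_0_iff)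
      ultimately have "P.vsq u1" using P.vsq_cancel[OF _ sq] by blast
      then show ?thesis using fin1 2 by blast
    qed
  next
    case 3
    have b: "small p (u2 - u1) (pval p u1 + 1)" "small p (u3 - u1) (pval p u1 + 1)"
      using small_mono[OF p int2(1)] small_mono[OF p int2(2)] 3 unfolding u2 u3 by simp_all
    have nz: "u2 \<noteq> 0" "u3 \<noteq> 0"
      using pval_add_eq(1)[OF p 3(1), of "u2 - u1"] pval_add_eq(1)[OF p 3(1), of "u3 - u1"] b
      by (auto simp: small_def[OF p])
    have "P.vsq (u1 * u2)" "P.vsq (u1 * u3)" using near[OF 3(1)] b by blast+
    then have "P.vsq (u1 * u2 * (u1 * u3))" by (rule P.vsq_mult)
    then have "P.vsq (u2 * u3 * (u1 * u1))" by (simp add: mult_ac)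
    then have "P.vsq (u2 * u3)" using P.vsq_mult_square[OF 3(1)] by blast
    then show ?thesis using fin23 nz by blast
  qed
qed auto

lemma vsq_QuadRes:
  assumes "p \<noteq> 2" "\<not> int p dvd t"
  shows "P.vsq (of_int t) \<longleftrightarrow> (\<exists>s. int p dvd s * s - t)"
proof
  have "\<not> int p dvd 2"
    using assms(1) p by (metis primes_dvd_imp_eq two_is_prime_nat int_dvd_int_iff of_nat_numeral)
  then have two: "pval p 2 = 0" using pval_unit[OF p, of 2] by simp
  assume "\<exists>s. int p dvd s * s - t"
  then obtain s where s: "int p dvd s * s - t" by blast
  have ps: "\<not> int p dvd s"
  proof
    assume "int p dvd s"
    then have "int p dvd s * s - (s * s - t)" using s by (meson dvd_diff dvd_mult)
    then show False using assms(2) by simp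
  qed
  have "small p (of_int (s * s - t)) 1" by (rule small_of_int_dvd[OF p s])
  then show "P.vsq (of_int t)"
    using padic_newton[OF p, of "of_int s" "of_int t"] two pval_unit[OF p ps] ps by auto
next
  assume "P.vsq (of_int t)"
  then obtain s where s: "small p (s * s - of_int t) 1" using vsq_approx[OF p] by blast
  have t0: "of_int t \<noteq> (0::rat)" using assms(2) by auto
  have "of_int t + (s * s - of_int t) \<noteq> 0 \<and> pval p (of_int t + (s * s - of_int t)) = 0"
    using pval_of_int_unit_add[OF assms(2) s] by blast
  then have "s \<noteq> 0" "pval p s = 0" by (auto simp: pval_mult[OF p])
  then have "pval p s \<ge> int 0" by simp
  then obtain a b where ab: "s = of_int a / of_int b" "\<not> int p dvd b"
    using pval_ge_iff[OF p \<open>s \<noteq> 0\<close>, of 0] by auto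
  have b0: "b \<noteq> 0" using ab by auto
  have "small p (of_int (a * a - t * (b * b))) 1"
  proof -
    have "of_int (a * a - t * (b * b)) = (s * s - of_int t) * (of_int b * of_int b)" using ab b0 by (simp add: field_simps)
    moreover have "pval p (of_int b) = 0" by (rule pval_unit[OF p ab(2)])
    ultimately show ?thesis using s b0 by (auto simp: small_def[OF p] pval_mult[OF p])
  qed
  then have d1: "int p dvd a * a - t * (b * b)" by (rule small_of_int_imp_dvd)
  have "coprime b (int p)" using ab(2) p by (metis coprime_commute prime_imp_coprime prime_nat_int_transfer)
  \<comment> \<open>\<open>c\<close> inverts the denominator \<open>b\<close> modulo
    \<open>p\<close>, which makes \<open>a c\<close> an integral root modulo
    \<open>p\<close>.\<close>
  then obtain c where c: "[b * c = 1] (mod int p)" using cong_solve_coprime_int by blast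
  then have d2: "int p dvd b * c - 1" by (simp add: cong_iff_dvd_diff)
  have "(a * c) * (a * c) - t = (a * a - t * (b * b)) * (c * c) + t * ((b * c - 1) * (b * c + 1))"
    by (simp add: algebra_simps)
  then have "int p dvd (a * c) * (a * c) - t" using d1 d2 by (metis dvd_add dvd_mult dvd_mult2)
  then show "\<exists>s. int p dvd s * s - t" by blast
qed

lemma vsq_two_adic: "p = 2 \<Longrightarrow> t mod 8 = 1 \<Longrightarrow> P.vsq (of_int t)"
proof -
  assume p2: "p = 2" and t: "t mod 8 = 1"
  have two: "pval p 2 = 1" using pval_p[OF p] p2 by simp
  have "(8::int) dvd 1 - t" using t by presburger
  then obtain k where k: "1 - t = 8 * k" by (elim dvdE)
  have "small p (of_int (1 - t)) 3"
  proof (cases "k = 0")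
    case False
    have "pval p ((2::rat) ^ 3) = 3" using pval_power[OF p, of 2 3] two by simp
    then have "pval p 8 = 3" by simp
    moreover have "(of_int (1 - t) :: rat) = of_int k * 8" unfolding k by simp
    ultimately have "pval p (of_int (1 - t)) = pval p (of_int k) + 3"
      using False pval_mult[OF p, of "of_int k" 8] by simp
    moreover have "pval p (of_int k) \<ge> 0" using False by (simp add: pval_of_int[OF p])
    ultimately show ?thesis by (simp add: small_def[OF p])
  qed (simp add: k small_def[OF p])
  then show ?thesis using padic_newton[OF p, of 1 "of_int t"] two pval_one[OF p] by simp
qed

end

section \<open>Character sums and solubility at the finite places\<close>

context
  fixes p :: nat
  assumes p: "Factorial_Ring.prime p" and odd: "p \<noteq> 2"
begin

interpretation P: abs_value "padic_abs p" by (rule padic_abs_value[OF p])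

lemma odd_prime_gt_2: "p > 2"
  using odd prime_ge_2_nat[OF p] by simp

lemma prime_int_p: "Factorial_Ring.prime (int p)"
  using p by simp

lemma Legendre_eq_0_iff: "Legendre t (int p) = 0 \<longleftrightarrow> int p dvd t"
  by (simp add: Legendre_def cong_0_iff)

lemma Legendre_eq_1_iff: "Legendre t (int p) = 1 \<longleftrightarrow> \<not> int p dvd t \<and> QuadRes (int p) t"
  by (simp add: Legendre_def cong_0_iff)

lemma Legendre_cases: "Legendre t (int p) \<in> {-1, 0, 1}"
  by (simp add: Legendre_def)

lemma Legendre_unit: "\<not> int p dvd t \<Longrightarrow> Legendre t (int p) = 1 \<or> Legendre t (int p) = -1"
  by (simp add: Legendre_def cong_0_iff)

lemma Legendre_cong: "[s = t] (mod int p) \<Longrightarrow> Legendre s (int p) = Legendre t (int p)"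
proof -
  assume "[s = t] (mod int p)"
  then have "[s = u] (mod int p) \<longleftrightarrow> [t = u] (mod int p)" "[u = s] (mod int p) \<longleftrightarrow> [u = t] (mod int p)" for u
    by (auto simp: cong_def)
  then show ?thesis by (simp add: Legendre_def QuadRes_def)
qed

lemma sign_cong_imp_eq:
  assumes "[s = t] (mod int p)" "s \<in> {-1, 0, 1}" "t \<in> {-1, 0, 1}"
  shows "s = t"
proof -
  have "int p dvd s - t" using assms(1) by (simp add: cong_iff_dvd_diff)
  moreover have "\<bar>s - t\<bar> \<le> 2" using assms(2,3) by auto
  ultimately show ?thesis using dvd_imp_le_int[of "s - t" "int p"] odd_prime_gt_2 by force
qed

lemma Legendre_mult: "Legendre (s * t) (int p) = Legendre s (int p) * Legendre t (int p)"
proof (rule sign_cong_imp_eq)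
  have e: "[Legendre t (int p) = t ^ ((p - 1) div 2)] (mod int p)" for t
    using euler_criterion[OF p odd_prime_gt_2, of t] by simp
  have "[Legendre (s * t) (int p) = s ^ ((p - 1) div 2) * t ^ ((p - 1) div 2)] (mod int p)"
    using e[of "s * t"] by (simp add: power_mult_distrib)
  then show "[Legendre (s * t) (int p) = Legendre s (int p) * Legendre t (int p)] (mod int p)"
    using cong_mult[OF e e, of s t] by (meson cong_sym cong_trans)
qed (use Legendre_cases[of s] Legendre_cases[of t] Legendre_cases[of "s * t"] in auto)

lemma Legendre_square: "\<not> int p dvd t \<Longrightarrow> Legendre (t * t) (int p) = 1"
  using Legendre_mult[of t t] Legendre_unit[of t] by auto

lemma Legendre_one: "Legendre 1 (int p) = 1"
  using Legendre_square[of 1] odd_prime_gt_2 by simp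

lemma Legendre_prod: "Legendre (\<Prod>t\<in>T. f t) (int p) = (\<Prod>t\<in>T. Legendre (f t) (int p))"
  by (induction T rule: infinite_finite_induct) (simp_all add: Legendre_one Legendre_mult)

lemma Legendre_minus_one: "Legendre (- 1) (int p) = (- 1) ^ ((p - 1) div 2)"
proof (rule sign_cong_imp_eq)
  show "[Legendre (- 1) (int p) = (- 1) ^ ((p - 1) div 2)] (mod int p)"
    using euler_criterion[OF p odd_prime_gt_2, of "- 1"] by simp
  show "(- 1) ^ ((p - 1) div 2) \<in> {- 1, 0, 1::int}" by (cases "even ((p - 1) div 2)") auto
qed (use Legendre_cases in auto)

lemma vsq_iff_Legendre: "\<not> int p dvd t \<Longrightarrow> P.vsq (of_int t) \<longleftrightarrow> Legendre t (int p) = 1"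
  unfolding vsq_QuadRes[OF p odd] Legendre_eq_1_iff QuadRes_def
  by (simp add: cong_iff_dvd_diff power2_eq_square)

text \<open>Reduced modulo \<open>p\<close>, \<open>f\<close> permutes the residues: on a finite set
  it is enough that \<open>f\<close> is injective modulo \<open>p\<close>.\<close>

lemma sum_residues_reindex:
  fixes f g :: "int \<Rightarrow> int"
  assumes "\<And>x y. [f x = f y] (mod int p) \<Longrightarrow> [x = y] (mod int p)"
    and "\<And>x y. [x = y] (mod int p) \<Longrightarrow> g x = g y"
  shows "(\<Sum>x\<in>{0..<int p}. g (f x)) = (\<Sum>x\<in>{0..<int p}. g x)"
proof -
  define h where "h x = f x mod int p" for x
  have "inj_on h {0..<int p}"
  proof (rule inj_onI)
    fix x y assume xy: "x \<in> {0..<int p}" "y \<in> {0..<int p}" "h x = h y"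
    then have "[f x = f y] (mod int p)" by (simp add: h_def cong_def)
    from assms(1)[OF this] show "x = y" using xy(1,2) by (simp add: cong_def)
  qed
  moreover have "h ` {0..<int p} \<subseteq> {0..<int p}"
    using odd_prime_gt_2 by (auto simp: h_def)
  ultimately have "bij_betw h {0..<int p} {0..<int p}"
    by (simp add: bij_betw_def endo_inj_surj)
  then have "(\<Sum>x\<in>{0..<int p}. g (h x)) = (\<Sum>x\<in>{0..<int p}. g x)" by (rule sum.reindex_bij_betw)
  moreover have "g (h x) = g (f x)" for x by (rule assms(2)) (simp add: h_def)
  ultimately show ?thesis by simp
qed

text \<open>If every unit were a square, squaring would map the finite set of units onto itself and
  hence be injective; but \<open>1\<close> and \<open>p - 1\<close> have the same square.\<close>

lemma exists_nonresidue: "\<exists>t. Legendre t (int p) = - 1"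
proof (rule ccontr)
  assume no: "\<not> ?thesis"
  define U where "U = {1..<int p}"
  define h where "h x = (x * x) mod int p" for x
  have un: "\<not> int p dvd x" if "x \<in> U" for x using that by (auto simp: U_def zdvd_not_zless)
  have im: "h x \<in> U" if "x \<in> U" for x
  proof -
    have "\<not> int p dvd x * x" using un[OF that] prime_int_p by (simp add: prime_dvd_mult_iff)
    then have "h x \<noteq> 0" by (auto simp: h_def dvd_eq_mod_eq_0)
    moreover have "0 \<le> h x" "h x < int p" using odd_prime_gt_2 by (auto simp: h_def)
    ultimately show ?thesis by (auto simp: U_def)
  qed
  have "U \<subseteq> h ` U"
  proof
    fix t assume t: "t \<in> U"
    then have "Legendre t (int p) = 1" using no Legendre_unit[OF un] by blast
    then obtain y where y: "[y\<^sup>2 = t] (mod int p)" by (auto simp: Legendre_eq_1_iff QuadRes_def)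
    have ty: "t = (y * y) mod int p" using y t by (simp add: cong_def power2_eq_square U_def)
    then have "t = h (y mod int p)" by (simp add: h_def mod_simps)
    moreover have "y mod int p \<noteq> 0" using ty t by (auto simp: U_def mod_mult_left_eq[symmetric, of y])
    then have "y mod int p \<in> U"
      using odd_prime_gt_2 pos_mod_sign[of "int p" y] pos_mod_bound[of "int p" y] by (auto simp: U_def)
    ultimately show "t \<in> h ` U" by blast
  qed
  then have "inj_on h U" by (intro finite_surj_inj[of U h]) (use im in \<open>auto simp: U_def\<close>)
  moreover have "h 1 = h (int p - 1)"
  proof -
    have "[(int p - 1) * (int p - 1) = 1 * 1] (mod int p)"
      by (simp add: cong_iff_dvd_diff algebra_simps)
    then show ?thesis by (simp add: h_def cong_def)
  qed
  moreover have "1 \<in> U" "int p - 1 \<in> U" using odd_prime_gt_2 by (auto simp: U_def)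
  ultimately have "1 = int p - 1" by (meson inj_onD)
  then show False using odd_prime_gt_2 by linarith
qed

text \<open>Multiplication by a nonresidue permutes the residues and changes the sign of the
  sum.\<close>

lemma sum_Legendre: "(\<Sum>x\<in>{0..<int p}. Legendre x (int p)) = 0"
proof -
  obtain t where t: "Legendre t (int p) = - 1" using exists_nonresidue by blast
  then have nt: "\<not> int p dvd t" using Legendre_eq_0_iff[of t] by auto
  have "(\<Sum>x\<in>{0..<int p}. Legendre (t * x) (int p)) = (\<Sum>x\<in>{0..<int p}. Legendre x (int p))"
  proof (rule sum_residues_reindex)
    have "coprime t (int p)" using nt prime_int_p by (metis coprime_commute prime_imp_coprime)
    then show "[x = y] (mod int p)" if "[t * x = t * y] (mod int p)" for x y
      using that by (simp add: cong_mult_lcancel)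
  qed (rule Legendre_cong)
  moreover have "(\<Sum>x\<in>{0..<int p}. Legendre (t * x) (int p)) = - (\<Sum>x\<in>{0..<int p}. Legendre x (int p))"
    by (simp add: Legendre_mult t sum_negf)
  ultimately show ?thesis by linarith
qed

lemma sum_Legendre_shift: "(\<Sum>x\<in>{0..<int p}. Legendre (x - c) (int p)) = 0"
  using sum_residues_reindex[of "\<lambda>x. x - c" "\<lambda>x. Legendre x (int p)"] Legendre_cong
  by (simp add: sum_Legendre cong_iff_dvd_diff)

text \<open>For nonzero \<open>x\<close> the product of the two symbols is the symbol of
  \<open>1 + c / x\<close>. Inversion, extended by \<open>0\<close>, permutes the residues, so the
  symbols of \<open>1 + c f(x)\<close> sum to \<open>0\<close>. The value \<open>- 1\<close> comes
  from the term \<open>1\<close> at \<open>x = 0\<close>, which the left side lacks.\<close>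

lemma sum_Legendre_pair0:
  assumes c: "\<not> int p dvd c"
  shows "(\<Sum>x\<in>{0..<int p}. Legendre x (int p) * Legendre (x + c) (int p)) = - 1"
proof -
  define f where "f x = (if int p dvd x then 0 else SOME y. [x * y = 1] (mod int p))" for x
  have cop: "coprime x (int p)" if "\<not> int p dvd x" for x
    using that prime_int_p by (metis coprime_commute prime_imp_coprime)
  have f: "[x * f x = 1] (mod int p)" if "\<not> int p dvd x" for x
    using someI_ex[OF cong_solve_coprime_int[OF cop[OF that]]] that by (simp add: f_def)
  have fu: "\<not> int p dvd f x" if "\<not> int p dvd x" for x
  proof
    assume "int p dvd f x"
    then have "[x * f x = 0] (mod int p)" by (simp add: cong_0_iff)
    then have "[1 = (0::int)] (mod int p)" using f[OF that] by (meson cong_sym cong_trans)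
    then show False using odd_prime_gt_2 by (simp add: cong_0_iff)
  qed
  have f0: "f x = 0" if "int p dvd x" for x using that by (simp add: f_def)
  have "(\<Sum>x\<in>{0..<int p}. Legendre (1 + c * f x) (int p)) = (\<Sum>x\<in>{0..<int p}. Legendre (1 + c * x) (int p))"
  proof (rule sum_residues_reindex[of f "\<lambda>x. Legendre (1 + c * x) (int p)"])
    fix x y assume xy: "[f x = f y] (mod int p)"
    show "[x = y] (mod int p)"
    proof (cases "int p dvd x \<or> int p dvd y")
      case True
      then have "int p dvd x \<and> int p dvd y" using fu f0 xy by (metis cong_0_iff cong_sym)
      then show ?thesis by (simp add: cong_iff_dvd_diff)
    next
      case False
      have "[x * 1 = x * (y * f y)] (mod int p)" by (intro cong_mult cong_refl cong_sym[OF f]) (use False in simp)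
      moreover have "[y * (x * f y) = y * (x * f x)] (mod int p)" by (intro cong_mult cong_refl cong_sym[OF xy])
      moreover have "[y * (x * f x) = y * 1] (mod int p)" by (intro cong_mult cong_refl f) (use False in simp)
      moreover have "x * (y * f y) = y * (x * f y)" by simp
      ultimately show ?thesis by (metis cong_trans mult.right_neutral)
    qed
  qed (intro Legendre_cong cong_add cong_mult cong_refl)
  also have "\<dots> = (\<Sum>x\<in>{0..<int p}. Legendre x (int p))"
  proof (rule sum_residues_reindex[of "\<lambda>x. 1 + c * x"])
    fix x y assume "[1 + c * x = 1 + c * y] (mod int p)"
    then show "[x = y] (mod int p)" using cop[OF c] by (simp add: cong_add_lcancel cong_mult_lcancel)
  qed (rule Legendre_cong)
  also have "\<dots> = 0" by (rule sum_Legendre)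
  finally have 0: "(\<Sum>x\<in>{0..<int p}. Legendre (1 + c * f x) (int p)) = 0" .
  have "Legendre x (int p) * Legendre (x + c) (int p) = Legendre (1 + c * f x) (int p) - (if x = 0 then 1 else 0)"
    if x: "x \<in> {0..<int p}" for x
  proof (cases "x = 0")
    case True then show ?thesis using f0[of 0] by (simp add: Legendre_one Legendre_eq_0_iff)
  next
    case False
    then have nx: "\<not> int p dvd x" using x by (auto simp: zdvd_not_zless)
    have "Legendre x (int p) * Legendre (f x) (int p) = 1"
      using Legendre_cong[OF f[OF nx]] by (simp add: Legendre_mult Legendre_one)
    then have e: "Legendre (f x) (int p) = Legendre x (int p)" using Legendre_unit[OF nx] by auto
    have "[x * f x + c * f x = 1 + c * f x] (mod int p)" by (intro cong_add f nx cong_refl)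
    then have "Legendre ((x + c) * f x) (int p) = Legendre (1 + c * f x) (int p)"
      using Legendre_cong by (simp add: distrib_right)
    then show ?thesis using False e by (simp add: Legendre_mult mult.commute)
  qed
  then have "(\<Sum>x\<in>{0..<int p}. Legendre x (int p) * Legendre (x + c) (int p)) =
      (\<Sum>x\<in>{0..<int p}. Legendre (1 + c * f x) (int p)) - (\<Sum>x\<in>{0..<int p}. if x = 0 then 1 else 0)"
    by (simp add: sum_subtractf)
  then show ?thesis using 0 odd_prime_gt_2 by simp
qed

lemma sum_Legendre_pair:
  assumes "\<not> int p dvd a - b"
  shows "(\<Sum>x\<in>{0..<int p}. Legendre (x - a) (int p) * Legendre (x - b) (int p)) = - 1"
proof -
  define g where "g x = Legendre x (int p) * Legendre (x + (a - b)) (int p)" for x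
  have "(\<Sum>x\<in>{0..<int p}. g (x - a)) = (\<Sum>x\<in>{0..<int p}. g x)"
  proof (rule sum_residues_reindex)
    fix x y assume "[x = y] (mod int p)"
    then show "g x = g y" unfolding g_def by (metis Legendre_cong cong_add cong_refl)
  qed (simp add: cong_iff_dvd_diff)
  then show ?thesis using sum_Legendre_pair0[OF assms] by (simp add: g_def)
qed

text \<open>
  For signs \<open>\<sigma>\<^sub>1 \<sigma>\<^sub>2 \<sigma>\<^sub>3 = 1\<close> the sum of \<open>\<Prod>\<^sub>i (1 + \<sigma>\<^sub>i \<chi>(x - e\<^sub>i))\<close> over the residues is
  \<open>p - (\<sigma>\<^sub>1 + \<sigma>\<^sub>2 + \<sigma>\<^sub>3) + T\<close> with \<open>T\<close> independent of the signs. It is nonnegative for the trivial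
  signs, hence at least 4 for the others.
\<close>

lemma Legendre_class_attained:
  fixes \<sigma>1 \<sigma>2 :: int
  assumes e: "\<not> int p dvd e1 - e2" "\<not> int p dvd e1 - e3" "\<not> int p dvd e2 - e3"
    and \<sigma>: "\<sigma>1 = 1 \<or> \<sigma>1 = - 1" "\<sigma>2 = 1 \<or> \<sigma>2 = - 1" "\<not> (\<sigma>1 = 1 \<and> \<sigma>2 = 1)"
  obtains x where "Legendre (x - e1) (int p) \<noteq> - \<sigma>1" "Legendre (x - e2) (int p) \<noteq> - \<sigma>2"
    "Legendre (x - e3) (int p) \<noteq> - (\<sigma>1 * \<sigma>2)"
proof -
  define l1 l2 l3 where "l1 x = Legendre (x - e1) (int p)" and "l2 x = Legendre (x - e2) (int p)"
    and "l3 x = Legendre (x - e3) (int p)" for x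
  define g where "g s t x = (1 + s * l1 x) * (1 + t * l2 x) * (1 + s * t * l3 x)" for s t x
  define T where "T = (\<Sum>x\<in>{0..<int p}. l1 x * l2 x * l3 x)"
  have s1: "sum l1 {0..<int p} = 0" "sum l2 {0..<int p} = 0" "sum l3 {0..<int p} = 0"
    unfolding l1_def l2_def l3_def by (rule sum_Legendre_shift)+
  have s2: "(\<Sum>x\<in>{0..<int p}. l1 x * l2 x) = - 1" "(\<Sum>x\<in>{0..<int p}. l1 x * l3 x) = - 1"
    "(\<Sum>x\<in>{0..<int p}. l2 x * l3 x) = - 1"
    unfolding l1_def l2_def l3_def using e by (simp_all add: sum_Legendre_pair)
  have S: "(\<Sum>x\<in>{0..<int p}. g s t x) = int p - (s + t + s * t) + T"
    if "s = 1 \<or> s = - 1" "t = 1 \<or> t = - 1" for s t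
  proof -
    \<comment> \<open>The triple product has the coefficient \<open>s t (s t) = 1\<close>; this is
      why \<open>T\<close> does not see the signs.\<close>
    have "g s t x = 1 + s * l1 x + t * l2 x + s * t * l3 x + s * t * (l1 x * l2 x) + t * (l1 x * l3 x)
        + s * (l2 x * l3 x) + l1 x * l2 x * l3 x" for x
      using that by (auto simp: g_def algebra_simps)
    then have "(\<Sum>x\<in>{0..<int p}. g s t x) = int p + s * sum l1 {0..<int p} + t * sum l2 {0..<int p}
        + s * t * sum l3 {0..<int p} + s * t * (\<Sum>x\<in>{0..<int p}. l1 x * l2 x)
        + t * (\<Sum>x\<in>{0..<int p}. l1 x * l3 x) + s * (\<Sum>x\<in>{0..<int p}. l2 x * l3 x) + T"
      by (simp add: sum.distrib sum_distrib_left T_def)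
    then show ?thesis by (simp add: s1 s2 algebra_simps)
  qed
  have "0 \<le> (\<Sum>x\<in>{0..<int p}. g 1 1 x)"
  proof (rule sum_nonneg)
    fix x
    show "0 \<le> g 1 1 x" unfolding g_def l1_def l2_def l3_def
      using Legendre_cases[of "x - e1"] Legendre_cases[of "x - e2"] Legendre_cases[of "x - e3"] by auto
  qed
  moreover have "\<sigma>1 + \<sigma>2 + \<sigma>1 * \<sigma>2 = - 1" using \<sigma> by auto
  ultimately have "(\<Sum>x\<in>{0..<int p}. g \<sigma>1 \<sigma>2 x) \<noteq> 0" using S[of 1 1] S[OF \<sigma>(1,2)] by linarith
  then obtain x where "g \<sigma>1 \<sigma>2 x \<noteq> 0" by (meson sum.not_neutral_contains_not_neutral)
  then have "1 + \<sigma>1 * l1 x \<noteq> 0" "1 + \<sigma>2 * l2 x \<noteq> 0" "1 + \<sigma>1 * \<sigma>2 * l3 x \<noteq> 0" by (auto simp: g_def)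
  then show thesis using \<sigma> by (intro that[of x]) (auto simp: l1_def l2_def l3_def)
qed

text \<open>A residue \<open>x\<close> in the right classes gives a point by lifting square roots.
  Only wrong signs are excluded by \<open>Legendre_class_attained\<close>, so \<open>x\<close> may
  be congruent to a root; the pair then has the class of the corresponding two-torsion point, which
  is what \<open>tors\<close> handles.\<close>

lemma visibly_soluble_good:
  fixes e1 e2 e3 d1 d2 :: int
  assumes e: "\<not> int p dvd e1 - e2" "\<not> int p dvd e1 - e3" "\<not> int p dvd e2 - e3"
    and d: "\<not> int p dvd d1" "\<not> int p dvd d2"
  shows "P.visibly_soluble (of_int e1) (of_int e2) (of_int e3) (of_int d1) (of_int d2)"
proof (cases "Legendre d1 (int p) = 1 \<and> Legendre d2 (int p) = 1")
  case True
  then show ?thesis unfolding P.visibly_soluble_def using vsq_iff_Legendre[OF d(1)] vsq_iff_Legendre[OF d(2)] by blast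
next
  case False
  define l where "l t = Legendre t (int p)" for t
  note lm = Legendre_mult[folded l_def] and lu = Legendre_unit[folded l_def]
  have ld: "l d1 = 1 \<or> l d1 = - 1" "l d2 = 1 \<or> l d2 = - 1" using lu d by blast+
  obtain x where x: "l (x - e1) \<noteq> - l d1" "l (x - e2) \<noteq> - l d2" "l (x - e3) \<noteq> - (l d1 * l d2)"
    using Legendre_class_attained[OF e ld(1)[unfolded l_def] ld(2)[unfolded l_def] False] unfolding l_def by blast
  have tors: "P.visibly_soluble (of_int a1) (of_int a2) (of_int a3) (of_int c1) (of_int c2)"
    if xa: "int p dvd x - a1" and a: "\<not> int p dvd a1 - a2" "\<not> int p dvd a1 - a3"
      and c: "\<not> int p dvd c1" "\<not> int p dvd c2" and l: "l (x - a2) \<noteq> - l c2" "l (x - a3) \<noteq> - (l c1 * l c2)"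
    for a1 a2 a3 c1 c2
  proof -
    have ca: "l (x - a') = l (a1 - a')" for a'
      unfolding l_def by (rule Legendre_cong) (use xa in \<open>simp add: cong_iff_dvd_diff\<close>)
    have u: "\<not> int p dvd (a1 - a2) * (a1 - a3) * c1" "\<not> int p dvd (a1 - a2) * c2"
      using a c prime_int_p by (simp_all add: prime_dvd_mult_iff)
    have "l (a1 - a2) = l c2" "l (a1 - a3) = l c1 * l c2"
      using l lu[OF a(1)] lu[OF a(2)] lu[OF c(1)] lu[OF c(2)] unfolding ca by auto
    then have "l ((a1 - a2) * (a1 - a3) * c1) = 1" "l ((a1 - a2) * c2) = 1"
      using lu[OF c(1)] lu[OF c(2)] by (auto simp: lm)
    then have "P.vsq (of_int ((a1 - a2) * (a1 - a3) * c1))" "P.vsq (of_int ((a1 - a2) * c2))"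
      using vsq_iff_Legendre[OF u(1)] vsq_iff_Legendre[OF u(2)] by (simp_all add: l_def)
    then show ?thesis
      using a by (intro P.visibly_soluble_cong[OF visibly_soluble_two_torsion[OF p, of "of_int a1" "of_int a2" "of_int a3"]])
        (auto simp flip: of_int_diff of_int_mult)
  qed
  have e': "\<not> int p dvd e2 - e1" "\<not> int p dvd e3 - e1" "\<not> int p dvd e3 - e2"
    using e by (simp_all add: dvd_diff_commute)
  have ud: "\<not> int p dvd d1 * d2" using d prime_int_p by (simp add: prime_dvd_mult_iff)
  consider "int p dvd x - e1" | "int p dvd x - e2" | "int p dvd x - e3"
    | "\<not> int p dvd x - e1" "\<not> int p dvd x - e2" "\<not> int p dvd x - e3" by blast
  then show ?thesis
  proof cases
    case 1 show ?thesis by (rule tors[OF 1 e(1,2) d x(2,3)])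
  next
    case 2
    have "P.visibly_soluble (of_int e2) (of_int e1) (of_int e3) (of_int d2) (of_int d1)"
      by (rule tors[OF 2 e'(1) e(3) d(2,1) x(1)]) (use x(3) in \<open>simp add: mult.commute\<close>)
    then show ?thesis by (rule P.visibly_soluble_perm2)
  next
    case 3
    have "l (d1 * d2) * l d2 = l d1" using ld by (auto simp: lm)
    then have "P.visibly_soluble (of_int e3) (of_int e2) (of_int e1) (of_int (d1 * d2)) (of_int d2)"
      using tors[OF 3 e'(3,2) ud d(2) x(2)] x(1) by simp
    from P.visibly_soluble_perm3[OF this]
    have "P.visibly_soluble (of_int e1) (of_int e2) (of_int e3) (of_int (d1 * d2) * of_int d2) (of_int d2)"
      using d by auto
    then show ?thesis
    proof (rule P.visibly_soluble_cong)
      show "P.vsq (of_int (d1 * d2) * of_int d2 * of_int d1)"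
        using P.vsq_square[of "of_int (d1 * d2)"] by (simp add: mult_ac)
    qed (use d P.vsq_square in auto)
  next
    case 4
    have v: "P.vsq (of_int ((x - a) * c))" if "\<not> int p dvd x - a" "\<not> int p dvd c" "l (x - a) \<noteq> - l c" for a c
    proof -
      have "\<not> int p dvd (x - a) * c" using that prime_int_p by (simp add: prime_dvd_mult_iff)
      moreover have "l ((x - a) * c) = 1" using that lu[of "x - a"] lu[of c] by (auto simp: lm)
      ultimately show ?thesis using vsq_iff_Legendre[of "(x - a) * c"] unfolding l_def by blast
    qed
    have ne: "x \<noteq> e1" "x \<noteq> e2" "x \<noteq> e3" using 4 by auto
    show ?thesis unfolding P.visibly_soluble_def
      using v[OF 4(1) d(1) x(1)] v[OF 4(2) d(2) x(2)] v[OF 4(3) ud] x(3) ne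
      by (intro disjI2 exI[of _ "of_int x"]) (simp add: lm)
  qed
qed

text \<open>The nonresidue \<open>s\<^sup>2 + b\<close> exists since otherwise the set of squares would be closed under adding \<open>b\<close>.\<close>

lemma visibly_soluble_multiplicative:
  fixes e1 e2 e3 d1 d2 :: int
  assumes e: "int p dvd e1 - e2" "Legendre (e3 - e1) (int p) = 1"
    and d: "\<not> int p dvd d1" "\<not> int p dvd d2" "Legendre d1 (int p) = Legendre d2 (int p)"
  shows "P.visibly_soluble (of_int e1) (of_int e2) (of_int e3) (of_int d1) (of_int d2)"
proof (cases "Legendre d1 (int p) = 1")
  case True
  then show ?thesis unfolding P.visibly_soluble_def
    using vsq_iff_Legendre[OF d(1)] vsq_iff_Legendre[OF d(2)] d(3) by metis
next
  case False
  then have l1: "Legendre d1 (int p) = - 1" "Legendre d2 (int p) = - 1" using Legendre_unit[OF d(1)] d(3) by auto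
  define b where "b = e3 - e1"
  have ub: "\<not> int p dvd b" using e(2) Legendre_eq_0_iff[of b] by (auto simp: b_def)
  have "\<exists>s. Legendre (s * s + b) (int p) = - 1"
  proof (rule ccontr)
    assume no: "\<not> ?thesis"
    \<comment> \<open>By iteration all multiples of \<open>b\<close> would be squares; as
      \<open>b\<close> is invertible modulo \<open>p\<close>, these are all residues.\<close>
    have sq: "\<exists>s. [s * s = int n * b] (mod int p)" for n
    proof (induction n)
      case 0 show ?case by (rule exI[of _ 0]) simp
    next
      case (Suc n)
      then obtain s where s: "[s * s = int n * b] (mod int p)" by blast
      have "Legendre (s * s + b) (int p) \<noteq> - 1" using no by blast
      then have "\<exists>y. [y * y = s * s + b] (mod int p)"
        by (auto simp: Legendre_def QuadRes_def power2_eq_square cong_sym_eq[of "s * s + b" 0]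
            split: if_splits intro: exI[of _ 0])
      then obtain y where y: "[y * y = s * s + b] (mod int p)" by blast
      have "[s * s + b = int n * b + b] (mod int p)" by (intro cong_add s cong_refl)
      from cong_trans[OF y this] show ?case by (intro exI[of _ y]) (simp add: distrib_right add.commute)
    qed
    obtain t where t: "Legendre t (int p) = - 1" using exists_nonresidue by blast
    have "coprime b (int p)" using ub prime_int_p by (metis coprime_commute prime_imp_coprime)
    then obtain c where c: "[b * c = 1] (mod int p)" using cong_solve_coprime_int by blast
    define n where "n = nat (t * c mod int p)"
    have n: "int n = t * c mod int p" using odd_prime_gt_2 by (simp add: n_def)
    have "[int n * b = t * c * b] (mod int p)" unfolding n by (intro cong_mult cong_refl) simp
    moreover have "[t * c * b = t] (mod int p)" using cong_mult[OF cong_refl[of t] c] by (simp add: mult_ac)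
    ultimately have nb: "[int n * b = t] (mod int p)" by (rule cong_trans)
    obtain s where "[s * s = int n * b] (mod int p)" using sq by blast
    then have "Legendre (s * s) (int p) = - 1" using Legendre_cong[OF cong_trans[OF _ nb]] t by simp
    then show False using Legendre_mult[of s s] Legendre_cases[of s] by auto
  qed
  then obtain s where s: "Legendre (s * s + b) (int p) = - 1" by blast
  have us: "\<not> int p dvd s"
  proof
    assume "int p dvd s"
    then have "[s * s + b = b] (mod int p)" by (simp add: cong_iff_dvd_diff)
    then show False using Legendre_cong[of "s * s + b" b] s e(2) by (simp add: b_def)
  qed
  \<comment> \<open>Now \<open>x - e3\<close> is a square, while \<open>x - e1\<close> and
    \<open>x - e2\<close> are congruent nonresidues: they match \<open>d1 d2\<close>,
    \<open>d1\<close> and \<open>d2\<close>.\<close>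
  define x where "x = s * s + e3"
  have x1: "Legendre (x - e1) (int p) = - 1" using s by (simp add: x_def b_def algebra_simps)
  have "[x - e2 = x - e1] (mod int p)" using e(1) by (simp add: cong_iff_dvd_diff)
  then have x2: "Legendre (x - e2) (int p) = - 1" using x1 Legendre_cong by metis
  have x3: "x - e3 = s * s" by (simp add: x_def)
  have u: "\<not> int p dvd x - e1" "\<not> int p dvd x - e2" using x1 x2 by (auto simp flip: Legendre_eq_0_iff)
  have u12: "\<not> int p dvd (x - e1) * d1" "\<not> int p dvd (x - e2) * d2" "\<not> int p dvd d1 * d2"
    using u d prime_int_p by (simp_all add: prime_dvd_mult_iff)
  have v: "P.vsq (of_int ((x - e1) * d1))" "P.vsq (of_int ((x - e2) * d2))" "P.vsq (of_int (d1 * d2))"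
    using vsq_iff_Legendre[OF u12(1)] vsq_iff_Legendre[OF u12(2)] vsq_iff_Legendre[OF u12(3)] x1 x2 l1
    by (simp_all add: Legendre_mult)
  have "P.vsq (of_int ((x - e3) * (d1 * d2)))"
    using P.vsq_mult[OF P.vsq_square[of "of_int s"] v(3)] unfolding x3 by (simp add: mult_ac)
  moreover have "x \<noteq> e1" "x \<noteq> e2" "x \<noteq> e3" using u us x3 by auto
  ultimately show ?thesis unfolding P.visibly_soluble_def
    using v by (intro disjI2 exI[of _ "of_int x"]) simp
qed

end

section \<open>Residue symbols between the bad primes\<close>

lemma Legendre_reciprocity_3mod4:
  fixes P l :: nat
  assumes P: "Factorial_Ring.prime P" "P mod 4 = 3" and l: "Factorial_Ring.prime l" "l \<noteq> 2" "l \<noteq> P"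
  shows "Legendre (int l) (int P) * Legendre (int P) (int l) = Legendre (- 1) (int l)"
proof -
  have "P \<noteq> 2" using P(2) by auto
  then have "Legendre (int l) (int P) * Legendre (int P) (int l) = (- 1) ^ ((l - 1) div 2 * ((P - 1) div 2))"
    using P l odd_prime_gt_2 by (intro Quadratic_Reciprocity) auto
  also have "\<dots> = ((- 1) ^ ((P - 1) div 2)) ^ ((l - 1) div 2)"
    by (simp only: power_mult[symmetric] mult.commute)
  also have "odd ((P - 1) div 2)" using P(2) by presburger
  then have "(- 1 :: int) ^ ((P - 1) div 2) = - 1" by simp
  finally show ?thesis using Legendre_minus_one[OF l(1,2)] by simp
qed

lemma Legendre_minus_one_1mod4:
  "Factorial_Ring.prime l \<Longrightarrow> l mod 4 = 1 \<Longrightarrow> Legendre (- 1) (int l) = 1"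
proof -
  assume l: "Factorial_Ring.prime l" "l mod 4 = 1"
  have "even ((l - 1) div 2)" using l(2) by presburger
  moreover have "l \<noteq> 2" using l(2) by auto
  ultimately show ?thesis using Legendre_minus_one[OF l(1)] by simp
qed

lemma Legendre_minus_one_3mod4:
  "Factorial_Ring.prime l \<Longrightarrow> l mod 4 = 3 \<Longrightarrow> Legendre (- 1) (int l) = - 1"
proof -
  assume l: "Factorial_Ring.prime l" "l mod 4 = 3"
  have "odd ((l - 1) div 2)" using l(2) by presburger
  moreover have "l \<noteq> 2" using l(2) by auto
  ultimately show ?thesis using Legendre_minus_one[OF l(1)] by simp
qed

lemma prime_dvd_square_plus_one:
  assumes l: "Factorial_Ring.prime l" "l \<noteq> 2" and d: "int l dvd m\<^sup>2 + 1"
  shows "l mod 4 = 1"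
proof (rule ccontr)
  assume n1: "l mod 4 \<noteq> 1"
  have "odd l" using l prime_odd_nat[of l] odd_prime_gt_2[OF l] by blast
  then have "l mod 4 = 3" using n1 by presburger
  then have "Legendre (- 1) (int l) = - 1" by (rule Legendre_minus_one_3mod4[OF l(1)])
  moreover have "[m * m = - 1] (mod int l)" using d by (simp add: cong_iff_dvd_diff power2_eq_square)
  ultimately have "Legendre (m * m) (int l) = - 1" using Legendre_cong[OF l] by metis
  then show False using Legendre_mult[OF l, of m m] Legendre_cases[OF l, of m] by auto
qed

lemma Legendre_eq_1_if_prime_factors:
  fixes n :: int
  assumes l: "Factorial_Ring.prime l" "l \<noteq> 2" and n: "n > 0"
    and t: "\<And>t. Factorial_Ring.prime t \<Longrightarrow> t dvd n \<Longrightarrow> Legendre t (int l) = 1"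
  shows "Legendre n (int l) = 1"
  using n t
proof (induction n rule: prime_divisors_induct)
  case (factor t n)
  have "t > 0" using factor.hyps by (simp add: prime_gt_0_int)
  then have "Legendre n (int l) = 1" using factor.prems by (intro factor.IH) (auto simp: zero_less_mult_iff)
  then show ?case using factor.hyps factor.prems(2)[of t] by (simp add: Legendre_mult[OF l])
qed (use Legendre_one[OF l] in \<open>auto simp: zdvd1_eq\<close>)

section \<open>The integers \<open>a\<close> and \<open>b\<close>, the bad primes and their mutual
  symbols\<close>

locale prime_quadruple =
  fixes m :: int
  assumes m_pos: "m > 0" and m_even: "even m"
    and prime_m1: "Factorial_Ring.prime (m - 1)" and prime_m2: "Factorial_Ring.prime (m + 1)"
    and sqfree: "squarefree (m\<^sup>2 + 1)"
    and prime_p': "Factorial_Ring.prime (m ^ 4 - 1 - 4 * m\<^sup>2)"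
    and prime_q': "Factorial_Ring.prime (m ^ 4 - 1 + 4 * m\<^sup>2)"
begin

definition a :: int where "a = m ^ 4 - 1"
definition b :: int where "b = 4 * m\<^sup>2"
definition p :: nat where "p = nat (a - b)"
definition q :: nat where "q = nat (a + b)"
definition r :: int where "r = (if m mod 4 = 0 then m - 1 else m + 1)"

lemma int_p: "int p = a - b" and int_q: "int q = a + b"
  using prime_gt_0_int[OF prime_p'] prime_gt_0_int[OF prime_q'] by (simp_all add: p_def q_def a_def b_def)

lemma prime_p: "Factorial_Ring.prime p" and prime_q: "Factorial_Ring.prime q"
  using prime_p' prime_q' by (simp_all flip: prime_nat_int_transfer add: int_p int_q) (simp_all add: a_def b_def)

lemma a_factor: "a = (m - 1) * (m + 1) * (m\<^sup>2 + 1)"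
  by (simp add: a_def power2_eq_square power4_eq_xxxx algebra_simps)

lemma b_pos: "b > 0" and a_gt_b: "a > b"
  using m_pos prime_gt_0_int[OF prime_p'] by (simp_all add: a_def b_def)

lemma a_mod_16: "a mod 16 = 15" and b_mod_16: "b mod 16 = 0"
proof -
  obtain k where k: "m = 2 * k" using m_even by blast
  have "m ^ 4 = 16 * k ^ 4" "m\<^sup>2 = 4 * k\<^sup>2" by (simp_all add: k power_mult_distrib)
  then have "a = 15 + 16 * (k ^ 4 - 1)" "b = 16 * k\<^sup>2" by (simp_all add: a_def b_def)
  then show "a mod 16 = 15" "b mod 16 = 0" by presburger+
qed

lemma p_mod_16: "p mod 16 = 15" and q_mod_16: "q mod 16 = 15"
proof -
  have "int p mod 16 = 15" "int q mod 16 = 15"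
    unfolding int_p int_q using a_mod_16 b_mod_16 by presburger+
  then show "p mod 16 = 15" "q mod 16 = 15" by presburger+
qed

lemma p_mod_4: "p mod 4 = 3" and q_mod_4: "q mod 4 = 3"
  using mod_mod_cancel[of 4 16 p] mod_mod_cancel[of 4 16 q] by (simp_all add: p_mod_16 q_mod_16)

lemma p_ne_2: "p \<noteq> 2" and q_ne_2: "q \<noteq> 2"
  using p_mod_4 q_mod_4 by auto

lemma p_ne_q: "p \<noteq> q"
  using int_p int_q b_pos by linarith

lemma prime_dvd_b: "Factorial_Ring.prime l \<Longrightarrow> l dvd b \<Longrightarrow> l = 2 \<or> l dvd m" for l :: int
proof -
  assume l: "Factorial_Ring.prime l" "l dvd b"
  then have "l dvd 2 * (2 * (m * m))" by (simp add: b_def power2_eq_square)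
  then have "l dvd 2 \<or> l dvd m" using l(1) prime_dvd_mult_iff by blast
  then show ?thesis using l(1) primes_dvd_imp_eq[of l 2] by auto
qed

lemma not_dvd_b: "\<not> int l dvd b" if l: "Factorial_Ring.prime l" "l \<noteq> 2" "int l dvd a" for l :: nat
proof
  assume "int l dvd b"
  then have "int l dvd m" using prime_dvd_b[of "int l"] l by auto
  then have "int l dvd m ^ 4" by (simp add: dvd_trans[OF _ dvd_power])
  from dvd_diff[OF this l(3)] have "int l dvd 1" by (simp add: a_def)
  then show False using l(1) by simp
qed

lemma not_dvd_a: "\<not> int l dvd a" if l: "Factorial_Ring.prime l" "l \<noteq> 2" "int l dvd a - b \<or> int l dvd a + b" for l :: nat
proof
  assume d: "int l dvd a"
  then have "int l dvd b" using l(3) dvd_diff[OF d, of "a - b"] dvd_add_right_iff[OF d] by auto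
  then show False using not_dvd_b[OF l(1,2) d] by blast
qed

lemma not_p_dvd_a: "\<not> int p dvd a" and not_q_dvd_a: "\<not> int q dvd a"
  using not_dvd_a[OF prime_p p_ne_2] not_dvd_a[OF prime_q q_ne_2] int_p int_q by auto

lemma not_p_dvd_q: "\<not> int p dvd int q" and not_q_dvd_p: "\<not> int q dvd int p"
  using primes_dvd_imp_eq[OF prime_p prime_q] primes_dvd_imp_eq[OF prime_q prime_p] p_ne_q by auto

lemma not_p_dvd_2: "\<not> int p dvd 2" and not_q_dvd_2: "\<not> int q dvd 2"
proof -
  have "p > 2" "q > 2" using odd_prime_gt_2 prime_p prime_q p_ne_2 q_ne_2 by blast+
  then show "\<not> int p dvd 2" "\<not> int q dvd 2" by (auto dest: zdvd_imp_le)
qed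

lemma not_p_dvd_b: "\<not> int p dvd b" and not_q_dvd_b: "\<not> int q dvd b"
proof -
  have "int p dvd a" if "int p dvd b" using dvd_add[OF that dvd_refl[of "int p"]] that by (simp add: int_p)
  then show "\<not> int p dvd b" using not_p_dvd_a by blast
  have "int q dvd a" if "int q dvd b" using dvd_diff[OF dvd_refl[of "int q"] that] that by (simp add: int_q)
  then show "\<not> int q dvd b" using not_q_dvd_a by blast
qed

lemma r_cases: "r = m - 1 \<or> r = m + 1" and prime_r: "Factorial_Ring.prime r" and r_mod_4: "r mod 4 = 3"
proof -
  show "r = m - 1 \<or> r = m + 1" "Factorial_Ring.prime r" using prime_m1 prime_m2 by (auto simp: r_def)
  show "r mod 4 = 3" using m_even unfolding r_def by presburger
qed

lemma a_gt_0: "a > 0"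
  using a_gt_b b_pos by simp

definition F :: "int set" where "F = prime_factors a"

lemma finite_F: "finite F"
  by (simp add: F_def)

lemma F_iff: "l \<in> F \<longleftrightarrow> Factorial_Ring.prime l \<and> l dvd a"
  using a_gt_0 by (auto simp: F_def in_prime_factors_iff)

lemma r_in_F: "r \<in> F"
  using r_cases prime_r by (auto simp: F_iff a_factor)

lemma two_notin_F: "2 \<notin> F"
  using a_mod_16 by (auto simp: F_iff) presburger

lemma p_notin_F: "int p \<notin> F" and q_notin_F: "int q \<notin> F"
  using not_p_dvd_a not_q_dvd_a by (simp_all add: F_iff)

text \<open>A prime factor of \<open>m^2 + 1\<close> has \<open>- 1\<close> as a square; of
  \<open>m - 1\<close> and \<open>m + 1\<close>, which differ by \<open>2\<close>, the one other
  than \<open>r\<close> is \<open>1\<close> modulo \<open>4\<close>.\<close>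

lemma F_mod_4: "int l \<in> F \<Longrightarrow> int l \<noteq> r \<Longrightarrow> l mod 4 = 1"
proof -
  assume l: "int l \<in> F" "int l \<noteq> r"
  have pl: "Factorial_Ring.prime (int l)" "l \<noteq> 2" using l(1) two_notin_F by (auto simp: F_iff)
  have "int l dvd m - 1 \<or> int l dvd m + 1 \<or> int l dvd m\<^sup>2 + 1"
    using l(1) unfolding F_iff a_factor prime_dvd_mult_iff[OF pl(1)] by blast
  then consider "int l = m - 1" | "int l = m + 1" | "int l dvd m\<^sup>2 + 1"
    using primes_dvd_imp_eq[OF pl(1)] prime_m1 prime_m2 by blast
  then show ?thesis
  proof cases
    case 3 then show ?thesis using prime_dvd_square_plus_one pl by simp
  next
    case 1
    then have "m mod 4 \<noteq> 0" using l(2) by (auto simp: r_def)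
    then have "int l mod 4 = 1" using m_even unfolding 1 by presburger
    then show ?thesis by presburger
  next
    case 2
    then have "m mod 4 = 0" using l(2) by (auto simp: r_def split: if_splits)
    then have "int l mod 4 = 1" unfolding 2 by presburger
    then show ?thesis by presburger
  qed
qed

text \<open>The factors are coprime because \<open>m^2 + 1\<close> is odd and differs from
  \<open>m^2 - 1\<close> by \<open>2\<close>. This ensures that a translation whose class contains
  \<open>a\<close> cancels a prime factor of \<open>a\<close> exactly.\<close>

lemma squarefree_a: "squarefree a"
proof -
  have "coprime (m - 1) (m + 1)"
    using prime_m1 prime_m2 by (intro primes_coprime) auto
  moreover have "coprime ((m - 1) * (m + 1)) (m\<^sup>2 + 1)"
  proof (rule coprimeI)
    fix c assume c: "c dvd (m - 1) * (m + 1)" "c dvd m\<^sup>2 + 1"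
    have "c dvd m\<^sup>2 + 1 - (m - 1) * (m + 1)" using c by (rule dvd_diff[rotated])
    then have "c dvd 2" by (simp add: power2_eq_square algebra_simps)
    moreover have "odd (m\<^sup>2 + 1)" using m_even by simp
    then have "odd c" using c(2) dvd_trans by blast
    ultimately show "is_unit c"
      using coprime_common_divisor[of c 2 c] by (simp add: coprime_right_2_iff_odd)
  qed
  ultimately show ?thesis
    unfolding a_factor using sqfree squarefree_prime[OF prime_m1] squarefree_prime[OF prime_m2]
    by (intro squarefree_mult_coprime) auto
qed

lemma prime_not_dvd_cofactor: "Factorial_Ring.prime l \<Longrightarrow> a = l * k \<Longrightarrow> \<not> l dvd k"
proof
  assume l: "Factorial_Ring.prime l" "a = l * k" "l dvd k"
  then have "l\<^sup>2 dvd a" by (simp add: power2_eq_square)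
  then have "is_unit l" using squarefreeD[OF squarefree_a] by blast
  then show False using l(1) not_prime_unit by blast
qed

lemma Legendre_minus_one_F: "int l \<in> F \<Longrightarrow> Legendre (- 1) (int l) = (if int l = r then - 1 else 1)"
proof -
  assume l: "int l \<in> F"
  then have pl: "Factorial_Ring.prime l" by (simp add: F_iff)
  have "l mod 4 = 3" if "int l = r" using r_mod_4 that by presburger
  then show ?thesis
    using Legendre_minus_one_3mod4[OF pl] Legendre_minus_one_1mod4[OF pl] F_mod_4[OF l] by metis
qed

lemma b_square: "b = (2 * m) * (2 * m)"
  by (simp add: b_def power2_eq_square)

lemma Legendre_b: "Factorial_Ring.prime l \<Longrightarrow> l \<noteq> 2 \<Longrightarrow> \<not> int l dvd b \<Longrightarrow> Legendre b (int l) = 1"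
  using Legendre_square[of l "2 * m"] unfolding b_square by (meson dvd_mult2)

text \<open>Modulo \<open>l\<close> the prime \<open>p\<close> is \<open>- b\<close> with
  \<open>b\<close> a square. So its symbol is that of \<open>- 1\<close>, which the sign in the
  reciprocity law cancels.\<close>

lemma chi_p_F: "l \<in> F \<Longrightarrow> Legendre l (int p) = 1"
proof -
  assume l: "l \<in> F"
  define n where "n = nat l"
  have n: "l = int n" using l prime_gt_0_int[of l] by (simp add: n_def F_iff)
  have pn: "Factorial_Ring.prime n" "n \<noteq> 2" "int n dvd a" using l two_notin_F by (auto simp: n F_iff)
  have "[int p = - 1 * b] (mod int n)" using pn(3) by (simp add: int_p cong_iff_dvd_diff)
  then have "Legendre (int p) (int n) = Legendre (- 1) (int n)"
    using Legendre_cong[OF pn(1,2)] Legendre_mult[OF pn(1,2), of "- 1" b] Legendre_b[OF pn(1,2) not_dvd_b[OF pn]]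
    by simp
  moreover have "n \<noteq> p" using pn(3) not_p_dvd_a by auto
  moreover have "Legendre (- 1) (int n) \<noteq> 0" using Legendre_minus_one_F l n by simp
  ultimately show ?thesis using Legendre_reciprocity_3mod4[OF prime_p p_mod_4 pn(1,2)] by (simp add: n)
qed

text \<open>Modulo \<open>l\<close> the prime \<open>q\<close> is the square \<open>b\<close>, so
  the sign in the reciprocity law survives: it is the symbol of \<open>- 1\<close>, nontrivial at
  \<open>r\<close> only.\<close>

lemma chi_q_F: "l \<in> F \<Longrightarrow> Legendre l (int q) = (if l = r then - 1 else 1)"
proof -
  assume l: "l \<in> F"
  define n where "n = nat l"
  have n: "l = int n" using l prime_gt_0_int[of l] by (simp add: n_def F_iff)
  have pn: "Factorial_Ring.prime n" "n \<noteq> 2" "int n dvd a" using l two_notin_F by (auto simp: n F_iff)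
  have "[int q = b] (mod int n)" using pn(3) by (simp add: int_q cong_iff_dvd_diff)
  then have "Legendre (int q) (int n) = 1"
    using Legendre_cong[OF pn(1,2)] Legendre_b[OF pn(1,2) not_dvd_b[OF pn]] by simp
  moreover have "n \<noteq> q" using pn(3) not_q_dvd_a by auto
  ultimately show ?thesis
    using Legendre_reciprocity_3mod4[OF prime_q q_mod_4 pn(1,2)] Legendre_minus_one_F[of n] l by (simp add: n)
qed

lemma chi_q_minus_one: "Legendre (- 1) (int q) = - 1"
  using Legendre_minus_one_3mod4 prime_q q_mod_4 by blast

text \<open>\<open>2 (m\<^sup>2 + 1) = (m\<^sup>2 - 1)\<^sup>2 - p\<close>.\<close>

lemma chi_p_2: "Legendre 2 (int p) = 1"
proof -
  have "Legendre (m\<^sup>2 + 1) (int p) = 1"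
  proof (rule Legendre_eq_1_if_prime_factors[OF prime_p p_ne_2])
    show "m\<^sup>2 + 1 > 0" by (simp add: add_nonneg_pos)
    fix t :: int assume "Factorial_Ring.prime t" "t dvd m\<^sup>2 + 1"
    then show "Legendre t (int p) = 1" by (intro chi_p_F) (simp add: F_iff a_factor)
  qed
  moreover have "(m\<^sup>2 - 1) * (m\<^sup>2 - 1) = 2 * (m\<^sup>2 + 1) + int p"
    by (simp add: int_p a_def b_def power2_eq_square power4_eq_xxxx algebra_simps)
  then have "[2 * (m\<^sup>2 + 1) = (m\<^sup>2 - 1) * (m\<^sup>2 - 1)] (mod int p)" by (simp add: cong_iff_dvd_diff)
  moreover have "a = (m\<^sup>2 - 1) * (m\<^sup>2 + 1)" by (simp add: a_factor power2_eq_square algebra_simps)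
  then have "\<not> int p dvd m\<^sup>2 - 1" using not_p_dvd_a by auto
  ultimately show ?thesis
    using Legendre_cong[OF prime_p p_ne_2] Legendre_square[OF prime_p p_ne_2] Legendre_mult[OF prime_p p_ne_2, of 2 "m\<^sup>2 + 1"]
    by simp
qed

text \<open>\<open>- 2 (m\<^sup>2 - 1) = (m\<^sup>2 + 1)\<^sup>2 - q\<close>.\<close>

lemma chi_q_2: "Legendre 2 (int q) = 1"
proof -
  \<comment> \<open>Exactly one of the two primes is \<open>r\<close>, so the product of the symbols
    is \<open>- 1\<close>.\<close>
  have "m - 1 \<in> F" "m + 1 \<in> F" using prime_m1 prime_m2 by (simp_all add: F_iff a_factor)
  then have "Legendre (m - 1) (int q) * Legendre (m + 1) (int q) = - 1"
    using chi_q_F r_cases by auto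
  then have "Legendre ((m - 1) * (m + 1)) (int q) = - 1" by (simp add: Legendre_mult[OF prime_q q_ne_2])
  moreover have "(m\<^sup>2 + 1) * (m\<^sup>2 + 1) = - 1 * 2 * ((m - 1) * (m + 1)) + int q"
    by (simp add: int_q a_def b_def power2_eq_square power4_eq_xxxx algebra_simps)
  then have "[- 1 * 2 * ((m - 1) * (m + 1)) = (m\<^sup>2 + 1) * (m\<^sup>2 + 1)] (mod int q)"
    unfolding cong_iff_dvd_diff by simp
  then have "Legendre (- 1 * 2 * ((m - 1) * (m + 1))) (int q) = Legendre ((m\<^sup>2 + 1) * (m\<^sup>2 + 1)) (int q)"
    by (rule Legendre_cong[OF prime_q q_ne_2])
  moreover have "\<not> int q dvd m\<^sup>2 + 1" using not_q_dvd_a by (auto simp: a_factor)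
  then have "Legendre ((m\<^sup>2 + 1) * (m\<^sup>2 + 1)) (int q) = 1" by (rule Legendre_square[OF prime_q q_ne_2])
  moreover have "Legendre (- 1 * 2 * ((m - 1) * (m + 1))) (int q)
      = Legendre (- 1) (int q) * Legendre 2 (int q) * Legendre ((m - 1) * (m + 1)) (int q)"
    by (simp only: Legendre_mult[OF prime_q q_ne_2])
  ultimately have "- 1 * Legendre 2 (int q) * - 1 = 1" using chi_q_minus_one by metis
  then show ?thesis by simp
qed

lemma chi_p_q: "Legendre (int q) (int p) = 1"
proof -
  have "[int q = 2 * b] (mod int p)" by (simp add: cong_iff_dvd_diff int_p int_q)
  then have "Legendre (int q) (int p) = Legendre (2 * b) (int p)" by (rule Legendre_cong[OF prime_p p_ne_2])
  then show ?thesis using chi_p_2 Legendre_b[OF prime_p p_ne_2 not_p_dvd_b] by (simp add: Legendre_mult[OF prime_p p_ne_2])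
qed

lemma chi_q_p: "Legendre (int p) (int q) = - 1"
proof -
  have "int p - - 1 * (2 * b) = int q" by (simp add: int_p int_q)
  then have "[int p = - 1 * (2 * b)] (mod int q)" unfolding cong_iff_dvd_diff by simp
  then have "Legendre (int p) (int q) = Legendre (- 1 * (2 * b)) (int q)" by (rule Legendre_cong[OF prime_q q_ne_2])
  then show ?thesis using chi_q_2 Legendre_b[OF prime_q q_ne_2 not_q_dvd_b] chi_q_minus_one
    by (simp only: Legendre_mult[OF prime_q q_ne_2])
qed

lemma chi_p_2a: "Legendre (2 * a) (int p) = 1"
proof -
  have "[a = b] (mod int p)" by (simp add: cong_iff_dvd_diff int_p)
  then have "Legendre a (int p) = Legendre b (int p)" by (rule Legendre_cong[OF prime_p p_ne_2])
  then show ?thesis using chi_p_2 Legendre_b[OF prime_p p_ne_2 not_p_dvd_b] by (simp add: Legendre_mult[OF prime_p p_ne_2])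
qed

lemma chi_q_2a: "Legendre (2 * a) (int q) = - 1"
proof -
  have "a - - 1 * b = int q" by (simp add: int_q)
  then have "[a = - 1 * b] (mod int q)" unfolding cong_iff_dvd_diff by simp
  then have "Legendre a (int q) = Legendre (- 1 * b) (int q)" by (rule Legendre_cong[OF prime_q q_ne_2])
  then show ?thesis using chi_q_2 Legendre_b[OF prime_q q_ne_2 not_q_dvd_b] chi_q_minus_one
    by (simp only: Legendre_mult[OF prime_q q_ne_2])
qed

end

section \<open>The local conditions for the explicit classes\<close>

lemma mod_16_eq_15: "x mod 16 = 15 \<Longrightarrow> [x = - 1] (mod 8) \<and> [x = - 1] (mod 4)" for x :: int
  unfolding cong_iff_dvd_diff by presburger

lemma odd_square_mod_8: "odd x \<Longrightarrow> [x * x = 1] (mod 8)" for x :: int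
proof -
  assume "odd x"
  then have "x mod 8 \<in> {1, 3, 5, 7}" by auto presburger
  then have "(x mod 8) * (x mod 8) mod 8 = 1" by auto
  then show ?thesis by (simp add: cong_def mod_mult_eq)
qed

lemma mod_4_eq_1: "[x = 1] (mod 4) \<Longrightarrow> x mod 8 = 1 \<or> x mod 8 = 5" for x :: int
  unfolding cong_iff_dvd_diff by presburger

context prime_quadruple
begin

definition sq_at :: "nat \<Rightarrow> int \<Rightarrow> bool"
  where "sq_at l t \<longleftrightarrow> abs_value.vsq (padic_abs l) (of_int t)"

definition soluble_at :: "nat \<Rightarrow> int \<Rightarrow> int \<Rightarrow> bool"
  where "soluble_at l d1 d2 \<longleftrightarrow>
    abs_value.visibly_soluble (padic_abs l) (of_int a) (of_int (- a)) (of_int b) (of_int d1) (of_int d2)"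

lemma a_ne_b: "a \<noteq> b" "- a \<noteq> b" "a \<noteq> - a"
  using a_gt_b b_pos by linarith+

context
  fixes l :: nat
  assumes l: "Factorial_Ring.prime l"
begin

interpretation P: abs_value "padic_abs l" by (rule padic_abs_value[OF l])

lemma sq_at_mult: "sq_at l s \<Longrightarrow> sq_at l t \<Longrightarrow> sq_at l (s * t)"
  using P.vsq_mult by (simp add: sq_at_def)

lemma sq_at_square: "sq_at l (s * s)"
  using P.vsq_square by (simp add: sq_at_def)

lemma sq_at_one: "sq_at l 1"
  using sq_at_square[of 1] by simp

lemma soluble_at_trivial: "sq_at l d1 \<Longrightarrow> sq_at l d2 \<Longrightarrow> soluble_at l d1 d2"
  by (simp add: sq_at_def soluble_at_def P.visibly_soluble_def)

lemma soluble_at_cong: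
  "soluble_at l d1 d2 \<Longrightarrow> sq_at l (d1 * d1') \<Longrightarrow> sq_at l (d2 * d2') \<Longrightarrow> d1 \<noteq> 0 \<Longrightarrow> d2 \<noteq> 0 \<Longrightarrow> soluble_at l d1' d2'"
  unfolding sq_at_def soluble_at_def of_int_mult by (erule P.visibly_soluble_cong) simp_all

text \<open>Up to sign the differences of the roots \<open>a\<close>, \<open>- a\<close>,
  \<open>b\<close> are \<open>2 a\<close>, \<open>p\<close> and \<open>q\<close>. The three
  two-torsion points therefore have the classes \<open>(2 a p, 2 a)\<close>,
  \<open>(- 2 a, 2 a q)\<close> and \<open>(- p, q)\<close>.\<close>

lemma soluble_at_T1:
  assumes "soluble_at l d1 d2" "d1 \<noteq> 0" "d2 \<noteq> 0"
  shows "soluble_at l (d1 * (2 * a * int p)) (d2 * (2 * a))"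
proof -
  have e: "of_int (2 * a * int p) = ((of_int a - of_int (- a)) * (of_int a - of_int b) :: rat)"
    "of_int (2 * a) = (of_int a - of_int (- a) :: rat)"
    unfolding int_p by simp_all
  show ?thesis
    unfolding soluble_at_def of_int_mult[of d1] of_int_mult[of d2] e
    by (rule visibly_soluble_translate1[OF l assms(1)[unfolded soluble_at_def]])
      (use assms a_ne_b in \<open>simp_all flip: of_int_minus\<close>)
qed

lemma soluble_at_T2:
  assumes "soluble_at l d1 d2" "d1 \<noteq> 0" "d2 \<noteq> 0"
  shows "soluble_at l (d1 * - (2 * a)) (d2 * (2 * a * int q))"
proof -
  have e: "of_int (2 * a * int q) = ((of_int (- a) - of_int a) * (of_int (- a) - of_int b) :: rat)"
    "of_int (- (2 * a)) = (of_int (- a) - of_int a :: rat)"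
    unfolding int_q by (simp_all add: algebra_simps)
  show ?thesis
    unfolding soluble_at_def of_int_mult[of d1] of_int_mult[of d2] e
    by (rule visibly_soluble_translate2[OF l assms(1)[unfolded soluble_at_def]])
      (use assms a_ne_b in \<open>simp_all flip: of_int_minus\<close>)
qed

lemma soluble_at_T3:
  assumes "soluble_at l d1 d2" "d1 \<noteq> 0" "d2 \<noteq> 0"
  shows "soluble_at l (d1 * - int p) (d2 * int q)"
proof -
  have e: "of_int (- int p) = (of_int b - of_int a :: rat)" "of_int (int q) = (of_int b - of_int (- a) :: rat)"
    unfolding int_p int_q by simp_all
  show ?thesis
    unfolding soluble_at_def of_int_mult[of d1] of_int_mult[of d2] e
    by (rule visibly_soluble_translate3[OF l assms(1)[unfolded soluble_at_def]])
      (use assms a_ne_b in \<open>simp_all flip: of_int_minus\<close>)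
qed

lemma sq_at_iff_Legendre: "l \<noteq> 2 \<Longrightarrow> \<not> int l dvd t \<Longrightarrow> sq_at l t \<longleftrightarrow> Legendre t (int l) = 1"
  unfolding sq_at_def by (rule vsq_iff_Legendre[OF l])

lemma sq_atI_Legendre: "l \<noteq> 2 \<Longrightarrow> Legendre t (int l) = 1 \<Longrightarrow> sq_at l t"
  using sq_at_iff_Legendre[of t] Legendre_eq_0_iff[OF l, of t] by auto

end

lemma sq_at_2: "t mod 8 = 1 \<Longrightarrow> sq_at 2 t"
  unfolding sq_at_def by (rule vsq_two_adic) simp_all

section \<open>The pairs attached to sets of bad primes, place by place\<close>

definition G :: "int set" where "G = F \<union> {2, int p, int q}"

text \<open>\<open>\<sigma> S\<close> is the sign for which \<open>d1 S\<close> becomes a square in \<open>\<rat>\<^sub>q\<close>.\<close>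

definition \<sigma> :: "int set \<Rightarrow> int"
  where "\<sigma> S = (if int p \<in> S then - 1 else 1) * (if r \<in> S then - 1 else 1)"

definition d1 :: "int set \<Rightarrow> int" where "d1 S = \<sigma> S * \<Prod>(S - {int q})"
definition d2 :: "int set \<Rightarrow> int" where "d2 S = \<Prod>(S - {int p})"

lemma finite_G: "finite G"
  by (simp add: G_def finite_F)

lemma prime_G: "t \<in> G \<Longrightarrow> Factorial_Ring.prime t"
  using prime_p prime_q by (auto simp: G_def F_iff)

lemma not_dvd_Prod:
  assumes "T \<subseteq> G" "int l \<notin> T" "Factorial_Ring.prime l"
  shows "\<not> int l dvd \<Prod>T"
proof -
  have "finite T" using assms(1) finite_G finite_subset by blast
  moreover have "int l \<noteq> t \<longrightarrow> \<not> int l dvd t" if "t \<in> T" for t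
    using that assms primes_dvd_imp_eq[of "int l" t] prime_G by auto
  ultimately show ?thesis using assms(2,3) by (metis prime_dvd_prod_iff prime_nat_int_transfer)
qed

lemma Prod_pos: "T \<subseteq> G \<Longrightarrow> \<Prod>T > 0"
  using prime_G prime_gt_0_int by (intro prod_pos) blast

lemma \<sigma>_cases: "\<sigma> S = 1 \<or> \<sigma> S = - 1"
  by (simp add: \<sigma>_def)

definition core :: "int set \<Rightarrow> int" where "core S = \<Prod>(S - {int p, int q})"
definition pp :: "int set \<Rightarrow> int" where "pp S = (if int p \<in> S then int p else 1)"
definition qq :: "int set \<Rightarrow> int" where "qq S = (if int q \<in> S then int q else 1)"

lemma d1_eq: "S \<subseteq> G \<Longrightarrow> d1 S = \<sigma> S * core S * pp S"
  and d2_eq: "S \<subseteq> G \<Longrightarrow> d2 S = core S * qq S"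
proof -
  assume "S \<subseteq> G"
  then have f: "finite S" using finite_G finite_subset by blast
  have e1: "S - {int q} = (if int p \<in> S then insert (int p) (S - {int p, int q}) else S - {int p, int q})"
    using p_ne_q by auto
  show "d1 S = \<sigma> S * core S * pp S" unfolding d1_def e1 core_def pp_def using f by simp
  have e2: "S - {int p} = (if int q \<in> S then insert (int q) (S - {int p, int q}) else S - {int p, int q})"
    using p_ne_q by auto
  show "d2 S = core S * qq S" unfolding d2_def e2 core_def qq_def using f by simp
qed

lemma core_ne_0: "S \<subseteq> G \<Longrightarrow> core S \<noteq> 0"
  using Prod_pos[OF order_trans[OF Diff_subset]] unfolding core_def by (metis less_irrefl)

lemma pp_ne_0: "pp S \<noteq> 0" and qq_ne_0: "qq S \<noteq> 0" and p_ne_0: "p \<noteq> 0" and q_ne_0: "q \<noteq> 0"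
  using prime_p prime_q by (auto simp: pp_def qq_def)

lemma d_ne_0: "S \<subseteq> G \<Longrightarrow> d1 S \<noteq> 0" "S \<subseteq> G \<Longrightarrow> d2 S \<noteq> 0"
  using \<sigma>_cases[of S] by (auto simp: d1_eq d2_eq core_ne_0 pp_ne_0 qq_ne_0)

lemma soluble_at_good:
  assumes S: "S \<subseteq> G" and l: "Factorial_Ring.prime l" "int l \<notin> G"
  shows "soluble_at l (d1 S) (d2 S)"
proof -
  have l2: "l \<noteq> 2" using l(2) by (auto simp: G_def)
  have pl: "Factorial_Ring.prime (int l)" using l by simp
  have "\<not> int l dvd 2" using l2 primes_dvd_imp_eq[OF pl, of 2] by auto
  moreover have "\<not> int l dvd a" using l by (auto simp: G_def F_iff)
  ultimately have "\<not> int l dvd 2 * a" by (simp add: prime_dvd_mult_iff[OF pl])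
  moreover have "\<not> int l dvd int p" "\<not> int l dvd int q"
    using l primes_dvd_imp_eq[OF l(1) prime_p] primes_dvd_imp_eq[OF l(1) prime_q] by (auto simp: G_def)
  moreover have "\<not> int l dvd \<Prod>(S - {int p})" "\<not> int l dvd \<Prod>(S - {int q})"
    by (rule not_dvd_Prod; use S l in blast)+
  ultimately show ?thesis
    unfolding soluble_at_def using \<sigma>_cases[of S]
    by (intro visibly_soluble_good[OF l(1) l2]) (auto simp: d1_def d2_def int_p int_q dvd_diff_commute dvd_minus_iff[symmetric, of _ "a + b"])
qed

text \<open>Modulo \<open>l\<close> the roots \<open>a\<close> and \<open>- a\<close> coincide and
  \<open>b - a\<close> is a square, so \<open>visibly_soluble_multiplicative\<close> settles pairs
  of units with equal symbols. If \<open>l\<close> lies in \<open>S\<close>, adding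
  \<open>(a, 0)\<close>, whose class contains \<open>l\<close> exactly once in each coordinate,
  leads back to units.\<close>

lemma soluble_at_F:
  assumes S: "S \<subseteq> G" and lF: "int l \<in> F"
  shows "soluble_at l (d1 S) (d2 S)"
proof -
  have l: "Factorial_Ring.prime l" "l \<noteq> 2" "int l dvd a" using lF two_notin_F by (auto simp: F_iff)
  have pl: "Factorial_Ring.prime (int l)" using l by simp
  have lpq: "int l \<noteq> int p" "int l \<noteq> int q" using lF p_notin_F q_notin_F by auto
  note lm = Legendre_mult[OF l(1,2)]
  define \<epsilon> where "\<epsilon> = Legendre (- 1) (int l)"
  have \<epsilon>: "\<epsilon> = (if int l = r then - 1 else 1)" using Legendre_minus_one_F[OF lF] by (simp add: \<epsilon>_def)
  have one: "Legendre 1 (int l) = 1" by (rule Legendre_one[OF l(1,2)])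
  have lb: "Legendre b (int l) = 1" by (rule Legendre_b[OF l(1,2) not_dvd_b[OF l]])
  have lba: "Legendre (b - a) (int l) = 1"
    using Legendre_cong[OF l(1,2), of "b - a" b] lb l(3) by (simp add: cong_iff_dvd_diff)
  have "[int p = - 1 * b] (mod int l)" using l(3) by (simp add: int_p cong_iff_dvd_diff)
  then have lp: "Legendre (int p) (int l) = \<epsilon>"
    using Legendre_cong[OF l(1,2)] lm[of "- 1" b] lb by (simp add: \<epsilon>_def)
  have "[int q = b] (mod int l)" using l(3) by (simp add: int_q cong_iff_dvd_diff)
  then have lq: "Legendre (int q) (int l) = 1" using Legendre_cong[OF l(1,2)] lb by simp
  have lpp: "Legendre (pp S) (int l) = (if int p \<in> S then \<epsilon> else 1)" by (simp add: pp_def lp one)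
  have lqq: "Legendre (qq S) (int l) = 1" by (simp add: qq_def lq one)
  have ls: "Legendre (\<sigma> S) (int l) = (if int p \<in> S then \<epsilon> else 1) * (if r \<in> S then \<epsilon> else 1)"
    using \<epsilon> by (auto simp: \<sigma>_def one \<epsilon>_def)
  have ee: "\<epsilon> * \<epsilon> = 1" by (simp add: \<epsilon>)
  have mult: "soluble_at l x y" if "Legendre x (int l) = Legendre y (int l)" "Legendre y (int l) \<noteq> 0" for x y
  proof -
    have "\<not> int l dvd x" "\<not> int l dvd y" using that Legendre_eq_0_iff[OF l(1,2)] by metis+
    then show ?thesis unfolding soluble_at_def
      using l(3) lba that by (intro visibly_soluble_multiplicative[OF l(1,2)]) auto
  qed
  show ?thesis
  proof (cases "int l \<in> S")
    case False
    have "\<not> int l dvd core S" unfolding core_def by (rule not_dvd_Prod) (use S l False in auto)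
    then have c: "Legendre (core S) (int l) \<noteq> 0" using Legendre_eq_0_iff[OF l(1,2)] by blast
    \<comment> \<open>Either \<open>r\<close> is outside \<open>S\<close>, or \<open>l\<close>
      differs from \<open>r\<close> and \<open>- 1\<close> is a square modulo
      \<open>l\<close>.\<close>
    have "(if r \<in> S then \<epsilon> else 1) = 1" using False \<epsilon> by auto
    then have "Legendre (d1 S) (int l) = Legendre (core S) (int l)" "Legendre (d2 S) (int l) = Legendre (core S) (int l)"
      using ee by (auto simp: d1_eq[OF S] d2_eq[OF S] lm ls lpp lqq)
    then show ?thesis using mult c by simp
  next
    case True
    define C where "C = \<Prod>(S - {int p, int q, int l})"
    have e: "S - {int p, int q} = insert (int l) (S - {int p, int q, int l})" using True lpq by auto
    have core: "core S = int l * C"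
      unfolding core_def e C_def using finite_subset[OF S finite_G] by simp
    obtain k where k: "a = int l * k" using l(3) by blast
    have nk: "\<not> int l dvd k" by (rule prime_not_dvd_cofactor[OF pl k])
    have "\<not> int l dvd C" unfolding C_def by (rule not_dvd_Prod) (use S l in auto)
    moreover have "\<not> int l dvd 2" using l(2) primes_dvd_imp_eq[OF pl, of 2] by auto
    ultimately have "\<not> int l dvd C * (2 * k)" using nk by (simp add: prime_dvd_mult_iff[OF pl])
    then have c: "Legendre (C * (2 * k)) (int l) \<noteq> 0" using Legendre_eq_0_iff[OF l(1,2)] by blast
    \<comment> \<open>These are \<open>d1 S\<close> times \<open>2 a p\<close> and
      \<open>d2 S\<close> times \<open>2 a\<close>, each divided by \<open>l^2\<close>.\<close>
    define x y where "x = \<sigma> S * pp S * int p * (C * (2 * k))" and "y = qq S * (C * (2 * k))"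
    \<comment> \<open>If \<open>l\<close> is \<open>r\<close>, the sign in \<open>\<sigma> S\<close>
      that comes from \<open>r\<close> offsets the symbol of \<open>p\<close>, which modulo
      \<open>l\<close> is that of \<open>- 1\<close>.\<close>
    have "(if r \<in> S then \<epsilon> else 1) * \<epsilon> = 1" using True \<epsilon> by auto
    then have "Legendre (\<sigma> S * pp S * int p) (int l) = 1"
      using ee by (auto simp: lm ls lpp lp)
    then have "Legendre x (int l) = Legendre (C * (2 * k)) (int l)" "Legendre y (int l) = Legendre (C * (2 * k)) (int l)"
      unfolding x_def y_def using lm[of "\<sigma> S * pp S * int p"] lm[of "qq S"] lqq by simp_all
    then have v: "soluble_at l x y" using mult c by simp
    have ne: "x \<noteq> 0" "y \<noteq> 0"
      using c Legendre_eq_0_iff[OF l(1,2), of 0] \<sigma>_cases[of S] pp_ne_0[of S] qq_ne_0[of S] p_ne_0 by (auto simp: x_def y_def)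
    have ss: "\<sigma> S * \<sigma> S = 1" using \<sigma>_cases[of S] by auto
    show ?thesis
    proof (rule soluble_at_cong[OF l(1) soluble_at_T1[OF l(1) v ne]])
      have e: "x * (2 * a * int p) * d1 S = (\<sigma> S * \<sigma> S) * ((C * (2 * a) * pp S * int p) * (C * (2 * a) * pp S * int p))"
        by (simp add: x_def d1_eq[OF S] core k mult_ac)
      show "sq_at l (x * (2 * a * int p) * d1 S)"
        unfolding e ss by (rule sq_at_mult[OF l(1) sq_at_one[OF l(1)] sq_at_square[OF l(1)]])
      have e: "y * (2 * a) * d2 S = (C * (2 * a) * qq S) * (C * (2 * a) * qq S)"
        by (simp add: y_def d2_eq[OF S] core k mult_ac)
      show "sq_at l (y * (2 * a) * d2 S)" unfolding e by (rule sq_at_square[OF l(1)])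
    qed (use ne a_gt_0 p_ne_0 in auto)
  qed
qed

lemma Legendre_core:
  assumes S: "S \<subseteq> G"
  shows "Legendre (core S) (int p) = 1" "Legendre (core S) (int q) = (if r \<in> S then - 1 else 1)"
proof -
  have t: "t \<in> F \<or> t = 2" if "t \<in> S - {int p, int q}" for t using that S by (auto simp: G_def)
  have "(\<Prod>t\<in>S - {int p, int q}. Legendre t (int p)) = 1"
    by (rule prod.neutral) (use t chi_p_F chi_p_2 in blast)
  then show "Legendre (core S) (int p) = 1" by (simp add: core_def Legendre_prod[OF prime_p p_ne_2])
  have f: "finite (S - {int p, int q})" using finite_subset[OF S finite_G] by simp
  have "r \<noteq> int p" "r \<noteq> int q" "r \<noteq> 2" using r_in_F p_notin_F q_notin_F two_notin_F by auto
  then have "(\<Prod>t\<in>S - {int p, int q}. Legendre t (int q)) = (\<Prod>t\<in>S - {int p, int q}. if t = r then - 1 else 1)"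
    using t chi_q_F chi_q_2 by (intro prod.cong) fastforce+
  also have "\<dots> = (if r \<in> S - {int p, int q} then - 1 else 1)" using f by (simp add: prod.delta)
  finally show "Legendre (core S) (int q) = (if r \<in> S then - 1 else 1)"
    using \<open>r \<noteq> int p\<close> \<open>r \<noteq> int q\<close> by (simp add: core_def Legendre_prod[OF prime_q q_ne_2])
qed

text \<open>At \<open>p\<close> the numbers \<open>2 a\<close>, \<open>q\<close> and
  \<open>core S\<close> are squares. Hence \<open>d2 S\<close> is a square and \<open>d1 S\<close>
  is \<open>1\<close>, \<open>p\<close>, \<open>- 1\<close> or \<open>- p\<close> up to squares. The
  points \<open>(a, 0)\<close> and \<open>(- a, 0)\<close> have the classes \<open>(p, 1)\<close>
  and \<open>(- 1, 1)\<close>, which generate exactly these four cases.\<close>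

lemma soluble_at_p:
  assumes S: "S \<subseteq> G"
  shows "soluble_at p (d1 S) (d2 S)"
proof -
  note I = sq_atI_Legendre[OF prime_p p_ne_2] and m = sq_at_mult[OF prime_p]
  have c: "sq_at p (core S)" by (rule I[OF Legendre_core(1)[OF S]])
  have A: "sq_at p (2 * a)" and Q: "sq_at p (int q)" using I chi_p_2a chi_p_q by blast+
  have qq: "sq_at p (qq S)" using Q sq_at_one[OF prime_p] by (simp add: qq_def)
  have d2: "sq_at p (d2 S)" unfolding d2_eq[OF S] by (rule m[OF c qq])
  note sol1 = soluble_at_trivial[OF prime_p sq_at_one[OF prime_p] sq_at_one[OF prime_p]]
  note T1 = soluble_at_T1[OF prime_p sol1, simplified] and T2 = soluble_at_T2[OF prime_p sol1, simplified]
  have nz: "a \<noteq> 0" "p \<noteq> 0" "q \<noteq> 0" using a_gt_0 p_ne_0 q_ne_0 by auto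
  show ?thesis
  proof (cases "\<sigma> S = 1"; cases "int p \<in> S")
    assume "\<sigma> S = 1" "int p \<notin> S"
    then have "d1 S = core S" by (simp add: d1_eq[OF S] pp_def)
    then show ?thesis using soluble_at_trivial[OF prime_p] c d2 by simp
  next
    assume "\<sigma> S = 1" "int p \<in> S"
    then have e: "2 * a * int p * d1 S = (2 * a * core S) * (int p * int p)" by (simp add: d1_eq[OF S] pp_def)
    have "sq_at p (2 * a * int p * d1 S)" unfolding e by (rule m[OF m[OF A c] sq_at_square[OF prime_p]])
    then show ?thesis by (rule soluble_at_cong[OF prime_p T1 _ m[OF A d2]]) (use nz in auto)
  next
    assume "\<sigma> S \<noteq> 1" "int p \<notin> S"
    then have e: "- (2 * a) * d1 S = 2 * a * core S" using \<sigma>_cases[of S] by (simp add: d1_eq[OF S] pp_def)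
    have "sq_at p (- (2 * a) * d1 S)" unfolding e by (rule m[OF A c])
    then show ?thesis by (rule soluble_at_cong[OF prime_p T2 _ m[OF m[OF A Q] d2]]) (use nz in auto)
  next
    assume "\<sigma> S \<noteq> 1" "int p \<in> S"
    then have e: "2 * a * int p * - (2 * a) * d1 S = ((2 * a) * (2 * a)) * core S * (int p * int p)"
      using \<sigma>_cases[of S] by (simp add: d1_eq[OF S] pp_def)
    have "soluble_at p (2 * a * int p * - (2 * a)) (2 * a * (2 * a * int q))"
      by (rule soluble_at_T2[OF prime_p T1]) (use nz in auto)
    then show ?thesis
    proof (rule soluble_at_cong[OF prime_p _ _ m[OF m[OF A m[OF A Q]] d2]])
      show "sq_at p (2 * a * int p * - (2 * a) * d1 S)"
        unfolding e by (rule m[OF m[OF sq_at_square[OF prime_p] c] sq_at_square[OF prime_p]])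
    qed (use nz in auto)
  qed
qed

lemma sq_at_q_d1:
  assumes S: "S \<subseteq> G"
  shows "sq_at q (d1 S)"
proof (rule sq_atI_Legendre[OF prime_q q_ne_2])
  have one: "Legendre 1 (int q) = 1" by (rule Legendre_one[OF prime_q q_ne_2])
  show "Legendre (d1 S) (int q) = 1"
    unfolding d1_eq[OF S] Legendre_mult[OF prime_q q_ne_2] Legendre_core(2)[OF S]
    by (auto simp: \<sigma>_def pp_def one chi_q_minus_one chi_q_p)
qed

text \<open>At \<open>q\<close> the numbers \<open>d1 S\<close>, \<open>- p\<close> and
  \<open>2 a p\<close> are squares, while \<open>2 a\<close> is a nonresidue. So
  \<open>(a, 0)\<close> and \<open>(b, 0)\<close> have the classes \<open>(1, 2 a)\<close> and
  \<open>(1, q)\<close>; the first is called for when \<open>r\<close> lies in \<open>S\<close>, the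
  second when \<open>q\<close> does.\<close>

lemma soluble_at_q:
  assumes S: "S \<subseteq> G"
  shows "soluble_at q (d1 S) (d2 S)"
proof -
  note I = sq_atI_Legendre[OF prime_q q_ne_2] and m = sq_at_mult[OF prime_q] and lm = Legendre_mult[OF prime_q q_ne_2]
  have d1: "sq_at q (d1 S)" by (rule sq_at_q_d1[OF S])
  have sq: "sq_at q (int q * int q)" by (rule sq_at_square[OF prime_q])
  have "Legendre (- 1 * int p) (int q) = 1" unfolding lm by (simp add: chi_q_minus_one chi_q_p)
  then have P: "sq_at q (- int p)" using I by simp
  have "Legendre (2 * a * int p) (int q) = 1" unfolding lm[of "2 * a"] by (simp add: chi_q_2a chi_q_p)
  then have AP: "sq_at q (2 * a * int p)" by (rule I)
  have c1: "sq_at q (core S)" if "r \<notin> S" using that Legendre_core(2)[OF S] by (intro I) simp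
  have c2: "sq_at q (2 * a * core S)" if "r \<in> S"
    using that Legendre_core(2)[OF S] chi_q_2a by (intro I) (simp add: lm[of "2 * a"])
  note sol1 = soluble_at_trivial[OF prime_q sq_at_one[OF prime_q] sq_at_one[OF prime_q]]
  note T1 = soluble_at_T1[OF prime_q sol1, simplified] and T3 = soluble_at_T3[OF prime_q sol1, simplified]
  have nz: "a \<noteq> 0" "p \<noteq> 0" "q \<noteq> 0" using a_gt_0 p_ne_0 q_ne_0 by auto
  show ?thesis
  proof (cases "r \<in> S"; cases "int q \<in> S")
    assume "r \<notin> S" "int q \<notin> S"
    then have "sq_at q (d2 S)" using c1 by (simp add: d2_eq[OF S] qq_def)
    then show ?thesis using soluble_at_trivial[OF prime_q] d1 by blast
  next
    assume "r \<notin> S" "int q \<in> S"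
    then have "sq_at q (int q * d2 S)" using m[OF c1 sq] by (simp add: d2_eq[OF S] qq_def mult_ac)
    then show ?thesis by (rule soluble_at_cong[OF prime_q T3 m[OF P d1]]) (use nz in auto)
  next
    assume "r \<in> S" "int q \<notin> S"
    then have "sq_at q (2 * a * d2 S)" using c2 by (simp add: d2_eq[OF S] qq_def)
    then show ?thesis by (rule soluble_at_cong[OF prime_q T1 m[OF AP d1]]) (use nz in auto)
  next
    assume "r \<in> S" "int q \<in> S"
    then have d: "sq_at q (2 * a * int q * d2 S)" using m[OF c2 sq] by (simp add: d2_eq[OF S] qq_def mult_ac)
    have s: "soluble_at q (2 * a * int p * - int p) (2 * a * int q)"
      by (rule soluble_at_T3[OF prime_q T1]) (use nz in auto)
    show ?thesis by (rule soluble_at_cong[OF prime_q s m[OF m[OF AP P] d1] d]) (use nz in auto)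
  qed
qed

lemma Prod_mod_4:
  assumes "T \<subseteq> F"
  shows "[\<Prod>T = (if r \<in> T then - 1 else 1)] (mod 4)"
proof -
  have f: "finite T" using assms finite_F finite_subset by blast
  have "[(\<Prod>t\<in>T. t) = (\<Prod>t\<in>T. if t = r then - 1 else 1)] (mod 4)"
  proof (rule cong_prod)
    fix t assume t: "t \<in> T"
    show "[t = (if t = r then - 1 else 1)] (mod 4)"
    proof (cases "t = r")
      case True then show ?thesis using r_mod_4 by (simp add: cong_def)
    next
      case False
      have tp: "t > 0" using t assms prime_gt_0_int by (auto simp: F_iff)
      then have "nat t mod 4 = 1" using F_mod_4[of "nat t"] t assms False by auto
      then have "int (nat t mod 4) = 1" by simp
      then have "t mod 4 = 1" using tp by (simp add: zmod_int)
      then show ?thesis using False by (simp add: cong_def)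
    qed
  qed
  then show ?thesis using f by (simp add: prod.delta)
qed

text \<open>The point with \<open>x = 1/4\<close> realises the class of \<open>(5, 5)\<close>.\<close>

lemma soluble_at_2_diagonal:
  assumes g: "[g = 1] (mod 4)"
  shows "soluble_at 2 g g"
proof -
  note g8 = mod_4_eq_1[OF g]
  interpret P: abs_value "padic_abs 2" by (rule padic_abs_value) simp
  have b8: "b mod 8 = 0" and a8: "a mod 8 = 7"
    using a_mod_16 b_mod_16 mod_mod_cancel[of 8 16 a] mod_mod_cancel[of 8 16 b] by simp_all
  show ?thesis
  proof (cases "g mod 8 = 1")
    case True then show ?thesis by (intro soluble_at_trivial sq_at_2) simp_all
  next
    case False
    then have g5: "g mod 8 = 5" using g8 by blast
    \<comment> \<open>As \<open>1/4\<close> is a square, only \<open>1 - 4 e\<close> modulo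
      \<open>8\<close> matters: it is \<open>5\<close> for the odd roots \<open>a\<close> and
      \<open>- a\<close>, and \<open>1\<close> for the even root \<open>b\<close>.\<close>
    have quarter: "P.vsq ((1 / 4 - of_int e) * of_int d)" if "((1 - 4 * e) * d) mod 8 = 1" for e d
    proof -
      have "P.vsq (of_int ((1 - 4 * e) * d) * ((1 / 2) * (1 / 2)))"
        by (rule P.vsq_mult[OF sq_at_2[OF that, unfolded sq_at_def] P.vsq_square])
      moreover have "(1 / 4 - of_int e) * of_int d = of_int ((1 - 4 * e) * d) * ((1 / 2) * (1 / 2) :: rat)"
        by (simp add: field_simps)
      ultimately show ?thesis by metis
    qed
    have c: "[y + 8 * k = y] (mod 8)" for y k :: int by (simp add: cong_def)
    have "a = 8 * (a div 8) + 7" "b = 8 * (b div 8)" using mult_div_mod_eq[of 8 a] mult_div_mod_eq[of 8 b] a8 b8 by simp_all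
    then obtain h k where hk: "a = 8 * h + 7" "b = 8 * k" by blast
    have "1 - 4 * a = 5 + 8 * (- 4 * h - 4)" "1 - 4 * - a = 5 + 8 * (4 * h + 3)" "1 - 4 * b = 1 + 8 * (- 4 * k)"
      by (simp_all add: hk)
    then have c8: "[1 - 4 * a = 5] (mod 8)" "[1 - 4 * - a = 5] (mod 8)" "[1 - 4 * b = 1] (mod 8)" "[g = 5] (mod 8)"
      using c g5 by (metis, metis, metis, simp add: cong_def)
    have "[(1 - 4 * a) * g = 5 * 5] (mod 8)" "[(1 - 4 * - a) * g = 5 * 5] (mod 8)"
      "[(1 - 4 * b) * (g * g) = 1 * (5 * 5)] (mod 8)" by (intro cong_mult c8)+
    then have e: "((1 - 4 * a) * g) mod 8 = 1" "((1 - 4 * - a) * g) mod 8 = 1" "((1 - 4 * b) * (g * g)) mod 8 = 1"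
      by (simp_all add: cong_def)
    have v: "P.vsq ((1 / 4 - of_int a) * of_int g)" "P.vsq ((1 / 4 - of_int (- a)) * of_int g)"
      "P.vsq ((1 / 4 - of_int b) * of_int (g * g))" by (rule quarter[OF e(1)] quarter[OF e(2)] quarter[OF e(3)])+
    have ne: "1 / 4 \<noteq> (of_int e :: rat)" for e
    proof
      assume "1 / 4 = (of_int e :: rat)"
      then have "of_int (4 * e) = (of_int 1 :: rat)" by (simp add: field_simps)
      then have "4 * e = 1" by (simp only: of_int_eq_iff)
      then show False by presburger
    qed
    show ?thesis unfolding soluble_at_def P.visibly_soluble_def
      using v ne[of a] ne[of "- a"] ne[of b] by (intro disjI2 exI[of _ "1 / 4"]) simp
  qed
qed

text \<open>Write \<open>d1 S = u g\<close> and \<open>d2 S = u n\<close> with \<open>u\<close>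
  equal to \<open>1\<close> or \<open>2\<close>. The sign \<open>\<sigma> S\<close> makes
  \<open>g\<close> congruent to \<open>1\<close> modulo \<open>4\<close>, and \<open>n\<close> is
  \<open>w g\<close> up to squares with \<open>w\<close> a sign. Since \<open>a\<close>,
  \<open>p\<close> and \<open>q\<close> are \<open>- 1\<close> modulo \<open>8\<close>, the points
  \<open>(- a, 0)\<close> and \<open>(b, 0)\<close> have the classes \<open>(2, 2)\<close> and
  \<open>(1, - 1)\<close> at \<open>2\<close>; all four cases thus come from the diagonal pair
  \<open>(g, g)\<close>.\<close>

lemma soluble_at_2:
  assumes S: "S \<subseteq> G"
  shows "soluble_at 2 (d1 S) (d2 S)"
proof -
  have p2: "Factorial_Ring.prime (2 :: nat)" by simp
  define D where "D = \<Prod>(S - {2, int p, int q})"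
  define u where "u = (if 2 \<in> S then 2 else 1 :: int)"
  have e: "S - {int p, int q} = (if 2 \<in> S then insert 2 (S - {2, int p, int q}) else S - {2, int p, int q})"
    using p_ne_2 q_ne_2 by auto
  have core: "core S = u * D"
    unfolding core_def e D_def u_def using finite_subset[OF S finite_G] by simp
  have "S - {2, int p, int q} \<subseteq> F" using S by (auto simp: G_def)
  from Prod_mod_4[OF this] have D4: "[D = (if r \<in> S then - 1 else 1)] (mod 4)"
    using r_in_F two_notin_F p_notin_F q_notin_F by (auto simp: D_def split: if_splits)
  have "int (p mod 16) = 15" "int (q mod 16) = 15" by (simp_all add: p_mod_16 q_mod_16)
  then have i: "int p mod 16 = 15" "int q mod 16 = 15" by (simp_all only: zmod_int of_nat_numeral)
  from mod_16_eq_15[OF i(1)] mod_16_eq_15[OF i(2)] mod_16_eq_15[OF a_mod_16] have p8: "[int p = - 1] (mod 8)" and q8: "[int q = - 1] (mod 8)" and a8: "[a = - 1] (mod 8)" and p4: "[int p = - 1] (mod 4)" by blast+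
  define s t where "s = (if int p \<in> S then - 1 else 1 :: int)" and "t = (if int q \<in> S then - 1 else 1 :: int)"
  have pp8: "[pp S = s] (mod 8)" and qq8: "[qq S = t] (mod 8)" and pp4: "[pp S = s] (mod 4)"
    using p8 q8 p4 by (simp_all add: pp_def qq_def s_def t_def)
  define g n where "g = \<sigma> S * D * pp S" and "n = D * qq S"
  have g4: "[g = 1] (mod 4)"
  proof -
    have "[g = \<sigma> S * (if r \<in> S then - 1 else 1) * s] (mod 4)"
      unfolding g_def by (intro cong_mult cong_refl D4 pp4)
    moreover have "\<sigma> S * (if r \<in> S then - 1 else 1) * s = 1" by (simp add: \<sigma>_def s_def)
    ultimately show ?thesis by simp
  qed
  have d: "d1 S = u * g" "d2 S = u * n" by (simp_all add: d1_eq[OF S] d2_eq[OF S] core g_def n_def)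
  have "odd D" using not_dvd_Prod[of "S - {2, int p, int q}" 2] S by (auto simp: D_def)
  then have DD: "[D * D = 1] (mod 8)" by (rule odd_square_mod_8)
  define w where "w = \<sigma> S * s * t"
  have gn: "[g * n = w] (mod 8)"
  proof -
    have "[\<sigma> S * (D * D) * pp S * qq S = \<sigma> S * 1 * s * t] (mod 8)" by (intro cong_mult cong_refl DD pp8 qq8)
    then show ?thesis by (simp add: g_def n_def w_def mult_ac)
  qed
  have gg: "[g * g = 1] (mod 8)"
  proof -
    have "[(\<sigma> S * \<sigma> S) * (D * D) * (pp S * pp S) = (\<sigma> S * \<sigma> S) * 1 * (s * s)] (mod 8)"
      by (intro cong_mult cong_refl DD pp8)
    moreover have "(\<sigma> S * \<sigma> S) * 1 * (s * s) = 1" using \<sigma>_cases[of S] by (auto simp: s_def)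
    moreover have "g * g = (\<sigma> S * \<sigma> S) * (D * D) * (pp S * pp S)" by (simp add: g_def mult_ac)
    ultimately show ?thesis by metis
  qed
  have sq: "sq_at 2 x" if "[x = 1] (mod 8)" for x using that by (intro sq_at_2) (simp add: cong_def)
  have sq4: "sq_at 2 (x * (2 * 2))" if "[x = 1] (mod 8)" for x
    by (rule sq_at_mult[OF p2 sq[OF that] sq_at_square[OF p2]])
  have g0: "g \<noteq> 0" using d(1) d_ne_0[OF S] by auto
  note sol = soluble_at_2_diagonal[OF g4]
  note T2 = soluble_at_T2[OF p2 sol g0 g0] and T3 = soluble_at_T3[OF p2 sol g0 g0]
  have w: "w = 1 \<or> w = - 1" using \<sigma>_cases[of S] by (auto simp: w_def s_def t_def)
  have nz: "a \<noteq> 0" "int p \<noteq> 0" "int q \<noteq> 0" using a_gt_0 p_ne_0 q_ne_0 by auto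
  show ?thesis
  proof (cases "2 \<in> S"; cases "w = 1")
    assume "2 \<notin> S" "w = 1"
    then show ?thesis
      using gg gn by (intro soluble_at_cong[OF p2 sol _ _ g0 g0] sq) (simp_all add: d u_def)
  next
    assume u: "2 \<notin> S" and "w \<noteq> 1"
    then have gn': "[g * n = - 1] (mod 8)" using gn w by simp
    have 1: "[- 1 * int p * (g * g) = - 1 * (- 1) * 1] (mod 8)" "[int q * (g * n) = (- 1) * (- 1)] (mod 8)"
      by (intro cong_mult cong_refl p8 gg q8 gn')+
    show ?thesis
    proof (rule soluble_at_cong[OF p2 T3])
      show "sq_at 2 (g * - int p * d1 S)" "sq_at 2 (g * int q * d2 S)"
        by (rule sq; use 1 u in \<open>simp add: d u_def mult_ac\<close>)+
    qed (use g0 nz in auto)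
  next
    assume u: "2 \<in> S" and "w = 1"
    then have gn': "[g * n = 1] (mod 8)" using gn by simp
    have 1: "[- 1 * a * (g * g) = - 1 * (- 1) * 1] (mod 8)" "[a * int q * (g * n) = (- 1) * (- 1) * 1] (mod 8)"
      by (intro cong_mult cong_refl a8 gg q8 gn')+
    show ?thesis
    proof (rule soluble_at_cong[OF p2 T2])
      show "sq_at 2 (g * - (2 * a) * d1 S)" using sq4[of "- 1 * a * (g * g)"] 1 u by (simp add: d u_def mult_ac)
      show "sq_at 2 (g * (2 * a * int q) * d2 S)" using sq4[of "a * int q * (g * n)"] 1 u by (simp add: d u_def mult_ac)
    qed (use g0 nz in auto)
  next
    assume u: "2 \<in> S" and "w \<noteq> 1"
    then have gn': "[g * n = - 1] (mod 8)" using gn w by simp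
    have 1: "[int p * a * (g * g) = - 1 * (- 1) * 1] (mod 8)"
      "[a * int q * int q * (g * n) = (- 1) * (- 1) * (- 1) * (- 1)] (mod 8)"
      by (intro cong_mult cong_refl a8 gg p8 q8 gn')+
    show ?thesis
    proof (rule soluble_at_cong[OF p2 soluble_at_T2[OF p2 T3]])
      show "sq_at 2 (g * - int p * - (2 * a) * d1 S)"
        using sq4[of "int p * a * (g * g)"] 1 u by (simp add: d u_def mult_ac)
      show "sq_at 2 (g * int q * (2 * a * int q) * d2 S)"
        using sq4[of "a * int q * int q * (g * n)"] 1 u by (simp add: d u_def mult_ac)
    qed (use g0 nz in auto)
  qed
qed

lemma visibly_soluble_real:
  assumes S: "S \<subseteq> G"
  shows "rabs.visibly_soluble (of_int a) (of_int (- a)) (of_int b) (of_int (d1 S)) (of_int (d2 S))"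
proof -
  have d2: "d2 S > 0" unfolding d2_def by (rule Prod_pos) (use S in blast)
  show ?thesis
  proof (cases "d1 S > 0")
    case True
    then show ?thesis unfolding rabs.visibly_soluble_def using d2 by (intro disjI1 conjI real_vsqI) simp_all
  next
    case False
    then have d1: "d1 S \<le> 0" by simp
    then have "0 \<le> - a * d1 S" "0 \<le> a * d2 S" "0 \<le> - b * (d1 S * d2 S)"
      using a_gt_0 b_pos d2 by (simp_all add: mult_nonneg_nonpos mult_nonpos_nonneg)
    then have "0 \<le> (of_int (- a * d1 S) :: rat)" "0 \<le> (of_int (a * d2 S) :: rat)" "0 \<le> (of_int (- b * (d1 S * d2 S)) :: rat)"
      by (simp_all only: of_int_0_le_iff)
    \<comment> \<open>The point \<open>x = 0\<close> lies on the oval of the real curve, between the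
      roots \<open>- a\<close> and \<open>b\<close>, where the signs of the three factors are those
      required.\<close>
    then show ?thesis unfolding rabs.visibly_soluble_def
      using a_gt_0 b_pos by (intro disjI2 exI[of _ 0] conjI real_vsqI) simp_all
  qed
qed

lemma visibly_soluble_everywhere:
  assumes S: "S \<subseteq> G" and v: "v \<in> places"
  shows "abs_value.visibly_soluble v (of_int a) (of_int (- a)) (of_int b) (of_int (d1 S)) (of_int (d2 S))"
proof -
  consider "v = (\<lambda>x. real_of_rat \<bar>x\<bar>)" | l where "Factorial_Ring.prime l" "v = padic_abs l"
    using v by (auto simp: places_def)
  then show ?thesis
  proof cases
    case 1 then show ?thesis using visibly_soluble_real[OF S] by simp
  next
    case (2 l)
    have "int l \<notin> G \<or> int l \<in> F \<or> l = 2 \<or> l = p \<or> l = q" by (auto simp: G_def)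
    then have "soluble_at l (d1 S) (d2 S)"
      using soluble_at_good[OF S 2(1)] soluble_at_F[OF S] soluble_at_2[OF S] soluble_at_p[OF S] soluble_at_q[OF S] by blast
    then show ?thesis using 2 by (simp add: soluble_at_def)
  qed
qed

end

section \<open>The Selmer group of the curve\<close>

text \<open>Multiplying by the square of a denominator reduces this to a positive integer with even
  multiplicities.\<close>

lemma rat_squareI:
  assumes x: "(x :: rat) > 0" and even: "\<And>l. Factorial_Ring.prime l \<Longrightarrow> even (pval l x)"
  obtains z where "x = z * z"
proof -
  obtain c d where cd: "x = of_int c / of_int d" "d \<noteq> 0" "x \<noteq> 0 \<Longrightarrow> c \<noteq> 0" using rat_fraction[OF two_is_prime_nat, of x] by blast
  define n where "n = nat (c * d)"
  have "x * (of_int d * of_int d) = of_int (c * d)" using cd(2) by (simp add: cd(1))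
  moreover have "x * (of_int d * of_int d) > 0" using x cd(2) by (metis mult_pos_pos of_int_eq_0_iff not_square_less_zero mult_eq_0_iff linorder_neqE)
  ultimately have "(of_int (c * d) :: rat) > 0" by metis
  then have "c * d > 0" by (simp only: of_int_0_less_iff)
  then have n: "int n = c * d" "n > 0" by (simp_all add: n_def)
  have xn: "x = of_nat n / (of_int d * of_int d)"
  proof -
    have "of_nat n = (of_int c * of_int d :: rat)" using n(1) by (metis of_int_mult of_int_of_nat_eq)
    then show ?thesis using cd(2) by (simp add: cd(1))
  qed
  have "even (multiplicity t (int n))" if t: "Factorial_Ring.prime t" for t
  proof -
    define l where "l = nat t"
    have t': "t = int l" using prime_gt_0_int[OF t] by (simp add: l_def)
    have l: "Factorial_Ring.prime l" using t by (simp add: t')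
    have "pval l x = pval l (of_int (int n)) - (pval l (of_int d) + pval l (of_int d))"
      using n(2) cd(2) by (simp add: xn pval_div[OF l] pval_mult[OF l])
    then have "even (pval l (of_int (int n)))" using even[OF l] by simp
    then show ?thesis using pval_of_int[OF l, of "int n"] n(2) by (simp add: t')
  qed
  then have "is_nth_power 2 (int n)" using is_nth_power_conv_multiplicity[of 2 "int n"] by simp
  then obtain k where k: "int n = k\<^sup>2" by (auto simp: is_nth_power_def)
  have "x = of_int (int n) / (of_int d * of_int d)" by (simp add: xn)
  then have "x = (of_int k / of_int d) * (of_int k / of_int d)" unfolding k by (simp add: power2_eq_square)
  then show thesis by (rule that)
qed

section \<open>Matching soluble pairs with sets of primes, and the count\<close>

context prime_quadruple
begin

lemma pval_Prod:
  assumes l: "Factorial_Ring.prime l" and T: "T \<subseteq> G"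
  shows "pval l (of_int (\<Prod>T)) = (if int l \<in> T then 1 else 0)"
proof (cases "int l \<in> T")
  case False
  then show ?thesis using pval_unit[OF l not_dvd_Prod[OF T _ l]] by simp
next
  case True
  have "\<Prod>T = int l * \<Prod>(T - {int l})" using True finite_subset[OF T finite_G] by (simp add: prod.remove)
  moreover have "pval l (of_int (\<Prod>(T - {int l}))) = 0" by (rule pval_unit[OF l not_dvd_Prod]) (use T l in auto)
  moreover have "(of_int (\<Prod>(T - {int l})) :: rat) \<noteq> 0"
    using Prod_pos[of "T - {int l}"] T unfolding of_int_eq_0_iff by force
  moreover have "(of_nat l :: rat) \<noteq> 0" using l by auto
  ultimately show ?thesis
    using True pval_mult[OF l, of "of_nat l" "of_int (\<Prod>(T - {int l}))"] pval_p[OF l] by (simp del: of_int_prod)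
qed

lemma pval_d1: "Factorial_Ring.prime l \<Longrightarrow> S \<subseteq> G \<Longrightarrow> pval l (of_int (d1 S)) = (if int l \<in> S \<and> l \<noteq> q then 1 else 0)"
  using \<sigma>_cases[of S] pval_Prod[OF _ subset_trans[OF Diff_subset], of l S "{int q}"] by (auto simp: d1_def simp del: of_int_prod)

lemma pval_d2: "Factorial_Ring.prime l \<Longrightarrow> S \<subseteq> G \<Longrightarrow> pval l (of_int (d2 S)) = (if int l \<in> S \<and> l \<noteq> p then 1 else 0)"
  using pval_Prod[OF _ subset_trans[OF Diff_subset], of l S "{int p}"] by (auto simp: d2_def simp del: of_int_prod)

text \<open>\<open>d1\<close> alone would lose \<open>q\<close> and \<open>d2\<close> alone would
  lose \<open>p\<close>; between them the parities of the valuations recover every prime of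
  \<open>S\<close>.\<close>

lemma d1_d2_determine:
  assumes S: "S \<subseteq> G" "S' \<subseteq> G"
    and eq: "of_int (d1 S) * of_int (d1 S') = (z1 * z1 :: rat)" "of_int (d2 S) * of_int (d2 S') = (z2 * z2 :: rat)"
  shows "S = S'"
proof -
  have "int l \<in> S \<longleftrightarrow> int l \<in> S'" if l: "Factorial_Ring.prime l" for l
  proof -
    have z: "z1 \<noteq> 0" "z2 \<noteq> 0" using eq d_ne_0[OF S(1)] d_ne_0[OF S(2)] by auto
    have "pval l (of_int (d1 S)) + pval l (of_int (d1 S')) = pval l z1 + pval l z1"
      using d_ne_0[OF S(1)] d_ne_0[OF S(2)] z by (simp flip: pval_mult[OF l] add: eq)
    moreover have "pval l (of_int (d2 S)) + pval l (of_int (d2 S')) = pval l z2 + pval l z2"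
      using d_ne_0[OF S(1)] d_ne_0[OF S(2)] z by (simp flip: pval_mult[OF l] add: eq)
    ultimately have "even (pval l (of_int (d1 S)) + pval l (of_int (d1 S')))"
      "even (pval l (of_int (d2 S)) + pval l (of_int (d2 S')))" by simp_all
    then show ?thesis using p_ne_q pval_d1[OF l S(1)] pval_d1[OF l S(2)] pval_d2[OF l S(1)] pval_d2[OF l S(2)]
      by (auto split: if_splits)
  qed
  moreover have "\<exists>l. Factorial_Ring.prime l \<and> t = int l" if "t \<in> G" for t
    using prime_G[OF that] prime_gt_0_int[of t] by (intro exI[of _ "nat t"]) simp
  ultimately show ?thesis using S by blast
qed

lemma soluble_imp_class:
  assumes d: "x \<noteq> 0" "y \<noteq> 0"
    and sol: "\<And>v. v \<in> places \<Longrightarrow> abs_value.soluble v (of_int a) (of_int (- a)) (of_int b) x y"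
  obtains S z1 z2 where "S \<subseteq> G" "x * of_int (d1 S) = z1 * z1" "y * of_int (d2 S) = z2 * z2"
proof -
  have real: "(\<lambda>x. real_of_rat \<bar>x\<bar>) \<in> places" and padic: "\<And>l. Factorial_Ring.prime l \<Longrightarrow> padic_abs l \<in> places"
    by (auto simp: places_def)
  have y0: "y > 0"
    by (rule real_soluble_pos[OF sol[OF real] _ _ d]) (use a_gt_0 b_pos in simp_all)
  have diffs: "a - - a = 2 * a" "a - b = int p" "- a - a = - (2 * a)" "- a - b = - int q" "b - - a = int q" "b - a = - int p"
    by (simp_all add: int_p int_q)
  \<comment> \<open>Evenness for \<open>x\<close> concerns primes away from the differences of the
    first root with the other two; permuting the roots gives the counterparts for \<open>y\<close>
    and for \<open>x y\<close>. At a prime dividing \<open>2 a\<close> only the last applies, and it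
    forces equal parities.\<close>
  have even_x: "even (pval l x)" if l: "Factorial_Ring.prime l" "\<not> int l dvd 2 * a" "\<not> int l dvd int p" for l
    by (rule soluble_even_pval[OF l(1) sol[OF padic[OF l(1)]] d]) (use l in \<open>simp_all only: diffs not_False_eq_True\<close>)
  have even_y: "even (pval l y)" if l: "Factorial_Ring.prime l" "\<not> int l dvd 2 * a" "\<not> int l dvd int q" for l
    by (rule soluble_even_pval[OF l(1) abs_value.soluble_perm2[OF padic_abs_value[OF l(1)] sol[OF padic[OF l(1)]]] d(2,1)])
      (use l in \<open>simp_all only: diffs dvd_minus_iff not_False_eq_True\<close>)
  have even_xy: "even (pval l x) \<longleftrightarrow> even (pval l y)"
    if l: "Factorial_Ring.prime l" "\<not> int l dvd int p" "\<not> int l dvd int q" for l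
  proof -
    have "even (pval l (x * y))"
      by (rule soluble_even_pval[OF l(1) abs_value.soluble_perm3[OF padic_abs_value[OF l(1)] sol[OF padic[OF l(1)]] d(2)] _ d(2)])
        (use l d in \<open>simp_all only: diffs dvd_minus_iff not_False_eq_True mult_eq_0_iff simp_thms\<close>)
    then show ?thesis using d by (simp add: pval_mult[OF l(1)])
  qed
  \<comment> \<open>The restriction to \<open>G\<close> loses nothing: outside \<open>G\<close> both
    valuations turn out to be even, by the last case of \<open>par\<close>.\<close>
  define S where "S = {t \<in> G. odd (pval (nat t) x) \<or> odd (pval (nat t) y)}"
  have S: "S \<subseteq> G" by (auto simp: S_def)
  have p2a: "\<not> int p dvd 2 * a" and q2a: "\<not> int q dvd 2 * a"
    using not_p_dvd_2 not_p_dvd_a not_q_dvd_2 not_q_dvd_a prime_p prime_q by (auto simp: prime_dvd_mult_iff)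
  have par: "(odd (pval l x) \<longleftrightarrow> int l \<in> S \<and> l \<noteq> q) \<and> (odd (pval l y) \<longleftrightarrow> int l \<in> S \<and> l \<noteq> p)"
    if l: "Factorial_Ring.prime l" for l
  proof -
    have inS: "int l \<in> S \<longleftrightarrow> int l \<in> G \<and> (odd (pval l x) \<or> odd (pval l y))" by (simp add: S_def)
    have lp: "\<not> int l dvd int p" if "l \<noteq> p" using primes_dvd_imp_eq[OF l prime_p] that by auto
    have lq: "\<not> int l dvd int q" if "l \<noteq> q" using primes_dvd_imp_eq[OF l prime_q] that by auto
    consider "l = p" | "l = q" | "l \<noteq> p" "l \<noteq> q" "int l \<in> G" | "l \<noteq> p" "l \<noteq> q" "int l \<notin> G" by blast
    then show ?thesis
    proof cases
      case 1
      then have "int l \<in> G" "even (pval l y)" using even_y[OF l] p2a not_p_dvd_q by (simp_all add: G_def)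
      then show ?thesis using inS 1 p_ne_q by auto
    next
      case 2
      then have "int l \<in> G" "even (pval l x)" using even_x[OF l] q2a not_q_dvd_p by (simp_all add: G_def)
      then show ?thesis using inS 2 p_ne_q by auto
    next
      case 3 then show ?thesis using inS even_xy[OF l lp lq] by auto
    next
      case 4
      have pl: "Factorial_Ring.prime (int l)" using l by simp
      have "\<not> int l dvd 2" using primes_dvd_imp_eq[OF pl, of 2] 4 by (auto simp: G_def)
      moreover have "\<not> int l dvd a" using 4 pl by (auto simp: G_def F_iff)
      ultimately have "\<not> int l dvd 2 * a" by (simp add: prime_dvd_mult_iff[OF pl])
      then show ?thesis using inS 4 even_x[OF l] even_y[OF l] lp lq by auto
    qed
  qed
  have d0: "of_int (d1 S) \<noteq> (0 :: rat)" "of_int (d2 S) \<noteq> (0 :: rat)" using d_ne_0[OF S] by auto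
  have e1: "even (pval l (x * of_int (d1 S)))" if l: "Factorial_Ring.prime l" for l
    using par[OF l] pval_mult[OF l d(1) d0(1)] pval_d1[OF l S] by auto
  have e2: "even (pval l (y * of_int (d2 S)))" if l: "Factorial_Ring.prime l" for l
    using par[OF l] pval_mult[OF l d(2) d0(2)] pval_d2[OF l S] by auto
  have "d2 S > 0" unfolding d2_def by (rule Prod_pos) (use S in blast)
  then have "y * of_int (d2 S) > 0" using y0 by simp
  then obtain z2 where z2: "y * of_int (d2 S) = z2 * z2" using rat_squareI[OF _ e2] by blast
  \<comment> \<open>With the wrong sign, \<open>- x d1\<close> would be a rational square. But
    \<open>x\<close> and \<open>d1 S\<close> are both squares at \<open>q\<close>, so
    \<open>- 1\<close> would be a square there.\<close>
  have "x * of_int (d1 S) > 0"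
  proof (rule ccontr)
    interpret P: abs_value "padic_abs q" by (rule padic_abs_value[OF prime_q])
    assume "\<not> x * of_int (d1 S) > 0"
    then have "- (x * of_int (d1 S)) > 0" using d d0(1) by (metis mult_eq_0_iff neg_0_less_iff_less linorder_neqE)
    moreover have "even (pval l (- (x * of_int (d1 S))))" if "Factorial_Ring.prime l" for l
      using e1[OF that] pval_minus[OF that] by simp
    ultimately obtain z where z: "- (x * of_int (d1 S)) = z * z" using rat_squareI by blast
    \<comment> \<open>Modulo \<open>q\<close> the roots \<open>- a\<close> and \<open>b\<close>
      meet, and \<open>- 2 a\<close> is the value of \<open>x - a\<close> at the node, which
      \<open>soluble_vsq\<close> requires to be a square.\<close>
    have "Legendre (- 1 * (2 * a)) (int q) = 1"
      unfolding Legendre_mult[OF prime_q q_ne_2, of "- 1"] chi_q_minus_one chi_q_2a by simp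
    then have "sq_at q (- 1 * (2 * a))" by (rule sq_atI_Legendre[OF prime_q q_ne_2])
    then have "P.vsq (of_int (- a - a))" by (simp add: sq_at_def)
    then have "P.vsq x"
      using q2a not_q_dvd_p by (intro soluble_vsq[OF prime_q q_ne_2 sol[OF padic[OF prime_q]] d]) (simp_all only: diffs, simp_all)
    then have "P.vsq (x * of_int (d1 S))" using P.vsq_mult sq_at_q_d1[OF S] by (simp add: sq_at_def)
    then have "P.vsq (of_int (- 1) * (z * z))" unfolding z[symmetric] by simp
    moreover have "z \<noteq> 0" using z d(1) d0(1) by auto
    ultimately have "sq_at q (- 1)" unfolding sq_at_def using P.vsq_mult_square by blast
    moreover have "\<not> int q dvd - 1" using prime_q by auto
    ultimately show False using sq_at_iff_Legendre[OF prime_q q_ne_2] chi_q_minus_one by simp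
  qed
  then obtain z1 where "x * of_int (d1 S) = z1 * z1" using rat_squareI[OF _ e1] by blast
  then show thesis using that S z2 by blast
qed

lemma E_curve_split:
  "E_curve m = [:- of_int a, 1:] * [:- of_int (- a), 1:] * [:- of_int b, 1:]"
  by (simp add: E_curve_def Let_def a_def b_def algebra_simps power2_eq_square power4_eq_xxxx)

lemma card_selmer_group: "card (selmer_group 2 (E_curve m)) = 2 ^ (card F + 3)"
proof -
  define c :: "int set \<Rightarrow> rat \<times> rat" where "c S = (of_int (d1 S), of_int (d2 S))" for S
  have "card (selmer_group 2 (E_curve m)) = card (c ` Pow G)"
  proof (rule selmer_card[OF _ _ _ E_curve_split])
    show "of_int a \<noteq> (of_int (- a) :: rat)" "of_int a \<noteq> (of_int b :: rat)" "of_int (- a) \<noteq> (of_int b :: rat)"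
      unfolding of_int_eq_iff using a_ne_b by auto
  next
    fix x y assume "(x, y) \<in> c ` Pow G"
    then show "x \<noteq> 0 \<and> y \<noteq> 0" using d_ne_0 by (auto simp: c_def)
  next
    fix x y x' y' z1 z2 :: rat
    assume "(x, y) \<in> c ` Pow G" "(x', y') \<in> c ` Pow G" "x * x' = z1 * z1" "y * y' = z2 * z2"
    then show "x = x' \<and> y = y'" using d1_d2_determine by (auto simp: c_def)
  next
    fix v and x y :: rat assume "v \<in> places" "(x, y) \<in> c ` Pow G"
    then show "abs_value.visibly_soluble v (of_int a) (of_int (- a)) (of_int b) x y"
      using visibly_soluble_everywhere by (auto simp: c_def simp del: of_int_minus)
  next
    fix x y :: rat assume "x \<noteq> 0" "y \<noteq> 0"
      "\<And>v. v \<in> places \<Longrightarrow> abs_value.soluble v (of_int a) (of_int (- a)) (of_int b) x y"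
    then obtain S z1 z2 where S: "S \<subseteq> G" "x * of_int (d1 S) = z1 * z1" "y * of_int (d2 S) = z2 * z2"
      using soluble_imp_class by blast
    then have "(of_int (d1 S), of_int (d2 S)) \<in> c ` Pow G" by (auto simp: c_def)
    then show "\<exists>x' y' z1 z2. (x', y') \<in> c ` Pow G \<and> x * x' = z1 * z1 \<and> y * y' = z2 * z2" using S by blast
  qed
  also have "card (c ` Pow G) = card (Pow G)"
  proof (rule card_image, rule inj_onI)
    fix S S' assume "S \<in> Pow G" "S' \<in> Pow G" "c S = c S'"
    then show "S = S'" using d1_d2_determine[of S S' "of_int (d1 S)" "of_int (d2 S)"] by (simp add: c_def)
  qed
  also have "card (Pow G) = 2 ^ card G" by (rule card_Pow[OF finite_G])
  also have "card G = card F + 3"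
    using finite_F two_notin_F p_notin_F q_notin_F p_ne_2 q_ne_2 p_ne_q by (simp add: G_def card_insert_if)
  finally show ?thesis .
qed

end

text \<open>Of the exponent \<open>w + 3\<close> the definition of the rank subtracts
  \<open>2\<close>, for the rational two-torsion. Counting distinct primes is the same as counting
  with multiplicity, as \<open>squarefree_a\<close> shows.\<close>

theorem corollary1p1:
  fixes m :: int
  assumes "m > 0" and "even m"
    and "Factorial_Ring.prime (m - 1)" and "Factorial_Ring.prime (m + 1)"
    and "squarefree (m^2 + 1)"
    and "Factorial_Ring.prime (m^4 - 1 - 4 * m^2)" and "Factorial_Ring.prime (m^4 - 1 + 4 * m^2)"
  shows "two_selmer_rank (E_curve m) = real (card (prime_factors (m^4 - 1)) + 1)"
proof -
  interpret prime_quadruple m using assms by unfold_locales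
  show ?thesis
    unfolding two_selmer_rank_def card_selmer_group F_def a_def
    by (simp add: log_nat_power)
qed

end
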